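(* Let $G$ be a group of order $36$ and let $J\in kG\otimes kG$ be a twist such that $(kG)^J$ is simple as a Hopf algebra. Then $G\cong D_3\times D_3$ and $(kG)^J\cong(k(D_3\times D_3))^{J_1}$, where $J_1$ is the twist lifted from a subgroup $H_1\cong\mathbb Z_2\times\mathbb Z_2$ of $D_3\times D_3$ associated with a 2-cocycle on $\widehat{H_1}$ with nontrivial cohomology class.
   Context: $k$ is an algebraically closed field of characteristic zero. $D_3$ denotes the dihedral group of order $6$. For a twist $J$ in a Hopf algebra $A$, $A^J$ is the Hopf algebra with the same algebra and counit, comultiplication $\Delta^J(h)=J^{-1}\Delta(h)J$ and twisted antipode. For an abelian subgroup $H$ of a finite group $G$, $\widehat H$ is its character group and $e_\chi=\frac{1}{|H|}\sum_{h\in H}\chi(h^{-1})h$; the twist lifted from $H$ associated with a 2-cocycle $\omega$ on $\widehat H$ is $J=\sum_{\alpha,\beta\in\widehat H}\omega(\alpha,\beta)e_\alpha\otimes e_\beta$. A Hopf algebra is simple if it has no normal Hopf subalgebras (stable under ${}^hx=\sum h_1xS(h_2)$) other than $k$ and itself. *)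

theory Defs
  imports "HOL-Algebra.Algebra" "HOL-Computational_Algebra.Polynomial"
begin

text \<open>An element a of kG is the function g |-> coefficient of g. kG (x) kG is identified
  with k[G x G] (functions on pairs), and kG (x) kG (x) kG with k[G x (G x G)].\<close>

definition galg :: "('g, 'm) monoid_scheme \<Rightarrow> ('g \<Rightarrow> 'k::zero) set" where
  "galg G = {a. \<forall>x. x \<notin> carrier G \<longrightarrow> a x = 0}"

definition gdelta :: "'g \<Rightarrow> 'g \<Rightarrow> 'k::{zero,one}" where
  "gdelta x = (\<lambda>y. if y = x then 1 else 0)"

definition gmult :: "('g, 'm) monoid_scheme \<Rightarrow> ('g \<Rightarrow> 'k::comm_ring_1) \<Rightarrow> ('g \<Rightarrow> 'k) \<Rightarrow> ('g \<Rightarrow> 'k)" where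
  "gmult G a b = (\<lambda>x. if x \<in> carrier G
      then (\<Sum>y\<in>carrier G. a y * b (inv\<^bsub>G\<^esub> y \<otimes>\<^bsub>G\<^esub> x)) else 0)"

definition gunit :: "('g, 'm) monoid_scheme \<Rightarrow> ('g \<Rightarrow> 'k::comm_ring_1)" where
  "gunit G = gdelta \<one>\<^bsub>G\<^esub>"

definition ginvertible :: "('g, 'm) monoid_scheme \<Rightarrow> ('g \<Rightarrow> 'k::comm_ring_1) \<Rightarrow> bool" where
  "ginvertible G a = (\<exists>b\<in>galg G. gmult G a b = gunit G \<and> gmult G b a = gunit G)"

definition ginv :: "('g, 'm) monoid_scheme \<Rightarrow> ('g \<Rightarrow> 'k::comm_ring_1) \<Rightarrow> ('g \<Rightarrow> 'k)" where
  "ginv G a = (THE b. b \<in> galg G \<and> gmult G a b = gunit G \<and> gmult G b a = gunit G)"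

definition gcounit :: "('g, 'm) monoid_scheme \<Rightarrow> ('g \<Rightarrow> 'k::comm_ring_1) \<Rightarrow> 'k" where
  "gcounit G a = (\<Sum>x\<in>carrier G. a x)"

definition gcomult :: "('g, 'm) monoid_scheme \<Rightarrow> ('g \<Rightarrow> 'k::comm_ring_1) \<Rightarrow> ('g \<times> 'g \<Rightarrow> 'k)" where
  "gcomult G a = (\<lambda>(x, y). if x = y \<and> x \<in> carrier G then a x else 0)"

text \<open>J is a twist: invertible, (Delta (x) id)(J)(J (x) 1) = (id (x) Delta)(J)(1 (x) J),
  and (eps (x) id)(J) = (id (x) eps)(J) = 1.\<close>
definition is_twist :: "('g, 'm) monoid_scheme \<Rightarrow> ('g \<times> 'g \<Rightarrow> 'k::comm_ring_1) \<Rightarrow> bool" where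
  "is_twist G J =
    (J \<in> galg (G \<times>\<times> G) \<and> ginvertible (G \<times>\<times> G) J \<and>
     gmult (G \<times>\<times> (G \<times>\<times> G))
        (\<lambda>(x, (y, z)). if x = y \<and> x \<in> carrier G then J (x, z) else 0)
        (\<lambda>(x, (y, z)). J (x, y) * gdelta \<one>\<^bsub>G\<^esub> z)
     = gmult (G \<times>\<times> (G \<times>\<times> G))
        (\<lambda>(x, (y, z)). if y = z \<and> y \<in> carrier G then J (x, y) else 0)
        (\<lambda>(x, (y, z)). gdelta \<one>\<^bsub>G\<^esub> x * J (y, z)) \<and>
     (\<forall>y\<in>carrier G. (\<Sum>x\<in>carrier G. J (x, y)) = gdelta \<one>\<^bsub>G\<^esub> y) \<and>
     (\<forall>x\<in>carrier G. (\<Sum>y\<in>carrier G. J (x, y)) = gdelta \<one>\<^bsub>G\<^esub> x))"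

definition tcomult :: "('g, 'm) monoid_scheme \<Rightarrow> ('g \<times> 'g \<Rightarrow> 'k::comm_ring_1) \<Rightarrow> ('g \<Rightarrow> 'k) \<Rightarrow> ('g \<times> 'g \<Rightarrow> 'k)" where
  "tcomult G J a = gmult (G \<times>\<times> G) (gmult (G \<times>\<times> G) (ginv (G \<times>\<times> G) J) (gcomult G a)) J"

text \<open>The antipode of (kG)^J: the unique linear map S (given by its values s on the basis)
  with m(S (x) id)Delta^J = m(id (x) S)Delta^J = u eps.\<close>
definition tantipode_basis :: "('g, 'm) monoid_scheme \<Rightarrow> ('g \<times> 'g \<Rightarrow> 'k::comm_ring_1) \<Rightarrow> 'g \<Rightarrow> ('g \<Rightarrow> 'k)" where
  "tantipode_basis G J = (THE s.
     (\<forall>x. x \<notin> carrier G \<longrightarrow> s x = (\<lambda>_. 0)) \<and>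
     (\<forall>x\<in>carrier G. s x \<in> galg G \<and>
        (\<lambda>z. \<Sum>(u, v)\<in>carrier G \<times> carrier G.
              tcomult G J (gdelta x) (u, v) * gmult G (s u) (gdelta v) z) = gunit G \<and>
        (\<lambda>z. \<Sum>(u, v)\<in>carrier G \<times> carrier G.
              tcomult G J (gdelta x) (u, v) * gmult G (gdelta u) (s v) z) = gunit G))"

definition tantipode :: "('g, 'm) monoid_scheme \<Rightarrow> ('g \<times> 'g \<Rightarrow> 'k::comm_ring_1) \<Rightarrow> ('g \<Rightarrow> 'k) \<Rightarrow> ('g \<Rightarrow> 'k)" where
  "tantipode G J a = (\<lambda>z. \<Sum>x\<in>carrier G. a x * tantipode_basis G J x z)"

definition tad :: "('g, 'm) monoid_scheme \<Rightarrow> ('g \<times> 'g \<Rightarrow> 'k::comm_ring_1) \<Rightarrow> ('g \<Rightarrow> 'k) \<Rightarrow> ('g \<Rightarrow> 'k) \<Rightarrow> ('g \<Rightarrow> 'k)" where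
  "tad G J h a = (\<lambda>z. \<Sum>(u, v)\<in>carrier G \<times> carrier G.
      tcomult G J h (u, v) * gmult G (gmult G (gdelta u) a) (tantipode G J (gdelta v)) z)"

definition tensor_span :: "('g \<Rightarrow> 'k::comm_ring_1) set \<Rightarrow> ('g \<times> 'g \<Rightarrow> 'k) set" where
  "tensor_span K = {T. \<exists>(n::nat) f g. (\<forall>i<n. f i \<in> K \<and> g i \<in> K) \<and> T = (\<lambda>(x, y). \<Sum>i<n. f i x * g i y)}"

definition hopf_subalg :: "('g, 'm) monoid_scheme \<Rightarrow> ('g \<times> 'g \<Rightarrow> 'k::comm_ring_1) \<Rightarrow> ('g \<Rightarrow> 'k) set \<Rightarrow> bool" where
  "hopf_subalg G J K =
    (K \<subseteq> galg G \<and> gunit G \<in> K \<and>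
     (\<forall>a\<in>K. \<forall>b\<in>K. (\<lambda>z. a z + b z) \<in> K) \<and>
     (\<forall>c. \<forall>a\<in>K. (\<lambda>z. c * a z) \<in> K) \<and>
     (\<forall>a\<in>K. \<forall>b\<in>K. gmult G a b \<in> K) \<and>
     (\<forall>a\<in>K. tcomult G J a \<in> tensor_span K) \<and>
     (\<forall>a\<in>K. tantipode G J a \<in> K))"

definition normal_hopf_subalg :: "('g, 'm) monoid_scheme \<Rightarrow> ('g \<times> 'g \<Rightarrow> 'k::comm_ring_1) \<Rightarrow> ('g \<Rightarrow> 'k) set \<Rightarrow> bool" where
  "normal_hopf_subalg G J K =
    (hopf_subalg G J K \<and> (\<forall>h\<in>galg G. \<forall>a\<in>K. tad G J h a \<in> K))"

definition twisted_simple :: "('g, 'm) monoid_scheme \<Rightarrow> ('g \<times> 'g \<Rightarrow> 'k::comm_ring_1) \<Rightarrow> bool" where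
  "twisted_simple G J =
    (\<forall>K. normal_hopf_subalg G J K \<longrightarrow>
        K = {(\<lambda>z. c * gunit G z) | c. True} \<or> K = galg G)"

definition tensor_map :: "('g, 'm) monoid_scheme \<Rightarrow> (('g \<Rightarrow> 'k::comm_ring_1) \<Rightarrow> ('h \<Rightarrow> 'k))
    \<Rightarrow> ('g \<times> 'g \<Rightarrow> 'k) \<Rightarrow> ('h \<times> 'h \<Rightarrow> 'k)" where
  "tensor_map G \<phi> T = (\<lambda>(x, y). \<Sum>(u, v)\<in>carrier G \<times> carrier G.
      T (u, v) * \<phi> (gdelta u) x * \<phi> (gdelta v) y)"

definition hopf_iso :: "('g, 'm) monoid_scheme \<Rightarrow> ('g \<times> 'g \<Rightarrow> 'k::comm_ring_1)
    \<Rightarrow> ('h, 'n) monoid_scheme \<Rightarrow> ('h \<times> 'h \<Rightarrow> 'k) \<Rightarrow> (('g \<Rightarrow> 'k) \<Rightarrow> ('h \<Rightarrow> 'k)) \<Rightarrow> bool" where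
  "hopf_iso G J H J' \<phi> =
    (bij_betw \<phi> (galg G) (galg H) \<and>
     (\<forall>a\<in>galg G. \<forall>b\<in>galg G. \<phi> (\<lambda>z. a z + b z) = (\<lambda>z. \<phi> a z + \<phi> b z)) \<and>
     (\<forall>c. \<forall>a\<in>galg G. \<phi> (\<lambda>z. c * a z) = (\<lambda>z. c * \<phi> a z)) \<and>
     (\<forall>a\<in>galg G. \<forall>b\<in>galg G. \<phi> (gmult G a b) = gmult H (\<phi> a) (\<phi> b)) \<and>
     \<phi> (gunit G) = gunit H \<and>
     (\<forall>a\<in>galg G. gcounit H (\<phi> a) = gcounit G a) \<and>
     (\<forall>a\<in>galg G. tcomult H J' (\<phi> a) = tensor_map G \<phi> (tcomult G J a)) \<and>
     (\<forall>a\<in>galg G. tantipode H J' (\<phi> a) = \<phi> (tantipode G J a)))"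

definition hopf_isomorphic :: "('g, 'm) monoid_scheme \<Rightarrow> ('g \<times> 'g \<Rightarrow> 'k::comm_ring_1)
    \<Rightarrow> ('h, 'n) monoid_scheme \<Rightarrow> ('h \<times> 'h \<Rightarrow> 'k) \<Rightarrow> bool" where
  "hopf_isomorphic G J H J' = (\<exists>\<phi>. hopf_iso G J H J' \<phi>)"

definition chars :: "('g, 'm) monoid_scheme \<Rightarrow> 'g set \<Rightarrow> ('g \<Rightarrow> 'k::field) set" where
  "chars G H = {\<chi>. \<chi> \<one>\<^bsub>G\<^esub> = 1 \<and> (\<forall>x\<in>H. \<forall>y\<in>H. \<chi> (x \<otimes>\<^bsub>G\<^esub> y) = \<chi> x * \<chi> y) \<and>
                   (\<forall>x. x \<notin> H \<longrightarrow> \<chi> x = 0)}"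

definition char_mult :: "('g \<Rightarrow> 'k::field) \<Rightarrow> ('g \<Rightarrow> 'k) \<Rightarrow> ('g \<Rightarrow> 'k)" where
  "char_mult \<alpha> \<beta> = (\<lambda>x. \<alpha> x * \<beta> x)"

definition char_idem :: "('g, 'm) monoid_scheme \<Rightarrow> 'g set \<Rightarrow> ('g \<Rightarrow> 'k::field) \<Rightarrow> ('g \<Rightarrow> 'k)" where
  "char_idem G H \<chi> = (\<lambda>x. if x \<in> H then \<chi> (inv\<^bsub>G\<^esub> x) / of_nat (card H) else 0)"

definition lifted_twist :: "('g, 'm) monoid_scheme \<Rightarrow> 'g set \<Rightarrow> (('g \<Rightarrow> 'k::field) \<Rightarrow> ('g \<Rightarrow> 'k) \<Rightarrow> 'k)
    \<Rightarrow> ('g \<times> 'g \<Rightarrow> 'k)" where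
  "lifted_twist G H \<omega> = (\<lambda>(x, y). \<Sum>\<alpha>\<in>chars G H. \<Sum>\<beta>\<in>chars G H.
      \<omega> \<alpha> \<beta> * char_idem G H \<alpha> x * char_idem G H \<beta> y)"

definition two_cocycle :: "('g, 'm) monoid_scheme \<Rightarrow> 'g set \<Rightarrow> (('g \<Rightarrow> 'k::field) \<Rightarrow> ('g \<Rightarrow> 'k) \<Rightarrow> 'k) \<Rightarrow> bool" where
  "two_cocycle G H \<omega> =
    ((\<forall>\<alpha>\<in>chars G H. \<forall>\<beta>\<in>chars G H. \<omega> \<alpha> \<beta> \<noteq> 0) \<and>
     (\<forall>\<alpha>\<in>chars G H. \<forall>\<beta>\<in>chars G H. \<forall>\<gamma>\<in>chars G H.
        \<omega> \<alpha> \<beta> * \<omega> (char_mult \<alpha> \<beta>) \<gamma> = \<omega> \<beta> \<gamma> * \<omega> \<alpha> (char_mult \<beta> \<gamma>)))"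

definition coboundary :: "('g, 'm) monoid_scheme \<Rightarrow> 'g set \<Rightarrow> (('g \<Rightarrow> 'k::field) \<Rightarrow> ('g \<Rightarrow> 'k) \<Rightarrow> 'k) \<Rightarrow> bool" where
  "coboundary G H \<omega> =
    (\<exists>\<mu>. (\<forall>\<alpha>\<in>chars G H. \<mu> \<alpha> \<noteq> 0) \<and>
         (\<forall>\<alpha>\<in>chars G H. \<forall>\<beta>\<in>chars G H. \<omega> \<alpha> \<beta> = \<mu> \<alpha> * \<mu> \<beta> / \<mu> (char_mult \<alpha> \<beta>)))"

text \<open>Dihedral group of order 6: (a, s) stands for r^a f^s, with f r = r^{-1} f.\<close>
definition D3 :: "(nat \<times> nat) monoid" where
  "D3 = \<lparr>carrier = {0..<3} \<times> {0..<2},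
         monoid.mult = (\<lambda>(a, s) (b, t). ((a + (if s = 0 then b else 2 * b)) mod 3, (s + t) mod 2)),
         one = (0, 0)\<rparr>"

definition Klein4 :: "(int \<times> int) monoid" where
  "Klein4 = integer_mod_group 2 \<times>\<times> integer_mod_group 2"

end

theory Submission
  imports Defs "HOL-Library.Function_Algebras"
begin

text \<open>The functions on G with the star product dual to J form an algebra B with an action of G, and J is
  gauge equivalent to a twist lifted from an abelian subgroup P with cocycle \<open>\<omega>\<close> as soon as B is induced
  from the \<open>\<omega>\<close>-twisted group algebra of the dual of P.

  A nontrivial central subgroup spans a normal Hopf subalgebra, so G is centerless. For order 36 this forces
  G = N P with N normal of order 9 and P of order 4, both abelian. Then B is graded by the dual of N, and its
  degree-one part is the twisted group algebra of the dual of P for a cocycle \<open>\<kappa>\<close>. If \<open>\<kappa>\<close> is symmetric,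
  which is automatic for cyclic P, then the degree-one part is split commutative and J is gauge equivalent to a
  twist lifted from N, so that kN becomes a normal Hopf subalgebra. Otherwise P is a Klein four-group, N has
  exponent 3 and G is the product of two dihedral groups. The degree-one part is now a matrix algebra, so B is
  its tensor product with its centralizer; cube roots of the unit in the centralizer split the latter, and B is
  induced from the \<open>\<kappa>\<close>-twisted group algebra of the dual of P.\<close>

section \<open>Group algebras\<close>

text \<open>Functions are the right setting because associativity of the star product is the cocycle
  equation of J, while left translations are algebra automorphisms. A linear map of functions that
  commutes with translations is convolution by a single function v, so an equivariant isomorphism of
  star algebras is a gauge transformation in disguise. Recognising an induced star algebra thus
  means finding suitable homogeneous elements. These come from invertibility of J: it yields a
  Galois identity, by which each degree of the grading and its inverse degree together produce the
  unit. In the symmetric case the remaining obstruction is a map from the dual of N to P,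
  multiplicative up to the action of P; it is trivial because 9 is odd. In the other case square
  roots, signs and cube roots can be chosen compatibly because 2 and 3 are coprime. The antipode of
  a twisted algebra is given by a definite description. An explicit formula settles existence;
  uniqueness lets every bialgebra isomorphism transport the antipode, and simplicity with
  it.\<close>

locale fin_group = group G for G (structure) +
  assumes fin [simp, intro]: "finite (carrier G)"

lemma fin_group_DirProd:
  assumes "fin_group G" "fin_group H"
  shows "fin_group (G \<times>\<times> H)"
  using assms unfolding fin_group_def fin_group_axioms_def by (auto intro: DirProd_group)

lemma galgI: "(\<And>x. x \<notin> carrier G \<Longrightarrow> a x = 0) \<Longrightarrow> a \<in> galg G"
  by (auto simp: galg_def)

lemma galgD: "a \<in> galg G \<Longrightarrow> x \<notin> carrier G \<Longrightarrow> a x = 0"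
  by (auto simp: galg_def)

lemma gdelta_galg [simp]: "x \<in> carrier G \<Longrightarrow> gdelta x \<in> galg G"
  by (auto simp: galg_def gdelta_def)

context fin_group
begin

lemma sum_gdelta:
  fixes F :: "'a \<Rightarrow> 'k::comm_ring_1"
  shows "x \<in> carrier G \<Longrightarrow> (\<Sum>y\<in>carrier G. gdelta x y * F y) = F x"
  unfolding gdelta_def by (subst sum.remove[of _ x]) (auto intro!: sum.neutral)

text \<open>Pairing with an arbitrary \<open>F\<close> avoids pointwise comparison, in which the
  \<open>inv y\<close> of the convolution formula would have to be manipulated;
  \<open>sum_gmult\<close> and \<open>sum_gpush\<close> turn both sides into plain sums over basis
  elements.\<close>

lemma galg_eqI:
  fixes a b :: "'a \<Rightarrow> 'k::comm_ring_1"
  assumes "a \<in> galg G" "b \<in> galg G"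
    and *: "\<And>F :: 'a \<Rightarrow> 'k. (\<Sum>x\<in>carrier G. a x * F x) = (\<Sum>x\<in>carrier G. b x * F x)"
  shows "a = b"
proof
  fix x show "a x = b x"
  proof (cases "x \<in> carrier G")
    case True
    with *[of "gdelta x"] show ?thesis
      by (simp add: sum_gdelta mult.commute[of _ "gdelta x _"])
  next
    case False
    with assms show ?thesis by (simp add: galgD)
  qed
qed

lemma gmult_galg [simp]: "gmult G a b \<in> galg G"
  by (auto simp: galg_def gmult_def)

lemma gunit_galg [simp]: "gunit G \<in> galg G"
  by (simp add: gunit_def)

lemma bij_betw_mult_left: "y \<in> carrier G \<Longrightarrow> bij_betw (\<lambda>z. y \<otimes> z) (carrier G) (carrier G)"
  by (rule bij_betwI[where g = "\<lambda>z. inv y \<otimes> z"]) (auto simp: m_assoc[symmetric])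

lemma bij_betw_inv: "bij_betw (\<lambda>z. inv z) (carrier G) (carrier G)"
  by (rule bij_betwI[where g = "\<lambda>z. inv z"]) auto

text \<open>The substitution x = y z removes the inverse from the convolution formula.\<close>

lemma sum_gmult:
  fixes a b :: "'a \<Rightarrow> 'k::comm_ring_1"
  shows "(\<Sum>x\<in>carrier G. gmult G a b x * F x) = (\<Sum>y\<in>carrier G. \<Sum>z\<in>carrier G. a y * b z * F (y \<otimes> z))"
proof -
  have "(\<Sum>x\<in>carrier G. gmult G a b x * F x)
      = (\<Sum>y\<in>carrier G. \<Sum>x\<in>carrier G. a y * b (inv y \<otimes> x) * F x)"
    by (simp add: gmult_def sum_distrib_right) (rule sum.swap)
  also have "\<dots> = (\<Sum>y\<in>carrier G. \<Sum>z\<in>carrier G. a y * b z * F (y \<otimes> z))"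
  proof (rule sum.cong[OF refl])
    fix y assume y: "y \<in> carrier G"
    show "(\<Sum>x\<in>carrier G. a y * b (inv y \<otimes> x) * F x) = (\<Sum>z\<in>carrier G. a y * b z * F (y \<otimes> z))"
      by (subst sum.reindex_bij_betw[OF bij_betw_mult_left[OF y], symmetric])
        (auto intro!: sum.cong simp: m_assoc[symmetric] y)
  qed
  finally show ?thesis .
qed

lemma gmult_assoc:
  fixes a b c :: "'a \<Rightarrow> 'k::comm_ring_1"
  shows "gmult G (gmult G a b) c = gmult G a (gmult G b c)"
proof (rule galg_eqI)
  fix F
  have "(\<Sum>x\<in>carrier G. gmult G (gmult G a b) c x * F x)
      = (\<Sum>z\<in>carrier G. \<Sum>x\<in>carrier G. gmult G a b x * (c z * F (x \<otimes> z)))"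
    by (subst sum_gmult, subst sum.swap) (simp add: mult_ac)
  also have "\<dots> = (\<Sum>y\<in>carrier G. \<Sum>x\<in>carrier G. gmult G b c x * (a y * F (y \<otimes> x)))"
    unfolding sum_gmult
    by (subst sum.swap, rule sum.cong[OF refl], subst sum.swap)
      (auto intro!: sum.cong simp: m_assoc mult_ac)
  also have "\<dots> = (\<Sum>x\<in>carrier G. gmult G a (gmult G b c) x * F x)"
    by (subst (2) sum_gmult) (simp add: mult_ac)
  finally show "(\<Sum>x\<in>carrier G. gmult G (gmult G a b) c x * F x)
      = (\<Sum>x\<in>carrier G. gmult G a (gmult G b c) x * F x)" .
qed auto

lemma gmult_gunit_left [simp]: "a \<in> galg G \<Longrightarrow> gmult G (gunit G) a = a"
proof (rule galg_eqI)
  fix F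
  show "(\<Sum>x\<in>carrier G. gmult G (gunit G) a x * F x) = (\<Sum>x\<in>carrier G. a x * F x)"
    unfolding sum_gmult gunit_def
    by (subst sum.swap) (auto simp: mult.assoc sum_gdelta)
qed auto

lemma gmult_gunit_right [simp]: "a \<in> galg G \<Longrightarrow> gmult G a (gunit G) = a"
proof (rule galg_eqI)
  fix F
  have "(\<Sum>x\<in>carrier G. gmult G a (gunit G) x * F x)
    = (\<Sum>y\<in>carrier G. a y * (\<Sum>x\<in>carrier G. gdelta \<one> x * F (y \<otimes> x)))"
    unfolding sum_gmult gunit_def by (simp add: sum_distrib_left mult.assoc)
  then show "(\<Sum>x\<in>carrier G. gmult G a (gunit G) x * F x) = (\<Sum>x\<in>carrier G. a x * F x)"
    by (simp add: sum_gdelta)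
qed auto

lemma gmult_gdelta:
  assumes "x \<in> carrier G" "y \<in> carrier G"
  shows "gmult G (gdelta x) (gdelta y) = gdelta (x \<otimes> y)"
proof (rule galg_eqI)
  fix F
  show "(\<Sum>z\<in>carrier G. gmult G (gdelta x) (gdelta y) z * F z) = (\<Sum>z\<in>carrier G. gdelta (x \<otimes> y) z * F z)"
    using assms by (simp add: sum_gmult mult.assoc sum_distrib_left[symmetric] sum_gdelta)
qed (use assms in auto)

lemma gmult_gdelta_left:
  assumes "u \<in> carrier G" "z \<in> carrier G" shows "gmult G (gdelta u) w z = w (inv u \<otimes> z)"
  using assms by (simp add: gmult_def sum_gdelta)

lemma gmult_gdelta_right:
  assumes "v \<in> carrier G" "z \<in> carrier G" shows "gmult G w (gdelta v) z = w (z \<otimes> inv v)"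
proof -
  have *: "inv y \<otimes> z = v \<longleftrightarrow> y = z \<otimes> inv v" if "y \<in> carrier G" for y
    using assms that by (metis inv_closed inv_solve_left inv_solve_right m_closed)
  have "gmult G w (gdelta v) z = (\<Sum>y\<in>carrier G. gdelta (z \<otimes> inv v) y * w y)"
    using assms by (auto simp: gmult_def gdelta_def * intro!: sum.cong)
  then show ?thesis using assms by (simp add: sum_gdelta)
qed

lemma gmult_sum_left:
  "gmult G (\<lambda>z. \<Sum>i\<in>I. c i * f i z) b = (\<lambda>z. \<Sum>i\<in>I. c i * gmult G (f i) b z)"
proof
  fix z show "gmult G (\<lambda>z. \<Sum>i\<in>I. c i * f i z) b z = (\<Sum>i\<in>I. c i * gmult G (f i) b z)"
    by (auto simp: gmult_def sum_distrib_right sum_distrib_left mult_ac intro: sum.swap)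
qed

lemma gmult_sum_right:
  "gmult G b (\<lambda>z. \<Sum>i\<in>I. c i * f i z) = (\<lambda>z. \<Sum>i\<in>I. c i * gmult G b (f i) z)"
proof
  fix z show "gmult G b (\<lambda>z. \<Sum>i\<in>I. c i * f i z) z = (\<Sum>i\<in>I. c i * gmult G b (f i) z)"
    by (auto simp: gmult_def sum_distrib_right sum_distrib_left mult_ac intro: sum.swap)
qed

lemma gmult_scale_left: "gmult G (\<lambda>z. c * f z) b = (\<lambda>z. c * gmult G f b z)"
  and gmult_scale_right: "gmult G b (\<lambda>z. c * f z) = (\<lambda>z. c * gmult G b f z)"
  by (auto simp: gmult_def sum_distrib_left mult_ac)

lemma gmult_add_left: "gmult G (\<lambda>z. f z + g z) b = (\<lambda>z. gmult G f b z + gmult G g b z)"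
  and gmult_add_right: "gmult G b (\<lambda>z. f z + g z) = (\<lambda>z. gmult G b f z + gmult G b g z)"
  by (auto simp: gmult_def sum.distrib algebra_simps)

lemma galg_expand:
  fixes a :: "'a \<Rightarrow> 'k::comm_ring_1"
  assumes "a \<in> galg G" shows "a = (\<lambda>z. \<Sum>x\<in>carrier G. a x * gdelta x z)"
proof
  fix z show "a z = (\<Sum>x\<in>carrier G. a x * gdelta x z)"
    using assms by (cases "z \<in> carrier G")
      (auto simp: gdelta_def galgD if_distrib sum.delta' cong: if_cong intro!: sum.neutral[symmetric])
qed

text \<open>A left inverse equals a right inverse. Below this also identifies two different-looking
  expressions, one shown to be a left and the other a right inverse of the same element.\<close>

lemma ginv_unique:
  assumes "b \<in> galg G" "c \<in> galg G" "gmult G b a = gunit G" "gmult G a c = gunit G"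
  shows "b = c"
  using gmult_assoc[of b a c] assms by simp

lemma ginv_eqI:
  assumes "b \<in> galg G" "gmult G a b = gunit G" "gmult G b a = gunit G"
  shows "ginv G a = b"
  unfolding ginv_def using assms by (intro the_equality) (auto intro: ginv_unique)

lemma ginvertible_ginv:
  assumes "ginvertible G a"
  shows "ginv G a \<in> galg G" "gmult G a (ginv G a) = gunit G" "gmult G (ginv G a) a = gunit G"
proof -
  obtain b where b: "b \<in> galg G" "gmult G a b = gunit G" "gmult G b a = gunit G"
    using assms unfolding ginvertible_def by blast
  from ginv_eqI[OF this] b show "ginv G a \<in> galg G" "gmult G a (ginv G a) = gunit G"
    "gmult G (ginv G a) a = gunit G" by auto
qed

lemma gmult_cancel_mid:
  assumes "gmult G b c = gunit G" "d \<in> galg G"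
  shows "gmult G (gmult G a b) (gmult G c d) = gmult G a d"
  using assms by (simp add: gmult_assoc) (metis gmult_assoc gmult_gunit_left)

end

text \<open>Pushforward along a map of the basis; for a group homomorphism it is the induced algebra map.
  The comultiplication, the counit and the maps \<open>\<Delta> \<otimes> id\<close>, \<open>id \<otimes> \<Delta>\<close> are all of this form.\<close>
definition gpush :: "('g, 'm) monoid_scheme \<Rightarrow> ('g \<Rightarrow> 'h) \<Rightarrow> ('g \<Rightarrow> 'k::comm_ring_1) \<Rightarrow> 'h \<Rightarrow> 'k" where
  "gpush A h a = (\<lambda>y. \<Sum>x\<in>carrier A. if h x = y then a x else 0)"

lemma gpush_galg: "h \<in> carrier A \<rightarrow> carrier B \<Longrightarrow> gpush A h a \<in> galg B"
  unfolding gpush_def by (rule galgI) (auto intro!: sum.neutral)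

text \<open>Pushforward is adjoint to composition with \<open>h\<close>. Together with
  \<open>galg_eqI\<close> this reduces identities between pushforwards to identities between maps of
  basis elements.\<close>

lemma sum_gpush:
  assumes "finite (carrier B)" "h \<in> carrier A \<rightarrow> carrier B"
  shows "(\<Sum>y\<in>carrier B. gpush A h a y * F y) = (\<Sum>x\<in>carrier A. a x * F (h x))"
proof -
  have "(\<Sum>y\<in>carrier B. gpush A h a y * F y) = (\<Sum>x\<in>carrier A. \<Sum>y\<in>carrier B. (if h x = y then a x else 0) * F y)"
    by (simp add: gpush_def sum_distrib_right) (rule sum.swap)
  also have "\<dots> = (\<Sum>x\<in>carrier A. a x * F (h x))"
  proof (rule sum.cong[OF refl])
    fix x assume "x \<in> carrier A"
    then have "h x \<in> carrier B" using assms by auto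
    then show "(\<Sum>y\<in>carrier B. (if h x = y then a x else 0) * F y) = a x * F (h x)"
      using assms by (subst sum.remove[of _ "h x"]) (auto intro!: sum.neutral split: if_splits)
  qed
  finally show ?thesis .
qed

lemma gpush_gmult:
  assumes "fin_group A" "fin_group B" "h \<in> hom A B"
  shows "gpush A h (gmult A a b) = gmult B (gpush A h a) (gpush A h b)"
proof -
  interpret A: fin_group A by fact
  interpret B: fin_group B by fact
  have h: "h \<in> carrier A \<rightarrow> carrier B" using assms(3) by (auto simp: hom_def)
  show ?thesis
  proof (rule B.galg_eqI)
    fix F
    have "(\<Sum>x\<in>carrier B. gmult B (gpush A h a) (gpush A h b) x * F x)
       = (\<Sum>y\<in>carrier B. gpush A h a y * (\<Sum>z\<in>carrier B. gpush A h b z * F (y \<otimes>\<^bsub>B\<^esub> z)))"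
      by (simp add: B.sum_gmult sum_distrib_left mult.assoc)
    also have "\<dots> = (\<Sum>y\<in>carrier A. a y * (\<Sum>z\<in>carrier A. b z * F (h y \<otimes>\<^bsub>B\<^esub> h z)))"
      by (simp add: sum_gpush h)
    also have "\<dots> = (\<Sum>x\<in>carrier B. gpush A h (gmult A a b) x * F x)"
      using assms(3) by (auto simp: sum_gpush h A.sum_gmult hom_mult sum_distrib_left mult.assoc intro!: sum.cong)
    finally show "(\<Sum>x\<in>carrier B. gpush A h (gmult A a b) x * F x)
       = (\<Sum>x\<in>carrier B. gmult B (gpush A h a) (gpush A h b) x * F x)" by simp
  qed (rule gpush_galg[OF h], rule B.gmult_galg)
qed

lemma sum_gmult_gpush:
  assumes "fin_group B" "h \<in> carrier A \<rightarrow> carrier B" "h' \<in> carrier A' \<rightarrow> carrier B"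
  shows "(\<Sum>y\<in>carrier B. gmult B (gpush A h a) (gpush A' h' a') y * F y)
     = (\<Sum>x\<in>carrier A. \<Sum>x'\<in>carrier A'. a x * a' x' * F (h x \<otimes>\<^bsub>B\<^esub> h' x'))"
proof -
  interpret B: fin_group B by fact
  have "(\<Sum>y\<in>carrier B. gmult B (gpush A h a) (gpush A' h' a') y * F y)
       = (\<Sum>y\<in>carrier B. gpush A h a y * (\<Sum>z\<in>carrier B. gpush A' h' a' z * F (y \<otimes>\<^bsub>B\<^esub> z)))"
    by (simp add: B.sum_gmult sum_distrib_left mult.assoc)
  also have "\<dots> = (\<Sum>x\<in>carrier A. a x * (\<Sum>x'\<in>carrier A'. a' x' * F (h x \<otimes>\<^bsub>B\<^esub> h' x')))"
    by (simp add: sum_gpush assms)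
  finally show ?thesis
    by (simp add: sum_distrib_left mult.assoc)
qed

lemma gpush_gdelta:
  assumes "finite (carrier A)" "x \<in> carrier A"
  shows "gpush A h (gdelta x) = gdelta (h x)"
proof
  fix y show "gpush A h (gdelta x) y = gdelta (h x) y"
    unfolding gpush_def gdelta_def using assms
    by (subst sum.remove[of _ x]) (auto intro!: sum.neutral split: if_splits)
qed

lemma gpush_gunit:
  assumes "fin_group A" "fin_group B" "h \<in> hom A B"
  shows "gpush A h (gunit A) = gunit B"
proof -
  interpret A: fin_group A by fact
  interpret B: fin_group B by fact
  show ?thesis unfolding gunit_def
    using assms(3) by (subst gpush_gdelta) (auto simp: hom_one[OF assms(3)] A.is_group B.is_group)
qed

lemma gpush_gpush:
  assumes "finite (carrier A)" "fin_group C" "finite (carrier B)"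
    and "h \<in> carrier A \<rightarrow> carrier B" "h' \<in> carrier B \<rightarrow> carrier C"
  shows "gpush B h' (gpush A h a) = gpush A (\<lambda>x. h' (h x)) a"
proof -
  interpret C: fin_group C by fact
  show ?thesis
    by (rule C.galg_eqI)
      (use assms in \<open>auto simp: sum_gpush Pi_def intro!: gpush_galg\<close>)
qed

lemma gpush_galg_eq:
  assumes "finite (carrier A)" "a \<in> galg A" "inj_on h (carrier A)"
  shows "x \<in> carrier A \<Longrightarrow> gpush A h a (h x) = a x"
  unfolding gpush_def using assms
  by (subst sum.remove[of _ x]) (auto intro!: sum.neutral dest: inj_onD split: if_splits)

lemma gpush_outside: "y \<notin> h ` carrier A \<Longrightarrow> gpush A h a y = 0"
  unfolding gpush_def by (auto intro!: sum.neutral)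

text \<open>A copy of the locale above, so that it can carry sublocales for the powers of G.\<close>
locale tensor_group = fin_group

context tensor_group
begin

abbreviation G2 where "G2 \<equiv> G \<times>\<times> G"
abbreviation G3 where "G3 \<equiv> G \<times>\<times> (G \<times>\<times> G)"

lemma fin_group_G: "fin_group G" ..
lemma fin_group_G2: "fin_group G2" by (intro fin_group_DirProd fin_group_G)
lemma fin_group_G3: "fin_group G3" by (intro fin_group_DirProd fin_group_G)

sublocale two: fin_group G2 by (rule fin_group_G2)
sublocale three: fin_group G3 by (rule fin_group_G3)

text \<open>Doubling a leg applies the comultiplication there, and inserting the unit tensors with
  1: pushing J along \<open>dup1\<close>, \<open>dup2\<close>, \<open>ins3\<close>,
  \<open>ins1\<close> gives (\<Delta> \<otimes> id)(J), (id \<otimes> \<Delta>)(J), J \<otimes> 1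
  and 1 \<otimes> J.\<close>

definition "dup1 = (\<lambda>(x, z). (x, (x, z)))"
definition "dup2 = (\<lambda>(x, y). (x, (y, y)))"
definition "ins3 = (\<lambda>(x, y). (x, (y, \<one>)))"
definition "ins1 = (\<lambda>(y, z). (\<one>, (y, z)))"

lemmas ins_dup_defs = dup1_def dup2_def ins3_def ins1_def

lemma hom_ins_dup: "dup1 \<in> hom G2 G3" "dup2 \<in> hom G2 G3" "ins3 \<in> hom G2 G3" "ins1 \<in> hom G2 G3"
  by (auto simp: hom_def ins_dup_defs)

lemma fun_ins_dup:
  "dup1 \<in> carrier G2 \<rightarrow> carrier G3" "dup2 \<in> carrier G2 \<rightarrow> carrier G3"
  "ins3 \<in> carrier G2 \<rightarrow> carrier G3" "ins1 \<in> carrier G2 \<rightarrow> carrier G3"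
  by (auto simp: ins_dup_defs)

lemma inj_ins_dup: "inj_on dup1 A" "inj_on dup2 A" "inj_on ins3 A" "inj_on ins1 A"
  by (auto simp: inj_on_def ins_dup_defs)

lemma hom_proj: "fst \<in> hom G2 G" "snd \<in> hom G2 G"
  by (auto simp: hom_def)

lemma hom_diag: "(\<lambda>x. (x, x)) \<in> hom G G2"
  by (auto simp: hom_def)

lemma gpush_fst: "gpush G2 fst J = (\<lambda>x. if x \<in> carrier G then \<Sum>y\<in>carrier G. J (x, y) else 0)"
proof
  fix x
  have "gpush G2 fst J x = (\<Sum>x'\<in>carrier G. if x' = x then \<Sum>y\<in>carrier G. J (x', y) else 0)"
    unfolding gpush_def carrier_DirProd sum.cartesian_product' by (intro sum.cong) simp_all
  then show "gpush G2 fst J x = (if x \<in> carrier G then \<Sum>y\<in>carrier G. J (x, y) else 0)"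
    by (simp add: sum.delta)
qed

lemma gpush_snd: "gpush G2 snd J = (\<lambda>y. if y \<in> carrier G then \<Sum>x\<in>carrier G. J (x, y) else 0)"
proof
  fix x
  have "gpush G2 snd J x = (\<Sum>y\<in>carrier G. if x \<in> carrier G then J (y, x) else 0)"
    unfolding gpush_def carrier_DirProd sum.cartesian_product' by (intro sum.cong) (simp_all add: sum.delta)
  then show "gpush G2 snd J x = (if x \<in> carrier G then \<Sum>y\<in>carrier G. J (y, x) else 0)"
    by simp
qed

lemma gpush_ins_dup:
  assumes "J \<in> galg G2"
  shows "gpush G2 dup1 J = (\<lambda>(x, (y, z)). if x = y \<and> x \<in> carrier G then J (x, z) else 0)"
    and "gpush G2 dup2 J = (\<lambda>(x, (y, z)). if y = z \<and> y \<in> carrier G then J (x, y) else 0)"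
    and "gpush G2 ins3 J = (\<lambda>(x, (y, z)). J (x, y) * gdelta \<one> z)"
    and "gpush G2 ins1 J = (\<lambda>(x, (y, z)). gdelta \<one> x * J (y, z))"
proof -
  note J = assms galgD[OF assms]
  note eq = gpush_galg_eq[OF two.fin assms inj_ins_dup(1)] gpush_galg_eq[OF two.fin assms inj_ins_dup(2)]
    gpush_galg_eq[OF two.fin assms inj_ins_dup(3)] gpush_galg_eq[OF two.fin assms inj_ins_dup(4)]
  show "gpush G2 dup1 J = (\<lambda>(x, (y, z)). if x = y \<and> x \<in> carrier G then J (x, z) else 0)"
  proof (unfold fun_eq_iff split_paired_All prod.case, intro allI)
    fix x y z
    show "gpush G2 dup1 J (x, y, z) = (if x = y \<and> x \<in> carrier G then J (x, z) else 0)"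
      using eq(1)[of "(x, z)"] J(2)[of "(x, z)"]
      by (cases "x = y \<and> x \<in> carrier G \<and> z \<in> carrier G") (auto simp: dup1_def intro!: gpush_outside)
  qed
  show "gpush G2 dup2 J = (\<lambda>(x, (y, z)). if y = z \<and> y \<in> carrier G then J (x, y) else 0)"
  proof (unfold fun_eq_iff split_paired_All prod.case, intro allI)
    fix x y z
    show "gpush G2 dup2 J (x, y, z) = (if y = z \<and> y \<in> carrier G then J (x, y) else 0)"
      using eq(2)[of "(x, z)"] J(2)[of "(x, z)"]
      by (cases "y = z \<and> x \<in> carrier G \<and> z \<in> carrier G") (auto simp: dup2_def intro!: gpush_outside)
  qed
  show "gpush G2 ins3 J = (\<lambda>(x, (y, z)). J (x, y) * gdelta \<one> z)"
  proof (unfold fun_eq_iff split_paired_All prod.case, intro allI)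
    fix x y z
    show "gpush G2 ins3 J (x, y, z) = J (x, y) * gdelta \<one> z"
      using eq(3)[of "(x, y)"] J(2)[of "(x, y)"]
      by (cases "z = \<one>"; cases "x \<in> carrier G \<and> y \<in> carrier G") 
        (auto simp: ins3_def gdelta_def intro!: gpush_outside)
  qed
  show "gpush G2 ins1 J = (\<lambda>(x, (y, z)). gdelta \<one> x * J (y, z))"
  proof (unfold fun_eq_iff split_paired_All prod.case, intro allI)
    fix x y z
    show "gpush G2 ins1 J (x, y, z) = gdelta \<one> x * J (y, z)"
      using eq(4)[of "(y, z)"] J(2)[of "(y, z)"]
      by (cases "x = \<one>"; cases "z \<in> carrier G \<and> y \<in> carrier G") 
        (auto simp: ins1_def gdelta_def intro!: gpush_outside)
  qed
qed

text \<open>All conditions become statements about pushforwards along group homomorphisms, so that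
  the multiplicativity \<open>gpush_gmult\<close> applies to each of them.\<close>

lemma is_twist_iff:
  "is_twist G J \<longleftrightarrow> J \<in> galg G2 \<and> ginvertible G2 J \<and>
     gmult G3 (gpush G2 dup1 J) (gpush G2 ins3 J) = gmult G3 (gpush G2 dup2 J) (gpush G2 ins1 J) \<and>
     gpush G2 fst J = gunit G \<and> gpush G2 snd J = gunit G"
proof (cases "J \<in> galg G2")
  case True
  have "gpush G2 fst J = gunit G \<longleftrightarrow> (\<forall>x\<in>carrier G. (\<Sum>y\<in>carrier G. J (x, y)) = gdelta \<one> x)"
    by (auto simp: gpush_fst gunit_def fun_eq_iff gdelta_def)
  moreover have "gpush G2 snd J = gunit G \<longleftrightarrow> (\<forall>y\<in>carrier G. (\<Sum>x\<in>carrier G. J (x, y)) = gdelta \<one> y)"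
    by (auto simp: gpush_snd gunit_def fun_eq_iff gdelta_def)
  ultimately show ?thesis
    unfolding is_twist_def gpush_ins_dup[OF True] by auto
qed (auto simp: is_twist_def)

lemma gcomult_eq_gpush:
  assumes "a \<in> galg G" shows "gcomult G a = gpush G (\<lambda>x. (x, x)) a"
proof (unfold fun_eq_iff split_paired_All gcomult_def prod.case, intro allI)
  fix x y
  show "(if x = y \<and> x \<in> carrier G then a x else 0) = gpush G (\<lambda>x. (x, x)) a (x, y)"
    using gpush_galg_eq[OF fin assms, of "\<lambda>x. (x, x)" x]
    by (auto simp: inj_on_def intro!: gpush_outside)
qed

lemma gcomult_gdelta: "x \<in> carrier G \<Longrightarrow> gcomult G (gdelta x) = gdelta (x, x)"
  by (auto simp: gcomult_def gdelta_def fun_eq_iff)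

lemma gcomult_gmult: "a \<in> galg G \<Longrightarrow> b \<in> galg G \<Longrightarrow>
   gcomult G (gmult G a b) = gmult G2 (gcomult G a) (gcomult G b)"
  by (simp add: gcomult_eq_gpush gpush_gmult[OF fin_group_G fin_group_G2 hom_diag])

lemma gcomult_galg [simp]: "gcomult G a \<in> galg G2"
  by (auto simp: gcomult_def galg_def)

lemma gcomult_gunit: "gcomult G (gunit G) = gunit G2"
  by (simp add: gunit_def gcomult_gdelta)

text \<open>The right action \<open>w \<cdot> (u \<otimes> v) = u\<inverse> w v\<close> and the left action \<open>(u \<otimes> v) \<cdot> w = u w v\<inverse>\<close>
  of \<open>kG \<otimes> kG\<close> on \<open>kG\<close>.\<close>
definition lact :: "('a \<times> 'a \<Rightarrow> 'k::comm_ring_1) \<Rightarrow> ('a \<Rightarrow> 'k) \<Rightarrow> 'a \<Rightarrow> 'k" where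
  "lact T w = (\<lambda>z. if z \<in> carrier G then \<Sum>p\<in>carrier G2. T p * w (fst p \<otimes> z \<otimes> inv (snd p)) else 0)"

definition ract :: "('a \<times> 'a \<Rightarrow> 'k::comm_ring_1) \<Rightarrow> ('a \<Rightarrow> 'k) \<Rightarrow> 'a \<Rightarrow> 'k" where
  "ract T w = (\<lambda>z. if z \<in> carrier G then \<Sum>p\<in>carrier G2. T p * w (inv (fst p) \<otimes> z \<otimes> snd p) else 0)"

lemma lact_galg [simp]: "lact T w \<in> galg G" and ract_galg [simp]: "ract T w \<in> galg G"
  by (auto simp: lact_def ract_def galg_def)

lemma lact_gmult: "lact (gmult G2 T T') w = lact T' (lact T w)"
proof
  fix z show "lact (gmult G2 T T') w z = lact T' (lact T w) z"
  proof (cases "z \<in> carrier G")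
    case True
    then have "lact (gmult G2 T T') w z = (\<Sum>p\<in>carrier G2. \<Sum>q\<in>carrier G2.
        T p * T' q * w (fst p \<otimes> fst q \<otimes> z \<otimes> inv (snd p \<otimes> snd q)))"
      by (simp add: lact_def two.sum_gmult mult_DirProd' del: carrier_DirProd)
    also have "\<dots> = (\<Sum>q\<in>carrier G2. \<Sum>p\<in>carrier G2.
        T' q * (T p * w (fst p \<otimes> (fst q \<otimes> z \<otimes> inv (snd q)) \<otimes> inv (snd p))))"
      using True by (subst sum.swap) (auto intro!: sum.cong simp: m_assoc inv_mult_group)
    also have "\<dots> = lact T' (lact T w) z"
      using True by (auto intro!: sum.cong simp: lact_def sum_distrib_left)
    finally show ?thesis .
  qed (simp add: lact_def)
qed

lemma ract_gmult: "ract (gmult G2 T T') w = ract T (ract T' w)"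
proof
  fix z show "ract (gmult G2 T T') w z = ract T (ract T' w) z"
  proof (cases "z \<in> carrier G")
    case True
    then have "ract (gmult G2 T T') w z = (\<Sum>p\<in>carrier G2. \<Sum>q\<in>carrier G2.
        T p * T' q * w (inv (fst p \<otimes> fst q) \<otimes> z \<otimes> (snd p \<otimes> snd q)))"
      by (simp add: ract_def two.sum_gmult mult_DirProd' del: carrier_DirProd)
    also have "\<dots> = (\<Sum>p\<in>carrier G2. \<Sum>q\<in>carrier G2.
        T p * (T' q * w (inv (fst q) \<otimes> (inv (fst p) \<otimes> z \<otimes> snd p) \<otimes> snd q)))"
      using True by (auto intro!: sum.cong simp: m_assoc inv_mult_group)
    also have "\<dots> = ract T (ract T' w) z"
      using True by (auto intro!: sum.cong simp: ract_def sum_distrib_left)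
    finally show ?thesis .
  qed (simp add: ract_def)
qed

lemma lact_gdelta:
  assumes "p \<in> carrier G2" "z \<in> carrier G"
  shows "lact (gdelta p) w z = w (fst p \<otimes> z \<otimes> inv (snd p))"
  using assms unfolding lact_def by (simp add: two.sum_gdelta del: carrier_DirProd)

lemma ract_gdelta:
  assumes "p \<in> carrier G2" "z \<in> carrier G"
  shows "ract (gdelta p) w z = w (inv (fst p) \<otimes> z \<otimes> snd p)"
  using assms unfolding ract_def by (simp add: two.sum_gdelta del: carrier_DirProd)

lemma conj_eq_one_iff:
  assumes "x \<in> carrier G" "z \<in> carrier G" shows "x \<otimes> z \<otimes> inv x = \<one> \<longleftrightarrow> z = \<one>"
  using assms inv_solve_right[of \<one> "x \<otimes> z" x] by (simp add: eq_commute[of \<one>])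

text \<open>Conjugation by x fixes the unit of kG. This invariance under the diagonal is what makes
  the explicit antipode below work.\<close>

lemma lact_diag: "x \<in> carrier G \<Longrightarrow> lact (gdelta (x, x)) (gunit G) = gunit G"
proof
  fix z assume x: "x \<in> carrier G"
  show "lact (gdelta (x, x)) (gunit G) z = gunit G z"
    using lact_gdelta[of "(x,x)" z "gunit G"] x
    by (cases "z \<in> carrier G") (auto simp: conj_eq_one_iff gunit_def gdelta_def lact_def)
qed

lemma ract_diag: "x \<in> carrier G \<Longrightarrow> ract (gdelta (x, x)) (gunit G) = gunit G"
proof
  fix z assume x: "x \<in> carrier G"
  show "ract (gdelta (x, x)) (gunit G) z = gunit G z"
    using ract_gdelta[of "(x,x)" z "gunit G"] x conj_eq_one_iff[of "inv x" z]
    by (cases "z \<in> carrier G") (auto simp: gunit_def gdelta_def ract_def)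
qed

lemma lact_gunit2: "w \<in> galg G \<Longrightarrow> lact (gunit G2) w = w"
proof
  fix z assume w: "w \<in> galg G"
  show "lact (gunit G2) w z = w z"
    using lact_gdelta[of "\<one>\<^bsub>G2\<^esub>" z w] w
    by (cases "z \<in> carrier G") (auto simp: gunit_def lact_def galgD)
qed

lemma ract_gunit2: "w \<in> galg G \<Longrightarrow> ract (gunit G2) w = w"
proof
  fix z assume w: "w \<in> galg G"
  show "ract (gunit G2) w z = w z"
    using ract_gdelta[of "\<one>\<^bsub>G2\<^esub>" z w] w
    by (cases "z \<in> carrier G") (auto simp: gunit_def ract_def galgD)
qed

end

section \<open>Twists and antipodes\<close>

context tensor_group
begin

text \<open>The predicate under the definite description in \<open>tantipode_basis\<close>, isolated
  so that existence and uniqueness can be proved separately.\<close>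

definition is_antipode_basis :: "('a \<times> 'a \<Rightarrow> 'k::comm_ring_1) \<Rightarrow> ('a \<Rightarrow> 'a \<Rightarrow> 'k) \<Rightarrow> bool" where
  "is_antipode_basis J s \<longleftrightarrow>
     (\<forall>x. x \<notin> carrier G \<longrightarrow> s x = (\<lambda>_. 0)) \<and>
     (\<forall>x\<in>carrier G. s x \<in> galg G \<and>
        (\<lambda>z. \<Sum>(u, v)\<in>carrier G \<times> carrier G.
              tcomult G J (gdelta x) (u, v) * gmult G (s u) (gdelta v) z) = gunit G \<and>
        (\<lambda>z. \<Sum>(u, v)\<in>carrier G \<times> carrier G.
              tcomult G J (gdelta x) (u, v) * gmult G (gdelta u) (s v) z) = gunit G)"

lemma tantipode_basis_eq_The: "tantipode_basis G J = (THE s. is_antipode_basis J s)"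
  unfolding tantipode_basis_def is_antipode_basis_def ..

lemma is_antipode_basisD:
  assumes "is_antipode_basis J s" "x \<in> carrier G"
  shows "s x \<in> galg G"
    and "(\<Sum>p\<in>carrier G2. tcomult G J (gdelta x) p * gmult G (s (fst p)) (gdelta (snd p)) z) = gunit G z"
    and "(\<Sum>p\<in>carrier G2. tcomult G J (gdelta x) p * gmult G (gdelta (fst p)) (s (snd p)) z) = gunit G z"
  using assms unfolding is_antipode_basis_def fun_eq_iff by (auto simp: case_prod_unfold)

lemma sum_gpush2: "(\<Sum>y\<in>carrier G. gpush G2 fst T y * F y) = (\<Sum>p\<in>carrier G2. T p * F (fst p))"
  "(\<Sum>y\<in>carrier G. gpush G2 snd T y * F y) = (\<Sum>p\<in>carrier G2. T p * F (snd p))"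
  by (rule sum_gpush; auto)+

end

locale twist = tensor_group G for G (structure) +
  fixes J :: "'a \<times> 'a \<Rightarrow> 'k::comm_ring_1"
  assumes twist: "is_twist G J"
begin

abbreviation "Jb \<equiv> ginv G2 J"

lemma J_galg [simp]: "J \<in> galg G2" and J_invertible: "ginvertible G2 J"
  and cocycle: "gmult G3 (gpush G2 dup1 J) (gpush G2 ins3 J) = gmult G3 (gpush G2 dup2 J) (gpush G2 ins1 J)"
  and counit_fst: "gpush G2 fst J = gunit G" and counit_snd: "gpush G2 snd J = gunit G"
  using twist unfolding is_twist_iff by auto

lemma Jb_galg [simp]: "Jb \<in> galg G2" and J_Jb: "gmult G2 J Jb = gunit G2" and Jb_J: "gmult G2 Jb J = gunit G2"
  using two.ginvertible_ginv[OF J_invertible] by auto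

lemma gpush_Jb:
  assumes "fin_group B" "h \<in> hom G2 B"
  shows "gmult B (gpush G2 h J) (gpush G2 h Jb) = gunit B" "gmult B (gpush G2 h Jb) (gpush G2 h J) = gunit B"
  using assms by (simp_all add: gpush_gmult[OF fin_group_G2, symmetric] J_Jb Jb_J gpush_gunit[OF fin_group_G2])

lemma counit_Jb: "gpush G2 fst Jb = gunit G" "gpush G2 snd Jb = gunit G"
proof -
  have "gpush G2 fst Jb \<in> galg G" "gpush G2 snd Jb \<in> galg G" by (auto intro!: gpush_galg)
  then show "gpush G2 fst Jb = gunit G" "gpush G2 snd Jb = gunit G"
    using gpush_Jb(1)[OF fin_group_G hom_proj(1)] gpush_Jb(1)[OF fin_group_G hom_proj(2)]
    by (simp_all add: counit_fst counit_snd)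
qed

lemma tcomult_galg [simp]: "tcomult G J a \<in> galg G2"
  by (simp add: tcomult_def)

lemma sum_counit:
  fixes F :: "'a \<Rightarrow> 'k"
  shows "(\<Sum>p\<in>carrier G2. J p * F (fst p)) = F \<one>" "(\<Sum>p\<in>carrier G2. J p * F (snd p)) = F \<one>"
    "(\<Sum>p\<in>carrier G2. Jb p * F (fst p)) = F \<one>" "(\<Sum>p\<in>carrier G2. Jb p * F (snd p)) = F \<one>"
  unfolding sum_gpush2[symmetric] counit_fst counit_snd counit_Jb by (simp_all add: gunit_def sum_gdelta)

text \<open>The classical elements \<Sum> J(u,v) u^-1 v and \<Sum> J^-1(u,v) u v^-1, written as the
  unit moved by J and by J^-1. The sums are recovered in \<open>tQ_eq_gpush\<close> and
  \<open>tQ'_eq_gpush\<close>; the action form suits the antipode axioms.\<close>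

definition "tQ = lact J (gunit G)"
definition "tQ' = ract Jb (gunit G)"

lemma tQ_galg [simp]: "tQ \<in> galg G" "tQ' \<in> galg G"
  by (simp_all add: tQ_def tQ'_def)

lemma tQ_eq_gpush: "tQ = gpush G2 (\<lambda>p. inv (fst p) \<otimes> snd p) J"
proof
  fix z 
  have *: "u \<otimes> z \<otimes> inv v = \<one> \<longleftrightarrow> inv u \<otimes> v = z" if "u \<in> carrier G" "v \<in> carrier G" "z \<in> carrier G" for u v
    using that inv_solve_right[of \<one> "u \<otimes> z" v] inv_solve_left[of z u v] by auto
  show "tQ z = gpush G2 (\<lambda>p. inv (fst p) \<otimes> snd p) J z"
    unfolding tQ_def lact_def gpush_def gunit_def gdelta_def
    by (auto simp: * intro!: sum.cong sum.neutral)
qed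

lemma tQ'_eq_gpush: "tQ' = gpush G2 (\<lambda>p. fst p \<otimes> inv (snd p)) Jb"
proof
  fix z 
  have *: "inv u \<otimes> z \<otimes> v = \<one> \<longleftrightarrow> u \<otimes> inv v = z" if "u \<in> carrier G" "v \<in> carrier G" "z \<in> carrier G" for u v
    using that inv_solve_right[of "inv u \<otimes> z" "\<one>" v] inv_solve_left[of "inv v" u z] by auto
  show "tQ' z = gpush G2 (\<lambda>p. fst p \<otimes> inv (snd p)) Jb z"
    unfolding tQ'_def ract_def gpush_def gunit_def gdelta_def
    by (auto simp: * intro!: sum.cong sum.neutral)
qed

text \<open>The cocycle equation multiplied by (id \<otimes> \<Delta>)(J^-1) on the left and by J^-1
  \<otimes> 1 on the right; in this arrangement it can be contracted to \<open>tQ'\<close> and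
  \<open>tQ\<close>.\<close>

lemma ins1_ins3: "gmult G3 (gpush G2 ins1 J) (gpush G2 ins3 Jb) = gmult G3 (gpush G2 dup2 Jb) (gpush G2 dup1 J)"
proof -
  let ?X = "gpush G2 dup1 J" and ?Y = "gpush G2 ins3 J" and ?X' = "gpush G2 dup2 J" and ?Y' = "gpush G2 ins1 J"
  let ?Yb = "gpush G2 ins3 Jb" and ?Xb' = "gpush G2 dup2 Jb"
  have in3: "gpush G2 ins1 J \<in> galg G3" "gpush G2 dup1 J \<in> galg G3"
    by (auto intro!: gpush_galg simp: ins_dup_defs)
  have "gmult G3 ?Xb' (gmult G3 (gmult G3 ?X' ?Y') ?Yb) = gmult G3 ?Xb' (gmult G3 (gmult G3 ?X ?Y) ?Yb)"
    by (simp add: cocycle)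
  also have "\<dots> = gmult G3 ?Xb' ?X"
    using gpush_Jb(1)[OF fin_group_G3 hom_ins_dup(3)] by (simp add: three.gmult_assoc in3)
  also have "gmult G3 ?Xb' (gmult G3 (gmult G3 ?X' ?Y') ?Yb) = gmult G3 (gmult G3 (gmult G3 ?Xb' ?X') ?Y') ?Yb"
    by (simp add: three.gmult_assoc)
  also have "\<dots> = gmult G3 ?Y' ?Yb"
    using gpush_Jb(2)[OF fin_group_G3 hom_ins_dup(2)] by (simp add: in3)
  finally show ?thesis .
qed

text \<open>Contracting both sides of \<open>ins1_ins3\<close> by a \<otimes> b \<otimes> c
  \<mapsto> a b^-1 c gives this product on one side; on the other side the doubled legs
  cancel.\<close>

lemma tQ'_tQ: "gmult G tQ' tQ = gunit G"
proof (rule galg_eqI)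
  fix F :: "'a \<Rightarrow> 'k"
  let ?F = "\<lambda>(a, (b, c)). F (a \<otimes> inv b \<otimes> c)"
  have "(\<Sum>x\<in>carrier G. gmult G tQ' tQ x * F x) = (\<Sum>p\<in>carrier G2. \<Sum>q\<in>carrier G2.
       Jb p * J q * F (fst p \<otimes> inv (snd p) \<otimes> (inv (fst q) \<otimes> snd q)))"
    unfolding tQ_eq_gpush tQ'_eq_gpush by (rule sum_gmult_gpush[OF fin_group_G]) auto
  also have "\<dots> = (\<Sum>q\<in>carrier G2. \<Sum>p\<in>carrier G2. J q * Jb p * ?F (ins1 q \<otimes>\<^bsub>G3\<^esub> ins3 p))"
    by (subst sum.swap) (auto intro!: sum.cong simp: ins_dup_defs inv_mult_group m_assoc)
  also have "\<dots> = (\<Sum>x\<in>carrier G3. gmult G3 (gpush G2 ins1 J) (gpush G2 ins3 Jb) x * ?F x)"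
    by (rule sum_gmult_gpush[OF fin_group_G3, symmetric]) (auto simp: ins_dup_defs)
  also have "\<dots> = (\<Sum>x\<in>carrier G3. gmult G3 (gpush G2 dup2 Jb) (gpush G2 dup1 J) x * ?F x)"
    by (simp only: ins1_ins3)
  also have "\<dots> = (\<Sum>q\<in>carrier G2. \<Sum>p\<in>carrier G2. Jb q * J p * ?F (dup2 q \<otimes>\<^bsub>G3\<^esub> dup1 p))"
    by (rule sum_gmult_gpush[OF fin_group_G3]) (auto simp: ins_dup_defs)
  \<comment> \<open>The three legs are q1 p1, q2 p1 and q2 p2, and (q1 p1)(q2 p1)^-1 (q2 p2) = q1
    p2. Only one leg of each twist survives, so the counit conditions evaluate both sums.\<close>
  also have "\<dots> = (\<Sum>q\<in>carrier G2. \<Sum>p\<in>carrier G2. Jb q * (J p * F (fst q \<otimes> snd p)))"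
  proof (intro sum.cong refl, clarsimp simp: ins_dup_defs)
    fix a b c d assume *: "a \<in> carrier G" "b \<in> carrier G" "c \<in> carrier G" "d \<in> carrier G"
    have "a \<otimes> c \<otimes> inv (b \<otimes> c) \<otimes> (b \<otimes> d) = a \<otimes> d"
      using * by (simp add: inv_mult_group m_assoc) (simp add: m_assoc[symmetric])
    then show "Jb (a, b) * J (c, d) * F (a \<otimes> c \<otimes> inv (b \<otimes> c) \<otimes> (b \<otimes> d)) = Jb (a, b) * (J (c, d) * F (a \<otimes> d))"
      by (simp add: mult.assoc)
  qed
  also have "\<dots> = (\<Sum>q\<in>carrier G2. Jb q * F (fst q \<otimes> \<one>))"
    unfolding sum_distrib_left[symmetric] by (simp add: sum_counit(2)[of "\<lambda>x. F (_ \<otimes> x)"] del: carrier_DirProd)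
  also have "\<dots> = F \<one>"
    by (simp add: sum_counit(3)[of "\<lambda>x. F (x \<otimes> \<one>)"] del: carrier_DirProd)
  finally show "(\<Sum>x\<in>carrier G. gmult G tQ' tQ x * F x) = (\<Sum>x\<in>carrier G. gunit G x * F x)"
    by (simp add: gunit_def sum_gdelta)
qed auto

text \<open>The twisted antipode Q^-1 S(x) Q with Q = \<open>tQ\<close>, where \<open>tQ'\<close>
  stands in the place of Q^-1.\<close>

definition antip :: "'a \<Rightarrow> 'a \<Rightarrow> 'k" where
  "antip x = (if x \<in> carrier G then gmult G (gmult G tQ' (gdelta (inv x))) tQ else (\<lambda>_. 0))"

lemma tcomult_gdelta: "x \<in> carrier G \<Longrightarrow>
    tcomult G J (gdelta x) = gmult G2 (gmult G2 Jb (gdelta (x, x))) J"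
  by (simp add: tcomult_def gcomult_gdelta)

text \<open>The coproduct J^-1 (x \<otimes> x) J undoes the J in \<open>tQ\<close>, fixes the unit
  and applies J again, so it fixes \<open>tQ\<close>; symmetrically it fixes \<open>tQ'\<close>.
  Both axioms thereby reduce to \<open>tQ'_tQ\<close>.\<close>

lemma is_antipode_antip: "is_antipode_basis J antip"
  unfolding is_antipode_basis_def
proof (intro conjI ballI allI impI)
  fix x assume x: "x \<in> carrier G"
  let ?T = "tcomult G J (gdelta x)"
  show "antip x \<in> galg G" by (simp add: antip_def x)
  have "lact ?T tQ = lact J (lact (gdelta (x, x)) (lact Jb (lact J (gunit G))))"
    using x by (simp add: tcomult_gdelta lact_gmult tQ_def)
  also have "lact Jb (lact J (gunit G)) = gunit G"
    by (simp add: lact_gmult[symmetric] J_Jb lact_gunit2)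
  finally have L: "lact ?T tQ = tQ" by (simp add: lact_diag x tQ_def)
  have "ract ?T tQ' = ract Jb (ract (gdelta (x, x)) (ract J (ract Jb (gunit G))))"
    using x by (simp add: tcomult_gdelta ract_gmult tQ'_def)
  also have "ract J (ract Jb (gunit G)) = gunit G"
    by (simp add: ract_gmult[symmetric] J_Jb ract_gunit2)
  finally have R: "ract ?T tQ' = tQ'" by (simp add: ract_diag x tQ'_def)
  have "(\<lambda>z. \<Sum>(u, v)\<in>carrier G \<times> carrier G. ?T (u, v) * gmult G (antip u) (gdelta v) z)
      = (\<lambda>z. \<Sum>p\<in>carrier G2. ?T p * gmult G tQ' (gmult G (gmult G (gdelta (inv (fst p))) tQ) (gdelta (snd p))) z)"
    by (auto simp: antip_def gmult_assoc intro!: ext sum.cong)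
  also have "\<dots> = gmult G tQ' (\<lambda>z. \<Sum>p\<in>carrier G2. ?T p * gmult G (gmult G (gdelta (inv (fst p))) tQ) (gdelta (snd p)) z)"
    by (simp only: gmult_sum_right)
  also have "(\<lambda>z. \<Sum>p\<in>carrier G2. ?T p * gmult G (gmult G (gdelta (inv (fst p))) tQ) (gdelta (snd p)) z) = lact ?T tQ"
  proof
    fix z show "(\<Sum>p\<in>carrier G2. ?T p * gmult G (gmult G (gdelta (inv (fst p))) tQ) (gdelta (snd p)) z) = lact ?T tQ z"
      by (cases "z \<in> carrier G") (auto simp: lact_def gmult_gdelta_right gmult_gdelta_left m_assoc
         galgD[OF gmult_galg] intro!: sum.cong)
  qed
  finally show "(\<lambda>z. \<Sum>(u, v)\<in>carrier G \<times> carrier G. ?T (u, v) * gmult G (antip u) (gdelta v) z) = gunit G"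
    by (simp add: L tQ'_tQ)
  have "(\<lambda>z. \<Sum>(u, v)\<in>carrier G \<times> carrier G. ?T (u, v) * gmult G (gdelta u) (antip v) z)
      = (\<lambda>z. \<Sum>p\<in>carrier G2. ?T p * gmult G (gmult G (gdelta (fst p)) (gmult G tQ' (gdelta (inv (snd p))))) tQ z)"
    by (auto simp: antip_def gmult_assoc intro!: ext sum.cong)
  also have "\<dots> = gmult G (\<lambda>z. \<Sum>p\<in>carrier G2. ?T p * gmult G (gdelta (fst p)) (gmult G tQ' (gdelta (inv (snd p)))) z) tQ"
    by (simp only: gmult_sum_left)
  also have "(\<lambda>z. \<Sum>p\<in>carrier G2. ?T p * gmult G (gdelta (fst p)) (gmult G tQ' (gdelta (inv (snd p)))) z) = ract ?T tQ'"
  proof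
    fix z show "(\<Sum>p\<in>carrier G2. ?T p * gmult G (gdelta (fst p)) (gmult G tQ' (gdelta (inv (snd p)))) z) = ract ?T tQ' z"
      by (cases "z \<in> carrier G") (auto simp: ract_def gmult_gdelta_right gmult_gdelta_left m_assoc
         galgD[OF gmult_galg] intro!: sum.cong)
  qed
  finally show "(\<lambda>z. \<Sum>(u, v)\<in>carrier G \<times> carrier G. ?T (u, v) * gmult G (gdelta u) (antip v) z) = gunit G"
    by (simp add: R tQ'_tQ)
qed (simp add: antip_def)

lemma sum_tcomult_gdelta:
  assumes "x \<in> carrier G"
  shows "(\<Sum>p\<in>carrier G2. tcomult G J (gdelta x) p * F p)
    = (\<Sum>p\<in>carrier G2. \<Sum>q\<in>carrier G2. Jb p * J q * F (fst p \<otimes> x \<otimes> fst q, snd p \<otimes> x \<otimes> snd q))"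
proof -
  have x: "(x, x) \<in> carrier G2" using assms by simp
  have "(\<Sum>p\<in>carrier G2. tcomult G J (gdelta x) p * F p) =
    (\<Sum>p\<in>carrier G2. \<Sum>r\<in>carrier G2. gdelta (x, x) r * (\<Sum>q\<in>carrier G2. Jb p * J q * F (p \<otimes>\<^bsub>G2\<^esub> r \<otimes>\<^bsub>G2\<^esub> q)))"
    unfolding tcomult_gdelta[OF assms] two.gmult_assoc two.sum_gmult[of Jb]
    apply (rule sum.cong[OF refl])
    subgoal for p
      using two.sum_gmult[of "gdelta (x, x)" J "\<lambda>r. Jb p * F (p \<otimes>\<^bsub>G2\<^esub> r)"]
      by (simp add: mult_ac sum_distrib_left two.m_assoc del: carrier_DirProd)
    done
  also have "\<dots> = (\<Sum>p\<in>carrier G2. \<Sum>q\<in>carrier G2. Jb p * J q * F (p \<otimes>\<^bsub>G2\<^esub> (x, x) \<otimes>\<^bsub>G2\<^esub> q))"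
    by (simp only: two.sum_gdelta[OF x])
  finally show ?thesis by (simp add: mult_DirProd')
qed

lemma sum_tcomult_counit:
  fixes F :: "'a \<Rightarrow> 'k"
  assumes "x \<in> carrier G"
  shows "(\<Sum>p\<in>carrier G2. tcomult G J (gdelta x) p * F (fst p)) = F x"
    and "(\<Sum>p\<in>carrier G2. tcomult G J (gdelta x) p * F (snd p)) = F x"
proof -
  have "(\<Sum>p\<in>carrier G2. tcomult G J (gdelta x) p * F (fst p)) =
      (\<Sum>p\<in>carrier G2. Jb p * (\<Sum>q\<in>carrier G2. J q * F (fst p \<otimes> x \<otimes> fst q)))"
    using assms by (simp add: sum_tcomult_gdelta sum_distrib_left mult.assoc del: carrier_DirProd)
  also have "\<dots> = F x"
    using assms by (simp add: sum_counit(1)[of "\<lambda>z. F (_ \<otimes> z)"] sum_counit(3)[of "\<lambda>z. F (z \<otimes> _ \<otimes> \<one>)"] del: carrier_DirProd)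
  finally show "(\<Sum>p\<in>carrier G2. tcomult G J (gdelta x) p * F (fst p)) = F x" .
  have "(\<Sum>p\<in>carrier G2. tcomult G J (gdelta x) p * F (snd p)) =
      (\<Sum>p\<in>carrier G2. Jb p * (\<Sum>q\<in>carrier G2. J q * F (snd p \<otimes> x \<otimes> snd q)))"
    using assms by (simp add: sum_tcomult_gdelta sum_distrib_left mult.assoc del: carrier_DirProd)
  also have "\<dots> = F x"
    using assms by (simp add: sum_counit(2)[of "\<lambda>z. F (_ \<otimes> z)"] sum_counit(4)[of "\<lambda>z. F (z \<otimes> _ \<otimes> \<one>)"] del: carrier_DirProd)
  finally show "(\<Sum>p\<in>carrier G2. tcomult G J (gdelta x) p * F (snd p)) = F x" .
qed

text \<open>Both iterated coproducts conjugate x \<otimes> x \<otimes> x by an element of the third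
  tensor power, and the cocycle equation says that the two conjugating elements coincide.\<close>

lemma tcomult_coassoc:
  assumes "x \<in> carrier G"
  shows "(\<Sum>p\<in>carrier G2. tcomult G J (gdelta x) p * (\<Sum>q\<in>carrier G2. tcomult G J (gdelta (fst p)) q * F (fst q, (snd q, snd p))))
    = (\<Sum>p\<in>carrier G2. tcomult G J (gdelta x) p * (\<Sum>q\<in>carrier G2. tcomult G J (gdelta (snd p)) q * F (fst p, (fst q, snd q))))"
proof -
  let ?P = "gpush G2"
  have dx: "?P dup1 (gdelta (x, x)) = gdelta (x, x, x)" "?P dup2 (gdelta (x, x)) = gdelta (x, x, x)"
    using gpush_gdelta[of G2 "(x, x)" dup1] gpush_gdelta[of G2 "(x, x)" dup2] assms by (simp_all add: ins_dup_defs)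
  note push = gpush_gmult[OF fin_group_G2 fin_group_G3]
  \<comment> \<open>Applying the twisted coproduct to the first leg of T is conjugating (\<Delta>
    \<otimes> id)(T) by J \<otimes> 1; \<open>R\<close> is the mirror statement for the second
    leg.\<close>
  have L: "(\<Sum>p\<in>carrier G2. T p * (\<Sum>q\<in>carrier G2. tcomult G J (gdelta (fst p)) q * F (fst q, (snd q, snd p))))
    = (\<Sum>t\<in>carrier G3. gmult G3 (gmult G3 (?P ins3 Jb) (?P dup1 T)) (?P ins3 J) t * F t)" for T
  proof -
    have "(\<Sum>t\<in>carrier G3. gmult G3 (gmult G3 (?P ins3 Jb) (?P dup1 T)) (?P ins3 J) t * F t)
      = (\<Sum>y\<in>carrier G3. gmult G3 (?P ins3 Jb) (?P dup1 T) y * (\<Sum>q\<in>carrier G3. ?P ins3 J q * F (y \<otimes>\<^bsub>G3\<^esub> q)))"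
      unfolding three.sum_gmult[of _ "?P ins3 J"] by (simp add: sum_distrib_left mult.assoc del: carrier_DirProd)
    also have "\<dots> = (\<Sum>a\<in>carrier G2. \<Sum>p\<in>carrier G2. Jb a * T p * (\<Sum>b\<in>carrier G2. J b * F (ins3 a \<otimes>\<^bsub>G3\<^esub> dup1 p \<otimes>\<^bsub>G3\<^esub> ins3 b)))"
      by (subst sum_gmult_gpush[OF fin_group_G3 fun_ins_dup(3,1)], subst sum_gpush[OF three.fin fun_ins_dup(3)]) simp
    also have "\<dots> = (\<Sum>p\<in>carrier G2. T p * (\<Sum>a\<in>carrier G2. \<Sum>b\<in>carrier G2. Jb a * J b * F (ins3 a \<otimes>\<^bsub>G3\<^esub> dup1 p \<otimes>\<^bsub>G3\<^esub> ins3 b)))"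
      by (subst sum.swap) (simp add: sum_distrib_left mult_ac del: carrier_DirProd)
    also have "\<dots> = (\<Sum>p\<in>carrier G2. T p * (\<Sum>q\<in>carrier G2. tcomult G J (gdelta (fst p)) q * F (fst q, (snd q, snd p))))"
    proof (rule sum.cong[OF refl], rule arg_cong2[of _ _ _ _ "(*)", OF refl])
      fix p assume p: "p \<in> carrier G2"
      then show "(\<Sum>a\<in>carrier G2. \<Sum>b\<in>carrier G2. Jb a * J b * F (ins3 a \<otimes>\<^bsub>G3\<^esub> dup1 p \<otimes>\<^bsub>G3\<^esub> ins3 b))
         = (\<Sum>q\<in>carrier G2. tcomult G J (gdelta (fst p)) q * F (fst q, (snd q, snd p)))"
        by (subst sum_tcomult_gdelta) (auto simp: ins_dup_defs intro!: sum.cong)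
    qed
    finally show ?thesis by simp
  qed
  have R: "(\<Sum>p\<in>carrier G2. T p * (\<Sum>q\<in>carrier G2. tcomult G J (gdelta (snd p)) q * F (fst p, (fst q, snd q))))
    = (\<Sum>t\<in>carrier G3. gmult G3 (gmult G3 (?P ins1 Jb) (?P dup2 T)) (?P ins1 J) t * F t)" for T
  proof -
    have "(\<Sum>t\<in>carrier G3. gmult G3 (gmult G3 (?P ins1 Jb) (?P dup2 T)) (?P ins1 J) t * F t)
      = (\<Sum>y\<in>carrier G3. gmult G3 (?P ins1 Jb) (?P dup2 T) y * (\<Sum>q\<in>carrier G3. ?P ins1 J q * F (y \<otimes>\<^bsub>G3\<^esub> q)))"
      unfolding three.sum_gmult[of _ "?P ins1 J"] by (simp add: sum_distrib_left mult.assoc del: carrier_DirProd)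
    also have "\<dots> = (\<Sum>a\<in>carrier G2. \<Sum>p\<in>carrier G2. Jb a * T p * (\<Sum>b\<in>carrier G2. J b * F (ins1 a \<otimes>\<^bsub>G3\<^esub> dup2 p \<otimes>\<^bsub>G3\<^esub> ins1 b)))"
      by (subst sum_gmult_gpush[OF fin_group_G3 fun_ins_dup(4,2)], subst sum_gpush[OF three.fin fun_ins_dup(4)]) simp
    also have "\<dots> = (\<Sum>p\<in>carrier G2. T p * (\<Sum>a\<in>carrier G2. \<Sum>b\<in>carrier G2. Jb a * J b * F (ins1 a \<otimes>\<^bsub>G3\<^esub> dup2 p \<otimes>\<^bsub>G3\<^esub> ins1 b)))"
      by (subst sum.swap) (simp add: sum_distrib_left mult_ac del: carrier_DirProd)
    also have "\<dots> = (\<Sum>p\<in>carrier G2. T p * (\<Sum>q\<in>carrier G2. tcomult G J (gdelta (snd p)) q * F (fst p, (fst q, snd q))))"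
    proof (rule sum.cong[OF refl], rule arg_cong2[of _ _ _ _ "(*)", OF refl])
      fix p assume p: "p \<in> carrier G2"
      then show "(\<Sum>a\<in>carrier G2. \<Sum>b\<in>carrier G2. Jb a * J b * F (ins1 a \<otimes>\<^bsub>G3\<^esub> dup2 p \<otimes>\<^bsub>G3\<^esub> ins1 b))
         = (\<Sum>q\<in>carrier G2. tcomult G J (gdelta (snd p)) q * F (fst p, (fst q, snd q)))"
        by (subst sum_tcomult_gdelta) (auto simp: ins_dup_defs intro!: sum.cong)
    qed
    finally show ?thesis by simp
  qed
  \<comment> \<open>The two conjugators agree by \<open>cocycle\<close>, hence so do their
    inverses.\<close>
  have inv_eq: "gmult G3 (?P ins3 Jb) (?P dup1 Jb) = gmult G3 (?P ins1 Jb) (?P dup2 Jb)"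
  proof (rule three.ginv_unique)
    have in3: "gpush G2 ins3 J \<in> galg G3" "gpush G2 ins1 J \<in> galg G3" "gpush G2 ins1 Jb \<in> galg G3" "gpush G2 dup2 Jb \<in> galg G3"
      by (auto intro!: gpush_galg simp: ins_dup_defs)
    show "gmult G3 (gmult G3 (?P ins3 Jb) (?P dup1 Jb)) (gmult G3 (?P dup1 J) (?P ins3 J)) = gunit G3"
      using three.gmult_cancel_mid[OF gpush_Jb(2)[OF fin_group_G3 hom_ins_dup(1)] in3(1)]
       gpush_Jb(2)[OF fin_group_G3 hom_ins_dup(3)] by simp
    show "gmult G3 (gmult G3 (?P dup1 J) (?P ins3 J)) (gmult G3 (?P ins1 Jb) (?P dup2 Jb)) = gunit G3"
      unfolding cocycle
      using three.gmult_cancel_mid[OF gpush_Jb(1)[OF fin_group_G3 hom_ins_dup(4)] in3(4)]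
       gpush_Jb(1)[OF fin_group_G3 hom_ins_dup(2)] by simp
  qed auto
  have "gmult G3 (gmult G3 (?P ins3 Jb) (?P dup1 (tcomult G J (gdelta x)))) (?P ins3 J)
     = gmult G3 (gmult G3 (gmult G3 (?P ins3 Jb) (?P dup1 Jb)) (gdelta (x, x, x))) (gmult G3 (?P dup1 J) (?P ins3 J))"
    unfolding tcomult_gdelta[OF assms] by (simp add: push hom_ins_dup dx three.gmult_assoc)
  also have "\<dots> = gmult G3 (gmult G3 (?P ins1 Jb) (?P dup2 (tcomult G J (gdelta x)))) (?P ins1 J)"
    unfolding tcomult_gdelta[OF assms] inv_eq cocycle by (simp add: push hom_ins_dup dx three.gmult_assoc)
  finally show ?thesis unfolding L R by simp
qed

text \<open>Uniqueness of convolution inverses: s = s (id s') = (s id) s' = s', with convolution as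
  product and coassociativity in the middle.\<close>

lemma antipode_unique:
  assumes s: "is_antipode_basis J s" and s': "is_antipode_basis J s'"
  shows "s = s'"
proof
  fix x
  show "s x = s' x"
  proof (cases "x \<in> carrier G")
    case True
    let ?T = "tcomult G J (gdelta x)"
    show ?thesis
    proof
      fix z
      let ?F = "\<lambda>(a, (b, c)). gmult G (gmult G (s a) (gdelta b)) (s' c) z"
      have "s x z = (\<Sum>p\<in>carrier G2. ?T p * s (fst p) z)"
        by (rule sum_tcomult_counit(1)[OF True, of "\<lambda>x. s x z", symmetric])
      also have "\<dots> = (\<Sum>p\<in>carrier G2. ?T p * (\<Sum>q\<in>carrier G2. tcomult G J (gdelta (snd p)) q * ?F (fst p, (fst q, snd q))))"
      proof (intro sum.cong refl arg_cong2[of _ _ _ _ "(*)"])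
        fix p assume "p \<in> carrier G2"
        then have p: "fst p \<in> carrier G" "snd p \<in> carrier G" by auto
        have "(\<Sum>q\<in>carrier G2. tcomult G J (gdelta (snd p)) q * ?F (fst p, (fst q, snd q)))
          = gmult G (s (fst p)) (\<lambda>z. \<Sum>q\<in>carrier G2. tcomult G J (gdelta (snd p)) q * gmult G (gdelta (fst q)) (s' (snd q)) z) z"
          by (simp only: gmult_sum_right gmult_assoc prod.case)
        also have "\<dots> = s (fst p) z"
          using is_antipode_basisD(1)[OF s p(1)] by (simp only: is_antipode_basisD(3)[OF s' p(2)] gmult_gunit_right)
        finally show "s (fst p) z = (\<Sum>q\<in>carrier G2. tcomult G J (gdelta (snd p)) q * ?F (fst p, (fst q, snd q)))" by simp
      qed
      also have "\<dots> = (\<Sum>p\<in>carrier G2. ?T p * (\<Sum>q\<in>carrier G2. tcomult G J (gdelta (fst p)) q * ?F (fst q, (snd q, snd p))))"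
        by (rule tcomult_coassoc[OF True, symmetric])
      also have "\<dots> = (\<Sum>p\<in>carrier G2. ?T p * s' (snd p) z)"
      proof (intro sum.cong refl arg_cong2[of _ _ _ _ "(*)"])
        fix p assume "p \<in> carrier G2"
        then have p: "fst p \<in> carrier G" "snd p \<in> carrier G" by auto
        have "(\<Sum>q\<in>carrier G2. tcomult G J (gdelta (fst p)) q * ?F (fst q, (snd q, snd p)))
          = gmult G (\<lambda>z. \<Sum>q\<in>carrier G2. tcomult G J (gdelta (fst p)) q * gmult G (s (fst q)) (gdelta (snd q)) z) (s' (snd p)) z"
          by (simp only: gmult_sum_left prod.case)
        also have "\<dots> = s' (snd p) z"
          using is_antipode_basisD(1)[OF s' p(2)] by (simp only: is_antipode_basisD(2)[OF s p(1)] gmult_gunit_left)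
        finally show "(\<Sum>q\<in>carrier G2. tcomult G J (gdelta (fst p)) q * ?F (fst q, (snd q, snd p))) = s' (snd p) z" .
      qed
      also have "\<dots> = s' x z"
        by (rule sum_tcomult_counit(2)[OF True, of "\<lambda>x. s' x z"])
      finally show "s x z = s' x z" .
    qed
  qed (use s s' in \<open>simp add: is_antipode_basis_def\<close>)
qed

lemma tantipode_basis_eqI: "is_antipode_basis J s \<Longrightarrow> tantipode_basis G J = s"
  unfolding tantipode_basis_eq_The by (rule the_equality) (auto intro: antipode_unique)

lemma tantipode_basis_eq: "tantipode_basis G J = antip"
  by (rule tantipode_basis_eqI[OF is_antipode_antip])

lemma tantipode_gdelta: "x \<in> carrier G \<Longrightarrow> tantipode G J (gdelta x) = antip x"
  unfolding tantipode_def tantipode_basis_eq by (auto simp: sum_gdelta fun_eq_iff)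

end

section \<open>Normal Hopf subalgebras\<close>

definition supported_on :: "'g set \<Rightarrow> ('g \<Rightarrow> 'k::zero) set" where
  "supported_on M = {a. \<forall>x. x \<notin> M \<longrightarrow> a x = 0}"

lemma supported_onI: "(\<And>x. a x \<noteq> 0 \<Longrightarrow> x \<in> M) \<Longrightarrow> a \<in> supported_on M"
  by (auto simp: supported_on_def)

lemma supported_onD: "a \<in> supported_on M \<Longrightarrow> a x \<noteq> 0 \<Longrightarrow> x \<in> M"
  by (auto simp: supported_on_def)

lemma gdelta_neq_zeroD: "gdelta x y \<noteq> (0::'k::zero_neq_one) \<Longrightarrow> y = x"
  by (auto simp: gdelta_def split: if_splits)

lemma sum_mult_neq_zeroE:
  fixes f g :: "'b \<Rightarrow> 'k::comm_ring_1"
  assumes "(\<Sum>x\<in>A. f x * g x) \<noteq> 0" obtains x where "x \<in> A" "f x \<noteq> 0" "g x \<noteq> 0"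
  using assms by (metis (no_types, lifting) mult_zero_left mult_zero_right sum.neutral)

lemma sum_neq_zeroE:
  assumes "sum f A \<noteq> 0" obtains x where "x \<in> A" "f x \<noteq> 0"
  using assms by (meson sum.not_neutral_contains_not_neutral)

text \<open>Row expansion: T is the sum over the points of M of a delta at the point tensored with
  the row of T there, and these rows again have support in M.\<close>

lemma tensor_span_supported:
  fixes T :: "'g \<times> 'g \<Rightarrow> 'k::comm_ring_1"
  assumes "finite M" "T \<in> supported_on (M \<times> M)"
  shows "T \<in> tensor_span (supported_on M)"
proof -
  obtain e where e: "bij_betw e {..<card M} M"
    using bij_betw_from_nat_into_finite[OF assms(1)] by blast
  have *: "T (x, y) = (\<Sum>i<card M. gdelta (e i) x * T (e i, y))" for x y
  proof -
    have "(\<Sum>i<card M. gdelta (e i) x * T (e i, y)) = (\<Sum>z\<in>M. gdelta z x * T (z, y))"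
      by (rule sum.reindex_bij_betw[OF e])
    also have "\<dots> = T (x, y)"
    proof (cases "x \<in> M")
      case True
      then have "(\<Sum>z\<in>M. gdelta z x * T (z, y)) = gdelta x x * T (x, y)"
        by (subst sum.remove[OF assms(1) True])
          (auto simp: gdelta_def intro!: sum.neutral split: if_splits)
      then show ?thesis by (simp add: gdelta_def)
    next
      case False
      then have "T (x, y) = 0" using assms(2) by (auto simp: supported_on_def)
      moreover have "(\<Sum>z\<in>M. gdelta z x * T (z, y)) = 0"
        using False by (intro sum.neutral) (auto simp: gdelta_def)
      ultimately show ?thesis by simp
    qed
    finally show ?thesis by simp
  qed
  have T: "T = (\<lambda>(x, y). \<Sum>i<card M. gdelta (e i) x * T (e i, y))"
    by (unfold fun_eq_iff split_paired_All prod.case, intro allI, rule *)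
  have e': "(gdelta (e i) :: 'g \<Rightarrow> 'k) \<in> supported_on M \<and> (\<lambda>y. T (e i, y)) \<in> supported_on M" if "i < card M" for i
    using that e assms(2) by (auto simp: supported_on_def gdelta_def bij_betw_def)
  show ?thesis
    unfolding tensor_span_def
    using e' T by (intro CollectI exI[of _ "card M"] exI[of _ "\<lambda>i. gdelta (e i)"] exI[of _ "\<lambda>i y. T (e i, y)"]) simp
qed

context fin_group
begin

lemma gmult_neq_zeroE:
  assumes "gmult G a b z \<noteq> 0"
  obtains y w where "y \<in> carrier G" "w \<in> carrier G" "a y \<noteq> 0" "b w \<noteq> 0" "z = y \<otimes> w"
proof -
  have z: "z \<in> carrier G" using assms by (auto simp: gmult_def split: if_splits)
  then obtain y where y: "y \<in> carrier G" "a y * b (inv y \<otimes> z) \<noteq> 0"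
    using assms by (auto simp: gmult_def elim: sum_neq_zeroE)
  show ?thesis
    by (rule that[of y "inv y \<otimes> z"]) (use y z in \<open>auto simp: m_assoc[symmetric]\<close>)
qed

lemma supported_on_galg: "M \<subseteq> carrier G \<Longrightarrow> supported_on M \<subseteq> galg G"
  by (auto simp: supported_on_def galg_def)

lemma gmult_supported:
  assumes "subgroup M G" "a \<in> supported_on M" "b \<in> supported_on M"
  shows "gmult G a b \<in> supported_on M"
  using assms by (intro supported_onI) (auto elim!: gmult_neq_zeroE dest!: supported_onD intro: subgroup.m_closed)

text \<open>Truncating b to M leaves a right inverse of a, because for x in M only factors in M
  enter the convolution. Uniqueness of inverses then forces b to equal its truncation.\<close>

lemma inverse_supported:
  assumes M: "subgroup M G" and a: "a \<in> supported_on M"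
    and b: "b \<in> galg G" "gmult G a b = gunit G" "gmult G b a = gunit G"
  shows "b \<in> supported_on M"
proof -
  define b' where "b' = (\<lambda>x. if x \<in> M then b x else 0)"
  have sub: "M \<subseteq> carrier G" using M by (rule subgroup.subset)
  have b': "b' \<in> supported_on M" by (auto simp: b'_def supported_on_def)
  then have b'': "b' \<in> galg G" using supported_on_galg[OF sub] by auto
  have "gmult G a b' = gunit G"
  proof
    fix x
    show "gmult G a b' x = gunit G x"
    proof (cases "x \<in> M")
      case True
      have "a y * b' (inv y \<otimes> x) = a y * b (inv y \<otimes> x)" for y
        using True a M by (cases "y \<in> M") (auto simp: b'_def supported_on_def subgroup.m_closed subgroup.m_inv_closed)
      then have "gmult G a b' x = gmult G a b x" by (simp add: gmult_def)
      with b show ?thesis by simp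
    next
      case False
      then have "gmult G a b' x = 0"
        using gmult_supported[OF M a b'] by (auto simp: supported_on_def)
      moreover have "x \<noteq> \<one>" using False subgroup.one_closed[OF M] by auto
      ultimately show ?thesis by (simp add: gunit_def gdelta_def)
    qed
  qed
  with ginv_unique[OF b(1) b'' b(3)] b' show ?thesis by simp
qed

end

context twist
begin

lemma tcomult_expand:
  assumes "a \<in> galg G" shows "tcomult G J a p = (\<Sum>x\<in>carrier G. a x * tcomult G J (gdelta x) p)"
proof -
  have "gcomult G a = (\<lambda>p. \<Sum>x\<in>carrier G. a x * gcomult G (gdelta x) p)"
  proof (unfold fun_eq_iff split_paired_All gcomult_def prod.case, intro allI)
    fix x y
    show "(if x = y \<and> x \<in> carrier G then a x else 0) =
        (\<Sum>xa\<in>carrier G. a xa * (if x = y \<and> x \<in> carrier G then gdelta xa x else 0))"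
    proof (cases "x = y \<and> x \<in> carrier G")
      case True
      then show ?thesis using fun_cong[OF galg_expand[OF assms], of x] by simp
    next
      case False
      then show ?thesis by (simp only: if_False mult_zero_right sum.neutral_const)
    qed
  qed
  then show ?thesis
    unfolding tcomult_def by (simp only: two.gmult_sum_left two.gmult_sum_right)
qed

lemma tcomult_neq_zeroE:
  assumes "a \<in> galg G" "tcomult G J a p \<noteq> 0"
  obtains x where "x \<in> carrier G" "a x \<noteq> 0" "tcomult G J (gdelta x) p \<noteq> 0"
  using assms(2) unfolding tcomult_expand[OF assms(1), of p] by (rule sum_mult_neq_zeroE) (rule that)

lemma tantipode_neq_zeroE:
  assumes "tantipode G J a z \<noteq> 0"
  obtains x where "x \<in> carrier G" "a x \<noteq> 0" "antip x z \<noteq> 0"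
  using assms by (auto simp: tantipode_def tantipode_basis_eq elim!: sum_mult_neq_zeroE)

lemma normal_hopf_subalg_supportedI:
  assumes M: "subgroup M G"
    and co: "\<And>x. x \<in> M \<Longrightarrow> tcomult G J (gdelta x) \<in> supported_on (M \<times> M)"
    and an: "\<And>x. x \<in> M \<Longrightarrow> antip x \<in> supported_on M"
    and ad: "\<And>h a. h \<in> galg G \<Longrightarrow> a \<in> supported_on M \<Longrightarrow> tad G J h a \<in> supported_on M"
  shows "normal_hopf_subalg G J (supported_on M)"
proof -
  note sub = subgroup.subset[OF M]
  have "finite M" using finite_subset[OF sub fin] .
  note ts = tensor_span_supported[OF this]
  have co': "tcomult G J a \<in> tensor_span (supported_on M)" if "a \<in> supported_on M" for a
  proof (intro ts supported_onI)
    fix p assume *: "tcomult G J a p \<noteq> 0"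
    have "a \<in> galg G" using that supported_on_galg[OF sub] by auto
    from tcomult_neq_zeroE[OF this *] obtain x where "a x \<noteq> 0" "tcomult G J (gdelta x) p \<noteq> 0" by metis
    then show "p \<in> M \<times> M" using that co by (blast dest: supported_onD)
  qed
  have an': "tantipode G J a \<in> supported_on M" if "a \<in> supported_on M" for a
    using that an by (intro supported_onI) (blast elim!: tantipode_neq_zeroE dest: supported_onD)
  have 1: "gunit G \<in> supported_on M"
    using subgroup.one_closed[OF M] by (auto simp: supported_on_def gunit_def gdelta_def)
  have 2: "(\<lambda>z. a z + b z) \<in> supported_on M" "(\<lambda>z. c * a z) \<in> supported_on M"
    if "a \<in> supported_on M" "b \<in> supported_on M" for a b and c :: 'k
    using that by (auto simp: supported_on_def)
  show ?thesis
    unfolding normal_hopf_subalg_def hopf_subalg_def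
    by (intro conjI ballI allI supported_on_galg[OF sub] gmult_supported[OF M] ad co' an' 1 2)
qed

text \<open>Central group elements commute with J, so they stay group-like after twisting and the
  antipode inverts them. Elements of their span commute with all of kG, so the adjoint action on
  them is through the counit.\<close>

lemma normal_hopf_subalg_central:
  assumes M: "subgroup M G" and central: "\<And>x y. x \<in> M \<Longrightarrow> y \<in> carrier G \<Longrightarrow> x \<otimes> y = y \<otimes> x"
  shows "normal_hopf_subalg G J (supported_on M)"
proof (rule normal_hopf_subalg_supportedI[OF M])
  note sub = subgroup.subset[OF M]
  have co: "tcomult G J (gdelta x) = gdelta (x, x)" if "x \<in> M" for x
  proof -
    have x: "x \<in> carrier G" using that sub by auto
    have xc: "inv y \<otimes> x = x \<otimes> inv y" if "y \<in> carrier G" for y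
      using central[OF \<open>x \<in> M\<close>, of "inv y"] that by simp
    have "gmult G2 (gdelta (x, x)) J = gmult G2 J (gdelta (x, x))"
    proof
      fix p show "gmult G2 (gdelta (x, x)) J p = gmult G2 J (gdelta (x, x)) p"
      proof (cases "p \<in> carrier G2")
        case True
        have "inv x \<otimes> y = y \<otimes> inv x" if "y \<in> carrier G" for y
          using central[OF subgroup.m_inv_closed[OF M \<open>x \<in> M\<close>] that] .
        then have "inv\<^bsub>G2\<^esub> (x, x) \<otimes>\<^bsub>G2\<^esub> p = p \<otimes>\<^bsub>G2\<^esub> inv\<^bsub>G2\<^esub> (x, x)"
          using True x by (auto simp: mult_DirProd' inv_DirProd is_group)
        moreover have "(x, x) \<in> carrier G2" using x by simp
        ultimately show ?thesis
          using True by (simp add: two.gmult_gdelta_left two.gmult_gdelta_right del: carrier_DirProd)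
      qed (simp add: gmult_def)
    qed
    then have "gmult G2 (gmult G2 Jb (gdelta (x, x))) J = gmult G2 (gmult G2 Jb J) (gdelta (x, x))"
      by (simp add: two.gmult_assoc)
    moreover have "gdelta (x, x) \<in> galg G2" using x by simp
    ultimately show ?thesis using x by (simp add: tcomult_gdelta Jb_J)
  qed
  show "tcomult G J (gdelta x) \<in> supported_on (M \<times> M)" if "x \<in> M" for x
    unfolding co[OF that] using that by (auto simp: supported_on_def gdelta_def)
  show "antip x \<in> supported_on M" if "x \<in> M" for x
  proof -
    have x: "x \<in> carrier G" "(x, x) \<in> carrier G2" using that sub by auto
    have "gmult G (antip x) (gdelta x) z = gunit G z" for z
      using is_antipode_basisD(2)[OF is_antipode_antip x(1), of z] unfolding co[OF that] two.sum_gdelta[OF x(2)]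
      by simp
    then have "gmult G (antip x) (gdelta x) = gunit G" by auto
    then have "gmult G (gmult G (antip x) (gdelta x)) (gdelta (inv x)) = gdelta (inv x)"
      using x by simp
    moreover have "gmult G (gmult G (antip x) (gdelta x)) (gdelta (inv x)) = gmult G (antip x) (gunit G)"
      unfolding gmult_assoc gmult_gdelta[OF x(1) inv_closed[OF x(1)]] gunit_def using x by simp
    moreover have "antip x \<in> galg G" by (simp add: antip_def x)
    ultimately have "antip x = gdelta (inv x)" by simp
    then show ?thesis using that M by (auto simp: supported_on_def gdelta_def subgroup.m_inv_closed)
  qed
  fix h a :: "'a \<Rightarrow> 'k" assume h: "h \<in> galg G" and a: "a \<in> supported_on M"
  have ag: "a \<in> galg G" using a supported_on_galg[OF sub] by auto
  have ca: "gmult G (gdelta u) a = gmult G a (gdelta u)" if "u \<in> carrier G" for u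
  proof
    fix z show "gmult G (gdelta u) a z = gmult G a (gdelta u) z"
    proof (cases "z \<in> carrier G")
      case True
      have "inv u \<otimes> z \<in> M \<Longrightarrow> inv u \<otimes> z = z \<otimes> inv u"
      proof -
        assume m: "inv u \<otimes> z \<in> M"
        have "inv u \<otimes> z \<otimes> u = z"
          unfolding central[OF m that] using that True by (simp add: m_assoc[symmetric])
        then show ?thesis using that True inv_solve_right[of "inv u \<otimes> z" z u] by simp
      qed
      moreover have "z \<otimes> inv u \<in> M \<Longrightarrow> inv u \<otimes> z = z \<otimes> inv u"
      proof -
        assume m: "z \<otimes> inv u \<in> M"
        have "u \<otimes> (z \<otimes> inv u) = z"
          unfolding central[OF m that, symmetric] using that True by (simp add: m_assoc)
        then show ?thesis using that True inv_solve_left[of "z \<otimes> inv u" u z] by simp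
      qed
      moreover have "a y = 0" if "y \<notin> M" for y using a that by (auto simp: supported_on_def)
      ultimately show ?thesis
        using that True by (metis gmult_gdelta_left gmult_gdelta_right)
    qed (simp add: gmult_def)
  qed
  \<comment> \<open>Moving the central a to the left leaves \<Sum> h_1 S(h_2), which the antipode
    axiom evaluates to the counit of h.\<close>
  have "tad G J h a z = gcounit G h * a z" for z
  proof -
    have "tad G J h a z = (\<Sum>p\<in>carrier G2. tcomult G J h p * gmult G a (gmult G (gdelta (fst p)) (antip (snd p))) z)"
      unfolding tad_def by (auto intro!: sum.cong simp: ca tantipode_gdelta gmult_assoc[symmetric])
    also have "\<dots> = (\<Sum>p\<in>carrier G2. \<Sum>x\<in>carrier G. h x * (tcomult G J (gdelta x) p * gmult G a (gmult G (gdelta (fst p)) (antip (snd p))) z))"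
      by (simp add: tcomult_expand[OF h] sum_distrib_right mult.assoc)
    also have "\<dots> = (\<Sum>x\<in>carrier G. h x * gmult G a (\<lambda>z. \<Sum>p\<in>carrier G2. tcomult G J (gdelta x) p * gmult G (gdelta (fst p)) (antip (snd p)) z) z)"
      by (subst sum.swap) (simp only: gmult_sum_right sum_distrib_left)
    also have "\<dots> = (\<Sum>x\<in>carrier G. h x * a z)"
      using ag by (intro sum.cong refl) (simp only: is_antipode_basisD(3)[OF is_antipode_antip] gmult_gunit_right)
    finally show ?thesis by (simp add: gcounit_def sum_distrib_right)
  qed
  then show "tad G J h a \<in> supported_on M" using a by (auto simp: supported_on_def)
qed

text \<open>When both legs of J lie in kN, twisting moves supports only within cosets: the coproduct
  of x lives on Nx \<times> Nx and the antipode of x on N x^-1. In an adjoint product the coset of x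
  cancels and an element of N remains.\<close>

lemma normal_hopf_subalg_normal:
  assumes "N \<lhd> G" and JN: "J \<in> supported_on (N \<times> N)"
  shows "normal_hopf_subalg G J (supported_on N)"
proof -
  interpret N: normal N G by fact
  have N: "subgroup N G" by (rule N.subgroup_axioms)
  have N2: "subgroup (N \<times> N) G2" by (rule DirProd_subgroups[OF is_group N is_group N])
  have JbN: "Jb \<in> supported_on (N \<times> N)"
    by (rule two.inverse_supported[OF N2 JN Jb_galg J_Jb Jb_J])
  have conj: "g \<otimes> n \<otimes> inv g \<in> N" "inv g \<otimes> n \<otimes> g \<in> N" if "n \<in> N" "g \<in> carrier G" for n g
    using that N.inv_op_closed1 N.inv_op_closed2 by auto
  have Q: "tQ z \<noteq> 0 \<Longrightarrow> z \<in> N" and Q': "tQ' z \<noteq> 0 \<Longrightarrow> z \<in> N" for z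
    using JN JbN unfolding tQ_eq_gpush tQ'_eq_gpush gpush_def
    by (auto elim!: sum_neq_zeroE dest!: supported_onD split: if_splits)
  have rN: "z \<in> carrier G \<and> (\<exists>n\<in>N. z = n \<otimes> inv x)" if an: "antip x z \<noteq> 0" and x: "x \<in> carrier G" for x z
  proof -
    have "gmult G (gmult G tQ' (gdelta (inv x))) tQ z \<noteq> 0" using an x by (simp add: antip_def)
    then obtain y w where yw: "gmult G tQ' (gdelta (inv x)) y \<noteq> 0" "tQ w \<noteq> 0" "z = y \<otimes> w"
      by (rule gmult_neq_zeroE)
    note yw = yw(1) Q[OF yw(2)] yw(3)
    from yw(1) obtain n where n: "n \<in> N" "y = n \<otimes> inv x"
      by (elim gmult_neq_zeroE) (auto dest!: Q' gdelta_neq_zeroD)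
    have "z = (n \<otimes> (inv x \<otimes> w \<otimes> x)) \<otimes> inv x"
      using yw n x by (simp add: m_assoc)
    moreover have "n \<otimes> (inv x \<otimes> w \<otimes> x) \<in> N" using n yw conj[of w x] x by simp
    ultimately show ?thesis using x by auto
  qed
  have T: "fst p \<in> carrier G \<and> snd p \<in> carrier G \<and> (\<exists>n\<in>N. fst p = n \<otimes> x) \<and> (\<exists>n\<in>N. snd p = n \<otimes> x)"
    if T: "tcomult G J (gdelta x) p \<noteq> 0" and x: "x \<in> carrier G" for x p
  proof -
    have aux: "\<exists>m\<in>N. n \<otimes> x \<otimes> n' = m \<otimes> x" if "n \<in> N" "n' \<in> N" for n n'
      using that x conj[of n' x] by (intro bexI[of _ "n \<otimes> (x \<otimes> n' \<otimes> inv x)"]) (auto simp: m_assoc)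
    have "gmult G2 (gmult G2 Jb (gdelta (x, x))) J p \<noteq> 0" using T x by (simp add: tcomult_gdelta)
    then obtain y w where yw: "gmult G2 Jb (gdelta (x, x)) y \<noteq> 0" "J w \<noteq> 0" "p = y \<otimes>\<^bsub>G2\<^esub> w"
      by (rule two.gmult_neq_zeroE)
    note yw = yw(1) supported_onD[OF JN yw(2)] yw(3)
    from yw(1) obtain n r where n: "Jb n \<noteq> 0" "gdelta (x, x) r \<noteq> (0::'k)" "y = n \<otimes>\<^bsub>G2\<^esub> r"
      by (rule two.gmult_neq_zeroE)
    note n = supported_onD[OF JbN n(1)] n(3)[unfolded gdelta_neq_zeroD[OF n(2)]]
    obtain n1 n2 w1 w2 where nw: "n = (n1, n2)" "w = (w1, w2)" by (cases n, cases w)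
    show ?thesis using aux[of n1 w1] aux[of n2 w2] n yw x unfolding nw by auto
  qed
  show ?thesis
  proof (rule normal_hopf_subalg_supportedI[OF N])
    show "tcomult G J (gdelta x) \<in> supported_on (N \<times> N)" if "x \<in> N" for x
    proof (rule supported_onI)
      fix p assume "tcomult G J (gdelta x) p \<noteq> 0"
      from T[OF this] that show "p \<in> N \<times> N" by (cases p) auto
    qed
    show "antip x \<in> supported_on N" if "x \<in> N" for x
      using rN[of x] that by (intro supported_onI) auto
    fix h a :: "'a \<Rightarrow> 'k" assume h: "h \<in> galg G" and a: "a \<in> supported_on N"
    show "tad G J h a \<in> supported_on N"
    proof (rule supported_onI)
      fix z assume "tad G J h a z \<noteq> 0"
      then obtain u v where uv: "u \<in> carrier G" "v \<in> carrier G" "tcomult G J h (u, v) \<noteq> 0"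
        "gmult G (gmult G (gdelta u) a) (tantipode G J (gdelta v)) z \<noteq> 0"
        unfolding tad_def case_prod_unfold by (elim sum_mult_neq_zeroE) auto
      from tcomult_neq_zeroE[OF h uv(3)] obtain x where x: "x \<in> carrier G" "tcomult G J (gdelta x) (u, v) \<noteq> 0"
        by metis
      from T[OF x(2,1)] obtain n1 n2 where n: "n1 \<in> N" "n2 \<in> N" "u = n1 \<otimes> x" "v = n2 \<otimes> x" by auto
      from uv(4) obtain y w where yw: "gmult G (gdelta u) a y \<noteq> 0" "antip v w \<noteq> 0" "z = y \<otimes> w"
        unfolding tantipode_gdelta[OF uv(2)] by (rule gmult_neq_zeroE)
      from yw(1) obtain n3 where n3: "n3 \<in> N" "y = u \<otimes> n3"
        using supported_onD[OF a] by (elim gmult_neq_zeroE) (auto dest!: gdelta_neq_zeroD)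
      from rN[OF yw(2) uv(2)] obtain n4 where n4: "n4 \<in> N" "w = n4 \<otimes> inv v" by auto
      \<comment> \<open>Here u = n1 x and v = n2 x, so the x of u and the x^-1 from the antipode of
        v conjugate n3 n4 inside the normal subgroup.\<close>
      have "z = n1 \<otimes> (x \<otimes> (n3 \<otimes> n4) \<otimes> inv x) \<otimes> inv n2"
        using n n3 n4 x by (simp add: yw(3) inv_mult_group m_assoc)
      moreover have "x \<otimes> (n3 \<otimes> n4) \<otimes> inv x \<in> N" using conj(1)[of "n3 \<otimes> n4" x] n3 n4 x by simp
      ultimately show "z \<in> N" using n by simp
    qed
  qed
qed

end

text \<open>A delta at a nontrivial element of M is not a scalar multiple of the unit, and a delta
  at an element outside M is not supported on M.\<close>

lemma not_twisted_simple:
  fixes J :: "'g \<times> 'g \<Rightarrow> 'k::comm_ring_1"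
  assumes "twist G J" "subgroup M G" "normal_hopf_subalg G J (supported_on M)" "M \<noteq> carrier G" "M \<noteq> {\<one>\<^bsub>G\<^esub>}"
  shows "\<not> twisted_simple G J"
proof
  assume simple: "twisted_simple G J"
  interpret twist G J by fact
  have sub: "M \<subseteq> carrier G" using assms(2) by (rule subgroup.subset)
  have "\<not> M \<subseteq> {\<one>\<^bsub>G\<^esub>}" using subgroup.one_closed[OF assms(2)] assms(5) by (simp add: subset_singleton_iff) auto
  then obtain x where x: "x \<in> M" "x \<noteq> \<one>\<^bsub>G\<^esub>" by auto
  obtain y where y: "y \<in> carrier G" "y \<notin> M" using assms(4) sub by auto
  have "(supported_on M :: ('g \<Rightarrow> 'k) set) = {(\<lambda>z. c * gunit G z) | c. True} \<or>
      (supported_on M :: ('g \<Rightarrow> 'k) set) = galg G"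
    using simple assms(3) unfolding twisted_simple_def by (elim allE impE)
  then consider "(supported_on M :: ('g \<Rightarrow> 'k) set) = {(\<lambda>z. c * gunit G z) | c. True}"
    | "(supported_on M :: ('g \<Rightarrow> 'k) set) = galg G" by (elim disjE)
  then show False
  proof cases
    case 1
    have "(gdelta x :: 'g \<Rightarrow> 'k) \<in> supported_on M" using x by (auto simp: supported_on_def gdelta_def)
    then have "gdelta x \<in> {(\<lambda>z. c * gunit G z) | c :: 'k. True}" by (simp only: 1)
    then obtain c :: 'k where "gdelta x = (\<lambda>z. c * gunit G z)" by blast
    from fun_cong[OF this, of x] x show False by (simp add: gdelta_def gunit_def)
  next
    case 2
    have "(gdelta y :: 'g \<Rightarrow> 'k) \<in> galg G" using y by simp
    then have "(gdelta y :: 'g \<Rightarrow> 'k) \<in> supported_on M" using 2 by metis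
    from supported_onD[OF this, of y] y show False by (simp add: gdelta_def)
  qed
qed

section \<open>Isomorphisms of twisted group algebras\<close>

definition lin_on :: "('g, 'm) monoid_scheme \<Rightarrow> (('g \<Rightarrow> 'k::comm_ring_1) \<Rightarrow> ('h \<Rightarrow> 'k)) \<Rightarrow> bool" where
  "lin_on G \<phi> \<longleftrightarrow> (\<forall>a\<in>galg G. \<forall>b\<in>galg G. \<phi> (\<lambda>z. a z + b z) = (\<lambda>z. \<phi> a z + \<phi> b z)) \<and>
     (\<forall>c. \<forall>a\<in>galg G. \<phi> (\<lambda>z. c * a z) = (\<lambda>z. c * \<phi> a z))"

lemma lin_on_add: "lin_on G \<phi> \<Longrightarrow> a \<in> galg G \<Longrightarrow> b \<in> galg G \<Longrightarrow> \<phi> (\<lambda>z. a z + b z) = (\<lambda>z. \<phi> a z + \<phi> b z)"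
  and lin_on_scale: "lin_on G \<phi> \<Longrightarrow> a \<in> galg G \<Longrightarrow> \<phi> (\<lambda>z. c * a z) = (\<lambda>z. c * \<phi> a z)"
  by (simp_all add: lin_on_def)

lemma lin_on_sum:
  assumes "lin_on G \<phi>" "finite I" "\<And>i. i \<in> I \<Longrightarrow> f i \<in> galg G"
  shows "\<phi> (\<lambda>z. \<Sum>i\<in>I. c i * f i z) = (\<lambda>z. \<Sum>i\<in>I. c i * \<phi> (f i) z)"
  using assms(2,3)
proof (induction I rule: finite_induct)
  case empty
  have "(\<lambda>z. 0) \<in> galg G" by (simp add: galg_def)
  then show ?case
    using bspec[OF spec[OF conjunct2[OF assms(1)[unfolded lin_on_def]], of 0], of "\<lambda>z. 0"] by simp
next
  case (insert j I)
  have 1: "(\<lambda>z. c j * f j z) \<in> galg G" using insert.prems[of j] by (auto simp: galg_def)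
  have 2: "(\<lambda>z. \<Sum>i\<in>I. c i * f i z) \<in> galg G" using insert.prems by (auto simp: galg_def)
  have "\<phi> (\<lambda>z. c j * f j z + (\<Sum>i\<in>I. c i * f i z)) = (\<lambda>z. \<phi> (\<lambda>z. c j * f j z) z + \<phi> (\<lambda>z. \<Sum>i\<in>I. c i * f i z) z)"
    by (rule lin_on_add[OF assms(1) 1 2])
  moreover have "\<phi> (\<lambda>z. c j * f j z) = (\<lambda>z. c j * \<phi> (f j) z)"
    by (rule lin_on_scale[OF assms(1)]) (simp add: insert.prems)
  ultimately show ?case using insert by simp
qed

lemma (in fin_group) lin_on_expand:
  assumes "lin_on G \<phi>" "a \<in> galg G"
  shows "\<phi> a = (\<lambda>z. \<Sum>x\<in>carrier G. a x * \<phi> (gdelta x) z)"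
proof -
  have "\<phi> a = \<phi> (\<lambda>z. \<Sum>x\<in>carrier G. a x * gdelta x z)"
    using galg_expand[OF assms(2)] by simp
  also have "\<dots> = (\<lambda>z. \<Sum>x\<in>carrier G. a x * \<phi> (gdelta x) z)"
    by (rule lin_on_sum[OF assms(1) fin]) simp
  finally show ?thesis .
qed

lemma (in fin_group) bilin_expand:
  assumes "lin_on G \<sigma>" "lin_on G Y" "b \<in> galg G" "d \<in> galg G"
  shows "(\<Sum>q\<in>carrier G. \<Sum>r\<in>carrier G. b q * d r * gmult G (\<sigma> (gdelta q)) (Y (gdelta r)) z) = gmult G (\<sigma> b) (Y d) z"
  unfolding lin_on_expand[OF assms(1,3)] lin_on_expand[OF assms(2,4)]
  by (simp only: gmult_sum_left gmult_sum_right sum_distrib_left mult.assoc)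

lemma sum_tensor_map:
  assumes "finite (carrier H)"
  shows "(\<Sum>q\<in>carrier H \<times> carrier H. tensor_map G \<phi> T q * F q)
   = (\<Sum>p\<in>carrier G \<times> carrier G. T p *
       (\<Sum>q\<in>carrier H. \<Sum>r\<in>carrier H. \<phi> (gdelta (fst p)) q * \<phi> (gdelta (snd p)) r * F (q, r)))"
proof -
  have "(\<Sum>q\<in>carrier H \<times> carrier H. tensor_map G \<phi> T q * F q)
     = (\<Sum>q\<in>carrier H \<times> carrier H. \<Sum>p\<in>carrier G \<times> carrier G.
         T p * (\<phi> (gdelta (fst p)) (fst q) * \<phi> (gdelta (snd p)) (snd q) * F q))"
    by (simp add: tensor_map_def case_prod_unfold sum_distrib_right mult.assoc)
  also have "\<dots> = (\<Sum>p\<in>carrier G \<times> carrier G. T p * (\<Sum>q\<in>carrier H \<times> carrier H.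
         \<phi> (gdelta (fst p)) (fst q) * \<phi> (gdelta (snd p)) (snd q) * F q))"
    by (subst sum.swap) (simp add: sum_distrib_left)
  finally show ?thesis by (simp add: sum.cartesian_product')
qed

definition gten :: "('g \<Rightarrow> 'k::comm_ring_1) \<Rightarrow> ('h \<Rightarrow> 'k) \<Rightarrow> 'g \<times> 'h \<Rightarrow> 'k" where
  "gten a b = (\<lambda>(x, y). a x * b y)"

lemma gten_gdelta: "gten (gdelta x) (gdelta y) = gdelta (x, y)"
  by (auto simp: gten_def gdelta_def fun_eq_iff)

context twist
begin

lemma lin_tantipode: "lin_on G (tantipode G J)"
  by (auto simp: lin_on_def tantipode_def algebra_simps sum.distrib sum_distrib_left)

lemma tantipode_galg [simp]: "tantipode G J a \<in> galg G"
proof (rule galgI)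
  fix x assume "x \<notin> carrier G"
  then show "tantipode G J a x = 0"
    unfolding tantipode_def tantipode_basis_eq antip_def
    by (intro sum.neutral) (simp add: galgD[OF gmult_galg])
qed

lemma antip_galg [simp]: "antip x \<in> galg G"
  by (auto simp: antip_def galg_def gmult_def)

lemma antipode_left:
  assumes "a \<in> galg G"
  shows "(\<Sum>p\<in>carrier G2. tcomult G J a p * gmult G (antip (fst p)) (gdelta (snd p)) z) = gcounit G a * gunit G z"
proof -
  have "(\<Sum>p\<in>carrier G2. tcomult G J a p * gmult G (antip (fst p)) (gdelta (snd p)) z)
     = (\<Sum>x\<in>carrier G. a x * (\<Sum>p\<in>carrier G2. tcomult G J (gdelta x) p * gmult G (antip (fst p)) (gdelta (snd p)) z))"
    unfolding tcomult_expand[OF assms] sum_distrib_left sum_distrib_right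
    by (subst sum.swap) (simp only: mult.assoc)
  then show ?thesis
    by (simp add: is_antipode_basisD(2)[OF is_antipode_antip] gcounit_def sum_distrib_right del: carrier_DirProd)
qed

lemma antipode_right:
  assumes "a \<in> galg G"
  shows "(\<Sum>p\<in>carrier G2. tcomult G J a p * gmult G (gdelta (fst p)) (antip (snd p)) z) = gcounit G a * gunit G z"
proof -
  have "(\<Sum>p\<in>carrier G2. tcomult G J a p * gmult G (gdelta (fst p)) (antip (snd p)) z)
     = (\<Sum>x\<in>carrier G. a x * (\<Sum>p\<in>carrier G2. tcomult G J (gdelta x) p * gmult G (gdelta (fst p)) (antip (snd p)) z))"
    unfolding tcomult_expand[OF assms] sum_distrib_left sum_distrib_right
    by (subst sum.swap) (simp only: mult.assoc)
  then show ?thesis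
    by (simp add: is_antipode_basisD(3)[OF is_antipode_antip] gcounit_def sum_distrib_right del: carrier_DirProd)
qed

end

lemma (in tensor_group) gmult_gten:
  "gmult G2 (gten a b) (gten a' b') = gten (gmult G a a') (gmult G b b')"
proof (unfold fun_eq_iff split_paired_All, intro allI)
  fix x y
  show "gmult G2 (gten a b) (gten a' b') (x, y) = gten (gmult G a a') (gmult G b b') (x, y)"
    by (auto simp: gmult_def gten_def sum.cartesian_product' sum_product is_group mult_ac intro!: sum.cong)
qed

lemma (in tensor_group) gten_gunit: "gten (gunit G) (gunit G) = gunit G2"
  by (simp add: gunit_def gten_gdelta)

lemma (in tensor_group) gten_galg: "a \<in> galg G \<Longrightarrow> b \<in> galg G \<Longrightarrow> gten a b \<in> galg G2"
  by (auto simp: galg_def gten_def)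

text \<open>Compatibility with antipodes is deliberately absent: \<open>antipode_transfer\<close>
  derives it from uniqueness, which spares a comparison of the explicit formulas.\<close>

locale bialg_iso = G: twist G J + H: twist H J' for G :: "('a, 'm) monoid_scheme" (structure)
    and J :: "'a \<times> 'a \<Rightarrow> 'k::comm_ring_1" and H :: "('b, 'n) monoid_scheme" and J' :: "'b \<times> 'b \<Rightarrow> 'k" +
  fixes \<phi> :: "('a \<Rightarrow> 'k) \<Rightarrow> ('b \<Rightarrow> 'k)"
  assumes bij: "bij_betw \<phi> (galg G) (galg H)"
    and lin: "lin_on G \<phi>"
    and mult: "\<And>a b. a \<in> galg G \<Longrightarrow> b \<in> galg G \<Longrightarrow> \<phi> (gmult G a b) = gmult H (\<phi> a) (\<phi> b)"
    and unit: "\<phi> (gunit G) = gunit H"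
    and counit: "\<And>a. a \<in> galg G \<Longrightarrow> gcounit H (\<phi> a) = gcounit G a"
    and comult: "\<And>a. a \<in> galg G \<Longrightarrow> tcomult H J' (\<phi> a) = tensor_map G \<phi> (tcomult G J a)"
begin

definition "\<psi> = inv_into (galg G) \<phi>"

lemma phi_galg [simp]: "a \<in> galg G \<Longrightarrow> \<phi> a \<in> galg H"
  using bij by (auto simp: bij_betw_def)

lemma psi_galg [simp]: "b \<in> galg H \<Longrightarrow> \<psi> b \<in> galg G"
  using bij unfolding \<psi>_def by (metis bij_betw_def inv_into_into)

lemma phi_psi [simp]: "b \<in> galg H \<Longrightarrow> \<phi> (\<psi> b) = b"
  using bij unfolding \<psi>_def by (metis bij_betw_inv_into_right)

lemma psi_phi [simp]: "a \<in> galg G \<Longrightarrow> \<psi> (\<phi> a) = a"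
  using bij unfolding \<psi>_def by (metis bij_betw_inv_into_left)

lemma galg_closed:
  "a \<in> galg K \<Longrightarrow> b \<in> galg K \<Longrightarrow> (\<lambda>z. a z + b z) \<in> galg K"
  "a \<in> galg K \<Longrightarrow> (\<lambda>z. (c::'k) * a z) \<in> galg K"
  by (auto simp: galg_def)

lemma lin_psi: "lin_on H \<psi>"
  unfolding lin_on_def
proof (intro conjI ballI allI)
  fix a b :: "'b \<Rightarrow> 'k" assume ab: "a \<in> galg H" "b \<in> galg H"
  have "\<phi> (\<lambda>z. \<psi> a z + \<psi> b z) = (\<lambda>z. a z + b z)"
    using lin ab unfolding lin_on_def by simp
  then show "\<psi> (\<lambda>z. a z + b z) = (\<lambda>z. \<psi> a z + \<psi> b z)"
    using psi_phi[of "\<lambda>z. \<psi> a z + \<psi> b z"] ab by (simp add: galg_closed)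
next
  fix a :: "'b \<Rightarrow> 'k" and c assume ab: "a \<in> galg H"
  have "\<phi> (\<lambda>z. c * \<psi> a z) = (\<lambda>z. c * a z)"
    using lin ab unfolding lin_on_def by simp
  then show "\<psi> (\<lambda>z. c * a z) = (\<lambda>z. c * \<psi> a z)"
    using psi_phi[of "\<lambda>z. c * \<psi> a z"] ab by (simp add: galg_closed)
qed

definition "\<sigma> b = \<phi> (tantipode G J (\<psi> b))"

lemma lin_sigma: "lin_on H \<sigma>"
  using lin lin_psi G.lin_tantipode unfolding lin_on_def \<sigma>_def by simp

text \<open>The transported map \<phi> S \<phi>^-1 satisfies the antipode axioms of the target
  because \<phi> respects products, units, counits and coproducts; by uniqueness it is the antipode
  there.\<close>

lemma antipode_transfer: "a \<in> galg G \<Longrightarrow> tantipode H J' (\<phi> a) = \<phi> (tantipode G J a)"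
proof -
  define s where "s y = (if y \<in> carrier H then \<sigma> (gdelta y) else (\<lambda>_. 0))" for y
  have lin_id: "lin_on H (\<lambda>b. b)" by (simp add: lin_on_def)
  have "H.is_antipode_basis J' s"
    unfolding H.is_antipode_basis_def
  proof (intro conjI ballI allI impI ext)
    fix y assume y: "y \<in> carrier H"
    show "s y \<in> galg H" using y by (simp add: s_def \<sigma>_def)
    define a where "a = \<psi> (gdelta y)"
    have a: "a \<in> galg G" "gdelta y = \<phi> a" using y by (simp_all add: a_def)
    have "gcounit G a = gcounit H (gdelta y)" using counit[OF a(1)] a(2) by simp
    then have ea: "gcounit G a = 1" using y H.sum_gdelta[OF y, of "\<lambda>_. 1::'k"] by (simp add: gcounit_def)
    fix z
    have "(\<Sum>(u, v)\<in>carrier H \<times> carrier H. tcomult H J' (gdelta y) (u, v) * gmult H (s u) (gdelta v) z)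
       = (\<Sum>q\<in>carrier H \<times> carrier H. tensor_map G \<phi> (tcomult G J a) q * gmult H (\<sigma> (gdelta (fst q))) (gdelta (snd q)) z)"
      unfolding a(2) comult[OF a(1)] by (auto simp: s_def intro!: sum.cong)
    also have "\<dots> = (\<Sum>p\<in>carrier G \<times> carrier G. tcomult G J a p * gmult H (\<sigma> (\<phi> (gdelta (fst p)))) (\<phi> (gdelta (snd p))) z)"
      unfolding sum_tensor_map[OF H.fin]
      by (intro sum.cong refl) (auto simp: H.bilin_expand[OF lin_sigma lin_id])
    also have "\<dots> = (\<Sum>p\<in>carrier G \<times> carrier G. tcomult G J a p * \<phi> (gmult G (G.antip (fst p)) (gdelta (snd p))) z)"
      by (intro sum.cong refl) (auto simp: \<sigma>_def mult G.tantipode_gdelta)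
    also have "\<dots> = \<phi> (\<lambda>z. \<Sum>p\<in>carrier G \<times> carrier G. tcomult G J a p * gmult G (G.antip (fst p)) (gdelta (snd p)) z) z"
      using lin_on_sum[OF lin, of "carrier G \<times> carrier G" "\<lambda>p. gmult G (G.antip (fst p)) (gdelta (snd p))" "tcomult G J a"]
      by simp
    also have "\<dots> = gunit H z"
      using G.antipode_left[OF a(1)] by (simp add: ea unit)
    finally show "(\<Sum>(u, v)\<in>carrier H \<times> carrier H. tcomult H J' (gdelta y) (u, v) * gmult H (s u) (gdelta v) z) = gunit H z" .
    have "(\<Sum>(u, v)\<in>carrier H \<times> carrier H. tcomult H J' (gdelta y) (u, v) * gmult H (gdelta u) (s v) z)
       = (\<Sum>q\<in>carrier H \<times> carrier H. tensor_map G \<phi> (tcomult G J a) q * gmult H (gdelta (fst q)) (\<sigma> (gdelta (snd q))) z)"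
      unfolding a(2) comult[OF a(1)] by (auto simp: s_def intro!: sum.cong)
    also have "\<dots> = (\<Sum>p\<in>carrier G \<times> carrier G. tcomult G J a p * gmult H (\<phi> (gdelta (fst p))) (\<sigma> (\<phi> (gdelta (snd p)))) z)"
      unfolding sum_tensor_map[OF H.fin]
      by (intro sum.cong refl) (auto simp: H.bilin_expand[OF lin_id lin_sigma])
    also have "\<dots> = (\<Sum>p\<in>carrier G \<times> carrier G. tcomult G J a p * \<phi> (gmult G (gdelta (fst p)) (G.antip (snd p))) z)"
      by (intro sum.cong refl) (auto simp: \<sigma>_def mult G.tantipode_gdelta)
    also have "\<dots> = \<phi> (\<lambda>z. \<Sum>p\<in>carrier G \<times> carrier G. tcomult G J a p * gmult G (gdelta (fst p)) (G.antip (snd p)) z) z"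
      using lin_on_sum[OF lin, of "carrier G \<times> carrier G" "\<lambda>p. gmult G (gdelta (fst p)) (G.antip (snd p))" "tcomult G J a"]
      by simp
    also have "\<dots> = gunit H z"
      using G.antipode_right[OF a(1)] by (simp add: ea unit)
    finally show "(\<Sum>(u, v)\<in>carrier H \<times> carrier H. tcomult H J' (gdelta y) (u, v) * gmult H (gdelta u) (s v) z) = gunit H z" .
  qed (simp add: s_def)
  from H.tantipode_basis_eqI[OF this]
  have S: "tantipode H J' b = \<sigma> b" if "b \<in> galg H" for b
    unfolding tantipode_def H.lin_on_expand[OF lin_sigma that] by (auto simp: s_def intro!: sum.cong)
  assume "a \<in> galg G"
  then show ?thesis using S by (simp add: \<sigma>_def)
qed

lemma hopf_iso: "hopf_iso G J H J' \<phi>"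
  unfolding hopf_iso_def
  using bij lin mult unit counit comult antipode_transfer by (auto simp: lin_on_def)

lemma lin_gmult_right: "lin_on H (\<lambda>b. gmult H b d)"
  unfolding lin_on_def by (simp add: H.gmult_add_left H.gmult_scale_left)

lemma tad_galg: "tad G J h a \<in> galg G"
  unfolding tad_def by (rule galgI) (auto simp: galgD[OF G.gmult_galg] intro!: sum.neutral)

lemma tad_transfer:
  assumes "h \<in> galg G" "a \<in> galg G"
  shows "\<phi> (tad G J h a) = tad H J' (\<phi> h) (\<phi> a)"
proof
  fix z
  have "tad H J' (\<phi> h) (\<phi> a) z = (\<Sum>q\<in>carrier H \<times> carrier H. tensor_map G \<phi> (tcomult G J h) q *
      gmult H (gmult H (gdelta (fst q)) (\<phi> a)) (tantipode H J' (gdelta (snd q))) z)"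
    unfolding tad_def comult[OF assms(1)] by (simp add: case_prod_unfold)
  also have "\<dots> = (\<Sum>p\<in>carrier G \<times> carrier G. tcomult G J h p *
      gmult H (gmult H (\<phi> (gdelta (fst p))) (\<phi> a)) (tantipode H J' (\<phi> (gdelta (snd p)))) z)"
    unfolding sum_tensor_map[OF H.fin]
    by (intro sum.cong refl) (auto simp: H.bilin_expand[OF lin_gmult_right H.lin_tantipode])
  also have "\<dots> = (\<Sum>p\<in>carrier G \<times> carrier G. tcomult G J h p *
      \<phi> (gmult G (gmult G (gdelta (fst p)) a) (tantipode G J (gdelta (snd p)))) z)"
    by (intro sum.cong refl) (auto simp: mult antipode_transfer assms)
  also have "\<dots> = \<phi> (tad G J h a) z"
    unfolding tad_def case_prod_unfold
    using lin_on_sum[OF lin, of "carrier G \<times> carrier G" "\<lambda>p. gmult G (gmult G (gdelta (fst p)) a) (tantipode G J (gdelta (snd p)))" "tcomult G J h"]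
    by simp
  finally show "\<phi> (tad G J h a) z = tad H J' (\<phi> h) (\<phi> a) z" by simp
qed

text \<open>Applying the inverse of \<phi> to both factors of a tensor expression over K' gives one
  over the preimage of K'.\<close>

lemma tensor_span_transfer:
  assumes K': "K' \<subseteq> galg H" and a: "a \<in> galg G" and T: "tcomult H J' (\<phi> a) \<in> tensor_span K'"
  shows "tcomult G J a \<in> tensor_span {a \<in> galg G. \<phi> a \<in> K'}"
proof -
  obtain n :: nat and f g where fg: "\<And>i. i < n \<Longrightarrow> f i \<in> K' \<and> g i \<in> K'"
    and eq: "tensor_map G \<phi> (tcomult G J a) = (\<lambda>(x, y). \<Sum>i<n. f i x * g i y)"
    using T unfolding comult[OF a] tensor_span_def by blast
  have "tcomult G J a (x, y) = (\<Sum>i<n. \<psi> (f i) x * \<psi> (g i) y)" for x y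
  proof -
    have 1: "(\<Sum>q\<in>carrier H. \<Sum>r\<in>carrier H. b q * d r * (\<psi> (gdelta q) x * \<psi> (gdelta r) y)) = \<psi> b x * \<psi> d y"
      if "b \<in> galg H" "d \<in> galg H" for b d
      unfolding H.lin_on_expand[OF lin_psi that(1)] H.lin_on_expand[OF lin_psi that(2)] sum_product
      by (simp add: mult_ac)
    have "(\<Sum>q\<in>carrier H \<times> carrier H. tensor_map G \<phi> (tcomult G J a) q * (\<psi> (gdelta (fst q)) x * \<psi> (gdelta (snd q)) y))
      = (\<Sum>p\<in>carrier G \<times> carrier G. tcomult G J a p * gdelta p (x, y))"
      unfolding sum_tensor_map[OF H.fin] fst_conv snd_conv
      by (intro sum.cong refl) (auto simp: 1 gten_gdelta[symmetric] gten_def)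
    also have "\<dots> = tcomult G J a (x, y)"
      using fun_cong[OF G.two.galg_expand[OF G.tcomult_galg], of a "(x, y)"] by simp
    finally have "tcomult G J a (x, y) = (\<Sum>q\<in>carrier H \<times> carrier H. (\<Sum>i<n. f i (fst q) * g i (snd q)) * (\<psi> (gdelta (fst q)) x * \<psi> (gdelta (snd q)) y))"
      unfolding eq by (simp add: case_prod_unfold)
    also have "\<dots> = (\<Sum>i<n. \<Sum>q\<in>carrier H \<times> carrier H. f i (fst q) * g i (snd q) * (\<psi> (gdelta (fst q)) x * \<psi> (gdelta (snd q)) y))"
      unfolding sum_distrib_right by (rule sum.swap)
    also have "\<dots> = (\<Sum>i<n. \<psi> (f i) x * \<psi> (g i) y)"
    proof (intro sum.cong refl)
      fix i assume "i \<in> {..<n}"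
      then have "f i \<in> galg H" "g i \<in> galg H" using fg K' by auto
      then show "(\<Sum>q\<in>carrier H \<times> carrier H. f i (fst q) * g i (snd q) * (\<psi> (gdelta (fst q)) x * \<psi> (gdelta (snd q)) y)) = \<psi> (f i) x * \<psi> (g i) y"
        using 1 by (simp add: sum.cartesian_product')
    qed
    finally show ?thesis .
  qed
  then have "tcomult G J a = (\<lambda>(x, y). \<Sum>i<n. \<psi> (f i) x * \<psi> (g i) y)"
    by (simp add: fun_eq_iff)
  moreover have "\<forall>i<n. \<psi> (f i) \<in> {a \<in> galg G. \<phi> a \<in> K'} \<and> \<psi> (g i) \<in> {a \<in> galg G. \<phi> a \<in> K'}"
    using fg K' by (auto simp: subset_iff)
  ultimately show ?thesis unfolding tensor_span_def
    by (intro CollectI exI[of _ n] exI[of _ "\<lambda>i. \<psi> (f i)"] exI[of _ "\<lambda>i. \<psi> (g i)"] conjI)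
qed

text \<open>The preimage of a normal Hopf subalgebra is a normal Hopf subalgebra, and \<phi> matches
  scalars with scalars and the whole algebra with the whole algebra.\<close>

lemma twisted_simple_transfer:
  assumes "twisted_simple G J" shows "twisted_simple H J'"
  unfolding twisted_simple_def
proof (intro allI impI)
  fix K' assume K': "normal_hopf_subalg H J' K'"
  define K where "K = {a \<in> galg G. \<phi> a \<in> K'}"
  note K'' = K'[unfolded normal_hopf_subalg_def hopf_subalg_def]
  have sub: "K' \<subseteq> galg H" using K'' by simp
  have "normal_hopf_subalg G J K"
    unfolding normal_hopf_subalg_def hopf_subalg_def
  proof (intro conjI ballI allI)
    show "K \<subseteq> galg G" by (auto simp: K_def)
    show "gunit G \<in> K" using K'' by (simp add: K_def unit)
    fix a assume a: "a \<in> K"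
    then have ag: "a \<in> galg G" "\<phi> a \<in> K'" by (auto simp: K_def)
    show "tcomult G J a \<in> tensor_span K"
      unfolding K_def using ag K'' by (intro tensor_span_transfer[OF sub]) auto
    show "tantipode G J a \<in> K" unfolding K_def using ag K'' by (simp add: antipode_transfer[symmetric])
    { fix b assume "b \<in> K"
      then have bg: "b \<in> galg G" "\<phi> b \<in> K'" by (auto simp: K_def)
      have "\<phi> (\<lambda>z. a z + b z) = (\<lambda>z. \<phi> a z + \<phi> b z)" by (rule lin_on_add[OF lin ag(1) bg(1)])
      then show "(\<lambda>z. a z + b z) \<in> K" using ag bg K'' by (simp add: K_def galg_closed)
      show "gmult G a b \<in> K" using ag bg K'' by (simp add: K_def mult) }
    { fix c
      have "\<phi> (\<lambda>z. c * a z) = (\<lambda>z. c * \<phi> a z)" by (rule lin_on_scale[OF lin ag(1)])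
      then show "(\<lambda>z. c * a z) \<in> K" using ag K'' by (simp add: K_def galg_closed) }
    fix h :: "'a \<Rightarrow> 'k" assume h: "h \<in> galg G"
    show "tad G J h a \<in> K" using K'' ag h by (simp add: K_def tad_galg tad_transfer)
  qed
  then consider "K = {(\<lambda>z. c * gunit G z) | c. True}" | "K = galg G"
    using assms unfolding twisted_simple_def by (elim allE impE disjE)
  then show "K' = {(\<lambda>z. c * gunit H z) | c. True} \<or> K' = galg H"
  proof cases
    case 1
    have "K' = \<phi> ` K"
    proof (intro equalityI subsetI)
      fix b assume "b \<in> K'"
      then have "\<psi> b \<in> K" "b = \<phi> (\<psi> b)" using sub by (auto simp: K_def subset_iff)
      then show "b \<in> \<phi> ` K" by blast
    qed (auto simp: K_def)
    also have "\<dots> = {(\<lambda>z. c * gunit H z) | c. True}"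
    proof -
      have "\<phi> (\<lambda>z. c * gunit G z) = (\<lambda>z. c * gunit H z)" for c
        using lin_on_scale[OF lin G.gunit_galg, of c] unit by simp
      then show ?thesis unfolding 1 by (auto simp: image_iff) metis+
    qed
    finally show ?thesis by simp
  next
    case 2
    have "galg H \<subseteq> K'"
    proof
      fix b :: "'b \<Rightarrow> 'k" assume "b \<in> galg H"
      then have "\<psi> b \<in> K" using 2 by simp
      then show "b \<in> K'" using \<open>b \<in> galg H\<close> by (simp add: K_def)
    qed
    with sub show ?thesis by auto
  qed
qed

end

lemma gpush_eq_sum: "gpush A h a = (\<lambda>y. \<Sum>x\<in>carrier A. a x * gdelta (h x) y)"
  by (auto simp: gpush_def gdelta_def fun_eq_iff intro!: sum.cong)

text \<open>The gauge relation says that the transported J is \<Delta>(c) J' (c^-1 \<otimes> c^-1),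
  with d in the role of c^-1. Transport by \<theta> followed by conjugation with c therefore turns
  the J-coproduct into the J'-coproduct.\<close>

lemma bialg_iso_gauge:
  fixes G :: "('a, 'm) monoid_scheme" and H :: "('b, 'n) monoid_scheme" and J :: "'a \<times> 'a \<Rightarrow> 'k::comm_ring_1"
  assumes G: "twist G J" and H: "twist H J'" and \<theta>: "\<theta> \<in> iso G H"
    and c: "c \<in> galg H" "d \<in> galg H" "gmult H c d = gunit H" "gmult H d c = gunit H"
    and gauge: "gmult (H \<times>\<times> H) (gpush (G \<times>\<times> G) (map_prod \<theta> \<theta>) J) (gten c c) = gmult (H \<times>\<times> H) (gcomult H c) J'"
  shows "bialg_iso G J H J' (\<lambda>a. gmult H (gmult H d (gpush G \<theta> a)) c)" (is "bialg_iso _ _ _ _ ?\<phi>")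
proof -
  interpret G: twist G J by fact
  interpret H: twist H J' by fact
  let ?G2 = "G \<times>\<times> G" and ?H2 = "H \<times>\<times> H"
  note fg = G.fin_group_G H.fin_group_G
  have hom: "\<theta> \<in> hom G H" and bij: "bij_betw \<theta> (carrier G) (carrier H)" using \<theta> by (auto simp: iso_def)
  have \<theta>c: "\<theta> \<in> carrier G \<rightarrow> carrier H" using hom by (auto simp: hom_def)
  define \<eta> where "\<eta> = inv_into (carrier G) \<theta>"
  have \<eta>: "\<eta> \<in> iso H G" unfolding \<eta>_def by (rule G.iso_set_sym[OF \<theta>])
  then have \<eta>c: "\<eta> \<in> carrier H \<rightarrow> carrier G" by (auto simp: iso_def hom_def)
  have hom2: "map_prod \<theta> \<theta> \<in> hom ?G2 ?H2" using hom by (auto simp: hom_def)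
  have push_galg: "gpush G \<theta> a \<in> galg H" for a :: "'a \<Rightarrow> 'k" by (rule gpush_galg[OF \<theta>c])
  have inv1: "gpush H \<eta> (gpush G \<theta> a) = a" if "a \<in> galg G" for a :: "'a \<Rightarrow> 'k"
  proof (rule G.galg_eqI[OF gpush_galg[OF \<eta>c] that])
    fix F
    have "\<eta> (\<theta> x) = x" if "x \<in> carrier G" for x using that bij by (simp add: \<eta>_def bij_betw_inv_into_left)
    then show "(\<Sum>x\<in>carrier G. gpush H \<eta> (gpush G \<theta> a) x * F x) = (\<Sum>x\<in>carrier G. a x * F x)"
      by (simp add: sum_gpush \<eta>c \<theta>c)
  qed
  have inv2: "gpush G \<theta> (gpush H \<eta> b) = b" if "b \<in> galg H" for b :: "'b \<Rightarrow> 'k"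
  proof (rule H.galg_eqI[OF gpush_galg[OF \<theta>c] that])
    fix F
    have "\<theta> (\<eta> x) = x" if "x \<in> carrier H" for x using that bij by (simp add: \<eta>_def bij_betw_inv_into_right)
    then show "(\<Sum>x\<in>carrier H. gpush G \<theta> (gpush H \<eta> b) x * F x) = (\<Sum>x\<in>carrier H. b x * F x)"
      by (simp add: sum_gpush \<eta>c \<theta>c)
  qed
  have conj: "gmult H (gmult H a c) (gmult H d b) = gmult H a b" if "b \<in> galg H" for a b
    using H.gmult_cancel_mid[OF c(3) that] .
  have pd: "gpush G \<theta> (gdelta x) = gdelta (\<theta> x)" if "x \<in> carrier G" for x
    by (rule gpush_gdelta[OF G.fin that])
  show ?thesis
  proof unfold_locales
    show "bij_betw ?\<phi> (galg G) (galg H)"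
    proof (rule bij_betwI[where g = "\<lambda>b. gpush H \<eta> (gmult H (gmult H c b) d)"])
      show "gpush H \<eta> (gmult H (gmult H c (?\<phi> a)) d) = a" if "a \<in> galg G" for a
      proof -
        have "gmult H (gmult H c (?\<phi> a)) d = gmult H (gmult H c d) (gmult H (gpush G \<theta> a) (gmult H c d))"
          by (simp add: H.gmult_assoc)
        then show ?thesis using that by (simp add: c push_galg inv1)
      qed
      show "?\<phi> (gpush H \<eta> (gmult H (gmult H c b) d)) = b" if "b \<in> galg H" for b
      proof -
        have "?\<phi> (gpush H \<eta> (gmult H (gmult H c b) d)) = gmult H (gmult H d (gmult H (gmult H c b) d)) c"
          by (simp add: inv2)
        also have "\<dots> = gmult H (gmult H d c) (gmult H b (gmult H d c))"
          by (simp add: H.gmult_assoc)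
        finally show ?thesis using that by (simp add: c)
      qed
    qed (use gpush_galg[OF \<eta>c] in auto)
    have lin_push: "lin_on G (gpush G \<theta> :: ('a \<Rightarrow> 'k) \<Rightarrow> _)"
      unfolding gpush_eq_sum by (auto simp: lin_on_def algebra_simps sum.distrib sum_distrib_left)
    show lin: "lin_on G ?\<phi>"
      using lin_push unfolding lin_on_def
      by (simp add: H.gmult_add_left H.gmult_add_right H.gmult_scale_left H.gmult_scale_right)
    fix a :: "'a \<Rightarrow> 'k" assume a: "a \<in> galg G"
    show "?\<phi> (gmult G a b) = gmult H (?\<phi> a) (?\<phi> b)" for b
    proof -
      have "gmult H (?\<phi> a) (?\<phi> b) = gmult H (gmult H (gmult H d (gpush G \<theta> a)) c) (gmult H d (gmult H (gpush G \<theta> b) c))"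
        by (simp add: H.gmult_assoc)
      also have "\<dots> = gmult H (gmult H d (gpush G \<theta> a)) (gmult H (gpush G \<theta> b) c)"
        by (rule conj) simp
      finally show ?thesis by (simp add: gpush_gmult[OF fg hom] H.gmult_assoc)
    qed
    show "gcounit H (?\<phi> a) = gcounit G a"
    proof -
      have eps: "gcounit H (gmult H x y) = gcounit H x * gcounit H y" for x y :: "'b \<Rightarrow> 'k"
        using H.sum_gmult[of x y "\<lambda>_. 1"] by (simp add: gcounit_def sum_product)
      have "gcounit H d * gcounit H c = gcounit H (gunit H :: 'b \<Rightarrow> 'k)" by (simp add: eps[symmetric] c)
      also have "\<dots> = 1" using H.sum_gdelta[of "\<one>\<^bsub>H\<^esub>" "\<lambda>_. 1::'k"] by (simp add: gcounit_def gunit_def)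
      finally have "gcounit H d * gcounit H c = 1" .
      moreover have "gcounit H (gpush G \<theta> a) = gcounit G a"
        using sum_gpush[OF H.fin \<theta>c, of a "\<lambda>_. 1"] by (simp add: gcounit_def)
      ultimately show ?thesis by (simp add: eps mult_ac)
    qed
    show "tcomult H J' (?\<phi> a) = tensor_map G ?\<phi> (tcomult G J a)"
    proof -
      define J0 where "J0 = gpush ?G2 (map_prod \<theta> \<theta>) J"
      define J0b where "J0b = gpush ?G2 (map_prod \<theta> \<theta>) G.Jb"
      have J0: "gmult ?H2 J0 J0b = gunit ?H2" "gmult ?H2 J0b J0 = gunit ?H2"
        unfolding J0_def J0b_def using G.gpush_Jb[OF H.fin_group_G2 hom2] by auto
      have J0b_in: "J0b \<in> galg ?H2" unfolding J0b_def using hom2 by (intro gpush_galg) (auto simp: hom_def)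
      have cd2: "gmult ?H2 (gten c c) (gten d d) = gunit ?H2" "gmult ?H2 (gten d d) (gten c c) = gunit ?H2"
        by (simp_all add: H.gmult_gten c H.gten_gunit)
      have Dcd: "gmult ?H2 (gcomult H d) (gcomult H c) = gunit ?H2"
        by (simp add: H.gcomult_gmult[symmetric] c H.gcomult_gunit)
      have tin: "gten c c \<in> galg ?H2" "gten d d \<in> galg ?H2" using c by (auto intro: H.gten_galg)
      \<comment> \<open>The gauge relation inverted: the two sides are a left and a right inverse of
        the same element.\<close>
      have inv: "gmult ?H2 H.Jb (gcomult H d) = gmult ?H2 (gten d d) J0b"
      proof (rule H.two.ginv_unique)
        show "gmult ?H2 (gmult ?H2 H.Jb (gcomult H d)) (gmult ?H2 J0 (gten c c)) = gunit ?H2"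
          unfolding J0_def gauge using H.two.gmult_cancel_mid[OF Dcd H.J_galg, of H.Jb] by (simp add: H.Jb_J)
        show "gmult ?H2 (gmult ?H2 J0 (gten c c)) (gmult ?H2 (gten d d) J0b) = gunit ?H2"
          using H.two.gmult_cancel_mid[OF cd2(1) J0b_in, of J0] by (simp add: J0)
      qed auto
      have push_T: "gpush ?G2 (map_prod \<theta> \<theta>) (tcomult G J a)
          = gmult ?H2 (gmult ?H2 J0b (gcomult H (gpush G \<theta> a))) J0"
      proof -
        have "gpush ?G2 (map_prod \<theta> \<theta>) (gcomult G a) = gcomult H (gpush G \<theta> a)"
          unfolding G.gcomult_eq_gpush[OF a] H.gcomult_eq_gpush[OF push_galg]
          using gpush_gpush[OF G.fin H.fin_group_G2 G.two.fin, of "\<lambda>x. (x, x)" "map_prod \<theta> \<theta>" a]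
            gpush_gpush[OF G.fin H.fin_group_G2 H.fin, of \<theta> "\<lambda>x. (x, x)" a] \<theta>c by (auto simp: Pi_def)
        then show ?thesis
          unfolding tcomult_def by (simp add: gpush_gmult[OF G.fin_group_G2 H.fin_group_G2 hom2] J0_def J0b_def)
      qed
      have "tensor_map G ?\<phi> T = gmult ?H2 (gmult ?H2 (gten d d) (gpush ?G2 (map_prod \<theta> \<theta>) T)) (gten c c)" for T
      proof -
        have "gten (?\<phi> (gdelta x)) (?\<phi> (gdelta y)) = gmult ?H2 (gmult ?H2 (gten d d) (gdelta (\<theta> x, \<theta> y))) (gten c c)"
          if "x \<in> carrier G" "y \<in> carrier G" for x y
          using that by (simp add: H.gmult_gten gten_gdelta[symmetric] pd)
        then have "tensor_map G ?\<phi> T = (\<lambda>q. \<Sum>p\<in>carrier ?G2. T p * gmult ?H2 (gmult ?H2 (gten d d) (gdelta (map_prod \<theta> \<theta> p))) (gten c c) q)"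
          by (auto simp: fun_eq_iff tensor_map_def gten_def mult.assoc intro!: sum.cong)
        then show ?thesis unfolding gpush_eq_sum by (simp only: H.two.gmult_sum_left H.two.gmult_sum_right)
      qed
      then have "tensor_map G ?\<phi> (tcomult G J a)
         = gmult ?H2 (gmult ?H2 (gmult ?H2 (gten d d) J0b) (gcomult H (gpush G \<theta> a))) (gmult ?H2 J0 (gten c c))"
        by (simp add: push_T H.two.gmult_assoc)
      also have "\<dots> = gmult ?H2 (gmult ?H2 (gmult ?H2 H.Jb (gcomult H d)) (gcomult H (gpush G \<theta> a))) (gmult ?H2 (gcomult H c) J')"
        by (simp only: inv gauge[folded J0_def])
      also have "\<dots> = tcomult H J' (?\<phi> a)"
        unfolding tcomult_def by (simp add: H.gcomult_gmult push_galg c H.two.gmult_assoc)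
      finally show ?thesis by simp
    qed
  next
    show "?\<phi> (gunit G) = gunit H"
      by (simp add: gpush_gunit[OF fg hom] c)
  qed
qed

section \<open>Characters of abelian subgroups\<close>

text \<open>Values outside M are left arbitrary, so that passing between a subgroup and a larger one
  needs no normalisation.\<close>

definition mult_char_on :: "('e, 'm) monoid_scheme \<Rightarrow> 'e set \<Rightarrow> ('e \<Rightarrow> 'k::field) \<Rightarrow> bool" where
  "mult_char_on E M \<chi> \<longleftrightarrow> (\<forall>x\<in>M. \<forall>y\<in>M. \<chi> (x \<otimes>\<^bsub>E\<^esub> y) = \<chi> x * \<chi> y) \<and> (\<forall>x\<in>M. \<chi> x \<noteq> 0)"

text \<open>With r the least positive exponent that brings y into M, every element of the enlarged
  subgroup is uniquely m y^i with i < r, and y may be sent to any r-th root of \<chi>(y^r).\<close>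

lemma (in comm_group) extend_char_step:
  fixes \<chi> :: "'a \<Rightarrow> 'k::field"
  assumes M: "subgroup M G" and \<chi>: "mult_char_on G M \<chi>" and y: "y \<in> carrier G"
    and r: "r > 0" "y [^] r \<in> M" "\<And>i. 0 < i \<Longrightarrow> i < r \<Longrightarrow> y [^] (i::nat) \<notin> M"
    and z: "z ^ r = \<chi> (y [^] r)"
  shows "\<exists>M' \<chi>'. subgroup M' G \<and> insert y M \<subseteq> M' \<and> mult_char_on G M' \<chi>' \<and> (\<forall>m\<in>M. \<chi>' m = \<chi> m) \<and> \<chi>' y = z"
proof -
  interpret M: subgroup M G by fact
  have Mc [simp]: "m \<in> M \<Longrightarrow> m \<in> carrier G" for m using M.subset by auto
  have mult: "\<chi> (a \<otimes> b) = \<chi> a * \<chi> b" if "a \<in> M" "b \<in> M" for a b using \<chi> that by (simp add: mult_char_on_def)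
  have nz: "\<chi> a \<noteq> 0" if "a \<in> M" for a using \<chi> that by (simp add: mult_char_on_def)
  have one: "\<chi> \<one> = 1" using mult[of \<one> \<one>] nz[of \<one>] by simp
  have z0: "z \<noteq> 0" using z nz[OF r(2)] r(1) by (auto simp: zero_power)
  define M' where "M' = {m \<otimes> y [^] i | m (i::nat). m \<in> M \<and> i < r}"
  have uniq: "m = m' \<and> i = j" if "m \<otimes> y [^] i = m' \<otimes> y [^] j" "m \<in> M" "m' \<in> M" "i < r" "j < r" "i \<le> j" for m m' and i j :: nat
  proof -
    have "y [^] j = y [^] i \<otimes> y [^] (j - i)" using that(6) y by (simp add: nat_pow_mult)
    then have "m \<otimes> y [^] i = (m' \<otimes> y [^] (j - i)) \<otimes> y [^] i" using that(1-3) y by (simp add: m_ac)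
    then have eq: "m = m' \<otimes> y [^] (j - i)" using that(2,3) y by simp
    then have "y [^] (j - i) = inv m' \<otimes> m" using that(2,3) y by (simp add: m_assoc[symmetric])
    then have "y [^] (j - i) \<in> M" using that(2,3) by simp
    moreover have "j - i < r" using that by simp
    ultimately have "i = j" using r(3)[of "j - i"] that by (cases "j - i = 0") auto
    with eq that(2,3) show ?thesis by simp
  qed
  have uniq': "m = m' \<and> i = j" if "m \<otimes> y [^] i = m' \<otimes> y [^] j" "m \<in> M" "m' \<in> M" "i < r" "j < r" for m m' and i j :: nat
    using uniq[OF that] uniq[OF that(1)[symmetric] that(3,2,5,4)] by (cases "i \<le> j") auto
  define \<chi>' where "\<chi>' x = (THE c. \<exists>m i. m \<in> M \<and> i < r \<and> x = m \<otimes> y [^] (i::nat) \<and> c = \<chi> m * z ^ i)" for x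
  have \<chi>': "\<chi>' (m \<otimes> y [^] i) = \<chi> m * z ^ i" if "m \<in> M" "i < r" for m i
    unfolding \<chi>'_def using that uniq' by (intro the_equality) blast+
  \<comment> \<open>The exponent i + j may reach r or more; the surplus y^r is absorbed into M, and
    z^r = \<chi>(y^r) keeps the value consistent.\<close>
  have wrap: "\<exists>m'' k. m'' \<in> M \<and> k < r \<and> m \<otimes> y [^] i \<otimes> (m' \<otimes> y [^] j) = m'' \<otimes> y [^] k \<and> \<chi> m'' * z ^ k = \<chi> m * z ^ i * (\<chi> m' * z ^ j)"
    if "m \<in> M" "m' \<in> M" "i < r" "j < r" for m m' and i j :: nat
  proof (cases "i + j < r")
    case True
    have "m \<otimes> y [^] i \<otimes> (m' \<otimes> y [^] j) = (m \<otimes> m') \<otimes> y [^] (i + j)"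
      using that y by (simp add: nat_pow_mult[symmetric] m_ac)
    then show ?thesis using True that by (intro exI[of _ "m \<otimes> m'"] exI[of _ "i + j"]) (simp add: mult power_add)
  next
    case False
    then have *: "i + j = r + (i + j - r)" "i + j - r < r" using that by auto
    have "m \<otimes> y [^] i \<otimes> (m' \<otimes> y [^] j) = (m \<otimes> m') \<otimes> y [^] (i + j)"
      using that y by (simp add: nat_pow_mult[symmetric] m_ac)
    also have "y [^] (i + j) = y [^] r \<otimes> y [^] (i + j - r)"
      using y by (subst *(1)) (simp add: nat_pow_mult)
    finally have 1: "m \<otimes> y [^] i \<otimes> (m' \<otimes> y [^] j) = (m \<otimes> m' \<otimes> y [^] r) \<otimes> y [^] (i + j - r)"
      using that y by (simp add: m_assoc)
    have "z ^ i * z ^ j = z ^ r * z ^ (i + j - r)" using *(1) by (metis power_add)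
    then have "\<chi> (m \<otimes> m' \<otimes> y [^] r) * z ^ (i + j - r) = \<chi> m * z ^ i * (\<chi> m' * z ^ j)"
      using that r(2) by (simp add: mult z[symmetric] mult_ac)
    with 1 that r(2) *(2) show ?thesis by (intro exI[of _ "m \<otimes> m' \<otimes> y [^] r"] exI[of _ "i + j - r"]) simp
  qed
  have sub: "subgroup M' G"
  proof (rule subgroupI)
    show "M' \<subseteq> carrier G" using y by (auto simp: M'_def)
    show "M' \<noteq> {}" using r(1) by (auto simp: M'_def intro!: exI[of _ \<one>] exI[of _ "0::nat"])
    fix a assume "a \<in> M'"
    then obtain m i where a: "a = m \<otimes> y [^] i" "m \<in> M" "i < r" by (auto simp: M'_def)
    show "inv a \<in> M'"
    proof (cases "i = 0")
      case True
      then show ?thesis using a r(1) unfolding M'_def by (intro CollectI exI[of _ "inv m"] exI[of _ "0::nat"]) auto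
    next
      case False
      have "y [^] r = y [^] i \<otimes> y [^] (r - i)" using a y by (simp add: nat_pow_mult)
      then have "(inv m \<otimes> inv (y [^] r) \<otimes> y [^] (r - i)) \<otimes> a = \<one>"
        using a y by (simp add: m_ac inv_mult)
      then have "inv a = (inv m \<otimes> inv (y [^] r)) \<otimes> y [^] (r - i)"
        using a y by (intro inv_equality) auto
      then show ?thesis using False a r unfolding M'_def
        by (intro CollectI exI[of _ "inv m \<otimes> inv (y [^] r)"] exI[of _ "r - i"]) auto
    qed
    fix b assume "b \<in> M'"
    then obtain m' j where b: "b = m' \<otimes> y [^] j" "m' \<in> M" "j < r" by (auto simp: M'_def)
    show "a \<otimes> b \<in> M'" using wrap[of m m' i j] a b unfolding M'_def by auto
  qed
  have "mult_char_on G M' \<chi>'"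
    unfolding mult_char_on_def
  proof (intro conjI ballI)
    fix a assume "a \<in> M'"
    then obtain m i where a: "a = m \<otimes> y [^] i" "m \<in> M" "i < r" by (auto simp: M'_def)
    show "\<chi>' a \<noteq> 0" using a \<chi>' nz z0 by simp
    fix b assume "b \<in> M'"
    then obtain m' j where b: "b = m' \<otimes> y [^] j" "m' \<in> M" "j < r" by (auto simp: M'_def)
    obtain m'' k where "m'' \<in> M" "k < r" "a \<otimes> b = m'' \<otimes> y [^] k" "\<chi> m'' * z ^ k = \<chi> m * z ^ i * (\<chi> m' * z ^ j)"
      using wrap[of m m' i j] a b by auto
    then show "\<chi>' (a \<otimes> b) = \<chi>' a * \<chi>' b" using \<chi>' a b by metis
  qed
  moreover have ext: "m \<in> M' \<and> \<chi>' m = \<chi> m" if "m \<in> M" for m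
    using \<chi>'[of m 0] that r(1) by (auto simp: M'_def intro!: exI[of _ m] exI[of _ "0::nat"])
  moreover have "y \<in> M' \<and> \<chi>' y = z"
  proof (cases "r = 1")
    case True
    then have "y \<in> M" "z = \<chi> y" using r(2) z y by auto
    then show ?thesis using ext by simp
  next
    case False
    then have "1 < r" using r(1) by simp
    then have "\<chi>' (\<one> \<otimes> y [^] (1::nat)) = \<chi> \<one> * z ^ 1" "\<one> \<otimes> y [^] (1::nat) \<in> M'"
      using \<chi>'[of \<one> 1] M.one_closed unfolding M'_def by blast+
    then show ?thesis using y one by simp
  qed
  ultimately show ?thesis using sub by blast
qed

text \<open>One generator is adjoined at a time, and algebraic closure supplies the root for
  \<open>extend_char_step\<close>. Finite order is asked modulo M, because in
  \<open>symmetric_cocycle_trivial\<close> M is a copy of the infinite group of units.\<close>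

lemma (in comm_group) extend_char:
  fixes \<chi> :: "'a \<Rightarrow> 'k::alg_closed_field"
  assumes "finite Y" "subgroup M G" "mult_char_on G M \<chi>"
    and "Y \<subseteq> carrier G" "\<And>y. y \<in> Y \<Longrightarrow> \<exists>r>0. y [^] (r::nat) \<in> M"
  shows "\<exists>M' \<chi>'. subgroup M' G \<and> M \<union> Y \<subseteq> M' \<and> mult_char_on G M' \<chi>' \<and> (\<forall>m\<in>M. \<chi>' m = \<chi> m)"
  using assms(1,4,5)
proof (induction Y rule: finite_induct)
  case empty
  then show ?case using assms(2,3) by blast
next
  case (insert y Y)
  then obtain M1 \<chi>1 where M1: "subgroup M1 G" "M \<union> Y \<subseteq> M1" "mult_char_on G M1 \<chi>1" "\<forall>m\<in>M. \<chi>1 m = \<chi> m"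
    by (metis insert_iff insert_subset)
  define r where "r = (LEAST r::nat. r > 0 \<and> y [^] r \<in> M1)"
  have ex: "\<exists>r::nat. r > 0 \<and> y [^] r \<in> M1" using insert.prems(2)[of y] M1(2) by auto
  have r: "r > 0" "y [^] r \<in> M1" using LeastI_ex[OF ex] by (auto simp: r_def)
  have "y [^] i \<notin> M1" if "0 < i" "i < r" for i :: nat
    using not_less_Least[of i "\<lambda>r. r > 0 \<and> y [^] r \<in> M1"] that by (auto simp: r_def)
  moreover obtain z where "z ^ r = \<chi>1 (y [^] r)" using nth_root_exists[OF r(1)] by blast
  ultimately obtain M' \<chi>' where "subgroup M' G" "insert y M1 \<subseteq> M'" "mult_char_on G M' \<chi>'" "\<forall>m\<in>M1. \<chi>' m = \<chi>1 m"
    using extend_char_step[OF M1(1,3) _ r] insert.prems(1) by (metis insert_subset)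
  then show ?case using M1 by (intro exI[of _ M'] exI[of _ \<chi>']) auto
qed

text \<open>Take a root of 1 + X + ... + X^(r-1). It differs from 1, where the polynomial has the
  value r, nonzero in characteristic zero.\<close>

lemma nontrivial_root_of_unity:
  assumes "r > 1"
  shows "\<exists>z :: 'k::{alg_closed_field, field_char_0}. z ^ r = 1 \<and> z \<noteq> 1"
proof -
  obtain z :: 'k where z: "(\<Sum>k\<le>r - 1. 1 * z ^ k) = 0"
    using alg_closed[of "r - 1" "\<lambda>_. 1"] assms by auto
  have r: "Suc (r - 1) = r" using assms by simp
  have "z \<noteq> 1"
  proof
    assume "z = 1"
    then have "(of_nat (Suc (r - 1)) :: 'k) = 0" using z by simp
    then show False unfolding of_nat_eq_0_iff by simp
  qed
  moreover have "1 - z ^ Suc (r - 1) = (1 - z) * (\<Sum>k\<le>r - 1. z ^ k)"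
    by (simp only: one_diff_power_eq lessThan_Suc_atMost)
  ultimately show ?thesis using z r by auto
qed

locale abelian_subgroup = fin_group G for G (structure) + fixes H
  assumes subgroup_H: "subgroup H G" and commute_H: "\<And>x y. x \<in> H \<Longrightarrow> y \<in> H \<Longrightarrow> x \<otimes> y = y \<otimes> x"
begin

sublocale H: subgroup H G by (rule subgroup_H)

lemma finite_H [simp]: "finite H"
  using finite_subset[OF H.subset fin] .

lemma H_nonempty [simp]: "H \<noteq> {}"
  using H.one_closed by blast

lemma card_H_pos: "card H > 0"
  by (simp add: card_gt_0_iff)

lemma comm_group_H: "comm_group (G\<lparr>carrier := H\<rparr>)"
  using commute_H by (intro group.group_comm_groupI subgroup_imp_group[OF subgroup_H]) auto

lemma chars_mult: "\<chi> \<in> chars G H \<Longrightarrow> x \<in> H \<Longrightarrow> y \<in> H \<Longrightarrow> \<chi> (x \<otimes> y) = \<chi> x * \<chi> y"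
  and chars_one: "\<chi> \<in> chars G H \<Longrightarrow> \<chi> \<one> = 1"
  and chars_outside: "\<chi> \<in> chars G H \<Longrightarrow> x \<notin> H \<Longrightarrow> \<chi> x = 0"
  by (auto simp: chars_def)

lemma chars_inv_mult: "\<chi> \<in> chars G H \<Longrightarrow> x \<in> H \<Longrightarrow> \<chi> (inv x) * \<chi> x = 1"
  using chars_mult[of \<chi> "inv x" x] chars_one[of \<chi>] by simp

lemma chars_nonzero: "\<chi> \<in> chars G H \<Longrightarrow> x \<in> H \<Longrightarrow> \<chi> x \<noteq> 0"
  using chars_inv_mult[of \<chi> x] by auto

lemma chars_inv: "\<chi> \<in> chars G H \<Longrightarrow> x \<in> H \<Longrightarrow> \<chi> (inv x) = inverse (\<chi> x)"
  using chars_inv_mult[of \<chi> x] chars_nonzero[of \<chi> x] by (simp add: field_simps)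

lemma chars_eqI: "\<chi> \<in> chars G H \<Longrightarrow> \<psi> \<in> chars G H \<Longrightarrow> (\<And>x. x \<in> H \<Longrightarrow> \<chi> x = \<psi> x) \<Longrightarrow> \<chi> = \<psi>"
  by (rule ext) (metis chars_outside)

definition triv_char :: "'a \<Rightarrow> 'k::field" where "triv_char x = (if x \<in> H then 1 else 0)"
definition inv_char :: "('a \<Rightarrow> 'k::field) \<Rightarrow> 'a \<Rightarrow> 'k" where "inv_char \<chi> x = (if x \<in> H then inverse (\<chi> x) else 0)"

lemma triv_char_in [simp]: "triv_char \<in> chars G H"
  by (auto simp: chars_def triv_char_def)

lemma inv_char_in [simp]: "\<chi> \<in> chars G H \<Longrightarrow> inv_char \<chi> \<in> chars G H"
  by (auto simp: chars_def inv_char_def)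

lemma char_mult_in [simp]: "\<chi> \<in> chars G H \<Longrightarrow> \<psi> \<in> chars G H \<Longrightarrow> char_mult \<chi> \<psi> \<in> chars G H"
  by (auto simp: chars_def char_mult_def)

lemma char_mult_assoc: "char_mult (char_mult \<chi> \<psi>) \<rho> = char_mult \<chi> (char_mult \<psi> \<rho>)"
  and char_mult_commute: "char_mult \<chi> \<psi> = char_mult \<psi> \<chi>"
  by (auto simp: char_mult_def)

lemma char_mult_triv [simp]: "\<chi> \<in> chars G H \<Longrightarrow> char_mult triv_char \<chi> = \<chi>" "\<chi> \<in> chars G H \<Longrightarrow> char_mult \<chi> triv_char = \<chi>"
  by (auto simp: char_mult_def triv_char_def chars_outside fun_eq_iff)

lemma char_mult_inv [simp]: "\<chi> \<in> chars G H \<Longrightarrow> char_mult (inv_char \<chi>) \<chi> = triv_char" "\<chi> \<in> chars G H \<Longrightarrow> char_mult \<chi> (inv_char \<chi>) = triv_char"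
  by (auto simp: char_mult_def triv_char_def inv_char_def chars_nonzero fun_eq_iff)

lemma char_mult_inv_cancel [simp]:
  "\<chi> \<in> chars G H \<Longrightarrow> \<psi> \<in> chars G H \<Longrightarrow> char_mult (inv_char \<chi>) (char_mult \<chi> \<psi>) = \<psi>"
  "\<chi> \<in> chars G H \<Longrightarrow> \<psi> \<in> chars G H \<Longrightarrow> char_mult \<chi> (char_mult (inv_char \<chi>) \<psi>) = \<psi>"
  by (simp_all add: char_mult_assoc[symmetric])

lemma bij_char_mult: "\<chi> \<in> chars G H \<Longrightarrow> bij_betw (char_mult \<chi>) (chars G H) (chars G H)"
  by (rule bij_betwI[where g = "char_mult (inv_char \<chi>)"]) auto

text \<open>Values on H are roots of X^n - 1 with n the order of H, so a character is one of
  finitely many functions on a finite set.\<close>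

lemma finite_chars [simp]: "finite (chars G H :: ('a \<Rightarrow> 'k::field) set)"
proof -
  let ?n = "card H"
  define R where "R = {z :: 'k. z ^ ?n = 1}"
  have "finite {z. poly (monom 1 ?n - 1) z = (0 :: 'k)}"
  proof (rule poly_roots_finite)
    have "coeff (monom 1 ?n - 1 :: 'k poly) ?n = 1" using card_H_pos by (simp add: coeff_1)
    then show "monom 1 ?n - (1 :: 'k poly) \<noteq> 0" by (metis coeff_0 zero_neq_one)
  qed
  then have fR: "finite R" by (simp add: R_def poly_monom)
  have "\<chi> x \<in> R" if "\<chi> \<in> chars G H" "x \<in> H" for \<chi> :: "'a \<Rightarrow> 'k" and x
  proof -
    interpret GH: group "G\<lparr>carrier := H\<rparr>" using comm_group_H by (simp add: comm_group_def)
    have pow: "x [^] (n::nat) \<in> H \<and> \<chi> (x [^] n) = \<chi> x ^ n" for n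
      using that by (induction n) (auto simp: chars_mult chars_one)
    have "x [^] ?n = \<one>"
      using GH.pow_order_eq_1[of x] that by (simp add: Coset.order_def nat_pow_consistent[symmetric])
    then show ?thesis using pow[of ?n] that chars_one[of \<chi>] by (simp add: R_def)
  qed
  then have "chars G H \<subseteq> {f. \<forall>x. (x \<in> H \<longrightarrow> f x \<in> R) \<and> (x \<notin> H \<longrightarrow> f x = 0)}"
    by (auto simp: chars_outside)
  then show ?thesis
    by (rule finite_subset) (rule finite_set_of_finite_funs[OF finite_H fR])
qed

text \<open>With r the order of x, sending x to a nontrivial r-th root of unity defines a character
  of the cyclic subgroup of x, which then extends to H.\<close>

lemma chars_separate:
  assumes "x \<in> H" "x \<noteq> \<one>"
  shows "\<exists>\<chi> \<in> chars G H. \<chi> x \<noteq> (1 :: 'k::{alg_closed_field, field_char_0})"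
proof -
  let ?E = "G\<lparr>carrier := H\<rparr>"
  interpret E: comm_group ?E by (rule comm_group_H)
  have ex: "\<exists>r::nat. r > 0 \<and> y [^]\<^bsub>?E\<^esub> r \<in> {\<one>}" if "y \<in> H" for y
    using E.pow_order_eq_1[of y] that card_H_pos by (intro exI[of _ "card H"]) (simp add: Coset.order_def)
  define r where "r = (LEAST r::nat. r > 0 \<and> x [^]\<^bsub>?E\<^esub> r \<in> {\<one>})"
  have r: "r > 0" "x [^]\<^bsub>?E\<^esub> r \<in> {\<one>}" using LeastI_ex[OF ex[OF assms(1)]] by (auto simp: r_def)
  have min: "x [^]\<^bsub>?E\<^esub> i \<notin> {\<one>}" if "0 < i" "i < r" for i :: nat
    using not_less_Least[of i "\<lambda>r. r > 0 \<and> x [^]\<^bsub>?E\<^esub> r \<in> {\<one>}"] that by (auto simp: r_def)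
  have "r \<noteq> 1" using r assms by auto
  then obtain z :: 'k where z: "z ^ r = 1" "z \<noteq> 1" using nontrivial_root_of_unity[of r] r(1) by auto
  have triv: "subgroup {\<one>} ?E" using E.triv_subgroup by simp
  have tchar: "mult_char_on ?E {\<one>} (\<lambda>_. 1 :: 'k)" by (auto simp: mult_char_on_def)
  have xE: "x \<in> carrier ?E" using assms by simp
  have "\<exists>M' \<chi>'. subgroup M' ?E \<and> insert x {\<one>} \<subseteq> M' \<and> mult_char_on ?E M' \<chi>' \<and> (\<forall>m\<in>{\<one>}. \<chi>' m = 1) \<and> \<chi>' x = z"
    by (rule E.extend_char_step[OF triv tchar xE r]) (use min z in auto)
  then obtain M \<chi> where M: "subgroup M ?E" "insert x {\<one>} \<subseteq> M" "mult_char_on ?E M \<chi>" "\<chi> x = z"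
    by (elim exE conjE) (rule that)
  have "\<exists>r>0. y [^]\<^bsub>?E\<^esub> (r::nat) \<in> M" if "y \<in> H" for y using ex[OF that] M(2) by auto
  then obtain M' \<chi>' where M': "subgroup M' ?E" "M \<union> H \<subseteq> M'" "mult_char_on ?E M' \<chi>'" "\<forall>m\<in>M. \<chi>' m = \<chi> m"
    using E.extend_char[OF finite_H M(1,3)] by auto
  have "M' = H" using subgroup.subset[OF M'(1)] M'(2) by auto
  then have mult: "\<chi>' (a \<otimes> b) = \<chi>' a * \<chi>' b" "\<chi>' a \<noteq> 0" if "a \<in> H" "b \<in> H" for a b
    using M'(3) that by (auto simp: mult_char_on_def)
  define \<rho> where "\<rho> a = (if a \<in> H then \<chi>' a else 0)" for a
  have "\<chi>' \<one> = 1" using mult[of \<one> \<one>] by simp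
  then have "\<rho> \<in> chars G H" using mult by (auto simp: chars_def \<rho>_def)
  moreover have "\<rho> x \<noteq> 1" using M M' z assms by (auto simp: \<rho>_def)
  ultimately show ?thesis by blast
qed

text \<open>Shifting the summation by an element x with \<chi>(x) different from 1 multiplies the
  sum by \<chi>(x).\<close>

lemma chars_orthogonal:
  assumes "\<chi> \<in> chars G H"
  shows "(\<Sum>h\<in>H. \<chi> h) = (if \<chi> = triv_char then of_nat (card H) else (0::'k::field))"
proof (cases "\<chi> = triv_char")
  case True
  then show ?thesis by (simp add: triv_char_def)
next
  case False
  then obtain x where x: "x \<in> H" "\<chi> x \<noteq> 1"
    using chars_eqI[OF assms triv_char_in] by (auto simp: triv_char_def)
  have "bij_betw ((\<otimes>) x) H H"
    by (rule bij_betwI[where g = "(\<otimes>) (inv x)"]) (use x in \<open>auto simp: m_assoc[symmetric]\<close>)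
  then have "(\<Sum>h\<in>H. \<chi> h) = (\<Sum>h\<in>H. \<chi> (x \<otimes> h))" by (rule sum.reindex_bij_betw[symmetric])
  also have "\<dots> = \<chi> x * (\<Sum>h\<in>H. \<chi> h)" using assms x by (simp add: chars_mult sum_distrib_left)
  finally show ?thesis using x False by simp
qed

lemma sum_chars_aux:
  assumes "x \<in> H"
  shows "(\<Sum>\<chi>\<in>chars G H. \<chi> x) = (if x = \<one> then of_nat (card (chars G H :: ('a \<Rightarrow> 'k::{alg_closed_field, field_char_0}) set)) else (0::'k))"
proof (cases "x = \<one>")
  case False
  then obtain \<psi> :: "'a \<Rightarrow> 'k" where \<psi>: "\<psi> \<in> chars G H" "\<psi> x \<noteq> 1" using chars_separate[OF assms] by blast
  have "(\<Sum>\<chi>\<in>chars G H. \<chi> x) = (\<Sum>\<chi>\<in>chars G H. char_mult \<psi> \<chi> x)"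
    using sum.reindex_bij_betw[OF bij_char_mult[OF \<psi>(1)], of "\<lambda>\<chi>. \<chi> x"] by simp
  also have "\<dots> = \<psi> x * (\<Sum>\<chi>\<in>chars G H. \<chi> x)" by (simp add: char_mult_def sum_distrib_left)
  finally show ?thesis using \<psi> False by simp
qed (simp add: chars_one)

text \<open>Summing \<chi>(x) over all pairs, in the two orders, gives the two
  cardinalities.\<close>

lemma card_chars: "card (chars G H :: ('a \<Rightarrow> 'k::{alg_closed_field, field_char_0}) set) = card H"
proof -
  have "(\<Sum>x\<in>H. \<Sum>\<chi>\<in>chars G H. \<chi> x :: 'k) = of_nat (card (chars G H :: ('a \<Rightarrow> 'k) set))"
    by (subst sum.remove[OF finite_H H.one_closed]) (simp add: sum_chars_aux)
  moreover have "(\<Sum>x\<in>H. \<Sum>\<chi>\<in>chars G H. \<chi> x :: 'k) = of_nat (card H)"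
    by (subst sum.swap, subst sum.remove[OF finite_chars triv_char_in])
      (simp add: chars_orthogonal)
  ultimately show ?thesis by (metis of_nat_eq_iff)
qed

lemma sum_chars:
  assumes "x \<in> H"
  shows "(\<Sum>\<chi>\<in>chars G H. \<chi> x) = (if x = \<one> then of_nat (card H) else (0::'k::{alg_closed_field, field_char_0}))"
  by (simp add: sum_chars_aux[OF assms] card_chars)

lemma chars_orthogonal2:
  assumes "\<chi> \<in> chars G H" "\<psi> \<in> chars G H"
  shows "(\<Sum>h\<in>H. \<chi> h * \<psi> (inv h)) = (if \<chi> = \<psi> then of_nat (card H) else (0::'k::field))"
proof -
  have "(\<Sum>h\<in>H. \<chi> h * \<psi> (inv h)) = (\<Sum>h\<in>H. char_mult \<chi> (inv_char \<psi>) h)"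
    using assms by (intro sum.cong) (auto simp: char_mult_def inv_char_def chars_inv)
  also have "\<dots> = (if char_mult \<chi> (inv_char \<psi>) = triv_char then of_nat (card H) else 0)"
    using assms by (intro chars_orthogonal) auto
  also have "char_mult \<chi> (inv_char \<psi>) = triv_char \<longleftrightarrow> \<chi> = \<psi>"
  proof
    assume "char_mult \<chi> (inv_char \<psi>) = triv_char"
    then have "char_mult (char_mult \<chi> (inv_char \<psi>)) \<psi> = char_mult triv_char \<psi>" by simp
    then show "\<chi> = \<psi>" using assms by (simp add: char_mult_assoc)
  qed (use assms in simp)
  finally show ?thesis .
qed

end

section \<open>The star product\<close>

lemma sum_fun_apply: "(\<Sum>i\<in>I. f i) t = (\<Sum>i\<in>I. f i t)"
  by (induction I rule: infinite_finite_induct) auto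

definition sc :: "'k::comm_ring_1 \<Rightarrow> ('g \<Rightarrow> 'k) \<Rightarrow> 'g \<Rightarrow> 'k" where
  "sc c f = (\<lambda>t. c * f t)"

lemma sc_apply: "sc c f t = c * f t" by (simp add: sc_def)

lemma sc_simps [simp]: "sc c (sc d f) = sc (c * d) f" "sc 1 f = f" "sc 0 f = 0" "sc c 0 = 0"
  by (auto simp: sc_def mult.assoc)

lemma sc_sum: "sc c (\<Sum>i\<in>I. f i) = (\<Sum>i\<in>I. sc c (f i))"
  by (auto simp: sc_def fun_eq_iff sum_fun_apply sum_distrib_left)

lemma sum_sc: "(\<Sum>i\<in>I. sc (c i) f) = sc (\<Sum>i\<in>I. c i) f"
  by (auto simp: sc_def fun_eq_iff sum_fun_apply sum_distrib_right)

lemma sc_eq_zero_iff: "sc c f = 0 \<longleftrightarrow> c = 0 \<or> f = 0" for c :: "'k::field"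
  by (auto simp: sc_def fun_eq_iff)

lemma sc_cancel: "sc c f = sc d f \<Longrightarrow> f \<noteq> 0 \<Longrightarrow> c = d" for c :: "'k::field"
  by (auto simp: sc_def fun_eq_iff)

lemma galg_zero [simp]: "0 \<in> galg G" and galg_add [simp]: "f \<in> galg G \<Longrightarrow> g \<in> galg G \<Longrightarrow> f + g \<in> galg G"
  and galg_sc [simp]: "f \<in> galg G \<Longrightarrow> sc c f \<in> galg G"
  by (auto simp: galg_def sc_def)

lemma galg_sum [simp]: "(\<And>i. i \<in> I \<Longrightarrow> f i \<in> galg G) \<Longrightarrow> (\<Sum>i\<in>I. f i) \<in> galg G"
  by (auto simp: galg_def sum_fun_apply)

text \<open>From a b = 1 every h is (h a) b, so the translates of b span kG. A nonzero x with x b =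
  0 would make one translate redundant and leave too few spanning elements. Hence right
  multiplication by b is injective, and it kills b a - 1.\<close>

lemma (in fin_group) gmult_inverse_commute:
  fixes a b :: "'a \<Rightarrow> 'k::field"
  assumes "a \<in> galg G" "b \<in> galg G" "gmult G a b = gunit G"
  shows "gmult G b a = gunit G"
proof -
  interpret V: vector_space "sc :: 'k \<Rightarrow> ('a \<Rightarrow> 'k) \<Rightarrow> _"
    by unfold_locales (auto simp: sc_def algebra_simps)
  have inj: "x = 0" if x: "x \<in> galg G" "gmult G x b = 0" for x
  proof (rule ccontr)
    assume "x \<noteq> 0"
    then obtain g0 where g0: "x g0 \<noteq> 0" "g0 \<in> carrier G" using x(1) by (auto simp: fun_eq_iff galg_def)
    let ?D = "gdelta ` carrier G :: ('a \<Rightarrow> 'k) set"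
    define Y where "Y = (\<lambda>g. gmult G (gdelta g) b) ` (carrier G - {g0})"
    have xb: "gmult G x' b = (\<Sum>g\<in>carrier G. sc (x' g) (gmult G (gdelta g) b))" if "x' \<in> galg G" for x'
    proof
      fix z show "gmult G x' b z = (\<Sum>g\<in>carrier G. sc (x' g) (gmult G (gdelta g) b)) z"
        by (cases "z \<in> carrier G") (auto simp: sum_fun_apply sc_def gmult_gdelta_left gmult_def[of G x'] galgD[OF gmult_galg])
    qed
    have rest: "gmult G (gdelta g) b \<in> V.span Y" if "g \<in> carrier G - {g0}" for g
      unfolding Y_def by (rule V.span_base) (use that in blast)
    have "sc (x g0) (gmult G (gdelta g0) b) = - (\<Sum>g\<in>carrier G - {g0}. sc (x g) (gmult G (gdelta g) b))"
      using xb[OF x(1)] x(2) by (subst (asm) sum.remove[OF fin g0(2)]) (simp add: add_eq_0_iff)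
    then have "gmult G (gdelta g0) b = sc (1 / x g0) (- (\<Sum>g\<in>carrier G - {g0}. sc (x g) (gmult G (gdelta g) b)))"
      using g0(1) by (metis sc_simps(1,2) divide_self_if mult.commute times_divide_eq_right mult.right_neutral)
    also have "\<dots> \<in> V.span Y"
      by (intro V.span_scale V.span_neg V.span_sum rest)
    finally have all: "gmult G (gdelta g) b \<in> V.span Y" if "g \<in> carrier G" for g
      using rest that by (cases "g = g0") auto
    have "gdelta h \<in> V.span Y" if "h \<in> carrier G" for h
    proof -
      have "gdelta h = gmult G (gmult G (gdelta h) a) b"
        using that by (simp add: gmult_assoc assms)
      also have "\<dots> \<in> V.span Y"
        unfolding xb[OF gmult_galg] by (intro V.span_scale V.span_sum all)
      finally show ?thesis .
    qed
    then have "?D \<subseteq> V.span Y" by auto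
    moreover have "V.independent ?D"
      unfolding V.independent_explicit_module
    proof (intro allI impI)
      fix t u v assume t: "finite t" "t \<subseteq> ?D" "(\<Sum>w\<in>t. sc (u w) w) = 0" "v \<in> t"
      then obtain h where h: "v = gdelta h" "h \<in> carrier G" by auto
      have "(\<Sum>w\<in>t. u w * w h) = 0" using fun_cong[OF t(3), of h] by (simp add: sum_fun_apply sc_def)
      moreover have "(\<Sum>w\<in>t. u w * w h) = u v"
        using t(2) by (subst sum.remove[OF t(1,4)]) (auto simp: h gdelta_def intro!: sum.neutral split: if_splits)
      ultimately show "u v = 0" by simp
    qed
    moreover have "finite Y" by (simp add: Y_def)
    ultimately have "card ?D \<le> card Y" using V.independent_span_bound by blast
    also have "\<dots> \<le> card (carrier G - {g0})" unfolding Y_def by (intro card_image_le) simp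
    also have "\<dots> < card (carrier G)" using g0(2) by (intro psubset_card_mono) auto
    also have "\<dots> = card ?D"
    proof (rule card_image[symmetric], rule inj_onI)
      fix x y assume "(gdelta x :: 'a \<Rightarrow> 'k) = gdelta y"
      from fun_cong[OF this, of x] show "x = y" by (simp add: gdelta_def split: if_splits)
    qed
    finally show False by simp
  qed
  define x where "x = (\<lambda>t. gmult G b a t + (- 1) * gunit G t)"
  have "x \<in> galg G" unfolding x_def using gmult_galg[of b a] gunit_galg by (simp add: galg_def)
  moreover have "gmult G x b = (\<lambda>t. gmult G (gmult G b a) b t + (- 1) * gmult G (gunit G) b t)"
    unfolding x_def gmult_add_left gmult_scale_left ..
  then have "gmult G x b = 0" using assms by (simp add: gmult_assoc zero_fun_def)
  ultimately have "x = 0" by (rule inj)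
  then have "x t = 0" for t by simp
  then show ?thesis by (intro ext) (simp add: x_def)
qed

context tensor_group
begin

definition one_fun :: "'a \<Rightarrow> 'k::comm_ring_1" where "one_fun t = (if t \<in> carrier G then 1 else 0)"

definition act :: "'a \<Rightarrow> ('a \<Rightarrow> 'k::comm_ring_1) \<Rightarrow> 'a \<Rightarrow> 'k" where
  "act h f t = (if t \<in> carrier G then f (inv h \<otimes> t) else 0)"

lemma one_fun_galg [simp]: "one_fun \<in> galg G" and act_galg [simp]: "act h f \<in> galg G"
  by (auto simp: galg_def one_fun_def act_def)

lemma act_eq_gmult: "h \<in> carrier G \<Longrightarrow> act h f = gmult G (gdelta h) f"
proof
  fix t assume "h \<in> carrier G"
  then show "act h f t = gmult G (gdelta h) f t"
    by (cases "t \<in> carrier G") (simp_all add: act_def gmult_gdelta_left galgD[OF gmult_galg])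
qed

lemma act_act: "h \<in> carrier G \<Longrightarrow> g \<in> carrier G \<Longrightarrow> act h (act g f) = act (h \<otimes> g) f"
  by (simp add: act_eq_gmult gmult_assoc[symmetric] gmult_gdelta)

lemma act_one [simp]: "f \<in> galg G \<Longrightarrow> act \<one> f = f"
  by (auto simp: act_def galg_def)

lemma act_one_fun [simp]: "h \<in> carrier G \<Longrightarrow> act h one_fun = one_fun"
  by (auto simp: act_def one_fun_def)

lemma act_sc: "act h (sc c f) = sc c (act h f)" and act_add: "act h (f + g) = act h f + act h g"
  and act_zero [simp]: "act h 0 = 0"
  by (auto simp: act_def sc_def)

lemma act_sum: "act h (\<Sum>i\<in>I. f i) = (\<Sum>i\<in>I. act h (f i))"
  by (auto simp: act_def fun_eq_iff sum_fun_apply)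

lemma act_inv_cancel [simp]: "h \<in> carrier G \<Longrightarrow> f \<in> galg G \<Longrightarrow> act (inv h) (act h f) = f"
  "h \<in> carrier G \<Longrightarrow> f \<in> galg G \<Longrightarrow> act h (act (inv h) f) = f"
  by (simp_all add: act_act)

lemma gmult_eq_sum_act: "f \<in> galg G \<Longrightarrow> gmult G f v = (\<Sum>g\<in>carrier G. sc (f g) (act g v))"
  by (auto simp: fun_eq_iff sum_fun_apply sc_def gmult_def act_def)

text \<open>The value at t is f \<otimes> g evaluated on \<Delta>(t) J: the product dual to a
  coproduct twisted on one side only. As J multiplies on the right, left translations are
  automorphisms (\<open>act_gstar\<close>).\<close>

definition gstar :: "('a \<times> 'a \<Rightarrow> 'k::comm_ring_1) \<Rightarrow> ('a \<Rightarrow> 'k) \<Rightarrow> ('a \<Rightarrow> 'k) \<Rightarrow> 'a \<Rightarrow> 'k" where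
  "gstar J f g t = (if t \<in> carrier G then \<Sum>p\<in>carrier G2. J p * (f (t \<otimes> fst p) * g (t \<otimes> snd p)) else 0)"

lemma gstar_galg [simp]: "gstar J f g \<in> galg G"
  by (simp add: galg_def gstar_def)

lemma gstar_add_left: "gstar J (f + f') g = gstar J f g + gstar J f' g"
  and gstar_add_right: "gstar J f (g + g') = gstar J f g + gstar J f g'"
  and gstar_sc_left [simp]: "gstar J (sc c f) g = sc c (gstar J f g)"
  and gstar_sc_right [simp]: "gstar J f (sc c g) = sc c (gstar J f g)"
  and gstar_zero_left [simp]: "gstar J 0 g = 0"
  and gstar_zero_right [simp]: "gstar J f 0 = 0"
  by (auto simp: gstar_def fun_eq_iff sc_def sum.distrib algebra_simps sum_distrib_left)

lemma gstar_sum_left: "gstar J (\<Sum>i\<in>I. f i) g = (\<Sum>i\<in>I. gstar J (f i) g)"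
proof
  fix t
  have "(\<Sum>p\<in>carrier G2. J p * ((\<Sum>i\<in>I. f i (t \<otimes> fst p)) * g (t \<otimes> snd p)))
    = (\<Sum>i\<in>I. \<Sum>p\<in>carrier G2. J p * (f i (t \<otimes> fst p) * g (t \<otimes> snd p)))"
    unfolding sum_distrib_left sum_distrib_right by (rule sum.swap)
  then show "gstar J (\<Sum>i\<in>I. f i) g t = (\<Sum>i\<in>I. gstar J (f i) g) t"
    unfolding sum_fun_apply gstar_def by (cases "t \<in> carrier G") simp_all
qed

lemma gstar_sum_right: "gstar J f (\<Sum>i\<in>I. g i) = (\<Sum>i\<in>I. gstar J f (g i))"
proof
  fix t
  have "(\<Sum>p\<in>carrier G2. J p * (f (t \<otimes> fst p) * (\<Sum>i\<in>I. g i (t \<otimes> snd p))))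
    = (\<Sum>i\<in>I. \<Sum>p\<in>carrier G2. J p * (f (t \<otimes> fst p) * g i (t \<otimes> snd p)))"
    unfolding sum_distrib_left sum_distrib_right by (rule sum.swap)
  then show "gstar J f (\<Sum>i\<in>I. g i) t = (\<Sum>i\<in>I. gstar J f (g i)) t"
    unfolding sum_fun_apply gstar_def by (cases "t \<in> carrier G") simp_all
qed

lemma act_gstar: "h \<in> carrier G \<Longrightarrow> act h (gstar J f g) = gstar J (act h f) (act h g)"
  by (auto simp: act_def gstar_def fun_eq_iff m_assoc intro!: sum.cong)

lemma gstar_at_one: "gstar J f g \<one> = (\<Sum>p\<in>carrier G2. J p * (f (fst p) * g (snd p)))"
  by (auto simp: gstar_def intro!: sum.cong)

text \<open>Both bracketings pair f \<otimes> g \<otimes> h with an element of the third tensor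
  power, and delta functions evaluated at the unit recover its coefficients. The direction from
  associativity to the cocycle equation later shows that a lifted \<open>J1\<close> is a
  twist.\<close>

lemma gstar_assoc_iff:
  fixes J :: "'a \<times> 'a \<Rightarrow> 'k::comm_ring_1"
  assumes "J \<in> galg G2"
  shows "(\<forall>f g h. gstar J (gstar J f g) h = gstar J f (gstar J g h)) \<longleftrightarrow>
     gmult G3 (gpush G2 dup1 J) (gpush G2 ins3 J) = gmult G3 (gpush G2 dup2 J) (gpush G2 ins1 J)"
proof -
  let ?L = "gmult G3 (gpush G2 dup1 J) (gpush G2 ins3 J)" and ?R = "gmult G3 (gpush G2 dup2 J) (gpush G2 ins1 J)"
  have L: "gstar J (gstar J f g) h t = (\<Sum>x\<in>carrier G3. ?L x * (f (t \<otimes> fst x) * g (t \<otimes> fst (snd x)) * h (t \<otimes> snd (snd x))))"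
    if "t \<in> carrier G" for f g h t
  proof -
    have "gstar J (gstar J f g) h t = (\<Sum>p\<in>carrier G2. \<Sum>q\<in>carrier G2. J p * J q *
        (f (t \<otimes> fst p \<otimes> fst q) * g (t \<otimes> fst p \<otimes> snd q) * h (t \<otimes> snd p)))"
      using that by (auto simp: gstar_def sum_distrib_left sum_distrib_right mult_ac intro!: sum.cong)
    also have "\<dots> = (\<Sum>x\<in>carrier G3. ?L x * (f (t \<otimes> fst x) * g (t \<otimes> fst (snd x)) * h (t \<otimes> snd (snd x))))"
      unfolding sum_gmult_gpush[OF fin_group_G3 fun_ins_dup(1,3)]
      using that by (intro sum.cong refl) (auto simp: ins_dup_defs m_assoc)
    finally show ?thesis .
  qed
  have R: "gstar J f (gstar J g h) t = (\<Sum>x\<in>carrier G3. ?R x * (f (t \<otimes> fst x) * g (t \<otimes> fst (snd x)) * h (t \<otimes> snd (snd x))))"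
    if "t \<in> carrier G" for f g h t
  proof -
    have "gstar J f (gstar J g h) t = (\<Sum>p\<in>carrier G2. \<Sum>q\<in>carrier G2. J p * J q *
        (f (t \<otimes> fst p) * g (t \<otimes> snd p \<otimes> fst q) * h (t \<otimes> snd p \<otimes> snd q)))"
      using that by (auto simp: gstar_def sum_distrib_left sum_distrib_right mult_ac intro!: sum.cong)
    also have "\<dots> = (\<Sum>x\<in>carrier G3. ?R x * (f (t \<otimes> fst x) * g (t \<otimes> fst (snd x)) * h (t \<otimes> snd (snd x))))"
      unfolding sum_gmult_gpush[OF fin_group_G3 fun_ins_dup(2,4)]
      using that by (intro sum.cong refl) (auto simp: ins_dup_defs m_assoc)
    finally show ?thesis .
  qed
  show ?thesis
  proof
    assume eq: "?L = ?R"
    show "\<forall>f g h. gstar J (gstar J f g) h = gstar J f (gstar J g h)"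
    proof (intro allI ext)
      fix f g h :: "'a \<Rightarrow> 'k" and t
      show "gstar J (gstar J f g) h t = gstar J f (gstar J g h) t"
      proof (cases "t \<in> carrier G")
        case True
        show ?thesis unfolding L[OF True] R[OF True] eq ..
      qed (simp add: gstar_def)
    qed
  next
    assume assoc: "\<forall>f g h. gstar J (gstar J f g) h = gstar J f (gstar J g h)"
    have ev: "(\<Sum>x\<in>carrier G3. W x * (gdelta a (\<one> \<otimes> fst x) * gdelta b (\<one> \<otimes> fst (snd x)) * gdelta c (\<one> \<otimes> snd (snd x)))) = W (a, b, c)"
      if "(a, b, c) \<in> carrier G3" for W :: "'a \<times> 'a \<times> 'a \<Rightarrow> 'k" and a b c
    proof -
      have "(\<Sum>x\<in>carrier G3. W x * (gdelta a (\<one> \<otimes> fst x) * gdelta b (\<one> \<otimes> fst (snd x)) * gdelta c (\<one> \<otimes> snd (snd x))))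
        = (\<Sum>x\<in>carrier G3. gdelta (a, b, c) x * W x)"
        by (rule sum.cong) (auto simp: gdelta_def)
      then show ?thesis by (simp only: three.sum_gdelta[OF that])
    qed
    show "?L = ?R"
    proof
      fix x :: "'a \<times> 'a \<times> 'a" obtain a b c where x: "x = (a, b, c)" by (cases x)
      show "?L x = ?R x"
      proof (cases "x \<in> carrier G3")
        case True
        have "gstar J (gstar J (gdelta a) (gdelta b)) (gdelta c) \<one> = gstar J (gdelta a) (gstar J (gdelta b) (gdelta c)) \<one>"
          using assoc by simp
        then show ?thesis
          unfolding L[OF one_closed] R[OF one_closed] using True unfolding x by (simp only: ev)
      qed (simp add: galgD[OF three.gmult_galg])
    qed
  qed
qed

end

context twist
begin

abbreviation star (infixl \<open>\<star>\<close> 75) where "f \<star> g \<equiv> gstar J f g"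

lemma star_assoc: "(f \<star> g) \<star> h = f \<star> (g \<star> h)"
  using gstar_assoc_iff[OF J_galg] cocycle by blast

lemma star_one [simp]: "f \<in> galg G \<Longrightarrow> one_fun \<star> f = f" "f \<in> galg G \<Longrightarrow> f \<star> one_fun = f"
proof -
  assume f: "f \<in> galg G"
  show "one_fun \<star> f = f"
  proof
    fix t show "(one_fun \<star> f) t = f t"
    proof (cases "t \<in> carrier G")
      case True
      then have "(one_fun \<star> f) t = (\<Sum>p\<in>carrier G2. J p * f (t \<otimes> snd p))"
        by (auto simp: gstar_def one_fun_def intro!: sum.cong)
      then show ?thesis using sum_counit(2)[of "\<lambda>x. f (t \<otimes> x)"] True by simp
    qed (simp add: gstar_def galgD[OF f])
  qed
  show "f \<star> one_fun = f"
  proof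
    fix t show "(f \<star> one_fun) t = f t"
    proof (cases "t \<in> carrier G")
      case True
      then have "(f \<star> one_fun) t = (\<Sum>p\<in>carrier G2. J p * f (t \<otimes> fst p))"
        by (auto simp: gstar_def one_fun_def intro!: sum.cong)
      then show ?thesis using sum_counit(1)[of "\<lambda>x. f (t \<otimes> x)"] True by simp
    qed (simp add: gstar_def galgD[OF f])
  qed
qed

text \<open>The Galois property of the star algebra: the map \<open>f \<otimes> g \<mapsto> (h \<mapsto> f \<star> act h g)\<close> hits the
  function supported at the unit; the preimage is read off from the inverse of J.\<close>
lemma galois_element:
  obtains F :: "'a \<Rightarrow> 'a \<Rightarrow> 'k" where
    "\<And>h. h \<in> carrier G \<Longrightarrow> (\<Sum>a\<in>carrier G. \<Sum>b\<in>carrier G. sc (F a b) (gdelta a \<star> act h (gdelta b)))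
       = (if h = \<one> then one_fun else 0)"
proof -
  define E :: "'a \<times> 'a \<Rightarrow> 'k" where "E q = (if fst q = snd q then 1 else 0)" for q
  \<comment> \<open>\<open>E\<close> is the indicator of the diagonal and \<open>F\<close> is
    \<open>E\<close> moved by J^-1, so summing \<open>F\<close> against J returns \<open>E\<close>.
    It is finally evaluated at (t, h^-1 t), which lies on the diagonal exactly when h is the
    unit.\<close>
  define F where "F q = (\<Sum>p\<in>carrier G2. Jb p * E (q \<otimes>\<^bsub>G2\<^esub> p))" for q
  have inv: "(\<Sum>p\<in>carrier G2. J p * F (q \<otimes>\<^bsub>G2\<^esub> p)) = E q" if "q \<in> carrier G2" for q
  proof -
    have "(\<Sum>p\<in>carrier G2. J p * F (q \<otimes>\<^bsub>G2\<^esub> p)) = (\<Sum>p\<in>carrier G2. \<Sum>r\<in>carrier G2. J p * Jb r * E (q \<otimes>\<^bsub>G2\<^esub> (p \<otimes>\<^bsub>G2\<^esub> r)))"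
      unfolding F_def using that by (simp add: sum_distrib_left mult.assoc two.m_assoc del: carrier_DirProd)
    also have "\<dots> = (\<Sum>x\<in>carrier G2. gmult G2 J Jb x * E (q \<otimes>\<^bsub>G2\<^esub> x))" by (simp only: two.sum_gmult)
    also have "\<dots> = E (q \<otimes>\<^bsub>G2\<^esub> \<one>\<^bsub>G2\<^esub>)"
      unfolding J_Jb gunit_def by (rule two.sum_gdelta) (rule two.one_closed)
    finally show ?thesis using two.r_one[OF that] by (simp only:)
  qed
  show ?thesis
  proof (rule that[of "\<lambda>a b. F (a, b)"])
    fix h assume h: "h \<in> carrier G"
    show "(\<Sum>a\<in>carrier G. \<Sum>b\<in>carrier G. sc (F (a, b)) (gdelta a \<star> act h (gdelta b))) = (if h = \<one> then one_fun else 0)"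
    proof
      fix t
      show "(\<Sum>a\<in>carrier G. \<Sum>b\<in>carrier G. sc (F (a, b)) (gdelta a \<star> act h (gdelta b))) t = (if h = \<one> then one_fun else 0) t"
      proof (cases "t \<in> carrier G")
        case True
        have "(\<Sum>a\<in>carrier G. \<Sum>b\<in>carrier G. sc (F (a, b)) (gdelta a \<star> act h (gdelta b))) t
          = (\<Sum>q\<in>carrier G2. \<Sum>p\<in>carrier G2. J p * (gdelta q (t \<otimes> fst p, inv h \<otimes> (t \<otimes> snd p)) * F q))"
          using True h unfolding sum_fun_apply sc_apply carrier_DirProd sum.cartesian_product'
          by (intro sum.cong refl) (auto simp: gstar_def act_def sum_distrib_left gten_gdelta[symmetric] gten_def
             sum.cartesian_product' mult_ac intro!: sum.cong)
        also have "\<dots> = (\<Sum>p\<in>carrier G2. J p * (\<Sum>q\<in>carrier G2. gdelta (t \<otimes> fst p, inv h \<otimes> (t \<otimes> snd p)) q * F q))"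
          by (subst sum.swap) (simp add: sum_distrib_left gdelta_def eq_commute)
        also have "\<dots> = (\<Sum>p\<in>carrier G2. J p * F ((t, inv h \<otimes> t) \<otimes>\<^bsub>G2\<^esub> p))"
        proof (intro sum.cong refl)
          fix p assume "p \<in> carrier G2"
          then have "(t \<otimes> fst p, inv h \<otimes> (t \<otimes> snd p)) \<in> carrier G2"
            "(t, inv h \<otimes> t) \<otimes>\<^bsub>G2\<^esub> p = (t \<otimes> fst p, inv h \<otimes> (t \<otimes> snd p))"
            using True h by (auto simp: m_assoc)
          then show "J p * (\<Sum>q\<in>carrier G2. gdelta (t \<otimes> fst p, inv h \<otimes> (t \<otimes> snd p)) q * F q) = J p * F ((t, inv h \<otimes> t) \<otimes>\<^bsub>G2\<^esub> p)"
            by (simp only: two.sum_gdelta)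
        qed
        also have "\<dots> = E (t, inv h \<otimes> t)" using True h by (intro inv) simp
        also have "\<dots> = (if h = \<one> then one_fun else 0) t"
        proof -
          have "t = inv h \<otimes> t \<longleftrightarrow> h = \<one>"
            using True h inv_solve_left[of t h t] by (auto simp: r_cancel_one')
          then show ?thesis using True by (auto simp: E_def one_fun_def)
        qed
        finally show ?thesis .
      qed (simp add: sum_fun_apply sc_apply gstar_def one_fun_def)
    qed
  qed
qed

end

section \<open>Gauge equivalence with lifted twists\<close>

context fin_group
begin

lemma gmult_fun_sum_left: "gmult G (\<Sum>i\<in>I. f i) b = (\<Sum>i\<in>I. gmult G (f i) b)"
proof
  fix t show "gmult G (\<Sum>i\<in>I. f i) b t = (\<Sum>i\<in>I. gmult G (f i) b) t"
    by (cases "t \<in> carrier G") (auto simp: gmult_def sum_fun_apply sum_distrib_right intro: sum.swap)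
qed

lemma gmult_sc_left: "gmult G (sc c f) b = sc c (gmult G f b)"
  unfolding sc_def by (rule gmult_scale_left)

text \<open>The antipode of the untwisted group algebra, an anti-automorphism. It converts the
  function v, by which functions are convolved, into the gauge element of kG.\<close>

definition ginvol :: "('a \<Rightarrow> 'k::comm_ring_1) \<Rightarrow> 'a \<Rightarrow> 'k" where
  "ginvol a x = (if x \<in> carrier G then a (inv x) else 0)"

lemma ginvol_galg [simp]: "ginvol a \<in> galg G"
  by (simp add: galg_def ginvol_def)

lemma ginvol_gmult: "ginvol (gmult G a b) = gmult G (ginvol b) (ginvol a)"
proof (rule galg_eqI)
  have inv_sum: "(\<Sum>x\<in>carrier G. ginvol a x * F x) = (\<Sum>x\<in>carrier G. a x * F (inv x))" for a F :: "'a \<Rightarrow> 'c"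
  proof -
    have "(\<Sum>x\<in>carrier G. a x * F (inv x)) = (\<Sum>x\<in>carrier G. a (inv x) * F (inv (inv x)))"
      by (rule sum.reindex_bij_betw[OF bij_betw_inv, symmetric])
    then show ?thesis by (simp add: ginvol_def)
  qed
  fix F :: "'a \<Rightarrow> 'c"
  have "(\<Sum>x\<in>carrier G. gmult G (ginvol b) (ginvol a) x * F x)
     = (\<Sum>x\<in>carrier G. ginvol b x * (\<Sum>y\<in>carrier G. ginvol a y * F (x \<otimes> y)))"
    by (simp add: sum_gmult sum_distrib_left mult.assoc)
  also have "\<dots> = (\<Sum>x\<in>carrier G. b x * (\<Sum>y\<in>carrier G. a y * F (inv x \<otimes> inv y)))"
    by (simp only: inv_sum)
  also have "\<dots> = (\<Sum>y\<in>carrier G. \<Sum>x\<in>carrier G. a y * b x * F (inv (y \<otimes> x)))"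
    unfolding sum_distrib_left by (subst sum.swap) (auto intro!: sum.cong simp: inv_mult_group mult_ac)
  also have "\<dots> = (\<Sum>x\<in>carrier G. ginvol (gmult G a b) x * F x)"
    by (simp add: inv_sum sum_gmult)
  finally show "(\<Sum>x\<in>carrier G. ginvol (gmult G a b) x * F x) = (\<Sum>x\<in>carrier G. gmult G (ginvol b) (ginvol a) x * F x)"
    by simp
qed auto

lemma ginvol_gunit: "ginvol (gunit G) = gunit G"
  by (auto simp: ginvol_def gunit_def gdelta_def)

end

text \<open>The model is the characters of H, extended by zero, in the star algebra of the lifted
  twist: weight vectors for H that multiply with \<omega>, are orthogonal to translates outside H,
  and whose translates span. A family u with these properties gives an equivariant isomorphism from
  that star algebra. The normalisation of \<omega> enters the counit conditions.\<close>

locale gauge_data = twist G J + abelian_subgroup G H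
  for G :: "('a, 'm) monoid_scheme" (structure) and J :: "'a \<times> 'a \<Rightarrow> 'k::{alg_closed_field, field_char_0}" and H +
  fixes u :: "('a \<Rightarrow> 'k) \<Rightarrow> 'a \<Rightarrow> 'k" and \<omega>
  assumes u_galg: "\<And>\<alpha>. \<alpha> \<in> chars G H \<Longrightarrow> u \<alpha> \<in> galg G"
    and u_act: "\<And>\<alpha> h. \<alpha> \<in> chars G H \<Longrightarrow> h \<in> H \<Longrightarrow> act h (u \<alpha>) = sc (\<alpha> (inv h)) (u \<alpha>)"
    and u_mult: "\<And>\<alpha> \<beta>. \<alpha> \<in> chars G H \<Longrightarrow> \<beta> \<in> chars G H \<Longrightarrow> u \<alpha> \<star> u \<beta> = sc (\<omega> \<alpha> \<beta>) (u (char_mult \<alpha> \<beta>))"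
    and u_orth: "\<And>\<alpha> \<beta> g. \<alpha> \<in> chars G H \<Longrightarrow> \<beta> \<in> chars G H \<Longrightarrow> g \<in> carrier G \<Longrightarrow> g \<notin> H \<Longrightarrow> u \<alpha> \<star> act g (u \<beta>) = 0"
    and u_span: "\<And>f. f \<in> galg G \<Longrightarrow> \<exists>C. f = (\<Sum>g\<in>carrier G. \<Sum>\<alpha>\<in>chars G H. sc (C g \<alpha>) (act g (u \<alpha>)))"
    and \<omega>_one: "\<And>\<alpha>. \<alpha> \<in> chars G H \<Longrightarrow> \<omega> triv_char \<alpha> = 1" "\<And>\<alpha>. \<alpha> \<in> chars G H \<Longrightarrow> \<omega> \<alpha> triv_char = 1"
begin

abbreviation "J1 \<equiv> lifted_twist G H \<omega>"
abbreviation "n \<equiv> (of_nat (card H) :: 'k)"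

lemma n_nz [simp]: "n \<noteq> 0" using card_H_pos by simp

lemma sum_over_H: "(\<And>x. x \<notin> H \<Longrightarrow> f x = 0) \<Longrightarrow> (\<Sum>x\<in>carrier G. f x) = (\<Sum>x\<in>H. f x)"
  using H.subset by (intro sum.mono_neutral_right) auto

lemma sum_char_idem:
  assumes "\<alpha> \<in> chars G H" "\<beta> \<in> chars G H"
  shows "(\<Sum>x\<in>carrier G. char_idem G H \<alpha> x * \<beta> x) = (if \<alpha> = \<beta> then 1 else (0::'k))"
proof -
  have "(\<Sum>x\<in>carrier G. char_idem G H \<alpha> x * \<beta> x) = (\<Sum>x\<in>H. \<beta> x * \<alpha> (inv x)) / n"
    by (subst sum_over_H) (auto simp: char_idem_def sum_divide_distrib mult.commute)
  then show ?thesis using chars_orthogonal2[OF assms(2,1)] by auto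
qed

lemma J1_galg: "J1 \<in> galg G2" and J1_supp: "J1 \<in> supported_on (H \<times> H)"
  using H.subset by (auto simp: galg_def supported_on_def lifted_twist_def char_idem_def intro!: sum.neutral)

text \<open>The idempotents are dual to the characters by \<open>sum_char_idem\<close>, so the
  pairing picks out one value of \<omega>.\<close>

lemma sum_J1:
  assumes "\<alpha> \<in> chars G H" "\<beta> \<in> chars G H"
  shows "(\<Sum>p\<in>carrier G2. J1 p * (\<alpha> (fst p) * \<beta> (snd p))) = \<omega> \<alpha> \<beta>"
proof -
  have "(\<Sum>p\<in>carrier G2. J1 p * (\<alpha> (fst p) * \<beta> (snd p)))
    = (\<Sum>p\<in>carrier G2. \<Sum>\<alpha>'\<in>chars G H. \<Sum>\<beta>'\<in>chars G H. \<omega> \<alpha>' \<beta>' *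
       ((char_idem G H \<alpha>' (fst p) * \<alpha> (fst p)) * (char_idem G H \<beta>' (snd p) * \<beta> (snd p))))"
    by (simp add: lifted_twist_def case_prod_unfold sum_distrib_right sum_distrib_left mult_ac)
  also have "\<dots> = (\<Sum>\<alpha>'\<in>chars G H. \<Sum>\<beta>'\<in>chars G H. \<omega> \<alpha>' \<beta>' *
       ((\<Sum>x\<in>carrier G. char_idem G H \<alpha>' x * \<alpha> x) * (\<Sum>y\<in>carrier G. char_idem G H \<beta>' y * \<beta> y)))"
    by (subst sum.swap, rule sum.cong[OF refl], subst sum.swap, rule sum.cong[OF refl])
      (simp add: sum_distrib_left[symmetric] sum.cartesian_product' sum_product)
  also have "\<dots> = (\<Sum>\<alpha>'\<in>chars G H. \<Sum>\<beta>'\<in>chars G H. if \<alpha>' = \<alpha> \<and> \<beta>' = \<beta> then \<omega> \<alpha>' \<beta>' else 0)"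
    using assms by (intro sum.cong refl) (simp add: sum_char_idem)
  also have "\<dots> = \<omega> \<alpha> \<beta>"
  proof -
    have "(\<Sum>\<beta>'\<in>chars G H. if \<alpha>' = \<alpha> \<and> \<beta>' = \<beta> then \<omega> \<alpha>' \<beta>' else 0) = (if \<alpha>' = \<alpha> then \<omega> \<alpha> \<beta> else 0)" for \<alpha>'
      using assms by (cases "\<alpha>' = \<alpha>") (simp_all add: sum.delta)
    then show ?thesis using assms by (simp add: sum.delta)
  qed
  finally show ?thesis .
qed

lemma chars_galg: "\<alpha> \<in> chars G H \<Longrightarrow> \<alpha> \<in> galg G"
  using H.subset chars_outside by (intro galgI) blast

lemma J1_mult:
  assumes "\<alpha> \<in> chars G H" "\<beta> \<in> chars G H"
  shows "gstar J1 \<alpha> \<beta> = sc (\<omega> \<alpha> \<beta>) (char_mult \<alpha> \<beta>)"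
proof
  fix t
  show "gstar J1 \<alpha> \<beta> t = sc (\<omega> \<alpha> \<beta>) (char_mult \<alpha> \<beta>) t"
  proof (cases "t \<in> H")
    case True
    have "gstar J1 \<alpha> \<beta> t = (\<Sum>p\<in>carrier G2. J1 p * (\<alpha> (fst p) * \<beta> (snd p))) * (\<alpha> t * \<beta> t)"
    proof -
      have eq: "J1 p * (\<alpha> (t \<otimes> fst p) * \<beta> (t \<otimes> snd p)) = J1 p * (\<alpha> (fst p) * \<beta> (snd p)) * (\<alpha> t * \<beta> t)" for p
      proof (cases "J1 p = 0")
        case False
        then have "fst p \<in> H" "snd p \<in> H" using supported_onD[OF J1_supp False] by auto
        then show ?thesis using True assms by (simp add: chars_mult)
      qed simp
      show ?thesis by (simp only: gstar_def eq sum_distrib_right H.mem_carrier[OF True] if_True)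
    qed
    then show ?thesis using sum_J1[OF assms] by (simp add: sc_def char_mult_def)
  next
    case False
    have "J1 p * (\<alpha> (t \<otimes> fst p) * \<beta> (t \<otimes> snd p)) = 0" if "t \<in> carrier G" for p
    proof (cases "J1 p = 0")
      case False
      then have p: "fst p \<in> H" using supported_onD[OF J1_supp False] by auto
      have "t \<otimes> fst p \<notin> H"
      proof
        assume "t \<otimes> fst p \<in> H"
        then have "t \<otimes> fst p \<otimes> inv (fst p) \<in> H" using p by simp
        then show False using \<open>t \<notin> H\<close> p that by (simp add: m_assoc)
      qed
      then show ?thesis using chars_outside[OF assms(1)] by simp
    qed simp
    then have "gstar J1 \<alpha> \<beta> t = 0" unfolding gstar_def by (simp only: sum.neutral_const if_cancel cong: if_cong)
    then show ?thesis using False chars_outside[OF assms(1)] by (simp add: sc_def char_mult_def)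
  qed
qed

text \<open>The lifted twist is supported on H \<times> H, so a nonzero term would put t in H and
  then g in H.\<close>

lemma J1_orth:
  assumes "\<alpha> \<in> chars G H" "\<beta> \<in> chars G H" "g \<in> carrier G" "g \<notin> H"
  shows "gstar J1 \<alpha> (act g \<beta>) = 0"
proof
  fix t
  have "J1 p * (\<alpha> (t \<otimes> fst p) * act g \<beta> (t \<otimes> snd p)) = 0" if t: "t \<in> carrier G" for p
  proof (rule ccontr)
    assume nz: "J1 p * (\<alpha> (t \<otimes> fst p) * act g \<beta> (t \<otimes> snd p)) \<noteq> 0"
    then have p: "fst p \<in> H" "snd p \<in> H" using supported_onD[OF J1_supp, of p] by auto
    have "t \<otimes> fst p \<in> H" using nz chars_outside[OF assms(1)] by force
    then have "t \<otimes> fst p \<otimes> inv (fst p) \<in> H" using p by simp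
    then have tH: "t \<in> H" using p t by (simp add: m_assoc)
    have "\<beta> (inv g \<otimes> (t \<otimes> snd p)) \<noteq> 0" using nz t p by (auto simp: act_def split: if_splits)
    then have "inv g \<otimes> (t \<otimes> snd p) \<in> H" using chars_outside[OF assms(2)] by blast
    then have "inv g \<otimes> (t \<otimes> snd p) \<otimes> inv (t \<otimes> snd p) \<in> H" using p tH by simp
    then have "inv g \<in> H" using p tH assms(3) by (simp add: m_assoc)
    then have "inv (inv g) \<in> H" by (rule H.m_inv_closed)
    then show False using assms(3,4) by simp
  qed
  then show "gstar J1 \<alpha> (act g \<beta>) t = 0 t"
    unfolding gstar_def by (simp only: sum.neutral_const if_cancel zero_fun_apply cong: if_cong)
qed

lemma char_act: "\<alpha> \<in> chars G H \<Longrightarrow> h \<in> H \<Longrightarrow> act h \<alpha> = sc (\<alpha> (inv h)) \<alpha>"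
proof
  fix t assume \<alpha>: "\<alpha> \<in> chars G H" and h: "h \<in> H"
  have "inv h \<otimes> t \<in> H \<Longrightarrow> t \<in> carrier G \<Longrightarrow> t \<in> H"
    using h H.m_closed[of h "inv h \<otimes> t"] by (simp add: m_assoc[symmetric])
  then show "act h \<alpha> t = sc (\<alpha> (inv h)) \<alpha> t"
    using \<alpha> h chars_outside[OF \<alpha>] H.mem_carrier
    by (cases "t \<in> H") (auto simp: act_def sc_def chars_mult)
qed

text \<open>The average of all characters of H is the delta function at the unit, so v is where an
  equivariant map sending each \<alpha> to u \<alpha> must take that delta. The map itself is then
  convolution f \<mapsto> f v.\<close>

definition "v = sc (1 / n) (\<Sum>\<alpha>\<in>chars G H. u \<alpha>)"

lemma v_galg [simp]: "v \<in> galg G"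
  unfolding v_def by (intro galg_sc galg_sum u_galg)

lemma Phi_char: "\<alpha> \<in> chars G H \<Longrightarrow> gmult G \<alpha> v = u \<alpha>"
proof -
  assume \<alpha>: "\<alpha> \<in> chars G H"
  have "gmult G \<alpha> v = (\<Sum>h\<in>carrier G. sc (\<alpha> h) (act h v))"
    by (rule gmult_eq_sum_act[OF chars_galg[OF \<alpha>]])
  also have "\<dots> = (\<Sum>h\<in>H. sc (\<alpha> h) (act h v))"
    using chars_outside[OF \<alpha>] by (intro sum.mono_neutral_right) (use H.subset in auto)
  also have "\<dots> = (\<Sum>h\<in>H. \<Sum>\<beta>\<in>chars G H. sc (\<alpha> h * \<beta> (inv h) / n) (u \<beta>))"
    unfolding v_def by (intro sum.cong refl) (simp add: act_sc act_sum sc_sum u_act)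
  also have "\<dots> = (\<Sum>\<beta>\<in>chars G H. sc ((\<Sum>h\<in>H. \<alpha> h * \<beta> (inv h)) / n) (u \<beta>))"
    by (subst sum.swap) (simp add: sum_sc sum_divide_distrib)
  also have "\<dots> = (\<Sum>\<beta>\<in>chars G H. if \<beta> = \<alpha> then u \<alpha> else 0)"
    using \<alpha> by (intro sum.cong refl) (auto simp: chars_orthogonal2)
  also have "\<dots> = u \<alpha>" using \<alpha> by (simp add: sum.delta)
  finally show ?thesis .
qed

lemma Phi_act: "g \<in> carrier G \<Longrightarrow> gmult G (act g f) v = act g (gmult G f v)"
  by (simp add: act_eq_gmult gmult_assoc)

text \<open>The average of the characters is the delta at the unit; its translates by g weighted
  with f g rebuild f.\<close>

lemma galg_char_expand:
  assumes "f \<in> galg G"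
  shows "f = (\<Sum>g\<in>carrier G. \<Sum>\<alpha>\<in>chars G H. sc (f g / n) (act g \<alpha>))"
proof
  fix t
  show "f t = (\<Sum>g\<in>carrier G. \<Sum>\<alpha>\<in>chars G H. sc (f g / n) (act g \<alpha>)) t"
  proof (cases "t \<in> carrier G")
    case True
    have "(\<Sum>\<alpha>\<in>chars G H. \<alpha> (inv g \<otimes> t)) = (if t = g then n else 0)" if g: "g \<in> carrier G" for g
    proof (cases "inv g \<otimes> t \<in> H")
      case H: True
      have "inv g \<otimes> t = \<one> \<longleftrightarrow> t = g" using g True inv_solve_left[of \<one> g t] by auto
      then show ?thesis using sum_chars[OF H, where 'k = 'k] by simp
    next
      case False
      then have "t \<noteq> g" using g by auto
      then show ?thesis using False by (auto simp: chars_outside intro!: sum.neutral)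
    qed
    moreover have "(\<Sum>g\<in>carrier G. \<Sum>\<alpha>\<in>chars G H. sc (f g / n) (act g \<alpha>)) t
        = (\<Sum>g\<in>carrier G. f g / n * (\<Sum>\<alpha>\<in>chars G H. \<alpha> (inv g \<otimes> t)))"
      using True by (simp only: sum_fun_apply sc_def act_def if_True sum_distrib_left)
    ultimately have "(\<Sum>g\<in>carrier G. \<Sum>\<alpha>\<in>chars G H. sc (f g / n) (act g \<alpha>)) t = (\<Sum>g\<in>carrier G. f g / n * (if t = g then n else 0))"
      by (simp only: cong: sum.cong)
    also have "\<dots> = (\<Sum>g\<in>carrier G. if t = g then f g else 0)" by (intro sum.cong) auto
    also have "\<dots> = f t" using True by (simp add: sum.delta')
    finally show ?thesis by simp
  next
    case False
    then show ?thesis by (simp add: sum_fun_apply sc_def act_def galgD[OF assms])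
  qed
qed

text \<open>Equivariance reduces to g = 1. For h in H both sides are governed by the weights and
  \<omega>; otherwise both vanish by orthogonality.\<close>

lemma Phi_basis:
  assumes "\<alpha> \<in> chars G H" "\<beta> \<in> chars G H" "g \<in> carrier G" "g' \<in> carrier G"
  shows "gmult G (gstar J1 (act g \<alpha>) (act g' \<beta>)) v = act g (u \<alpha>) \<star> act g' (u \<beta>)"
proof -
  define h where "h = inv g \<otimes> g'"
  have h: "h \<in> carrier G" "g' = g \<otimes> h" using assms by (auto simp: h_def m_assoc[symmetric])
  have 1: "gstar J1 (act g \<alpha>) (act g' \<beta>) = act g (gstar J1 \<alpha> (act h \<beta>))"
    using assms h by (simp add: act_gstar act_act)
  have 2: "act g (u \<alpha>) \<star> act g' (u \<beta>) = act g (u \<alpha> \<star> act h (u \<beta>))"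
    using assms h by (simp add: act_gstar act_act)
  have "gmult G (gstar J1 \<alpha> (act h \<beta>)) v = u \<alpha> \<star> act h (u \<beta>)"
  proof (cases "h \<in> H")
    case True
    then show ?thesis
      using assms by (simp add: char_act u_act J1_mult u_mult gmult_sc_left Phi_char)
  next
    case False
    have "gmult G 0 v = 0" by (auto simp: gmult_def)
    then show ?thesis using False assms h by (simp add: J1_orth u_orth)
  qed
  then show ?thesis using assms by (simp only: 1 2 Phi_act)
qed

lemma Phi_mult_galg:
  assumes "f \<in> galg G" "f' \<in> galg G"
  shows "gmult G (gstar J1 f f') v = gmult G f v \<star> gmult G f' v"
proof -
  let ?f = "\<Sum>g\<in>carrier G. \<Sum>\<alpha>\<in>chars G H. sc (f g / n) (act g \<alpha>)"
  let ?f' = "\<Sum>g\<in>carrier G. \<Sum>\<alpha>\<in>chars G H. sc (f' g / n) (act g \<alpha>)"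
  have "gmult G (gstar J1 ?f ?f') v = gmult G ?f v \<star> gmult G ?f' v"
    by (simp add: gstar_sum_left gstar_sum_right gmult_fun_sum_left gmult_sc_left Phi_basis Phi_act Phi_char sc_sum
        cong: sum.cong)
  then show ?thesis using galg_char_expand[OF assms(1)] galg_char_expand[OF assms(2)] by simp
qed

text \<open>Values off the carrier enter neither side, so both arguments may be restricted. The
  unrestricted form is convenient because associativity is stated for arbitrary functions.\<close>

lemma Phi_mult: "gmult G (gstar J1 f f') v = gmult G f v \<star> gmult G f' v"
proof -
  define r where "r f t = (if t \<in> carrier G then f t else (0::'k))" for f t
  have "gstar J1 (r f) (r f') = gstar J1 f f'" by (auto simp: gstar_def r_def intro!: ext sum.cong)
  moreover have "gmult G (r f) v = gmult G f v" for f by (auto simp: gmult_def r_def)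
  moreover have "r f \<in> galg G" for f by (simp add: galg_def r_def)
  ultimately show ?thesis using Phi_mult_galg[of "r f" "r f'"] by simp
qed

text \<open>Since the translates of the u \<alpha> span, \<open>gunit\<close> has a preimage w under
  convolution by v; finite dimensionality makes this one-sided inverse two-sided.\<close>

lemma v_invertible: "\<exists>w\<in>galg G. gmult G w v = gunit G \<and> gmult G v w = gunit G"
proof -
  obtain C where C: "gunit G = (\<Sum>g\<in>carrier G. \<Sum>\<alpha>\<in>chars G H. sc (C g \<alpha>) (act g (u \<alpha>)))"
    using u_span[OF gunit_galg] by blast
  define w where "w = (\<Sum>g\<in>carrier G. \<Sum>\<alpha>\<in>chars G H. sc (C g \<alpha>) (act g \<alpha>))"
  have w: "w \<in> galg G" unfolding w_def by (intro galg_sum galg_sc act_galg)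
  have "gmult G w v = gunit G"
    unfolding w_def C by (simp add: gmult_fun_sum_left gmult_sc_left Phi_act Phi_char cong: sum.cong)
  with gmult_inverse_commute[OF w v_galg this] w show ?thesis by blast
qed

text \<open>Comparing both sides of \<open>Phi_mult\<close> on delta functions, at the unit, gives
  the gauge relation coefficient by coefficient. It makes \<open>J1\<close> invertible. Convolution
  by v is injective, so associativity passes back to the star product of \<open>J1\<close>, which is
  the cocycle equation.\<close>

lemma gauge:
  assumes w: "w \<in> galg G" "gmult G w v = gunit G" "gmult G v w = gunit G"
  defines "c \<equiv> ginvol v" and "d \<equiv> ginvol w"
  shows "gmult G c d = gunit G" "gmult G d c = gunit G"
    and "gmult G2 J (gten c c) = gmult G2 (gcomult G c) J1"
    and "is_twist G J1"
proof -
  show cd: "gmult G c d = gunit G" "gmult G d c = gunit G"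
    unfolding c_def d_def ginvol_gmult[symmetric] w ginvol_gunit by auto
  have c_eq: "gmult G (gdelta a) v x = c (inv x \<otimes> a)" if "a \<in> carrier G" "x \<in> carrier G" for a x
    using that by (simp add: gmult_gdelta_left c_def ginvol_def inv_mult_group)
  show gauge: "gmult G2 J (gten c c) = gmult G2 (gcomult G c) J1"
  proof
    fix q :: "'a \<times> 'a"
    obtain a b where q: "q = (a, b)" by (cases q)
    show "gmult G2 J (gten c c) q = gmult G2 (gcomult G c) J1 q"
    proof (cases "q \<in> carrier G2")
      case True
      then have ab: "a \<in> carrier G" "b \<in> carrier G" by (auto simp: q)
      have 1: "(gmult G (gdelta a) v \<star> gmult G (gdelta b) v) \<one> = gmult G2 J (gten c c) q"
        unfolding gstar_at_one gmult_def[of G2] using True ab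
        by (auto simp: c_eq gten_def q is_group intro!: sum.cong)
      have st: "gstar J1 (gdelta a) (gdelta b) g = J1 (inv g \<otimes> a, inv g \<otimes> b)" if g: "g \<in> carrier G" for g
      proof -
        have "gdelta a (g \<otimes> fst p) * gdelta b (g \<otimes> snd p) = (gdelta (inv g \<otimes> a, inv g \<otimes> b) p :: 'k)" if "p \<in> carrier G2" for p
        proof -
          have "x = inv g \<otimes> y \<longleftrightarrow> g \<otimes> x = y" if "x \<in> carrier G" "y \<in> carrier G" for x y
            using that g inv_solve_left[of x g y] by auto
          then show ?thesis using that ab by (cases p) (auto simp: gdelta_def)
        qed
        then have "gstar J1 (gdelta a) (gdelta b) g = (\<Sum>p\<in>carrier G2. gdelta (inv g \<otimes> a, inv g \<otimes> b) p * J1 p)"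
          using g by (simp add: gstar_def mult.commute cong: sum.cong)
        also have "\<dots> = J1 (inv g \<otimes> a, inv g \<otimes> b)"
          using g ab by (intro two.sum_gdelta) simp
        finally show ?thesis .
      qed
      have "gmult G (gstar J1 (gdelta a) (gdelta b)) v \<one> = (\<Sum>g\<in>carrier G. c g * J1 (inv g \<otimes> a, inv g \<otimes> b))"
        by (auto simp: gmult_def st c_def ginvol_def intro!: sum.cong)
      also have "\<dots> = (\<Sum>y\<in>carrier G2. gcomult G c y * J1 (inv\<^bsub>G2\<^esub> y \<otimes>\<^bsub>G2\<^esub> q))"
      proof -
        have cg: "c \<in> galg G" by (simp add: c_def)
        show ?thesis
          unfolding gcomult_eq_gpush[OF cg]
          by (subst sum_gpush[OF two.fin]) (auto simp: q is_group intro!: sum.cong)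
      qed
      also have "\<dots> = gmult G2 (gcomult G c) J1 q" using True by (simp add: gmult_def)
      finally show ?thesis using 1 Phi_mult[of "gdelta a" "gdelta b"] by simp
    qed (simp add: gmult_def)
  qed
  have cg: "c \<in> galg G" "d \<in> galg G" by (simp_all add: c_def d_def)
  have Dcd: "gmult G2 (gcomult G d) (gcomult G c) = gunit G2" "gmult G2 (gcomult G c) (gcomult G d) = gunit G2"
    using cg by (simp_all add: gcomult_gmult[symmetric] cd gcomult_gunit)
  have tcd: "gmult G2 (gten d d) (gten c c) = gunit G2" "gmult G2 (gten c c) (gten d d) = gunit G2"
    by (simp_all add: gmult_gten cd gten_gunit)
  have J1_eq: "gmult G2 (gcomult G d) (gmult G2 J (gten c c)) = J1"
    unfolding gauge two.gmult_assoc[symmetric] Dcd using J1_galg by simp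
  have inv: "ginvertible G2 J1"
    unfolding ginvertible_def
  proof (intro bexI conjI)
    let ?K = "gmult G2 (gten d d) (gmult G2 Jb (gcomult G c))"
    show "?K \<in> galg G2" by simp
    have tin: "gten d d \<in> galg G2" "gten c c \<in> galg G2" using cg by (auto intro: gten_galg)
    have "gmult G2 J1 ?K = gmult G2 (gmult G2 (gmult G2 (gcomult G d) J) (gten c c)) ?K"
      by (subst J1_eq[symmetric]) (simp add: two.gmult_assoc)
    also have "\<dots> = gmult G2 (gmult G2 (gcomult G d) J) (gmult G2 Jb (gcomult G c))"
      by (rule two.gmult_cancel_mid[OF tcd(2)]) simp
    also have "\<dots> = gunit G2" using two.gmult_cancel_mid[OF J_Jb gcomult_galg, of "gcomult G d" c] Dcd by simp
    finally show "gmult G2 J1 ?K = gunit G2" .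
    have "gmult G2 ?K J1 = gmult G2 (gmult G2 (gmult G2 (gten d d) Jb) (gcomult G c)) (gmult G2 (gcomult G d) (gmult G2 J (gten c c)))"
      unfolding J1_eq by (simp add: two.gmult_assoc)
    also have "\<dots> = gmult G2 (gmult G2 (gten d d) Jb) (gmult G2 J (gten c c))"
      by (rule two.gmult_cancel_mid[OF Dcd(2)]) simp
    also have "\<dots> = gunit G2" using two.gmult_cancel_mid[OF Jb_J tin(2), of "gten d d"] tcd by simp
    finally show "gmult G2 ?K J1 = gunit G2" .
  qed
  have inj: "f = f'" if "f \<in> galg G" "f' \<in> galg G" "gmult G f v = gmult G f' v" for f f'
  proof -
    have "gmult G (gmult G f v) w = gmult G (gmult G f' v) w" using that by simp
    then have "gmult G f (gunit G) = gmult G f' (gunit G)" by (simp only: gmult_assoc w)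
    then show ?thesis using that(1,2) by simp
  qed
  have "\<forall>f g h. gstar J1 (gstar J1 f g) h = gstar J1 f (gstar J1 g h)"
  proof (intro allI)
    fix f g h
    show "gstar J1 (gstar J1 f g) h = gstar J1 f (gstar J1 g h)"
      by (rule inj) (simp_all add: Phi_mult star_assoc)
  qed
  then have coc: "gmult G3 (gpush G2 dup1 J1) (gpush G2 ins3 J1) = gmult G3 (gpush G2 dup2 J1) (gpush G2 ins1 J1)"
    unfolding gstar_assoc_iff[OF J1_galg] .
  \<comment> \<open>For the counit conditions: the idempotents sum to the unit of kG, and the counit
    of an idempotent vanishes unless its character is trivial, where \<omega> is normalised.\<close>
  have e1: "(\<Sum>\<alpha>\<in>chars G H. char_idem G H \<alpha> x) = (if x = \<one> then 1 else (0::'k))" for x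
  proof (cases "x \<in> H")
    case True
    have "x = \<one>" if "inv x = \<one>" using that True inv_inv[of x] H.mem_carrier by fastforce
    then have "inv x = \<one> \<longleftrightarrow> x = \<one>" by auto
    then show ?thesis using True sum_chars[of "inv x", where 'k = 'k]
      by (auto simp: char_idem_def sum_divide_distrib[symmetric])
  next
    case False
    then have "x \<noteq> \<one>" using H.one_closed by blast
    then show ?thesis using False by (simp add: char_idem_def)
  qed
  have e2: "(\<Sum>x\<in>carrier G. char_idem G H \<alpha> x) = (if \<alpha> = triv_char then 1 else (0::'k))" if "\<alpha> \<in> chars G H" for \<alpha>
  proof -
    have "(\<Sum>x\<in>carrier G. char_idem G H \<alpha> x) = (\<Sum>x\<in>carrier G. char_idem G H \<alpha> x * triv_char x)"
      by (intro sum.cong) (auto simp: char_idem_def triv_char_def)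
    then show ?thesis using sum_char_idem[OF that triv_char_in] by simp
  qed
  have f1: "(\<Sum>y\<in>carrier G. J1 (x, y)) = gdelta \<one> x" if "x \<in> carrier G" for x
  proof -
    have "(\<Sum>y\<in>carrier G. J1 (x, y)) = (\<Sum>\<alpha>\<in>chars G H. \<Sum>\<beta>\<in>chars G H. \<omega> \<alpha> \<beta> * char_idem G H \<alpha> x * (\<Sum>y\<in>carrier G. char_idem G H \<beta> y))"
      unfolding lifted_twist_def prod.case sum_distrib_left
      by (subst sum.swap, rule sum.cong[OF refl], rule sum.swap)
    also have "\<dots> = (\<Sum>\<alpha>\<in>chars G H. \<Sum>\<beta>\<in>chars G H. if \<beta> = (triv_char :: 'a \<Rightarrow> 'k) then char_idem G H \<alpha> x else 0)"
      by (rule sum.cong[OF refl], rule sum.cong[OF refl]) (simp add: e2 \<omega>_one)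
    finally show ?thesis by (simp add: e1 gdelta_def sum.delta)
  qed
  have f2: "(\<Sum>x\<in>carrier G. J1 (x, y)) = gdelta \<one> y" if "y \<in> carrier G" for y
  proof -
    have "(\<Sum>x\<in>carrier G. J1 (x, y)) = (\<Sum>\<alpha>\<in>chars G H. \<Sum>\<beta>\<in>chars G H. \<omega> \<alpha> \<beta> * char_idem G H \<beta> y * (\<Sum>x\<in>carrier G. char_idem G H \<alpha> x))"
      unfolding lifted_twist_def prod.case sum_distrib_left
      by (subst sum.swap, rule sum.cong[OF refl], subst sum.swap) (simp add: mult_ac)
    also have "\<dots> = (\<Sum>\<alpha>\<in>chars G H. \<Sum>\<beta>\<in>chars G H. if \<alpha> = (triv_char :: 'a \<Rightarrow> 'k) then char_idem G H \<beta> y else 0)"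
      by (rule sum.cong[OF refl], rule sum.cong[OF refl]) (simp add: e2 \<omega>_one)
    also have "\<dots> = (\<Sum>\<beta>\<in>chars G H. \<Sum>\<alpha>\<in>chars G H. if \<alpha> = (triv_char :: 'a \<Rightarrow> 'k) then char_idem G H \<beta> y else 0)"
      by (rule sum.swap)
    finally show ?thesis by (simp add: e1 gdelta_def sum.delta)
  qed
  show "is_twist G J1"
    unfolding is_twist_iff using J1_galg inv coc f1 f2
    by (auto simp: gpush_fst gpush_snd gunit_def fun_eq_iff gdelta_def)
qed

end

section \<open>Twists on semidirect products\<close>

lemma sc_add: "sc c (f + g) = sc c f + sc c g"
  by (auto simp: sc_def fun_eq_iff distrib_left)

locale semidirect_twist = twist G J
  for G :: "('a, 'm) monoid_scheme" (structure) and J :: "'a \<times> 'a \<Rightarrow> 'k::{alg_closed_field, field_char_0}" +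
  fixes N P
  assumes normal_N: "N \<lhd> G" and commute_N: "\<And>x y. x \<in> N \<Longrightarrow> y \<in> N \<Longrightarrow> x \<otimes> y = y \<otimes> x"
    and subgroup_P: "subgroup P G" and commute_P: "\<And>x y. x \<in> P \<Longrightarrow> y \<in> P \<Longrightarrow> x \<otimes> y = y \<otimes> x"
    and decomp: "\<And>g. g \<in> carrier G \<Longrightarrow> \<exists>n\<in>N. \<exists>p\<in>P. g = n \<otimes> p"
    and trivial_Int: "N \<inter> P = {\<one>}"
begin

sublocale N: abelian_subgroup G N
  by (intro abelian_subgroup.intro fin_group_G abelian_subgroup_axioms.intro normal_imp_subgroup normal_N commute_N)
sublocale P: abelian_subgroup G P
  by (intro abelian_subgroup.intro fin_group_G abelian_subgroup_axioms.intro subgroup_P commute_P)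

lemma N_carrier [simp]: "x \<in> N \<Longrightarrow> x \<in> carrier G" and P_carrier [simp]: "x \<in> P \<Longrightarrow> x \<in> carrier G"
  using N.H.mem_carrier P.H.mem_carrier by auto

lemma conj_N: "n \<in> N \<Longrightarrow> g \<in> carrier G \<Longrightarrow> g \<otimes> n \<otimes> inv g \<in> N" "n \<in> N \<Longrightarrow> g \<in> carrier G \<Longrightarrow> inv g \<otimes> n \<otimes> g \<in> N"
  using normal.inv_op_closed1[OF normal_N] normal.inv_op_closed2[OF normal_N] by auto

text \<open>The quotient map G \<rightarrow> G/N read in the complement P.\<close>

definition "pr g = (THE p. p \<in> P \<and> g \<otimes> inv p \<in> N)"

lemma pr_eqI:
  assumes "n \<in> N" "p \<in> P" shows "pr (n \<otimes> p) = p"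
  unfolding pr_def
proof (rule the_equality)
  show "p \<in> P \<and> n \<otimes> p \<otimes> inv p \<in> N" using assms by (simp add: m_assoc)
  fix p' assume p': "p' \<in> P \<and> n \<otimes> p \<otimes> inv p' \<in> N"
  then have "inv n \<otimes> (n \<otimes> p \<otimes> inv p') \<in> N" using N.H.m_closed[OF N.H.m_inv_closed[OF assms(1)]] by blast
  then have "p \<otimes> inv p' \<in> N \<inter> P" using assms p' by (simp add: m_assoc[symmetric])
  then have "p \<otimes> inv p' = \<one>" using trivial_Int by auto
  then show "p' = p" using assms p' inv_solve_right[of \<one> p p'] by simp
qed

lemma pr_decomp: "g \<in> carrier G \<Longrightarrow> \<exists>n\<in>N. g = n \<otimes> pr g"
  using decomp[of g] pr_eqI by auto

lemma pr_P [simp]: "g \<in> carrier G \<Longrightarrow> pr g \<in> P"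
  using decomp[of g] pr_eqI by auto

lemma pr_N [simp]: "n \<in> N \<Longrightarrow> pr n = \<one>" and pr_id [simp]: "p \<in> P \<Longrightarrow> pr p = p"
  using pr_eqI[of n \<one>] pr_eqI[of \<one> p] by auto

lemma pr_mult [simp]: "g \<in> carrier G \<Longrightarrow> h \<in> carrier G \<Longrightarrow> pr (g \<otimes> h) = pr g \<otimes> pr h"
proof -
  assume gh: "g \<in> carrier G" "h \<in> carrier G"
  obtain n where n: "n \<in> N" "g = n \<otimes> pr g" using pr_decomp gh by blast
  obtain m where m: "m \<in> N" "h = m \<otimes> pr h" using pr_decomp gh by blast
  have "g \<otimes> h = n \<otimes> pr g \<otimes> (m \<otimes> pr h)" using n m by simp
  also have "\<dots> = (n \<otimes> (pr g \<otimes> m \<otimes> inv (pr g))) \<otimes> (pr g \<otimes> pr h)"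
    using n(1) m(1) gh by (simp add: m_assoc) (simp add: m_assoc[symmetric])
  finally show ?thesis using n(1) m(1) gh conj_N(1)[of m "pr g"] by (simp add: pr_eqI)
qed

lemma pr_one [simp]: "pr \<one> = \<one>" by simp

lemma pr_inv [simp]: "g \<in> carrier G \<Longrightarrow> pr (inv g) = inv (pr g)"
  using pr_mult[of "inv g" g] inv_equality[of "pr (inv g)" "pr g"] by simp

lemma pr_eq_one_iff: "g \<in> carrier G \<Longrightarrow> pr g = \<one> \<longleftrightarrow> g \<in> N"
  using pr_decomp[of g] by auto

section \<open>Inflated characters of P and their 2-cocycle\<close>

definition infl :: "('a \<Rightarrow> 'k) \<Rightarrow> 'a \<Rightarrow> 'k" where
  "infl \<rho> t = (if t \<in> carrier G then \<rho> (pr t) else 0)"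

abbreviation "PC \<equiv> chars G P :: ('a \<Rightarrow> 'k) set"
abbreviation "NC \<equiv> chars G N :: ('a \<Rightarrow> 'k) set"

lemma infl_galg [simp]: "infl \<rho> \<in> galg G" by (simp add: galg_def infl_def)

lemma infl_mult: "\<rho> \<in> PC \<Longrightarrow> s \<in> carrier G \<Longrightarrow> t \<in> carrier G \<Longrightarrow> infl \<rho> (s \<otimes> t) = infl \<rho> s * infl \<rho> t"
  by (simp add: infl_def P.chars_mult)

lemma infl_triv [simp]: "infl P.triv_char = one_fun"
  by (auto simp: infl_def P.triv_char_def one_fun_def)

lemma act_infl: "\<rho> \<in> PC \<Longrightarrow> g \<in> carrier G \<Longrightarrow> act g (infl \<rho>) = sc (\<rho> (inv (pr g))) (infl \<rho>)"
  by (auto simp: act_def infl_def sc_def P.chars_mult)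

lemma infl_nz: "\<rho> \<in> PC \<Longrightarrow> infl \<rho> \<noteq> 0"
proof
  assume "\<rho> \<in> PC" "infl \<rho> = 0"
  from fun_cong[OF this(2), of \<one>] this(1) show False by (simp add: infl_def P.chars_one)
qed

text \<open>Pushing J to G/N = P gives a twist of an abelian group; \<kappa> is its Fourier
  transform.\<close>

definition "\<kappa> \<rho> \<mu> = (\<Sum>p\<in>carrier G2. J p * (infl \<rho> (fst p) * infl \<mu> (snd p)))"

lemma infl_star:
  assumes "\<rho> \<in> PC" "\<mu> \<in> PC"
  shows "infl \<rho> \<star> infl \<mu> = sc (\<kappa> \<rho> \<mu>) (infl (char_mult \<rho> \<mu>))"
proof
  fix t show "(infl \<rho> \<star> infl \<mu>) t = sc (\<kappa> \<rho> \<mu>) (infl (char_mult \<rho> \<mu>)) t"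
  proof (cases "t \<in> carrier G")
    case True
    then have "(infl \<rho> \<star> infl \<mu>) t = (\<Sum>p\<in>carrier G2. J p * (infl \<rho> (fst p) * infl \<mu> (snd p)) * (infl \<rho> t * infl \<mu> t))"
      using assms by (auto simp: gstar_def infl_mult intro!: sum.cong)
    then show ?thesis using True by (simp add: sc_def \<kappa>_def sum_distrib_right infl_def char_mult_def)
  qed (simp add: gstar_def sc_def infl_def)
qed

text \<open>The function p \<mapsto> infl \<rho> (fst p) infl \<mu> (snd p) is multiplicative on G
  \<times> G, so it extends to an algebra character of kG \<otimes> kG, whose value at the
  invertible J cannot be 0.\<close>

lemma \<kappa>_nz:
  assumes "\<rho> \<in> PC" "\<mu> \<in> PC" shows "\<kappa> \<rho> \<mu> \<noteq> 0"
proof -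
  let ?F = "\<lambda>p. infl \<rho> (fst p) * infl \<mu> (snd p)"
  have "?F \<one>\<^bsub>G2\<^esub> = (\<Sum>x\<in>carrier G2. gmult G2 J Jb x * ?F x)"
    unfolding J_Jb gunit_def by (rule two.sum_gdelta[OF two.one_closed, symmetric])
  also have "\<dots> = (\<Sum>p\<in>carrier G2. \<Sum>q\<in>carrier G2. (J p * ?F p) * (Jb q * ?F q))"
    unfolding two.sum_gmult using assms by (intro sum.cong refl) (auto simp: infl_mult)
  also have "\<dots> = \<kappa> \<rho> \<mu> * (\<Sum>q\<in>carrier G2. Jb q * ?F q)"
    by (simp add: \<kappa>_def sum_product)
  finally show ?thesis using assms by (auto simp: infl_def P.chars_one)
qed

lemma \<kappa>_triv [simp]: "\<rho> \<in> PC \<Longrightarrow> \<kappa> P.triv_char \<rho> = 1" "\<rho> \<in> PC \<Longrightarrow> \<kappa> \<rho> P.triv_char = 1"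
proof -
  assume l: "\<rho> \<in> PC"
  have "sc 1 (infl \<rho>) = sc (\<kappa> P.triv_char \<rho>) (infl \<rho>)" using infl_star[OF P.triv_char_in l] l by simp
  from sc_cancel[OF this infl_nz[OF l]] show "\<kappa> P.triv_char \<rho> = 1" by simp
  have "sc 1 (infl \<rho>) = sc (\<kappa> \<rho> P.triv_char) (infl \<rho>)" using infl_star[OF l P.triv_char_in] l by simp
  from sc_cancel[OF this infl_nz[OF l]] show "\<kappa> \<rho> P.triv_char = 1" by simp
qed

text \<open>Associativity of the star product for three inflated characters, compared on the line
  spanned by the inflation of their product.\<close>

lemma \<kappa>_cocycle:
  assumes "\<rho> \<in> PC" "\<mu> \<in> PC" "\<nu> \<in> PC"
  shows "\<kappa> \<rho> \<mu> * \<kappa> (char_mult \<rho> \<mu>) \<nu> = \<kappa> \<mu> \<nu> * \<kappa> \<rho> (char_mult \<mu> \<nu>)"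
proof -
  have "sc (\<kappa> \<rho> \<mu> * \<kappa> (char_mult \<rho> \<mu>) \<nu>) (infl (char_mult \<rho> (char_mult \<mu> \<nu>))) = (infl \<rho> \<star> infl \<mu>) \<star> infl \<nu>"
    using assms by (simp add: infl_star P.char_mult_assoc)
  also have "\<dots> = sc (\<kappa> \<mu> \<nu> * \<kappa> \<rho> (char_mult \<mu> \<nu>)) (infl (char_mult \<rho> (char_mult \<mu> \<nu>)))"
    unfolding star_assoc using assms by (simp add: infl_star)
  finally show ?thesis by (rule sc_cancel) (use assms in \<open>simp add: infl_nz\<close>)
qed

section \<open>The grading of the star algebra by characters of N\<close>

definition grade :: "('a \<Rightarrow> 'k) \<Rightarrow> ('a \<Rightarrow> 'k) set" where
  "grade \<chi> = {f \<in> galg G. \<forall>n\<in>N. act n f = sc (\<chi> (inv n)) f}"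

lemma grade_galg [simp]: "f \<in> grade \<chi> \<Longrightarrow> f \<in> galg G" unfolding grade_def by blast

lemma grade_act: "f \<in> grade \<chi> \<Longrightarrow> n \<in> N \<Longrightarrow> act n f = sc (\<chi> (inv n)) f" unfolding grade_def by blast

lemma gradeI: "f \<in> galg G \<Longrightarrow> (\<And>n. n \<in> N \<Longrightarrow> act n f = sc (\<chi> (inv n)) f) \<Longrightarrow> f \<in> grade \<chi>"
  unfolding grade_def by blast

lemma grade_star: "f \<in> grade \<chi> \<Longrightarrow> g \<in> grade \<psi> \<Longrightarrow> f \<star> g \<in> grade (char_mult \<chi> \<psi>)"
  by (rule gradeI) (simp_all add: act_gstar grade_act char_mult_def mult.commute)

lemma grade_sc: "f \<in> grade \<chi> \<Longrightarrow> sc c f \<in> grade \<chi>"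
  by (rule gradeI) (simp_all add: act_sc grade_act mult.commute)

lemma grade_add: "f \<in> grade \<chi> \<Longrightarrow> g \<in> grade \<chi> \<Longrightarrow> f + g \<in> grade \<chi>"
  by (rule gradeI) (simp_all add: act_add grade_act sc_add)

lemma grade_zero: "0 \<in> grade \<chi>"
  by (rule gradeI) simp_all

lemma grade_sum: "(\<And>i. i \<in> I \<Longrightarrow> f i \<in> grade \<chi>) \<Longrightarrow> (\<Sum>i\<in>I. f i) \<in> grade \<chi>"
proof (induction I rule: infinite_finite_induct)
  case (insert i I)
  have "sum f (insert i I) = f i + sum f I" using insert.hyps by (rule sum.insert)
  moreover have "f i \<in> grade \<chi>" "sum f I \<in> grade \<chi>" using insert by blast+
  ultimately show ?case using grade_add by metis
qed (simp_all only: sum.infinite sum.empty grade_zero not_False_eq_True)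

lemma one_grade: "one_fun \<in> grade N.triv_char"
  by (rule gradeI) (simp_all add: N.triv_char_def)

lemma infl_grade: "\<rho> \<in> PC \<Longrightarrow> infl \<rho> \<in> grade N.triv_char"
  by (rule gradeI) (simp_all add: act_infl N.triv_char_def P.chars_one)

definition cact :: "'a \<Rightarrow> ('a \<Rightarrow> 'k) \<Rightarrow> 'a \<Rightarrow> 'k" where
  "cact g \<chi> n = (if n \<in> N then \<chi> (inv g \<otimes> n \<otimes> g) else 0)"

lemma cact_in [simp]: "\<chi> \<in> NC \<Longrightarrow> g \<in> carrier G \<Longrightarrow> cact g \<chi> \<in> NC"
proof -
  assume \<chi>: "\<chi> \<in> NC" and g: "g \<in> carrier G"
  have "inv g \<otimes> (x \<otimes> y) \<otimes> g = (inv g \<otimes> x \<otimes> g) \<otimes> (inv g \<otimes> y \<otimes> g)" if "x \<in> N" "y \<in> N" for x y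
    using that g by (simp add: m_assoc) (simp add: m_assoc[symmetric])
  then show ?thesis
    using \<chi> g conj_N(2) unfolding chars_def cact_def by (auto simp: N.chars_mult[OF \<chi>] N.chars_one[OF \<chi>])
qed

lemma cact_cact: "\<chi> \<in> NC \<Longrightarrow> g \<in> carrier G \<Longrightarrow> h \<in> carrier G \<Longrightarrow> cact g (cact h \<chi>) = cact (g \<otimes> h) \<chi>"
  using conj_N(2) by (auto simp: cact_def fun_eq_iff inv_mult_group m_assoc)

lemma cact_one [simp]: "\<chi> \<in> NC \<Longrightarrow> cact \<one> \<chi> = \<chi>"
  by (auto simp: cact_def fun_eq_iff N.chars_outside)

lemma cact_cancel [simp]: "\<chi> \<in> NC \<Longrightarrow> g \<in> carrier G \<Longrightarrow> cact (inv g) (cact g \<chi>) = \<chi>"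
  "\<chi> \<in> NC \<Longrightarrow> g \<in> carrier G \<Longrightarrow> cact g (cact (inv g) \<chi>) = \<chi>"
  by (simp_all add: cact_cact)

text \<open>Since N is normal, n applied after g equals g applied after g^-1 n g, so translation by
  g permutes the degrees by conjugation.\<close>

lemma grade_act_G:
  assumes "f \<in> grade \<chi>" "g \<in> carrier G" shows "act g f \<in> grade (cact g \<chi>)"
  unfolding grade_def
proof (intro CollectI conjI ballI)
  fix n assume n: "n \<in> N"
  have "act n (act g f) = act g (act (inv g \<otimes> n \<otimes> g) f)"
    using n assms by (simp add: act_act m_assoc[symmetric])
  also have "\<dots> = sc (\<chi> (inv (inv g \<otimes> n \<otimes> g))) (act g f)"
    using n assms conj_N(2)[OF n assms(2)] by (simp add: grade_act act_sc)
  finally show "act n (act g f) = sc (cact g \<chi> (inv n)) (act g f)"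
    using n assms by (simp add: cact_def inv_mult_group m_assoc)
qed simp

definition proj :: "('a \<Rightarrow> 'k) \<Rightarrow> ('a \<Rightarrow> 'k) \<Rightarrow> 'a \<Rightarrow> 'k" where
  "proj \<chi> f = sc (1 / of_nat (card N)) (\<Sum>n\<in>N. sc (\<chi> n) (act n f))"

lemma cardN_nz [simp]: "(of_nat (card N) :: 'k) \<noteq> 0" using N.card_H_pos by simp
lemma cardP_nz [simp]: "(of_nat (card P) :: 'k) \<noteq> 0" using P.card_H_pos by simp

lemma bij_mult_N: "m \<in> N \<Longrightarrow> bij_betw ((\<otimes>) m) N N"
  by (rule bij_betwI[where g = "(\<otimes>) (inv m)"]) (auto simp: m_assoc[symmetric])

lemma proj_grade:
  assumes "\<chi> \<in> NC" shows "proj \<chi> f \<in> grade \<chi>"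
  unfolding grade_def
proof (intro CollectI conjI ballI)
  show "proj \<chi> f \<in> galg G" unfolding proj_def by (intro galg_sc galg_sum act_galg)
  fix m assume m: "m \<in> N"
  have "act m (\<Sum>n\<in>N. sc (\<chi> n) (act n f)) = (\<Sum>n\<in>N. sc (\<chi> n) (act (m \<otimes> n) f))"
    using m by (simp add: act_sum act_sc act_act cong: sum.cong)
  also have "\<dots> = (\<Sum>n\<in>N. sc (\<chi> (inv m) * \<chi> (m \<otimes> n)) (act (m \<otimes> n) f))"
    using m assms N.chars_inv_mult[OF assms m] by (intro sum.cong refl) (simp add: N.chars_mult mult.assoc[symmetric])
  also have "\<dots> = (\<Sum>n\<in>N. sc (\<chi> (inv m) * \<chi> n) (act n f))"
    using sum.reindex_bij_betw[OF bij_mult_N[OF m], of "\<lambda>n. sc (\<chi> (inv m) * \<chi> n) (act n f)"] by simp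
  also have "\<dots> = sc (\<chi> (inv m)) (\<Sum>n\<in>N. sc (\<chi> n) (act n f))" by (simp add: sc_sum)
  finally show "act m (proj \<chi> f) = sc (\<chi> (inv m)) (proj \<chi> f)"
    by (simp add: proj_def act_sc mult.commute)
qed

lemma proj_on_grade:
  assumes "\<chi> \<in> NC" "\<psi> \<in> NC" "f \<in> grade \<psi>"
  shows "proj \<chi> f = (if \<chi> = \<psi> then f else 0)"
proof -
  have "proj \<chi> f = sc (1 / of_nat (card N)) (\<Sum>n\<in>N. sc (\<chi> n * \<psi> (inv n)) f)"
    unfolding proj_def using assms(3) by (simp add: grade_act cong: sum.cong)
  also have "\<dots> = sc (1 / of_nat (card N) * (\<Sum>n\<in>N. \<chi> n * \<psi> (inv n))) f" by (simp add: sum_sc)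
  finally show ?thesis by (simp add: N.chars_orthogonal2[OF assms(1,2)])
qed

lemma proj_sum: "proj \<chi> (\<Sum>i\<in>I. f i) = (\<Sum>i\<in>I. proj \<chi> (f i))"
  unfolding proj_def by (simp add: act_sum sc_sum) (rule sum.swap)

lemma proj_sc: "proj \<chi> (sc c f) = sc c (proj \<chi> f)"
  unfolding proj_def by (simp add: act_sc sc_sum mult_ac)

lemma sum_proj: "f \<in> galg G \<Longrightarrow> (\<Sum>\<chi>\<in>NC. proj \<chi> f) = f"
proof -
  assume f: "f \<in> galg G"
  have "(\<Sum>\<chi>\<in>NC. proj \<chi> f) = (\<Sum>n\<in>N. \<Sum>\<chi>\<in>NC. sc (\<chi> n / of_nat (card N)) (act n f))"
    unfolding proj_def by (simp add: sc_sum) (rule sum.swap)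
  also have "\<dots> = (\<Sum>n\<in>N. sc ((\<Sum>\<chi>\<in>NC. \<chi> n) / of_nat (card N)) (act n f))"
    by (simp add: sum_sc sum_divide_distrib)
  also have "\<dots> = (\<Sum>n\<in>N. if n = \<one> then f else 0)"
    using f by (intro sum.cong refl) (simp add: N.sum_chars)
  finally show ?thesis by (simp add: sum.delta)
qed

text \<open>Invariance under N makes f a function on G/N, and Fourier inversion on P expands it in
  characters.\<close>

lemma grade_triv_expand:
  assumes "f \<in> grade N.triv_char"
  shows "\<exists>C. f = (\<Sum>\<rho>\<in>PC. sc (C \<rho>) (infl \<rho>))"
proof -
  have inv: "f (n \<otimes> t) = f t" if "n \<in> N" "t \<in> carrier G" for n t
  proof -
    have "act (inv n) f t = f t" using grade_act[OF assms, of "inv n"] that by (simp add: N.triv_char_def sc_def)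
    then show ?thesis using that by (simp add: act_def)
  qed
  define C where "C \<rho> = (\<Sum>p\<in>P. f p * \<rho> (inv p)) / of_nat (card P)" for \<rho>
  have "f = (\<Sum>\<rho>\<in>PC. sc (C \<rho>) (infl \<rho>))"
  proof
    fix t
    show "f t = (\<Sum>\<rho>\<in>PC. sc (C \<rho>) (infl \<rho>)) t"
    proof (cases "t \<in> carrier G")
      case True
      obtain n where n: "n \<in> N" "t = n \<otimes> pr t" using pr_decomp[OF True] by blast
      have "(\<Sum>\<rho>\<in>PC. sc (C \<rho>) (infl \<rho>)) t = (\<Sum>\<rho>\<in>PC. \<Sum>p\<in>P. f p / of_nat (card P) * \<rho> (inv p \<otimes> pr t))"
        using True by (auto simp: sum_fun_apply sc_def C_def infl_def sum_divide_distrib sum_distrib_right P.chars_mult intro!: sum.cong)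
      also have "\<dots> = (\<Sum>p\<in>P. f p / of_nat (card P) * (\<Sum>\<rho>\<in>PC. \<rho> (inv p \<otimes> pr t)))"
        unfolding sum_distrib_left by (rule sum.swap)
      also have "\<dots> = (\<Sum>p\<in>P. if p = pr t then f p else 0)"
      proof (intro sum.cong refl)
        fix p assume p: "p \<in> P"
        have "inv p \<otimes> pr t = \<one> \<longleftrightarrow> p = pr t" using p True inv_solve_left[of \<one> p "pr t"] by auto
        then show "f p / of_nat (card P) * (\<Sum>\<rho>\<in>PC. \<rho> (inv p \<otimes> pr t)) = (if p = pr t then f p else 0)"
          using P.sum_chars[of "inv p \<otimes> pr t", where 'k = 'k] p True by simp
      qed
      also have "\<dots> = f (pr t)" using True by (simp add: sum.delta)
      also have "\<dots> = f t" using inv[of n "pr t"] n True by simp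
      finally show ?thesis by simp
    next
      case False
      then show ?thesis using galgD[OF grade_galg[OF assms]] by (simp add: sum_fun_apply sc_def infl_def)
    qed
  qed
  then show ?thesis by blast
qed

text \<open>Weight the Galois identity by \<chi>(h) and sum over h in N: only h = 1 contributes on
  the right, and the second factors become projections to degree \<chi>. Taking the component of
  trivial degree then projects the first factors to the inverse degree.\<close>

lemma strongly_graded:
  assumes \<chi>: "\<chi> \<in> NC"
  shows "\<exists>F. one_fun = (\<Sum>a\<in>carrier G. \<Sum>b\<in>carrier G. sc (F a b) (proj (N.inv_char \<chi>) (gdelta a) \<star> proj \<chi> (gdelta b)))"
proof -
  obtain F where F: "\<And>h. h \<in> carrier G \<Longrightarrow> (\<Sum>a\<in>carrier G. \<Sum>b\<in>carrier G. sc (F a b) (gdelta a \<star> act h (gdelta b)))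
       = (if h = \<one> then one_fun else 0)"
    by (rule galois_element) blast
  let ?n = "of_nat (card N) :: 'k"
  have "one_fun = (\<Sum>h\<in>N. sc (\<chi> h) (if h = \<one> then one_fun else 0))"
    using N.chars_one[OF \<chi>] by (simp add: if_distrib[of "sc _"] sum.delta cong: if_cong)
  also have "\<dots> = (\<Sum>h\<in>N. \<Sum>a\<in>carrier G. \<Sum>b\<in>carrier G. sc (F a b) (gdelta a \<star> sc (\<chi> h) (act h (gdelta b))))"
    by (intro sum.cong refl) (simp add: F[symmetric] sc_sum mult_ac)
  also have "\<dots> = (\<Sum>a\<in>carrier G. \<Sum>b\<in>carrier G. sc (F a b) (gdelta a \<star> (\<Sum>h\<in>N. sc (\<chi> h) (act h (gdelta b)))))"
    by (subst sum.swap, rule sum.cong[OF refl], subst sum.swap) (simp only: gstar_sum_right sc_sum)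
  also have "\<dots> = (\<Sum>a\<in>carrier G. \<Sum>b\<in>carrier G. sc (?n * F a b) (gdelta a \<star> proj \<chi> (gdelta b)))"
    by (intro sum.cong refl) (simp add: proj_def)
  finally have 1: "one_fun = (\<Sum>a\<in>carrier G. \<Sum>b\<in>carrier G. sc (?n * F a b) (gdelta a \<star> proj \<chi> (gdelta b)))" .
  have 2: "proj N.triv_char (gdelta a \<star> proj \<chi> (gdelta b)) = proj (N.inv_char \<chi>) (gdelta a) \<star> proj \<chi> (gdelta b)"
    if a: "a \<in> carrier G" for a b
  proof -
    have "gdelta a \<star> proj \<chi> (gdelta b) = (\<Sum>\<psi>\<in>NC. proj \<psi> (gdelta a) \<star> proj \<chi> (gdelta b))"
      using sum_proj[of "gdelta a"] a by (simp add: gstar_sum_left[symmetric])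
    then have "proj N.triv_char (gdelta a \<star> proj \<chi> (gdelta b))
        = (\<Sum>\<psi>\<in>NC. proj N.triv_char (proj \<psi> (gdelta a) \<star> proj \<chi> (gdelta b)))" by (simp add: proj_sum)
    also have "\<dots> = (\<Sum>\<psi>\<in>NC. if \<psi> = N.inv_char \<chi> then proj \<psi> (gdelta a) \<star> proj \<chi> (gdelta b) else 0)"
    proof (intro sum.cong refl)
      fix \<psi> assume \<psi>: "\<psi> \<in> NC"
      have g: "proj \<psi> (gdelta a) \<star> proj \<chi> (gdelta b) \<in> grade (char_mult \<psi> \<chi>)"
        using \<psi> \<chi> by (intro grade_star proj_grade)
      have eq: "N.triv_char = char_mult \<psi> \<chi> \<longleftrightarrow> \<psi> = N.inv_char \<chi>"
      proof
        assume "N.triv_char = char_mult \<psi> \<chi>"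
        then have "char_mult (char_mult \<psi> \<chi>) (N.inv_char \<chi>) = char_mult N.triv_char (N.inv_char \<chi>)" by simp
        then show "\<psi> = N.inv_char \<chi>" using \<psi> \<chi> by (simp add: N.char_mult_assoc)
      qed (use \<chi> in simp)
      show "proj N.triv_char (proj \<psi> (gdelta a) \<star> proj \<chi> (gdelta b))
          = (if \<psi> = N.inv_char \<chi> then proj \<psi> (gdelta a) \<star> proj \<chi> (gdelta b) else 0)"
        by (simp only: proj_on_grade[OF N.triv_char_in N.char_mult_in[OF \<psi> \<chi>] g] eq)
    qed
    also have "\<dots> = proj (N.inv_char \<chi>) (gdelta a) \<star> proj \<chi> (gdelta b)" using \<chi> by (simp add: sum.delta)
    finally show ?thesis .
  qed
  have "one_fun = proj N.triv_char one_fun" using proj_on_grade[OF N.triv_char_in N.triv_char_in one_grade] by simp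
  also have "\<dots> = (\<Sum>a\<in>carrier G. \<Sum>b\<in>carrier G. sc (?n * F a b) (proj (N.inv_char \<chi>) (gdelta a) \<star> proj \<chi> (gdelta b)))"
    by (subst 1) (simp add: proj_sum proj_sc 2 cong: sum.cong)
  finally show ?thesis by (intro exI[of _ "\<lambda>a b. ?n * F a b"])
qed

end

context semidirect_twist
begin

text \<open>A symmetric 2-cocycle on a finite abelian group is a coboundary: it describes an abelian
  extension by the divisible group of units of the field, and the identity character of the units
  extends to it.\<close>
lemma symmetric_cocycle_trivial:
  assumes sym: "\<And>\<rho> \<mu>. \<rho> \<in> PC \<Longrightarrow> \<mu> \<in> PC \<Longrightarrow> \<kappa> \<rho> \<mu> = \<kappa> \<mu> \<rho>"
  shows "\<exists>s. (\<forall>\<rho>\<in>PC. s \<rho> \<noteq> 0) \<and> (\<forall>\<rho>\<in>PC. \<forall>\<mu>\<in>PC. s \<rho> * s \<mu> * \<kappa> \<rho> \<mu> = s (char_mult \<rho> \<mu>))"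
proof -
  define E :: "('k \<times> ('a \<Rightarrow> 'k)) monoid" where
    "E = \<lparr>carrier = {(c, \<rho>). c \<noteq> 0 \<and> \<rho> \<in> PC},
          monoid.mult = (\<lambda>(c, \<rho>) (d, \<mu>). (c * d * \<kappa> \<rho> \<mu>, char_mult \<rho> \<mu>)), one = (1, P.triv_char)\<rparr>"
  have cE: "(c, \<rho>) \<in> carrier E \<longleftrightarrow> c \<noteq> 0 \<and> \<rho> \<in> PC" for c \<rho> by (simp add: E_def)
  have mE: "(c, \<rho>) \<otimes>\<^bsub>E\<^esub> (d, \<mu>) = (c * d * \<kappa> \<rho> \<mu>, char_mult \<rho> \<mu>)" for c d \<rho> \<mu> by (simp add: E_def)
  have oE: "\<one>\<^bsub>E\<^esub> = (1, P.triv_char)" by (simp add: E_def)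
  interpret E: comm_group E
  proof (rule comm_groupI)
    fix x y assume "x \<in> carrier E" "y \<in> carrier E"
    then show "x \<otimes>\<^bsub>E\<^esub> y \<in> carrier E" by (cases x, cases y) (simp add: cE mE \<kappa>_nz)
  next
    show "\<one>\<^bsub>E\<^esub> \<in> carrier E" by (simp add: cE oE)
  next
    fix x y z assume "x \<in> carrier E" "y \<in> carrier E" "z \<in> carrier E"
    then obtain c \<rho> d \<mu> e \<nu> where x: "x = (c, \<rho>)" "y = (d, \<mu>)" "z = (e, \<nu>)" "\<rho> \<in> PC" "\<mu> \<in> PC" "\<nu> \<in> PC"
      by (cases x, cases y, cases z) (auto simp: cE)
    have "c * d * \<kappa> \<rho> \<mu> * e * \<kappa> (char_mult \<rho> \<mu>) \<nu> = c * d * e * (\<kappa> \<rho> \<mu> * \<kappa> (char_mult \<rho> \<mu>) \<nu>)" by (simp add: mult_ac)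
    also have "\<dots> = c * (d * e * \<kappa> \<mu> \<nu>) * \<kappa> \<rho> (char_mult \<mu> \<nu>)" by (simp only: \<kappa>_cocycle[OF x(4-6)] mult_ac)
    finally show "(x \<otimes>\<^bsub>E\<^esub> y) \<otimes>\<^bsub>E\<^esub> z = x \<otimes>\<^bsub>E\<^esub> (y \<otimes>\<^bsub>E\<^esub> z)"
      by (simp add: x mE P.char_mult_assoc)
  next
    fix x y assume "x \<in> carrier E" "y \<in> carrier E"
    then show "x \<otimes>\<^bsub>E\<^esub> y = y \<otimes>\<^bsub>E\<^esub> x"
      by (cases x, cases y) (simp add: cE mE sym P.char_mult_commute mult_ac)
  next
    fix x assume "x \<in> carrier E"
    then show "\<one>\<^bsub>E\<^esub> \<otimes>\<^bsub>E\<^esub> x = x" by (cases x) (simp add: cE mE oE)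
  next
    fix x assume "x \<in> carrier E"
    then obtain c \<rho> where x: "x = (c, \<rho>)" "c \<noteq> 0" "\<rho> \<in> PC" by (cases x) (auto simp: cE)
    let ?y = "(inverse (c * \<kappa> (P.inv_char \<rho>) \<rho>), P.inv_char \<rho>)"
    have nz: "\<kappa> (P.inv_char \<rho>) \<rho> \<noteq> 0" using x by (intro \<kappa>_nz) auto
    have "?y \<in> carrier E" "?y \<otimes>\<^bsub>E\<^esub> x = \<one>\<^bsub>E\<^esub>" using x nz by (auto simp: cE mE oE field_simps)
    then show "\<exists>y\<in>carrier E. y \<otimes>\<^bsub>E\<^esub> x = \<one>\<^bsub>E\<^esub>" by blast
  qed
  define M where "M = {(c, P.triv_char :: 'a \<Rightarrow> 'k) | c. c \<noteq> (0::'k)}"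
  have subM: "subgroup M E"
  proof (rule E.subgroupI)
    show "M \<subseteq> carrier E" by (auto simp: M_def cE)
    have "(1, P.triv_char) \<in> M" by (simp add: M_def)
    then show "M \<noteq> {}" by blast
    fix a assume "a \<in> M"
    then obtain c where a: "a = (c, P.triv_char)" "c \<noteq> 0" by (auto simp: M_def)
    have "inv\<^bsub>E\<^esub> a = (inverse c, P.triv_char)"
      by (rule E.inv_equality) (use a in \<open>auto simp: cE mE oE\<close>)
    then show "inv\<^bsub>E\<^esub> a \<in> M" using a by (simp add: M_def)
    fix b assume "b \<in> M"
    then obtain d where b: "b = (d, P.triv_char)" "d \<noteq> 0" by (auto simp: M_def)
    show "a \<otimes>\<^bsub>E\<^esub> b \<in> M" using a b by (simp add: M_def mE)
  qed
  have charM: "mult_char_on E M fst" by (auto simp: mult_char_on_def M_def mE)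
  define Y where "Y = Pair (1::'k) ` PC"
  have "finite Y" "Y \<subseteq> carrier E" by (auto simp: Y_def cE)
  \<comment> \<open>The second component of the power of y with exponent |P| is \<rho>^|P|, which is
    trivial; so y has finite order modulo the copy of the units, as \<open>extend_char\<close>
    requires.\<close>
  moreover have "\<exists>r>0. y [^]\<^bsub>E\<^esub> (r::nat) \<in> M" if "y \<in> Y" for y
  proof -
    obtain \<rho> where y: "y = (1, \<rho>)" "\<rho> \<in> PC" using \<open>y \<in> Y\<close> by (auto simp: Y_def)
    have yE: "y \<in> carrier E" using y by (simp add: cE)
    have pow: "x \<in> P \<Longrightarrow> snd (y [^]\<^bsub>E\<^esub> r) x = \<rho> x ^ r" for x and r :: nat
    proof (induction r)
      case 0
      then show ?case by (simp add: oE P.triv_char_def)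
    next
      case (Suc r)
      obtain c \<mu> where c: "y [^]\<^bsub>E\<^esub> r = (c, \<mu>)" by (cases "y [^]\<^bsub>E\<^esub> r")
      have "y [^]\<^bsub>E\<^esub> Suc r = (c * 1 * \<kappa> \<mu> \<rho>, char_mult \<mu> \<rho>)"
        unfolding E.nat_pow_Suc c unfolding y(1) mE ..
      then show ?case using Suc c by (simp add: char_mult_def mult.commute)
    qed
    interpret GP: group "G\<lparr>carrier := P\<rparr>" using P.comm_group_H by (simp add: comm_group_def)
    have rp: "\<rho> x ^ card P = 1" if x: "x \<in> P" for x
    proof -
      have "x [^] card P = \<one>"
        using GP.pow_order_eq_1[of x] x by (simp add: Coset.order_def nat_pow_consistent[symmetric])
      moreover have "x [^] r \<in> P \<and> \<rho> (x [^] r) = \<rho> x ^ r" for r :: nat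
        using x y(2) by (induction r) (auto simp: P.chars_mult P.chars_one)
      ultimately show ?thesis using P.chars_one[OF y(2)] by metis
    qed
    obtain c \<mu> where c: "y [^]\<^bsub>E\<^esub> card P = (c, \<mu>)" by (cases "y [^]\<^bsub>E\<^esub> card P")
    have mu: "c \<noteq> 0" "\<mu> \<in> PC" using E.nat_pow_closed[OF yE, of "card P"] unfolding c cE by auto
    have "\<mu> = P.triv_char"
      by (rule P.chars_eqI[OF mu(2) P.triv_char_in]) (use pow[of _ "card P"] rp c in \<open>simp add: P.triv_char_def\<close>)
    then have "y [^]\<^bsub>E\<^esub> card P \<in> M" using mu c by (simp add: M_def)
    then show ?thesis using P.card_H_pos by blast
  qed
  ultimately obtain M' \<chi> where M': "M \<union> Y \<subseteq> M'" "mult_char_on E M' \<chi>" "\<forall>m\<in>M. \<chi> m = fst m"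
    using E.extend_char[OF _ subM charM, of Y] by blast
  have nz: "\<chi> (1, \<rho>) \<noteq> 0" if "\<rho> \<in> PC" for \<rho>
    using M' that by (auto simp: mult_char_on_def Y_def)
  have mult: "\<chi> (1, \<rho>) * \<chi> (1, \<mu>) = \<kappa> \<rho> \<mu> * \<chi> (1, char_mult \<rho> \<mu>)" if "\<rho> \<in> PC" "\<mu> \<in> PC" for \<rho> \<mu>
  proof -
    have Y': "(1, \<rho>) \<in> M'" "(1, \<mu>) \<in> M'" "(1, char_mult \<rho> \<mu>) \<in> M'" using M'(1) that by (auto simp: Y_def)
    have M1: "(\<kappa> \<rho> \<mu>, P.triv_char) \<in> M" using that by (simp add: M_def \<kappa>_nz)
    then have M2: "(\<kappa> \<rho> \<mu>, P.triv_char) \<in> M'" using M'(1) by blast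
    have "\<chi> (1, \<rho>) * \<chi> (1, \<mu>) = \<chi> ((1, \<rho>) \<otimes>\<^bsub>E\<^esub> (1, \<mu>))" using M'(2) Y' by (simp add: mult_char_on_def)
    also have "(1, \<rho>) \<otimes>\<^bsub>E\<^esub> (1, \<mu>) = (\<kappa> \<rho> \<mu>, P.triv_char) \<otimes>\<^bsub>E\<^esub> (1, char_mult \<rho> \<mu>)"
      using that by (simp add: mE)
    also have "\<chi> \<dots> = \<chi> (\<kappa> \<rho> \<mu>, P.triv_char) * \<chi> (1, char_mult \<rho> \<mu>)" using M'(2) Y' M2 by (simp add: mult_char_on_def)
    finally show ?thesis using M'(3) M1 by simp
  qed
  show ?thesis
  \<comment> \<open>On the section \<rho> \<mapsto> (1, \<rho>) the extended character is
    multiplicative up to the factor \<kappa>; its inverse therefore cancels \<kappa>.\<close>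
  proof (intro exI[of _ "\<lambda>\<rho>. inverse (\<chi> (1, \<rho>))"] conjI ballI)
    fix \<rho> assume r: "\<rho> \<in> PC"
    show "inverse (\<chi> (1, \<rho>)) \<noteq> 0" using nz[OF r] by simp
    fix \<mu> assume m: "\<mu> \<in> PC"
    have "inverse (\<chi> (1, \<rho>)) * inverse (\<chi> (1, \<mu>)) = inverse (\<kappa> \<rho> \<mu> * \<chi> (1, char_mult \<rho> \<mu>))"
      by (simp add: mult[OF r m, symmetric])
    then show "inverse (\<chi> (1, \<rho>)) * inverse (\<chi> (1, \<mu>)) * \<kappa> \<rho> \<mu> = inverse (\<chi> (1, char_mult \<rho> \<mu>))"
      using \<kappa>_nz[OF r m] by simp
  qed
qed

end

text \<open>The degree-one part of the N-grading is a split commutative algebra, with primitive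
  idempotents the P-translates of e.\<close>
locale split_semidirect = semidirect_twist G J N P
  for G :: "('a, 'm) monoid_scheme" (structure) and J :: "'a \<times> 'a \<Rightarrow> 'k::{alg_closed_field, field_char_0}" and N P +
  fixes s :: "('a \<Rightarrow> 'k) \<Rightarrow> 'k"
  assumes s_nz: "\<And>\<rho>. \<rho> \<in> PC \<Longrightarrow> s \<rho> \<noteq> 0"
    and s_mult: "\<And>\<rho> \<mu>. \<rho> \<in> PC \<Longrightarrow> \<mu> \<in> PC \<Longrightarrow> s \<rho> * s \<mu> * \<kappa> \<rho> \<mu> = s (char_mult \<rho> \<mu>)"
begin

text \<open>The scalars s turn the projective family of inflated characters into a genuine copy of
  the dual of P.\<close>

definition "U \<rho> = sc (s \<rho>) (infl \<rho>)"

lemma U_star: "\<rho> \<in> PC \<Longrightarrow> \<mu> \<in> PC \<Longrightarrow> U \<rho> \<star> U \<mu> = U (char_mult \<rho> \<mu>)"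
  by (simp add: U_def infl_star s_mult mult_ac flip: s_mult)

lemma U_triv [simp]: "U P.triv_char = one_fun"
  using s_mult[OF P.triv_char_in P.triv_char_in] s_nz[OF P.triv_char_in] by (simp add: U_def)

lemma U_act: "\<rho> \<in> PC \<Longrightarrow> g \<in> carrier G \<Longrightarrow> act g (U \<rho>) = sc (\<rho> (inv (pr g))) (U \<rho>)"
  by (simp add: U_def act_sc act_infl mult.commute)

text \<open>The averaging idempotent of the group algebra of the dual of P. Its translates
  correspond to the points of P; they are orthogonal and sum to the unit.\<close>

definition "e = sc (1 / of_nat (card P)) (\<Sum>\<rho>\<in>PC. U \<rho>)"

abbreviation "ee q \<equiv> act q e"

lemma U_galg [simp]: "U \<rho> \<in> galg G" by (simp add: U_def)
lemma e_galg [simp]: "e \<in> galg G" unfolding e_def by (intro galg_sc galg_sum U_galg)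

lemma U_grade: "\<rho> \<in> PC \<Longrightarrow> U \<rho> \<in> grade N.triv_char"
  unfolding U_def by (intro grade_sc infl_grade)

lemma e_grade: "e \<in> grade N.triv_char"
  unfolding e_def by (intro grade_sc grade_sum U_grade)

lemma U_e: "\<rho> \<in> PC \<Longrightarrow> U \<rho> \<star> e = e" "\<rho> \<in> PC \<Longrightarrow> e \<star> U \<rho> = e"
proof -
  assume r: "\<rho> \<in> PC"
  have "(\<Sum>\<mu>\<in>PC. U \<rho> \<star> U \<mu>) = (\<Sum>\<mu>\<in>PC. U (char_mult \<rho> \<mu>))" using r by (simp add: U_star cong: sum.cong)
  also have "\<dots> = (\<Sum>\<mu>\<in>PC. U \<mu>)" by (rule sum.reindex_bij_betw[OF P.bij_char_mult[OF r]])
  finally have *: "(\<Sum>\<mu>\<in>PC. U \<rho> \<star> U \<mu>) = (\<Sum>\<mu>\<in>PC. U \<mu>)" .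
  then show "U \<rho> \<star> e = e" by (simp add: e_def gstar_sum_right)
  have "(\<Sum>\<mu>\<in>PC. U \<mu> \<star> U \<rho>) = (\<Sum>\<mu>\<in>PC. U \<rho> \<star> U \<mu>)"
    using r by (simp add: U_star P.char_mult_commute[of \<rho>] cong: sum.cong)
  with * show "e \<star> U \<rho> = e" by (simp add: e_def gstar_sum_left)
qed

lemma U_eq:
  assumes "\<rho> \<in> PC" "q \<in> P" shows "U \<rho> \<star> ee q = sc (\<rho> q) (ee q)" "ee q \<star> U \<rho> = sc (\<rho> q) (ee q)"
proof -
  have U: "U \<rho> = sc (\<rho> q) (act q (U \<rho>))"
    using assms P.chars_inv_mult[OF assms] by (simp add: U_act mult.commute)
  show "U \<rho> \<star> ee q = sc (\<rho> q) (ee q)"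
    by (subst U) (use assms in \<open>simp add: act_gstar[symmetric] U_e\<close>)
  show "ee q \<star> U \<rho> = sc (\<rho> q) (ee q)"
    by (subst U) (use assms in \<open>simp add: act_gstar[symmetric] U_e\<close>)
qed

lemma eq_expand: "q \<in> P \<Longrightarrow> ee q = sc (1 / of_nat (card P)) (\<Sum>\<rho>\<in>PC. sc (\<rho> (inv q)) (U \<rho>))"
  by (simp add: e_def act_sc act_sum U_act cong: sum.cong)

lemma eq_eq:
  assumes "q \<in> P" "q' \<in> P" shows "ee q \<star> ee q' = (if q = q' then ee q else 0)"
proof -
  have "ee q \<star> ee q' = sc (1 / of_nat (card P)) (\<Sum>\<rho>\<in>PC. sc (\<rho> (inv q)) (U \<rho> \<star> ee q'))"
    by (subst eq_expand[OF assms(1)]) (simp add: gstar_sum_left)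
  also have "\<dots> = sc (1 / of_nat (card P)) (\<Sum>\<rho>\<in>PC. sc (\<rho> (inv q \<otimes> q')) (ee q'))"
    using assms by (simp add: U_eq P.chars_mult cong: sum.cong)
  also have "\<dots> = sc (1 / of_nat (card P) * (\<Sum>\<rho>\<in>PC. \<rho> (inv q \<otimes> q'))) (ee q')" by (simp add: sum_sc)
  also have "(\<Sum>\<rho>\<in>PC. \<rho> (inv q \<otimes> q')) = (if q = q' then of_nat (card P) else 0)"
  proof -
    have "inv q \<otimes> q' = \<one> \<longleftrightarrow> q = q'" using assms inv_solve_left[of \<one> q q'] by auto
    then show ?thesis using P.sum_chars[of "inv q \<otimes> q'", where 'k = 'k] assms by simp
  qed
  finally show ?thesis by (cases "q = q'") (simp_all add: zero_fun_def)
qed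

lemma sum_eq: "(\<Sum>q\<in>P. ee q) = one_fun"
proof -
  have "(\<Sum>q\<in>P. ee q) = (\<Sum>q\<in>P. \<Sum>\<rho>\<in>PC. sc (1 / of_nat (card P) * \<rho> (inv q)) (U \<rho>))"
    by (intro sum.cong refl) (simp add: eq_expand sc_sum)
  also have "\<dots> = (\<Sum>\<rho>\<in>PC. sc (\<Sum>q\<in>P. 1 / of_nat (card P) * \<rho> (inv q)) (U \<rho>))"
    by (subst sum.swap) (simp only: sum_sc)
  also have "\<dots> = (\<Sum>\<rho>\<in>PC. if \<rho> = P.triv_char then one_fun else 0)"
  proof (intro sum.cong refl)
    fix \<rho> assume r: "\<rho> \<in> PC"
    have "(\<Sum>q\<in>P. 1 / of_nat (card P) * \<rho> (inv q)) = 1 / of_nat (card P) * (\<Sum>q\<in>P. P.triv_char q * \<rho> (inv q))"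
      by (simp add: sum_distrib_left P.triv_char_def cong: sum.cong)
    also have "\<dots> = (if \<rho> = P.triv_char then 1 else 0)"
      unfolding P.chars_orthogonal2[OF P.triv_char_in r] by auto
    finally show "sc (\<Sum>q\<in>P. 1 / of_nat (card P) * \<rho> (inv q)) (U \<rho>) = (if \<rho> = P.triv_char then one_fun else 0)" by auto
  qed
  finally show ?thesis by (simp add: sum.delta)
qed

lemma one_fun_nz: "(one_fun :: 'a \<Rightarrow> 'k) \<noteq> 0"
proof
  assume "(one_fun :: 'a \<Rightarrow> 'k) = 0"
  from fun_cong[OF this, of \<one>] show False by (simp add: one_fun_def)
qed

lemma e_nz: "e \<noteq> 0"
proof
  assume "e = 0"
  then have "(\<Sum>q\<in>P. ee q) = (\<Sum>q\<in>P. (0 :: 'a \<Rightarrow> 'k))" by (intro sum.cong refl) (simp only: act_zero)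
  then show False using sum_eq one_fun_nz by (simp only: sum.neutral_const)
qed

lemma eq_one: "ee \<one> = e" by simp

lemma e_e [simp]: "e \<star> e = e"
  using eq_eq[of \<one> \<one>] by simp

lemma eq_grade: "q \<in> P \<Longrightarrow> ee q \<in> grade N.triv_char"
  by (subst eq_expand) (auto intro!: grade_sc grade_sum U_grade)

text \<open>Each U \<rho> acts on the idempotent at q by the scalar \<rho>(q), and the degree-one
  part is spanned by the U \<rho>.\<close>

lemma triv_star_eq:
  assumes "f \<in> grade N.triv_char" "q \<in> P"
  shows "\<exists>c. f \<star> ee q = sc c (ee q) \<and> ee q \<star> f = sc c (ee q)"
proof -
  obtain C where C: "f = (\<Sum>\<rho>\<in>PC. sc (C \<rho>) (infl \<rho>))" using grade_triv_expand[OF assms(1)] by blast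
  have inflU: "infl \<rho> = sc (inverse (s \<rho>)) (U \<rho>)" if "\<rho> \<in> PC" for \<rho>
    using s_nz[OF that] by (simp add: U_def)
  have f: "f = (\<Sum>\<rho>\<in>PC. sc (C \<rho> * inverse (s \<rho>)) (U \<rho>))"
    unfolding C by (intro sum.cong refl) (simp add: inflU)
  have "f \<star> ee q = sc (\<Sum>\<rho>\<in>PC. C \<rho> * inverse (s \<rho>) * \<rho> q) (ee q)"
    unfolding f using assms(2) by (simp add: gstar_sum_left U_eq sum_sc cong: sum.cong)
  moreover have "ee q \<star> f = sc (\<Sum>\<rho>\<in>PC. C \<rho> * inverse (s \<rho>) * \<rho> q) (ee q)"
    unfolding f using assms(2) by (simp add: gstar_sum_right U_eq sum_sc cong: sum.cong)
  ultimately show ?thesis by blast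
qed

text \<open>An equivalence between the idempotents e and \<open>ee q\<close>, implemented by b in
  degree \<chi> with a as its inverse in the opposite degree.\<close>

definition good :: "('a \<Rightarrow> 'k) \<Rightarrow> 'a \<Rightarrow> ('a \<Rightarrow> 'k) \<Rightarrow> ('a \<Rightarrow> 'k) \<Rightarrow> bool" where
  "good \<chi> q a b \<longleftrightarrow> q \<in> P \<and> a \<in> grade (N.inv_char \<chi>) \<and> b \<in> grade \<chi> \<and>
     ee q \<star> b = b \<and> b \<star> e = b \<and> e \<star> a = a \<and> a \<star> ee q = a \<and> a \<star> b = e \<and> b \<star> a = ee q"

lemma good_triv: "good N.triv_char \<one> e e"
proof -
  have "N.inv_char N.triv_char = (N.triv_char :: 'a \<Rightarrow> 'k)" by (auto simp: N.inv_char_def N.triv_char_def)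
  then show ?thesis by (simp add: good_def e_grade)
qed

text \<open>The unit is a sum of products from degrees \<chi>^-1 and \<chi>. Cut by e on both sides
  and with the idempotents inserted between the factors, some product must survive because e is
  nonzero. Corners of the degree-one part are lines, so the surviving factors are inverse to each
  other up to a scalar.\<close>

lemma good_exists:
  assumes \<chi>: "\<chi> \<in> NC" shows "\<exists>q a b. good \<chi> q a b"
proof -
  have \<chi>': "N.inv_char \<chi> \<in> NC" using \<chi> by simp
  obtain F where F: "one_fun = (\<Sum>x\<in>carrier G. \<Sum>y\<in>carrier G. sc (F x y) (proj (N.inv_char \<chi>) (gdelta x) \<star> proj \<chi> (gdelta y)))"
    using strongly_graded[OF \<chi>] by blast
  have "\<exists>q\<in>P. \<exists>a\<in>grade (N.inv_char \<chi>). \<exists>b\<in>grade \<chi>. (e \<star> a \<star> ee q) \<star> (ee q \<star> b \<star> e) \<noteq> 0"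
  proof (rule ccontr)
    assume neg: "\<not> ?thesis"
    have z: "e \<star> (a \<star> b) \<star> e = 0" if "a \<in> grade (N.inv_char \<chi>)" "b \<in> grade \<chi>" for a b
    proof -
      have "a \<star> b = a \<star> (one_fun \<star> b)" using that by simp
      also have "\<dots> = (\<Sum>q\<in>P. a \<star> (ee q \<star> b))" unfolding sum_eq[symmetric] by (simp add: gstar_sum_left gstar_sum_right)
      also have "\<dots> = (\<Sum>q\<in>P. (a \<star> ee q) \<star> (ee q \<star> b))"
      proof (intro sum.cong refl)
        fix q assume q: "q \<in> P"
        have "(a \<star> ee q) \<star> (ee q \<star> b) = a \<star> ((ee q \<star> ee q) \<star> b)" by (simp only: star_assoc)
        then show "a \<star> (ee q \<star> b) = (a \<star> ee q) \<star> (ee q \<star> b)" using q by (simp add: eq_eq)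
      qed
      finally have "e \<star> (a \<star> b) \<star> e = (\<Sum>q\<in>P. (e \<star> a \<star> ee q) \<star> (ee q \<star> b \<star> e))"
        by (simp add: gstar_sum_left gstar_sum_right star_assoc)
      also have "\<dots> = (\<Sum>q\<in>P. 0)" using neg that by (intro sum.cong refl) blast
      finally show ?thesis by (simp only: sum.neutral_const)
    qed
    have "e = e \<star> one_fun \<star> e" by simp
    also have "\<dots> = (\<Sum>x\<in>carrier G. \<Sum>y\<in>carrier G. sc (F x y) (e \<star> (proj (N.inv_char \<chi>) (gdelta x) \<star> proj \<chi> (gdelta y)) \<star> e))"
      by (subst F) (simp only: gstar_sum_left gstar_sum_right gstar_sc_left gstar_sc_right)
    also have "\<dots> = 0" by (simp only: z[OF proj_grade[OF \<chi>'] proj_grade[OF \<chi>]] sc_simps sum.neutral_const)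
    finally show False using e_nz by simp
  qed
  then obtain q a0 b0 where q: "q \<in> P" and a0: "a0 \<in> grade (N.inv_char \<chi>)" and b0: "b0 \<in> grade \<chi>"
    and nz: "(e \<star> a0 \<star> ee q) \<star> (ee q \<star> b0 \<star> e) \<noteq> 0" by blast
  define a where "a = e \<star> a0 \<star> ee q"
  define b where "b = ee q \<star> b0 \<star> e"
  have a: "a \<in> grade (N.inv_char \<chi>)"
    using grade_star[OF grade_star[OF e_grade a0] eq_grade[OF q]] \<chi>' unfolding a_def by simp
  have b: "b \<in> grade \<chi>"
    using grade_star[OF grade_star[OF eq_grade[OF q] b0] e_grade] \<chi> unfolding b_def by simp
  have ab0: "ee q \<star> b = b" "b \<star> e = b" "e \<star> a = a" "a \<star> ee q = a"
    unfolding a_def b_def using q by (simp_all add: star_assoc eq_eq) (simp_all add: star_assoc[symmetric] eq_eq)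
  have "a \<star> b \<in> grade N.triv_char" "b \<star> a \<in> grade N.triv_char"
    using grade_star[OF a b] grade_star[OF b a] \<chi> by simp_all
  then obtain c c' where c: "(a \<star> b) \<star> ee \<one> = sc c (ee \<one>)" "(b \<star> a) \<star> ee q = sc c' (ee q)"
    using triv_star_eq[of _ \<one>] triv_star_eq[of _ q] q by (metis P.H.one_closed)
  have ab: "a \<star> b = sc c e" "b \<star> a = sc c' (ee q)"
    using c ab0 by (simp_all add: star_assoc)
  have "c \<noteq> 0" using nz ab(1) unfolding a_def[symmetric] b_def[symmetric] by auto
  have b_nz: "b \<noteq> 0" using nz unfolding a_def[symmetric] b_def[symmetric] by auto
  \<comment> \<open>Associativity shows that the scalars of the two products agree, so a single
    rescaling inverts on both sides.\<close>
  have "sc c b = b \<star> (a \<star> b)" using ab ab0 by simp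
  also have "\<dots> = (b \<star> a) \<star> b" by (simp only: star_assoc)
  also have "\<dots> = sc c' b" by (simp only: ab ab0 gstar_sc_left)
  finally have "c = c'" using b_nz by (rule sc_cancel)
  have "good \<chi> q (sc (1 / c) a) b"
    unfolding good_def using q a b ab0 ab \<open>c \<noteq> 0\<close> \<open>c = c'\<close> by (simp add: grade_sc)
  then show ?thesis by blast
qed

lemma good_nz: "good \<chi> q a b \<Longrightarrow> b \<noteq> 0"
  using e_nz by (auto simp: good_def)

text \<open>f e = (f a) b, and f a is a multiple of the idempotent at q.\<close>

lemma good_star_e:
  assumes "good \<chi> q a b" "\<chi> \<in> NC" "f \<in> grade \<chi>" shows "\<exists>c. f \<star> e = sc c b"
proof -
  have g: "q \<in> P" "a \<in> grade (N.inv_char \<chi>)" "b \<in> grade \<chi>" "ee q \<star> b = b" "b \<star> e = b" "e \<star> a = a" "a \<star> ee q = a" "a \<star> b = e" "b \<star> a = ee q"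
    using assms(1) by (auto simp: good_def)
  have "f \<star> a \<in> grade N.triv_char" using grade_star[OF assms(3) g(2)] assms(2) by simp
  then obtain c where "(f \<star> a) \<star> ee q = sc c (ee q)" using triv_star_eq[OF _ g(1)] by blast
  then have "f \<star> a = sc c (ee q)" using g by (simp add: star_assoc)
  then have "(f \<star> a) \<star> b = sc c b" using g by simp
  then show ?thesis using g by (auto simp: star_assoc)
qed

text \<open>By \<open>good_star_e\<close> the element b' is a multiple of b, so the idempotents at q
  and q' both fix it from the left; orthogonality makes them equal.\<close>

lemma good_unique:
  assumes "good \<chi> q a b" "\<chi> \<in> NC" "b' \<in> grade \<chi>" "b' \<noteq> 0" "q' \<in> P" "ee q' \<star> b' = b'" "b' \<star> e = b'"
  shows "q' = q"
proof -
  obtain c where c: "b' = sc c b" using good_star_e[OF assms(1-3)] assms(7) by auto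
  have q: "q \<in> P" "ee q \<star> b = b" using assms(1) by (auto simp: good_def)
  have "b' = ee q' \<star> (ee q \<star> b')" using assms(6) q c by simp
  also have "\<dots> = (ee q' \<star> ee q) \<star> b'" by (simp only: star_assoc)
  finally show ?thesis using eq_eq[OF assms(5) q(1)] assms(4) by (auto split: if_splits)
qed

text \<open>The point of P whose idempotent is linked to e in degree \<chi>;
  \<open>good_unique\<close> makes the choice irrelevant.\<close>

definition "\<sigma> \<chi> = (SOME q. \<exists>a b. good \<chi> q a b)"

lemma \<sigma>_good: "\<chi> \<in> NC \<Longrightarrow> \<exists>a b. good \<chi> (\<sigma> \<chi>) a b"
  unfolding \<sigma>_def using good_exists[of \<chi>] by (rule someI_ex)

lemma \<sigma>_P [simp]: "\<chi> \<in> NC \<Longrightarrow> \<sigma> \<chi> \<in> P"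
  using \<sigma>_good[of \<chi>] by (auto simp: good_def)

text \<open>Translating the link for \<psi> by \<sigma> \<chi> and composing it with the link for
  \<chi> gives a nonzero element from e to the idempotent at the product, and
  \<open>good_unique\<close> identifies that target.\<close>

lemma \<sigma>_mult:
  assumes "\<psi> \<in> NC" "\<chi> \<in> NC"
  shows "\<sigma> (char_mult (cact (\<sigma> \<chi>) \<psi>) \<chi>) = \<sigma> \<chi> \<otimes> \<sigma> \<psi>"
proof -
  let ?g = "\<sigma> \<chi>" and ?h = "\<sigma> \<psi>"
  have gh: "?g \<in> P" "?h \<in> P" using assms by auto
  obtain a1 b1 where g1: "good \<chi> ?g a1 b1" using \<sigma>_good[OF assms(2)] by blast
  obtain a2 b2 where g2: "good \<psi> ?h a2 b2" using \<sigma>_good[OF assms(1)] by blast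
  let ?b = "act ?g b2 \<star> b1"
  note G1 = g1[unfolded good_def] and G2 = g2[unfolded good_def]
  have "?b \<in> grade (char_mult (cact ?g \<psi>) \<chi>)" using G1 G2 gh by (intro grade_star grade_act_G) auto
  moreover have "act ?g a2 \<star> ?b = b1"
  proof -
    have "act ?g a2 \<star> ?b = act ?g (a2 \<star> b2) \<star> b1" using gh by (simp add: act_gstar star_assoc)
    then show ?thesis using G1 G2 by simp
  qed
  then have "?b \<noteq> 0" using good_nz[OF g1] by auto
  moreover have "ee (?g \<otimes> ?h) \<star> ?b = ?b"
  proof -
    have "ee (?g \<otimes> ?h) \<star> ?b = act ?g (ee ?h \<star> b2) \<star> b1" using gh by (simp add: act_gstar act_act star_assoc)
    then show ?thesis using G2 by simp
  qed
  moreover have "?b \<star> e = ?b" using G1 by (simp add: star_assoc)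
  moreover obtain a b where "good (char_mult (cact ?g \<psi>) \<chi>) (\<sigma> (char_mult (cact ?g \<psi>) \<chi>)) a b"
    using \<sigma>_good[of "char_mult (cact ?g \<psi>) \<chi>"] assms gh by auto
  ultimately show ?thesis using good_unique[of _ _ a b ?b "?g \<otimes> ?h"] assms gh by auto
qed

text \<open>If \<open>\<sigma> \<chi>\<close> is an involution t, then \<open>\<eta> \<mapsto> cact (\<sigma> \<eta>) \<chi> \<cdot> \<eta>\<close> matches the fibres of \<open>\<sigma>\<close> over q and
  q t, so that the dual of N would have an even number of elements.\<close>
lemma \<sigma>_trivial:
  assumes odd: "odd (card N)" and four: "card P = 4" and \<chi>: "\<chi> \<in> NC"
  shows "\<sigma> \<chi> = \<one>"
proof (rule ccontr)
  assume nt: "\<sigma> \<chi> \<noteq> \<one>"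
  have p4: "p [^] (4::nat) = \<one>" if p: "p \<in> P" for p
  proof -
    interpret GP: group "G\<lparr>carrier := P\<rparr>" using P.comm_group_H by (simp add: comm_group_def)
    show ?thesis using GP.pow_order_eq_1[of p] p by (simp add: Coset.order_def nat_pow_consistent[symmetric] four)
  qed
  have "\<exists>\<chi>0\<in>NC. \<sigma> \<chi>0 \<noteq> \<one> \<and> \<sigma> \<chi>0 \<otimes> \<sigma> \<chi>0 = \<one>"
  proof (cases "\<sigma> \<chi> \<otimes> \<sigma> \<chi> = \<one>")
    case True
    then show ?thesis using nt \<chi> by blast
  next
    case False
    \<comment> \<open>A value of order 4 is replaced by its square, an involution, which
      \<open>\<sigma>_mult\<close> with both arguments \<chi> shows to be a value of \<sigma> as
      well.\<close>
    let ?c = "char_mult (cact (\<sigma> \<chi>) \<chi>) \<chi>"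
    have 1: "\<sigma> ?c = \<sigma> \<chi> \<otimes> \<sigma> \<chi>" by (rule \<sigma>_mult[OF \<chi> \<chi>])
    have "\<sigma> ?c \<otimes> \<sigma> ?c = \<sigma> \<chi> [^] (4::nat)" using \<chi> by (simp add: 1 numeral_eq_Suc m_assoc)
    then show ?thesis using p4 False 1 \<chi> by (intro bexI[of _ ?c]) auto
  qed
  then obtain \<chi>0 where c0: "\<chi>0 \<in> NC" and t: "\<sigma> \<chi>0 \<noteq> \<one>" "\<sigma> \<chi>0 \<otimes> \<sigma> \<chi>0 = \<one>" by blast
  let ?t = "\<sigma> \<chi>0"
  have tP: "?t \<in> P" using c0 by simp
  define T where "T \<eta> = char_mult (cact (\<sigma> \<eta>) \<chi>0) \<eta>" for \<eta>
  have T_in: "T \<eta> \<in> NC" and \<sigma>T: "\<sigma> (T \<eta>) = \<sigma> \<eta> \<otimes> ?t" if "\<eta> \<in> NC" for \<eta>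
    unfolding T_def using that c0 by (auto intro: \<sigma>_mult)
  have injT: "inj_on T NC"
  proof (rule inj_onI)
    fix x y assume xy: "x \<in> NC" "y \<in> NC" "T x = T y"
    then have "\<sigma> x \<otimes> ?t = \<sigma> y \<otimes> ?t" using \<sigma>T by metis
    then have "\<sigma> x = \<sigma> y" using xy tP by simp
    then have "char_mult (cact (\<sigma> x) \<chi>0) x = char_mult (cact (\<sigma> x) \<chi>0) y" using xy(3) by (simp add: T_def)
    then have "char_mult (N.inv_char (cact (\<sigma> x) \<chi>0)) (char_mult (cact (\<sigma> x) \<chi>0) x)
       = char_mult (N.inv_char (cact (\<sigma> x) \<chi>0)) (char_mult (cact (\<sigma> x) \<chi>0) y)" by simp
    then show "x = y" using xy c0 by simp
  qed
  define Fb where "Fb q = {\<eta> \<in> NC. \<sigma> \<eta> = q}" for q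
  have finF: "finite (Fb q)" for q by (simp add: Fb_def)
  have le: "card (Fb q) \<le> card (Fb (q \<otimes> ?t))" if "q \<in> P" for q
  proof (rule card_inj_on_le[OF _ _ finF])
    show "inj_on T (Fb q)" using injT by (rule inj_on_subset) (auto simp: Fb_def)
    show "T ` Fb q \<subseteq> Fb (q \<otimes> ?t)" using T_in \<sigma>T by (auto simp: Fb_def)
  qed
  have eqc: "card (Fb (q \<otimes> ?t)) = card (Fb q)" if "q \<in> P" for q
    using le[OF that] le[of "q \<otimes> ?t"] that tP t by (simp add: m_assoc)
  have "card {\<one>, ?t} = 2" using t by simp
  then have "\<not> P \<subseteq> {\<one>, ?t}" using four card_mono[of "{\<one>, ?t}" P] by auto
  then obtain r where r: "r \<in> P" "r \<noteq> \<one>" "r \<noteq> ?t" by blast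
  have rt: "r \<otimes> ?t \<noteq> \<one>" "r \<otimes> ?t \<noteq> ?t" "r \<otimes> ?t \<noteq> r"
  proof -
    show "r \<otimes> ?t \<noteq> \<one>"
    proof
      assume "r \<otimes> ?t = \<one>"
      then have "r \<otimes> ?t = ?t \<otimes> ?t" using t by simp
      then show False using r tP by simp
    qed
  qed (use r tP t in simp_all)
  have "{\<one>, ?t, r, r \<otimes> ?t} \<subseteq> P" using r tP by auto
  moreover have "card {\<one>, ?t, r, r \<otimes> ?t} = 4" using r rt t by (auto simp: card_insert_if)
  \<comment> \<open>P consists of the two cosets of {1, t}. Equal fibres within each coset make the
    dual of N even, while it has as many elements as N.\<close>
  ultimately have P_eq: "P = {\<one>, ?t, r, r \<otimes> ?t}" using card_subset_eq[OF P.finite_H] four by metis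
  have "card NC = (\<Sum>q\<in>P. card (Fb q))"
  proof -
    have "NC = (\<Union>q\<in>P. Fb q)" by (auto simp: Fb_def)
    then have "card NC = card (\<Union>q\<in>P. Fb q)" by simp
    also have "\<dots> = (\<Sum>q\<in>P. card (Fb q))"
      by (rule card_UN_disjoint) (auto simp: finF, auto simp: Fb_def)
    finally show ?thesis .
  qed
  also have "\<dots> = (\<Sum>q\<in>{\<one>, ?t, r, r \<otimes> ?t}. card (Fb q))" by (rule sum.cong[OF P_eq refl])
  also have "\<dots> = 2 * (card (Fb \<one>) + card (Fb r))"
    using r rt t eqc[of \<one>] eqc[OF r(1)] tP by simp
  finally show False using odd N.card_chars[where 'k = 'k] by simp
qed

end

lemma gpush_map_prod_id:
  assumes "fin_group G" "J \<in> galg G" shows "gpush G (map_prod id id) J = J"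
proof -
  interpret fin_group G by fact
  have h: "map_prod id id \<in> carrier G \<rightarrow> carrier G" by (auto simp: prod.map_id)
  show ?thesis
    by (rule galg_eqI[OF gpush_galg[OF h] assms(2)]) (simp add: sum_gpush[OF fin h] prod.map_id)
qed

text \<open>Since \<sigma> is trivial, every degree \<chi> contains an element u \<chi> linking e to
  itself, and the star algebra is induced from the twisted group algebra they span. J is then gauge
  equivalent to a twist supported on N \<times> N, for which kN is a proper nontrivial normal Hopf
  subalgebra.\<close>

lemma (in split_semidirect) not_simple:
  assumes odd: "odd (card N)" and four: "card P = 4" and nontriv: "card N \<noteq> 1"
  shows "\<not> twisted_simple G J"
proof
  assume simple: "twisted_simple G J"
  have good1: "\<exists>a b. good \<chi> \<one> a b \<and> (\<chi> = N.triv_char \<longrightarrow> b = e)" if "\<chi> \<in> NC" for \<chi>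
  proof (cases "\<chi> = N.triv_char")
    case True
    then show ?thesis using good_triv by blast
  next
    case False
    then show ?thesis using \<sigma>_good[OF that] \<sigma>_trivial[OF odd four that] by auto
  qed
  \<comment> \<open>In trivial degree the choice is pinned to e, so that the resulting \<omega> is
    normalised.\<close>
  define u where "u \<chi> = (SOME b. (\<exists>a. good \<chi> \<one> a b) \<and> (\<chi> = N.triv_char \<longrightarrow> b = e))" for \<chi>
  have u: "(\<exists>a. good \<chi> \<one> a (u \<chi>)) \<and> (\<chi> = N.triv_char \<longrightarrow> u \<chi> = e)" if "\<chi> \<in> NC" for \<chi>
    unfolding u_def
    by (rule someI_ex[where P = "\<lambda>b. (\<exists>a. good \<chi> \<one> a b) \<and> (\<chi> = N.triv_char \<longrightarrow> b = e)"]) (use good1[OF that] in blast)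
  have u_grade: "u \<chi> \<in> grade \<chi>" and u_e: "e \<star> u \<chi> = u \<chi>" "u \<chi> \<star> e = u \<chi>" and u_nz: "u \<chi> \<noteq> 0" if \<chi>: "\<chi> \<in> NC" for \<chi>
  proof -
    obtain a where g: "good \<chi> \<one> a (u \<chi>)" using u[OF \<chi>] by blast
    show "u \<chi> \<in> grade \<chi>" "e \<star> u \<chi> = u \<chi>" "u \<chi> \<star> e = u \<chi>" using g by (auto simp: good_def)
    show "u \<chi> \<noteq> 0" by (rule good_nz[OF g])
  qed
  have star_e: "\<exists>c. f \<star> e = sc c (u \<chi>)" if "\<chi> \<in> NC" "f \<in> grade \<chi>" for \<chi> f
    using u[OF that(1)] good_star_e[OF _ that] by blast
  have star_ee: "\<exists>c. f \<star> ee q = sc c (act q (u (cact (inv q) \<chi>)))" if \<chi>: "\<chi> \<in> NC" "f \<in> grade \<chi>" "q \<in> P" for \<chi> f q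
  proof -
    have "act (inv q) f \<in> grade (cact (inv q) \<chi>)" using \<chi> by (intro grade_act_G) auto
    then obtain c where c: "act (inv q) f \<star> e = sc c (u (cact (inv q) \<chi>))"
      using star_e[of "cact (inv q) \<chi>"] \<chi> by auto
    have "f \<star> ee q = act q (act (inv q) f \<star> e)" using \<chi> by (simp add: act_gstar)
    then show ?thesis unfolding c by (auto simp: act_sc)
  qed
  have abs: "ee q \<star> (f \<star> ee q) = f \<star> ee q" if \<chi>: "\<chi> \<in> NC" "f \<in> grade \<chi>" "q \<in> P" for \<chi> f q
  proof -
    obtain c where c: "f \<star> ee q = sc c (act q (u (cact (inv q) \<chi>)))" using star_ee[OF \<chi>] by blast
    have "ee q \<star> act q (u (cact (inv q) \<chi>)) = act q (u (cact (inv q) \<chi>))"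
      using \<chi> u_e(1)[of "cact (inv q) \<chi>"] by (simp flip: act_gstar)
    then show ?thesis by (simp add: c)
  qed
  have central: "e \<star> f = f \<star> e" if \<chi>: "\<chi> \<in> NC" "f \<in> grade \<chi>" for \<chi> f
  proof -
    have "e \<star> f = e \<star> (f \<star> one_fun)" using that by simp
    also have "\<dots> = (\<Sum>q\<in>P. e \<star> (f \<star> ee q))" unfolding sum_eq[symmetric] by (simp add: gstar_sum_right)
    also have "\<dots> = (\<Sum>q\<in>P. if q = \<one> then f \<star> e else 0)"
    proof (intro sum.cong refl)
      fix q assume q: "q \<in> P"
      have "e \<star> (f \<star> ee q) = (ee \<one> \<star> ee q) \<star> (f \<star> ee q)" using abs[OF \<chi> q] by (simp add: star_assoc)
      also have "\<dots> = (if q = \<one> then f \<star> e else 0)"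
        unfolding eq_eq[OF P.H.one_closed q] using abs[OF \<chi> P.H.one_closed] by auto
      finally show "e \<star> (f \<star> ee q) = (if q = \<one> then f \<star> e else 0)" .
    qed
    finally show ?thesis by (simp add: sum.delta)
  qed
  define \<omega> where "\<omega> \<alpha> \<beta> = (SOME c. u \<alpha> \<star> u \<beta> = sc c (u (char_mult \<alpha> \<beta>)))" for \<alpha> \<beta>
  have \<omega>: "u \<alpha> \<star> u \<beta> = sc (\<omega> \<alpha> \<beta>) (u (char_mult \<alpha> \<beta>))" if "\<alpha> \<in> NC" "\<beta> \<in> NC" for \<alpha> \<beta>
    unfolding \<omega>_def
  proof (rule someI_ex)
    have "u \<alpha> \<star> u \<beta> \<in> grade (char_mult \<alpha> \<beta>)" using that u_grade by (intro grade_star) auto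
    from star_e[OF N.char_mult_in[OF that] this]
    show "\<exists>c. u \<alpha> \<star> u \<beta> = sc c (u (char_mult \<alpha> \<beta>))" using u_e(2)[OF that(2)] by (simp add: star_assoc)
  qed
  have \<omega>1: "\<omega> N.triv_char \<alpha> = 1" "\<omega> \<alpha> N.triv_char = 1" if "\<alpha> \<in> NC" for \<alpha>
  proof -
    have "u N.triv_char = e" using u[OF N.triv_char_in] by blast
    then have "sc (\<omega> N.triv_char \<alpha>) (u \<alpha>) = sc 1 (u \<alpha>)" "sc (\<omega> \<alpha> N.triv_char) (u \<alpha>) = sc 1 (u \<alpha>)"
      using \<omega>[OF N.triv_char_in that] \<omega>[OF that N.triv_char_in] u_e[OF that] that by simp_all
    then show "\<omega> N.triv_char \<alpha> = 1" "\<omega> \<alpha> N.triv_char = 1" using sc_cancel[OF _ u_nz[OF that]] by blast+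
  qed
  \<comment> \<open>e has trivial N-degree, so only the P-part of g moves it; for g outside N the
    translate is an orthogonal idempotent.\<close>
  have ee_pr: "act g e = ee (pr g)" if g: "g \<in> carrier G" for g
  proof -
    obtain n where n: "n \<in> N" "g = n \<otimes> pr g" using pr_decomp[OF g] by blast
    have "act n (act (pr g) e) = act (n \<otimes> pr g) e" by (rule act_act) (simp_all add: n(1) g)
    then have "act g e = act n (act (pr g) e)" by (simp only: n(2)[symmetric])
    also have "\<dots> = act (pr g) e" using grade_act[OF eq_grade[OF pr_P[OF g]] n(1)] n(1) by (simp add: N.triv_char_def)
    finally show ?thesis .
  qed
  interpret gd: gauge_data G J N u \<omega>
  proof unfold_locales
    fix \<alpha> assume a: "\<alpha> \<in> NC"
    show "u \<alpha> \<in> galg G" using u_grade[OF a] by simp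
    show "act h (u \<alpha>) = sc (\<alpha> (inv h)) (u \<alpha>)" if "h \<in> N" for h using grade_act[OF u_grade[OF a] that] .
    show "\<omega> N.triv_char \<alpha> = 1" "\<omega> \<alpha> N.triv_char = 1" using \<omega>1[OF a] by auto
    fix \<beta> assume b: "\<beta> \<in> NC"
    show "u \<alpha> \<star> u \<beta> = sc (\<omega> \<alpha> \<beta>) (u (char_mult \<alpha> \<beta>))" by (rule \<omega>[OF a b])
    fix g assume g: "g \<in> carrier G" "g \<notin> N"
    have "u \<alpha> \<star> act g (u \<beta>) = (u \<alpha> \<star> e) \<star> act g (e \<star> u \<beta>)" using u_e a b by simp
    also have "\<dots> = u \<alpha> \<star> ((ee \<one> \<star> ee (pr g)) \<star> act g (u \<beta>))" 
      unfolding act_gstar[OF g(1)] ee_pr[OF g(1)] eq_one by (simp only: star_assoc)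
    also have "ee \<one> \<star> ee (pr g) = 0"
    proof -
      have "\<one> \<noteq> pr g" using g pr_eq_one_iff[of g] by metis
      then show ?thesis using eq_eq[OF P.H.one_closed pr_P[OF g(1)]] by (simp only: if_False)
    qed
    finally show "u \<alpha> \<star> act g (u \<beta>) = 0" by (simp only: gstar_zero_left gstar_zero_right)
  next
    fix f :: "'a \<Rightarrow> 'k" assume f: "f \<in> galg G"
    have "\<exists>c. proj \<chi> f \<star> ee q = sc c (act q (u (cact (inv q) \<chi>)))" if "\<chi> \<in> NC" "q \<in> P" for \<chi> q
      using star_ee[OF that(1) proj_grade[OF that(1)] that(2)] .
    then obtain c where c: "\<And>\<chi> q. \<chi> \<in> NC \<Longrightarrow> q \<in> P \<Longrightarrow> proj \<chi> f \<star> ee q = sc (c \<chi> q) (act q (u (cact (inv q) \<chi>)))" by metis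
    have bij: "bij_betw (cact q) NC NC" if "q \<in> P" for q
      by (rule bij_betwI[where g = "cact (inv q)"]) (use that in auto)
    \<comment> \<open>Splitting f by degrees and by the idempotents leaves pieces that are multiples
      of translates of some u.\<close>
    have "f = f \<star> one_fun" using f by simp
    also have "\<dots> = (\<Sum>q\<in>P. (\<Sum>\<chi>\<in>NC. proj \<chi> f) \<star> ee q)"
      unfolding sum_eq[symmetric] sum_proj[OF f] by (rule gstar_sum_right)
    also have "\<dots> = (\<Sum>q\<in>P. \<Sum>\<chi>\<in>NC. sc (c \<chi> q) (act q (u (cact (inv q) \<chi>))))"
      by (simp add: gstar_sum_left c cong: sum.cong)
    also have "\<dots> = (\<Sum>q\<in>P. \<Sum>\<chi>\<in>NC. sc (c (cact q \<chi>) q) (act q (u \<chi>)))"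
    proof (rule sum.cong[OF refl])
      fix q assume q: "q \<in> P"
      have "(\<Sum>\<chi>\<in>NC. sc (c \<chi> q) (act q (u (cact (inv q) \<chi>)))) = (\<Sum>\<chi>\<in>NC. sc (c (cact q \<chi>) q) (act q (u (cact (inv q) (cact q \<chi>)))))"
        by (rule sum.reindex_bij_betw[OF bij[OF q], symmetric])
      then show "(\<Sum>\<chi>\<in>NC. sc (c \<chi> q) (act q (u (cact (inv q) \<chi>)))) = (\<Sum>\<chi>\<in>NC. sc (c (cact q \<chi>) q) (act q (u \<chi>)))"
        using q by (simp cong: sum.cong)
    qed
    also have "\<dots> = (\<Sum>g\<in>carrier G. \<Sum>\<chi>\<in>NC. sc (if g \<in> P then c (cact g \<chi>) g else 0) (act g (u \<chi>)))"
      using P.H.subset by (intro sum.mono_neutral_cong_left) auto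
    finally show "\<exists>C. f = (\<Sum>g\<in>carrier G. \<Sum>\<chi>\<in>NC. sc (C g \<chi>) (act g (u \<chi>)))"
      by (intro exI[of _ "\<lambda>g \<chi>. if g \<in> P then c (cact g \<chi>) g else 0"])
  qed
  obtain w where w: "w \<in> galg G" "gmult G w gd.v = gunit G" "gmult G gd.v w = gunit G" using gd.v_invertible by blast
  note gauge = gd.gauge[OF w]
  have T1: "twist G gd.J1"
    by (intro twist.intro twist_axioms.intro gauge(4)) (rule tensor_group_axioms)
  have "bialg_iso G J G gd.J1 (\<lambda>a. gmult G (gmult G (ginvol w) (gpush G id a)) (ginvol gd.v))"
  proof (rule bialg_iso_gauge[OF twist_axioms T1])
    show "id \<in> iso G G" by (simp add: iso_def hom_def)
    show "gmult G2 (gpush G2 (map_prod id id) J) (gten (ginvol gd.v) (ginvol gd.v)) = gmult G2 (gcomult G (ginvol gd.v)) gd.J1"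
      using gauge(3) by (simp add: gpush_map_prod_id[OF fin_group_G2 J_galg])
  qed (use gauge in auto)
  then have simple1: "twisted_simple G gd.J1" using simple by (rule bialg_iso.twisted_simple_transfer)
  have "normal_hopf_subalg G gd.J1 (supported_on N)"
    by (rule twist.normal_hopf_subalg_normal[OF T1 normal_N gd.J1_supp])
  moreover have "N \<noteq> carrier G"
  proof
    assume "N = carrier G"
    then have "P \<subseteq> {\<one>}" using trivial_Int P.H.subset by auto
    then have "card P \<le> card {\<one>}" by (intro card_mono) auto
    then show False using four by simp
  qed
  moreover have "N \<noteq> {\<one>}" using nontriv by auto
  ultimately show False using not_twisted_simple[OF T1 N.subgroup_H] simple1 by blast
qed

text \<open>Symmetry makes \<kappa> a coboundary, and its trivialisation s splits the degree-one
  part.\<close>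

theorem (in semidirect_twist) symmetric_not_simple:
  assumes "odd (card N)" "card P = 4" "card N \<noteq> 1"
    and "\<And>\<rho> \<mu>. \<rho> \<in> PC \<Longrightarrow> \<mu> \<in> PC \<Longrightarrow> \<kappa> \<rho> \<mu> = \<kappa> \<mu> \<rho>"
  shows "\<not> twisted_simple G J"
proof -
  obtain s where s: "\<forall>\<rho>\<in>PC. s \<rho> \<noteq> 0" "\<forall>\<rho>\<in>PC. \<forall>\<mu>\<in>PC. s \<rho> * s \<mu> * \<kappa> \<rho> \<mu> = s (char_mult \<rho> \<mu>)"
    using symmetric_cocycle_trivial[OF assms(4)] by blast
  interpret split_semidirect G J N P s
    by unfold_locales (use s in auto)
  show ?thesis by (rule not_simple[OF assms(1-3)])
qed

text \<open>For cyclic P the inflated characters are scalar multiples of the powers of a single one.\<close>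
theorem (in semidirect_twist) cyclic_not_simple:
  assumes "odd (card N)" "card P = 4" "card N \<noteq> 1"
    and p: "p \<in> P" and Pmem: "\<And>x. x \<in> P \<Longrightarrow> x = \<one> \<or> x = p \<or> x = p \<otimes> p \<or> x = p \<otimes> p \<otimes> p"
  shows "\<not> twisted_simple G J"
proof (rule symmetric_not_simple[OF assms(1-3)])
  have pp: "p \<in> carrier G" "p \<otimes> p \<in> P" "p \<otimes> p \<otimes> p \<in> P" using p by simp_all
  have "p \<otimes> p \<noteq> \<one>"
  proof
    assume "p \<otimes> p = \<one>"
    then have "P \<subseteq> {\<one>, p}" using Pmem pp by fastforce
    then have "card P \<le> card {\<one>, p}" by (intro card_mono) auto
    then show False using assms(2) card_insert_le_m1[of 2 "{p}" \<one>] by simp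
  qed
  \<comment> \<open>Being nontrivial on p p, \<tau> takes a primitive fourth root of unity at p, so
    every character of P is a power of \<tau>.\<close>
  then obtain \<tau> where \<tau>: "\<tau> \<in> PC" "\<tau> (p \<otimes> p) \<noteq> 1" using P.chars_separate[OF pp(2)] by blast
  have char_p4: "\<rho> p ^ 4 = 1" if "\<rho> \<in> PC" for \<rho>
  proof -
    interpret GP: group "G\<lparr>carrier := P\<rparr>" using P.comm_group_H by (simp add: comm_group_def)
    have "p [^] (4::nat) = \<one>" using GP.pow_order_eq_1[of p] p by (simp add: Coset.order_def nat_pow_consistent[symmetric] assms(2))
    then have "p \<otimes> p \<otimes> p \<otimes> p = \<one>" using pp by (simp add: numeral_eq_Suc)
    then have "\<rho> (p \<otimes> p \<otimes> p \<otimes> p) = 1" using P.chars_one[OF that] by simp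
    then show ?thesis using that p pp by (simp add: P.chars_mult numeral_eq_Suc mult_ac)
  qed
  let ?z = "\<tau> p"
  have z2: "?z ^ 2 = - 1"
  proof -
    have "?z ^ 2 \<noteq> 1" using \<tau> p by (simp add: P.chars_mult power2_eq_square)
    moreover have "(?z ^ 2) ^ 2 = 1" using char_p4[OF \<tau>(1)] by (simp flip: power_mult)
    ultimately show ?thesis using power2_eq_1_iff by blast
  qed
  have val: "\<exists>i. \<rho> p = ?z ^ i" if "\<rho> \<in> PC" for \<rho>
  proof -
    have "(\<rho> p ^ 2) ^ 2 = 1" using char_p4[OF that] by (simp flip: power_mult)
    then consider "\<rho> p ^ 2 = 1" | "\<rho> p ^ 2 = ?z ^ 2" using power2_eq_1_iff z2 by metis
    then show ?thesis
    proof cases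
      case 1
      then have "\<rho> p = 1 \<or> \<rho> p = - 1" by (simp add: power2_eq_1_iff)
      then have "\<rho> p = ?z ^ 0 \<or> \<rho> p = ?z ^ 2" using z2 by simp
      then show ?thesis by blast
    next
      case 2
      then have "\<rho> p = ?z \<or> \<rho> p = - ?z" by (simp add: power2_eq_iff)
      moreover have "?z ^ 3 = - ?z" using z2 by (simp add: power3_eq_cube power2_eq_square)
      ultimately have "\<rho> p = ?z ^ 1 \<or> \<rho> p = ?z ^ 3" by simp
      then show ?thesis by blast
    qed
  qed
  \<comment> \<open>\<open>pw\<close> are the star powers of infl \<tau>, which commute, and
    \<open>cp\<close> are the characters to which they are proportional; commuting two powers gives
    the symmetry of \<kappa>.\<close>
  define pw where "pw i = ((\<lambda>f. infl \<tau> \<star> f) ^^ i) one_fun" for i :: nat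
  have pw_comm: "pw i \<star> pw j = pw (i + j)" for i j
  proof (induction i)
    case 0
    have "pw j \<in> galg G" by (cases j) (auto simp: pw_def)
    then show ?case by (simp add: pw_def)
  next
    case (Suc i)
    then show ?case by (simp add: pw_def star_assoc)
  qed
  define cp where "cp i = ((\<lambda>f. char_mult \<tau> f) ^^ i) P.triv_char" for i :: nat
  have cp_in: "cp i \<in> PC" for i using \<tau> by (induction i) (auto simp: cp_def)
  have cp_val: "cp i p = ?z ^ i" for i
    using p by (induction i) (auto simp: cp_def char_mult_def P.triv_char_def)
  have pw_cp: "\<exists>c. c \<noteq> 0 \<and> pw i = sc c (infl (cp i))" for i
  proof (induction i)
    case 0
    then show ?case by (intro exI[of _ 1]) (simp add: pw_def cp_def)
  next
    case (Suc i)
    then obtain c where c: "c \<noteq> 0" "pw i = sc c (infl (cp i))" by blast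
    have "pw (Suc i) = sc (c * \<kappa> \<tau> (cp i)) (infl (cp (Suc i)))"
      using c infl_star[OF \<tau>(1) cp_in[of i]] by (simp add: pw_def cp_def)
    then show ?case using c \<kappa>_nz[OF \<tau>(1) cp_in[of i]] by (intro exI[of _ "c * \<kappa> \<tau> (cp i)"]) simp
  qed
  have cp_all: "\<exists>i. \<rho> = cp i" if \<rho>: "\<rho> \<in> PC" for \<rho>
  proof -
    obtain i where i: "\<rho> p = ?z ^ i" using val[OF \<rho>] by blast
    have "\<rho> x = cp i x" if "x \<in> P" for x
    proof -
      have "x = \<one> \<or> x = p \<or> x = p \<otimes> p \<or> x = p \<otimes> p \<otimes> p" by (rule Pmem[OF that])
      then show ?thesis
        using i cp_val[of i] \<open>\<rho> \<in> PC\<close> cp_in[of i] p pp by (auto simp: P.chars_one P.chars_mult)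
    qed
    then have "\<rho> = cp i" using P.chars_eqI[OF \<rho> cp_in] by blast
    then show ?thesis ..
  qed
  fix \<rho> \<mu> assume r: "\<rho> \<in> PC" and m: "\<mu> \<in> PC"
  obtain i j where ij: "\<rho> = cp i" "\<mu> = cp j" using cp_all[OF r] cp_all[OF m] by blast
  obtain c d where cd: "c \<noteq> 0" "pw i = sc c (infl \<rho>)" "d \<noteq> 0" "pw j = sc d (infl \<mu>)" using pw_cp[of i] pw_cp[of j] ij by blast
  have "pw i \<star> pw j = pw j \<star> pw i" by (simp add: pw_comm add.commute)
  then have "sc (c * d * \<kappa> \<rho> \<mu>) (infl (char_mult \<rho> \<mu>)) = sc (c * d * \<kappa> \<mu> \<rho>) (infl (char_mult \<rho> \<mu>))"
    using r m by (simp add: cd infl_star P.char_mult_commute[of \<mu>] mult_ac)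
  then have "c * d * \<kappa> \<rho> \<mu> = c * d * \<kappa> \<mu> \<rho>" by (rule sc_cancel) (use r m in \<open>simp add: infl_nz\<close>)
  then show "\<kappa> \<rho> \<mu> = \<kappa> \<mu> \<rho>" using cd by simp
qed

section \<open>Nondegenerate cocycles on a Klein four-group\<close>

context semidirect_twist
begin

definition "Linv \<rho> = sc (inverse (\<kappa> \<rho> (P.inv_char \<rho>))) (infl (P.inv_char \<rho>))"

lemma Linv_galg [simp]: "Linv \<rho> \<in> galg G" by (simp add: Linv_def)

text \<open>The cocycle equation at \<rho>, \<rho>^-1, \<rho> equates the scalars of the two
  products, so one normalisation inverts on both sides.\<close>

lemma Linv_left:
  assumes r: "\<rho> \<in> PC" shows "infl \<rho> \<star> Linv \<rho> = one_fun" "Linv \<rho> \<star> infl \<rho> = one_fun"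
proof -
  have i: "P.inv_char \<rho> \<in> PC" using r by simp
  have "\<kappa> \<rho> (P.inv_char \<rho>) = \<kappa> (P.inv_char \<rho>) \<rho>" using \<kappa>_cocycle[OF r i r] r by simp
  then show "infl \<rho> \<star> Linv \<rho> = one_fun" "Linv \<rho> \<star> infl \<rho> = one_fun"
    using r \<kappa>_nz[OF r i] by (simp_all add: Linv_def infl_star)
qed

lemma Linv_cancel [simp]:
  assumes "\<rho> \<in> PC" "f \<in> galg G"
  shows "infl \<rho> \<star> (Linv \<rho> \<star> f) = f" "Linv \<rho> \<star> (infl \<rho> \<star> f) = f"
  using assms Linv_left[OF assms(1)] by (simp_all flip: star_assoc)

lemma Linv_grade: "\<rho> \<in> PC \<Longrightarrow> Linv \<rho> \<in> grade N.triv_char"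
  unfolding Linv_def by (intro grade_sc infl_grade P.inv_char_in)

definition "\<theta> \<rho> f = infl \<rho> \<star> f \<star> Linv \<rho>"

lemma \<theta>_galg [simp]: "\<theta> \<rho> f \<in> galg G" by (simp add: \<theta>_def)

text \<open>Scalars cancel in a conjugation, so the projective family of inflated characters induces
  a genuine action of the dual of P.\<close>

lemma \<theta>_\<theta>:
  assumes "\<rho> \<in> PC" "\<mu> \<in> PC" shows "\<theta> \<rho> (\<theta> \<mu> f) = \<theta> (char_mult \<rho> \<mu>) f"
proof -
  let ?k = "\<kappa> \<rho> \<mu>" and ?rm = "char_mult \<rho> \<mu>"
  have rm: "?rm \<in> PC" using assms by simp
  have "infl ?rm \<star> sc ?k (Linv \<mu> \<star> Linv \<rho>) = (infl \<rho> \<star> infl \<mu>) \<star> (Linv \<mu> \<star> Linv \<rho>)"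
    using assms by (simp add: infl_star)
  also have "\<dots> = infl \<rho> \<star> (infl \<mu> \<star> (Linv \<mu> \<star> Linv \<rho>))" by (simp only: star_assoc)
  also have "\<dots> = one_fun" using assms by (simp add: Linv_left)
  finally have *: "infl ?rm \<star> sc ?k (Linv \<mu> \<star> Linv \<rho>) = one_fun" .
  have "sc ?k (Linv \<mu> \<star> Linv \<rho>) = Linv ?rm \<star> (infl ?rm \<star> sc ?k (Linv \<mu> \<star> Linv \<rho>))"
    using rm by (simp del: gstar_sc_right)
  then have **: "sc ?k (Linv \<mu> \<star> Linv \<rho>) = Linv ?rm" unfolding * by simp
  have "\<theta> \<rho> (\<theta> \<mu> f) = (infl \<rho> \<star> infl \<mu>) \<star> f \<star> (Linv \<mu> \<star> Linv \<rho>)" by (simp add: \<theta>_def star_assoc)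
  also have "\<dots> = infl ?rm \<star> f \<star> sc ?k (Linv \<mu> \<star> Linv \<rho>)" using assms by (simp add: infl_star)
  finally show ?thesis by (simp add: ** \<theta>_def)
qed

lemma \<theta>_sum: "\<theta> \<rho> (\<Sum>i\<in>I. f i) = (\<Sum>i\<in>I. \<theta> \<rho> (f i))"
  by (simp add: \<theta>_def gstar_sum_left gstar_sum_right)

lemma \<theta>_sc: "\<theta> \<rho> (sc c f) = sc c (\<theta> \<rho> f)"
  by (simp add: \<theta>_def)

text \<open>The commutator pairing of \<kappa>: an alternating bicharacter, trivial exactly when
  \<kappa> is symmetric.\<close>

definition "\<beta> \<mu> \<rho> = \<kappa> \<mu> \<rho> / \<kappa> \<rho> \<mu>"

lemma \<theta>_infl: "\<rho> \<in> PC \<Longrightarrow> \<mu> \<in> PC \<Longrightarrow> \<theta> \<mu> (infl \<rho>) = sc (\<beta> \<mu> \<rho>) (infl \<rho>)"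
proof -
  assume r: "\<rho> \<in> PC" and m: "\<mu> \<in> PC"
  have "infl \<mu> \<star> infl \<rho> = sc (\<beta> \<mu> \<rho>) (infl \<rho> \<star> infl \<mu>)"
    using r m \<kappa>_nz[OF r m] by (simp add: infl_star \<beta>_def P.char_mult_commute[of \<mu>])
  then show ?thesis using r m by (simp add: \<theta>_def star_assoc Linv_left)
qed

lemma \<beta>_mult: "\<rho> \<in> PC \<Longrightarrow> \<mu> \<in> PC \<Longrightarrow> \<nu> \<in> PC \<Longrightarrow> \<beta> (char_mult \<mu> \<nu>) \<rho> = \<beta> \<mu> \<rho> * \<beta> \<nu> \<rho>"
proof -
  assume r: "\<rho> \<in> PC" and m: "\<mu> \<in> PC" and n: "\<nu> \<in> PC"
  have "sc (\<beta> (char_mult \<mu> \<nu>) \<rho>) (infl \<rho>) = sc (\<beta> \<mu> \<rho> * \<beta> \<nu> \<rho>) (infl \<rho>)"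
    using \<theta>_\<theta>[OF m n, of "infl \<rho>"] r m n by (simp add: \<theta>_infl \<theta>_sc mult.commute)
  then show ?thesis by (rule sc_cancel) (rule infl_nz[OF r])
qed

lemma \<beta>_self: "\<rho> \<in> PC \<Longrightarrow> \<beta> \<rho> \<rho> = 1" using \<kappa>_nz[of \<rho> \<rho>] by (simp add: \<beta>_def)
lemma \<beta>_swap: "\<beta> \<rho> \<mu> = inverse (\<beta> \<mu> \<rho>)" by (simp add: \<beta>_def)
lemma \<beta>_triv: "\<rho> \<in> PC \<Longrightarrow> \<beta> P.triv_char \<rho> = 1" "\<rho> \<in> PC \<Longrightarrow> \<beta> \<rho> P.triv_char = 1" by (simp_all add: \<beta>_def)

text \<open>A nontrivial value at \<rho>0, \<mu>0 makes the trivial character, \<rho>0, \<mu>0 and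
  their product four distinct elements, hence the whole dual of P. Each nontrivial one pairs
  nontrivially with \<rho>0 or \<mu>0.\<close>

lemma \<beta>_nondegenerate:
  assumes four: "card P = 4" and r0: "\<rho>0 \<in> PC" and m0: "\<mu>0 \<in> PC" and ns: "\<kappa> \<mu>0 \<rho>0 \<noteq> \<kappa> \<rho>0 \<mu>0"
    and r: "\<rho> \<in> PC" "\<rho> \<noteq> P.triv_char"
  shows "\<exists>\<mu>\<in>PC. \<beta> \<mu> \<rho> \<noteq> 1"
proof -
  have b: "\<beta> \<mu>0 \<rho>0 \<noteq> 1" using ns \<kappa>_nz[OF r0 m0] by (simp add: \<beta>_def)
  then have b': "\<beta> \<rho>0 \<mu>0 \<noteq> 1" by (simp add: \<beta>_swap[of \<rho>0])
  let ?x = "char_mult \<rho>0 \<mu>0"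
  have x: "?x \<in> PC" using r0 m0 by simp
  have bx: "\<beta> \<mu>0 ?x \<noteq> 1"
  proof -
    have "\<beta> ?x \<mu>0 \<noteq> 1" using \<beta>_mult[OF m0 r0 m0] \<beta>_self[OF m0] b' by simp
    then show ?thesis by (simp add: \<beta>_swap[of \<mu>0])
  qed
  have d: "\<rho>0 \<noteq> P.triv_char" "\<mu>0 \<noteq> P.triv_char" "\<mu>0 \<noteq> \<rho>0" "?x \<noteq> P.triv_char"
    using b bx \<beta>_triv[OF m0] \<beta>_triv[OF r0] \<beta>_self[OF r0] by auto
  have d': "?x \<noteq> \<rho>0" "?x \<noteq> \<mu>0"
    using bx \<beta>_self[OF m0] \<beta>_mult[OF r0 r0 m0] \<beta>_self[OF r0] b by auto
  have "{P.triv_char, \<rho>0, \<mu>0, ?x} \<subseteq> PC" using r0 m0 by auto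
  moreover have "card {P.triv_char, \<rho>0, \<mu>0, ?x} = 4" using d d' by (auto simp: card_insert_if)
  ultimately have "{P.triv_char, \<rho>0, \<mu>0, ?x} = PC"
    using card_subset_eq[OF P.finite_chars] P.card_chars[where 'k = 'k] four by metis
  then have "\<rho> = \<rho>0 \<or> \<rho> = \<mu>0 \<or> \<rho> = ?x" using r by blast
  then show ?thesis using b b' bx r0 m0 by auto
qed

section \<open>The centralizer of the degree-one part\<close>

definition cent :: "('a \<Rightarrow> 'k) set" where
  "cent = {f \<in> galg G. \<forall>\<rho>\<in>PC. infl \<rho> \<star> f = f \<star> infl \<rho>}"

lemma cent_galg [simp]: "f \<in> cent \<Longrightarrow> f \<in> galg G" unfolding cent_def by blast
lemma centD: "f \<in> cent \<Longrightarrow> \<rho> \<in> PC \<Longrightarrow> infl \<rho> \<star> f = f \<star> infl \<rho>" unfolding cent_def by blast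
lemma centI: "f \<in> galg G \<Longrightarrow> (\<And>\<rho>. \<rho> \<in> PC \<Longrightarrow> infl \<rho> \<star> f = f \<star> infl \<rho>) \<Longrightarrow> f \<in> cent" unfolding cent_def by blast

lemma cent_star: "f \<in> cent \<Longrightarrow> g \<in> cent \<Longrightarrow> f \<star> g \<in> cent"
proof (rule centI)
  fix \<rho> assume "f \<in> cent" "g \<in> cent" "\<rho> \<in> PC"
  then have "infl \<rho> \<star> (f \<star> g) = (f \<star> infl \<rho>) \<star> g" by (simp add: centD flip: star_assoc)
  also have "\<dots> = f \<star> g \<star> infl \<rho>" using \<open>g \<in> cent\<close> \<open>\<rho> \<in> PC\<close> by (simp add: centD star_assoc)
  finally show "infl \<rho> \<star> (f \<star> g) = f \<star> g \<star> infl \<rho>" .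
qed simp

lemma cent_sc: "f \<in> cent \<Longrightarrow> sc c f \<in> cent" and cent_one: "one_fun \<in> cent"
  by (auto intro!: centI simp: centD)

lemma cent_add: "f \<in> cent \<Longrightarrow> g \<in> cent \<Longrightarrow> f + g \<in> cent"
  by (rule centI) (simp_all add: gstar_add_left gstar_add_right centD)

lemma cent_act: "f \<in> cent \<Longrightarrow> g \<in> carrier G \<Longrightarrow> act g f \<in> cent"
proof (rule centI)
  fix \<rho> assume f: "f \<in> cent" and g: "g \<in> carrier G" and r: "\<rho> \<in> PC"
  have c: "\<rho> (pr g) * \<rho> (inv (pr g)) = 1" using P.chars_inv_mult[OF r, of "pr g"] g by (simp add: mult.commute)
  have infl: "infl \<rho> = sc (\<rho> (pr g)) (act g (infl \<rho>))" using r g c by (simp add: act_infl)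
  have "infl \<rho> \<star> act g f = sc (\<rho> (pr g)) (act g (infl \<rho> \<star> f))" by (subst infl) (simp add: act_gstar g)
  also have "\<dots> = sc (\<rho> (pr g)) (act g (f \<star> infl \<rho>))" using f r by (simp add: centD)
  also have "\<dots> = act g f \<star> infl \<rho>" by (subst (2) infl) (simp add: act_gstar g)
  finally show "infl \<rho> \<star> act g f = act g f \<star> infl \<rho>" .
qed simp

lemma cent_\<theta>: "f \<in> galg G \<Longrightarrow> (\<And>\<rho>. \<rho> \<in> PC \<Longrightarrow> \<theta> \<rho> f = f) \<Longrightarrow> f \<in> cent"
proof (rule centI)
  fix \<rho> assume f: "f \<in> galg G" and "\<And>\<rho>. \<rho> \<in> PC \<Longrightarrow> \<theta> \<rho> f = f" and r: "\<rho> \<in> PC"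
  then have "f \<star> infl \<rho> = \<theta> \<rho> f \<star> infl \<rho>" by simp
  then show "infl \<rho> \<star> f = f \<star> infl \<rho>" using r f by (simp add: \<theta>_def star_assoc Linv_left)
qed

lemma \<theta>_cent: "f \<in> cent \<Longrightarrow> \<rho> \<in> PC \<Longrightarrow> \<theta> \<rho> f = f"
  by (simp add: \<theta>_def centD star_assoc Linv_left)

text \<open>Averaging over conjugations is the projection onto the centralizer
  (\<open>E_cent\<close>, \<open>E_on_cent\<close>), and it preserves N-degrees.\<close>

definition "E f = sc (1 / of_nat (card P)) (\<Sum>\<rho>\<in>PC. \<theta> \<rho> f)"

lemma E_galg [simp]: "E f \<in> galg G" unfolding E_def by (intro galg_sc galg_sum \<theta>_galg)

lemma E_cent: "E f \<in> cent"
proof (rule cent_\<theta>)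
  fix \<mu> assume m: "\<mu> \<in> PC"
  have "(\<Sum>\<rho>\<in>PC. \<theta> \<mu> (\<theta> \<rho> f)) = (\<Sum>\<rho>\<in>PC. \<theta> (char_mult \<mu> \<rho>) f)" using m by (simp add: \<theta>_\<theta> cong: sum.cong)
  also have "\<dots> = (\<Sum>\<rho>\<in>PC. \<theta> \<rho> f)" by (rule sum.reindex_bij_betw[OF P.bij_char_mult[OF m]])
  finally show "\<theta> \<mu> (E f) = E f" by (simp add: E_def \<theta>_sc \<theta>_sum)
qed simp

lemma E_grade: "\<chi> \<in> NC \<Longrightarrow> f \<in> grade \<chi> \<Longrightarrow> E f \<in> grade \<chi>"
proof -
  assume \<chi>: "\<chi> \<in> NC" and f: "f \<in> grade \<chi>"
  have "\<theta> \<rho> f \<in> grade \<chi>" if "\<rho> \<in> PC" for \<rho>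
    using grade_star[OF grade_star[OF infl_grade[OF that] f] Linv_grade[OF that]] \<chi> by (simp add: \<theta>_def)
  then show ?thesis unfolding E_def by (intro grade_sc grade_sum)
qed

lemma E_on_cent: "f \<in> cent \<Longrightarrow> E f = f"
proof -
  assume "f \<in> cent"
  then have "E f = sc (1 / of_nat (card P)) (\<Sum>\<rho>\<in>PC. sc 1 f)" by (simp add: E_def \<theta>_cent cong: sum.cong)
  also have "\<dots> = f" unfolding sum_sc by (simp add: P.card_chars)
  finally show ?thesis .
qed

end

text \<open>The degree-one part of the N-grading is a matrix algebra, so that the star algebra is its tensor product
  with its centralizer; the other assumptions describe the product of two dihedral groups of order 6.\<close>
locale klein_semidirect = semidirect_twist G J N P
  for G :: "('a, 'm) monoid_scheme" (structure) and J :: "'a \<times> 'a \<Rightarrow> 'k::{alg_closed_field, field_char_0}" and N P +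
  fixes \<rho>0 \<mu>0 \<chi>1 \<chi>2 :: "'a \<Rightarrow> 'k" and p q
  assumes four: "card P = 4" and \<rho>0: "\<rho>0 \<in> PC" and \<mu>0: "\<mu>0 \<in> PC" and nonsym: "\<kappa> \<mu>0 \<rho>0 \<noteq> \<kappa> \<rho>0 \<mu>0"
    and \<chi>1: "\<chi>1 \<in> NC" and \<chi>2: "\<chi>2 \<in> NC" and p: "p \<in> P" "p \<otimes> p = \<one>" and q: "q \<in> P" "q \<otimes> q = \<one>"
    and Pgen: "\<And>x. x \<in> P \<Longrightarrow> x = \<one> \<or> x = p \<or> x = q \<or> x = p \<otimes> q"
    and p_\<chi>: "cact p \<chi>1 = \<chi>1" "cact p \<chi>2 = N.inv_char \<chi>2" and q_\<chi>: "cact q \<chi>1 = N.inv_char \<chi>1" "cact q \<chi>2 = \<chi>2"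
    and cube: "char_mult \<chi>1 (char_mult \<chi>1 \<chi>1) = N.triv_char" "char_mult \<chi>2 (char_mult \<chi>2 \<chi>2) = N.triv_char"
    and indep: "\<And>\<phi> \<psi>. \<phi> \<in> {N.triv_char, \<chi>1, char_mult \<chi>1 \<chi>1} \<Longrightarrow> \<psi> \<in> {N.triv_char, \<chi>2, char_mult \<chi>2 \<chi>2} \<Longrightarrow>
       char_mult \<phi> \<psi> = N.triv_char \<Longrightarrow> \<phi> = N.triv_char \<and> \<psi> = N.triv_char"
    and \<chi>_nontriv: "\<chi>1 \<noteq> N.triv_char" "\<chi>2 \<noteq> N.triv_char" "char_mult \<chi>1 \<chi>1 \<noteq> N.triv_char" "char_mult \<chi>2 \<chi>2 \<noteq> N.triv_char"
    and NC_gen: "\<And>\<chi>. \<chi> \<in> NC \<Longrightarrow> \<exists>\<phi>\<in>{N.triv_char, \<chi>1, char_mult \<chi>1 \<chi>1}. \<exists>\<psi>\<in>{N.triv_char, \<chi>2, char_mult \<chi>2 \<chi>2}. \<chi> = char_mult \<phi> \<psi>"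
begin

text \<open>Nondegeneracy provides \<nu> with \<beta> \<nu> \<rho> different from 1, and shifting
  the sum by \<nu> scales it by that factor.\<close>

lemma sum_\<beta>: "\<rho> \<in> PC \<Longrightarrow> (\<Sum>\<mu>\<in>PC. \<beta> \<mu> \<rho>) = (if \<rho> = P.triv_char then of_nat (card P) else 0)"
proof (cases "\<rho> = P.triv_char")
  case True
  then show ?thesis by (simp add: \<beta>_triv P.card_chars cong: sum.cong)
next
  case False
  assume r: "\<rho> \<in> PC"
  obtain \<nu> where n: "\<nu> \<in> PC" "\<beta> \<nu> \<rho> \<noteq> 1" using \<beta>_nondegenerate[OF four \<rho>0 \<mu>0 nonsym r False] by blast
  have "(\<Sum>\<mu>\<in>PC. \<beta> \<mu> \<rho>) = (\<Sum>\<mu>\<in>PC. \<beta> (char_mult \<nu> \<mu>) \<rho>)"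
    by (rule sum.reindex_bij_betw[OF P.bij_char_mult[OF n(1)], symmetric])
  also have "\<dots> = \<beta> \<nu> \<rho> * (\<Sum>\<mu>\<in>PC. \<beta> \<mu> \<rho>)" using r n by (simp add: \<beta>_mult sum_distrib_left)
  finally show ?thesis using n False by simp
qed

text \<open>Summing over \<mu>, orthogonality of \<beta> kills every conjugate \<theta> \<rho> f
  except the trivial one. This is the tensor decomposition into the degree-one part and its
  centralizer.\<close>

lemma E_expand:
  assumes f: "f \<in> galg G" shows "f = (\<Sum>\<mu>\<in>PC. infl \<mu> \<star> E (Linv \<mu> \<star> f))"
proof -
  have "(\<Sum>\<mu>\<in>PC. infl \<mu> \<star> E (Linv \<mu> \<star> f)) = (\<Sum>\<mu>\<in>PC. \<Sum>\<rho>\<in>PC. sc (1 / of_nat (card P)) (infl \<mu> \<star> \<theta> \<rho> (Linv \<mu> \<star> f)))"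
    by (simp add: E_def gstar_sum_right sc_sum)
  also have "\<dots> = (\<Sum>\<mu>\<in>PC. \<Sum>\<rho>\<in>PC. sc (\<beta> \<mu> \<rho> / of_nat (card P)) (\<theta> \<rho> f))"
  proof (rule sum.cong[OF refl], rule sum.cong[OF refl])
    fix \<mu> \<rho> assume m: "\<mu> \<in> PC" and r: "\<rho> \<in> PC"
    have "infl \<mu> \<star> \<theta> \<rho> (Linv \<mu> \<star> f) = \<theta> \<mu> (infl \<rho>) \<star> f \<star> Linv \<rho>" by (simp add: \<theta>_def star_assoc)
    also have "\<dots> = sc (\<beta> \<mu> \<rho>) (\<theta> \<rho> f)" unfolding \<theta>_infl[OF r m] by (simp add: \<theta>_def)
    finally show "sc (1 / of_nat (card P)) (infl \<mu> \<star> \<theta> \<rho> (Linv \<mu> \<star> f)) = sc (\<beta> \<mu> \<rho> / of_nat (card P)) (\<theta> \<rho> f)" by simp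
  qed
  also have "\<dots> = (\<Sum>\<rho>\<in>PC. sc ((\<Sum>\<mu>\<in>PC. \<beta> \<mu> \<rho>) / of_nat (card P)) (\<theta> \<rho> f))"
    by (subst sum.swap) (simp add: sum_sc sum_divide_distrib)
  also have "\<dots> = (\<Sum>\<rho>\<in>PC. if \<rho> = P.triv_char then f else 0)"
  proof (rule sum.cong[OF refl])
    fix \<rho> assume r: "\<rho> \<in> PC"
    have "\<theta> P.triv_char f = f" using f Linv_left[OF P.triv_char_in] by (simp add: \<theta>_def)
    then show "sc ((\<Sum>\<mu>\<in>PC. \<beta> \<mu> \<rho>) / of_nat (card P)) (\<theta> \<rho> f) = (if \<rho> = P.triv_char then f else 0)"
      using r by (cases "\<rho> = P.triv_char") (simp_all add: sum_\<beta> zero_fun_def)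
  qed
  finally show ?thesis by (simp add: sum.delta)
qed

definition "Z \<chi> = cent \<inter> grade \<chi>"

lemma Z_galg [simp]: "f \<in> Z \<chi> \<Longrightarrow> f \<in> galg G" by (simp add: Z_def)

lemma Z_star: "f \<in> Z \<chi> \<Longrightarrow> g \<in> Z \<psi> \<Longrightarrow> f \<star> g \<in> Z (char_mult \<chi> \<psi>)"
  by (simp add: Z_def cent_star grade_star)

lemma Z_sc: "f \<in> Z \<chi> \<Longrightarrow> sc c f \<in> Z \<chi>"
  by (simp add: Z_def cent_sc grade_sc)

lemma Z_act: "f \<in> Z \<chi> \<Longrightarrow> g \<in> carrier G \<Longrightarrow> act g f \<in> Z (cact g \<chi>)"
  by (simp add: Z_def cent_act grade_act_G)

text \<open>By \<open>sum_\<beta>\<close> the projection E annihilates the nontrivial inflated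
  characters: a matrix algebra meets its centralizer only in scalars.\<close>

lemma Z_triv: "f \<in> Z N.triv_char \<Longrightarrow> \<exists>c. f = sc c one_fun"
proof -
  assume f: "f \<in> Z N.triv_char"
  obtain C where C: "f = (\<Sum>\<rho>\<in>PC. sc (C \<rho>) (infl \<rho>))" using grade_triv_expand[of f] f by (auto simp: Z_def)
  have EL: "E (infl \<rho>) = (if \<rho> = P.triv_char then one_fun else 0)" if r: "\<rho> \<in> PC" for \<rho>
  proof -
    have "E (infl \<rho>) = sc (1 / of_nat (card P) * (\<Sum>\<mu>\<in>PC. \<beta> \<mu> \<rho>)) (infl \<rho>)"
      using r by (simp add: E_def \<theta>_infl sum_sc cong: sum.cong)
    then show ?thesis using r by (cases "\<rho> = P.triv_char") (simp_all add: sum_\<beta> zero_fun_def)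
  qed
  have Es: "E (\<Sum>i\<in>I. sc (c i) (g i)) = (\<Sum>i\<in>I. sc (c i) (E (g i)))" for I c and g :: "_ \<Rightarrow> 'a \<Rightarrow> 'k"
    unfolding E_def \<theta>_sum \<theta>_sc by (subst sum.swap) (simp add: sc_sum mult.commute)
  have "f = E f" using f E_on_cent by (simp add: Z_def)
  also have "\<dots> = (\<Sum>\<rho>\<in>PC. sc (C \<rho>) (E (infl \<rho>)))" by (subst C) (rule Es)
  also have "\<dots> = (\<Sum>\<rho>\<in>PC. if \<rho> = P.triv_char then sc (C \<rho>) one_fun else 0)"
    by (rule sum.cong[OF refl]) (simp add: EL)
  also have "\<dots> = sc (C P.triv_char) one_fun" by (simp add: sum.delta)
  finally show ?thesis by blast
qed

text \<open>If all products of centralizer elements of degrees \<chi>^-1 and \<chi> vanished,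
  \<open>E_expand\<close> would make every product of these degrees vanish, against
  \<open>strongly_graded\<close>. A nonzero product is a scalar by \<open>Z_triv\<close>, and
  associativity gives the same scalar in the other order.\<close>

lemma Z_invertible:
  assumes \<chi>: "\<chi> \<in> NC"
  shows "\<exists>x\<in>Z \<chi>. \<exists>x'\<in>Z (N.inv_char \<chi>). x \<star> x' = one_fun \<and> x' \<star> x = one_fun"
proof -
  have \<chi>': "N.inv_char \<chi> \<in> NC" using \<chi> by simp
  have "\<exists>w\<in>Z (N.inv_char \<chi>). \<exists>z\<in>Z \<chi>. w \<star> z \<noteq> 0"
  proof (rule ccontr)
    assume neg: "\<not> ?thesis"
    have 0: "a \<star> b = 0" if a: "a \<in> grade (N.inv_char \<chi>)" and b: "b \<in> grade \<chi>" for a b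
    proof -
      have za: "E (Linv \<nu> \<star> a) \<in> Z (N.inv_char \<chi>)" and zb: "E (Linv \<nu> \<star> b) \<in> Z \<chi>" if n: "\<nu> \<in> PC" for \<nu>
        using grade_star[OF Linv_grade[OF n] a] grade_star[OF Linv_grade[OF n] b] \<chi> \<chi>' 
        by (auto simp: Z_def E_cent intro!: E_grade)
      have "a \<star> b = (\<Sum>\<nu>\<in>PC. \<Sum>\<mu>\<in>PC. (infl \<nu> \<star> E (Linv \<nu> \<star> a)) \<star> (infl \<mu> \<star> E (Linv \<mu> \<star> b)))"
        using E_expand[of a] E_expand[of b] a b by (simp flip: gstar_sum_left gstar_sum_right)
      also have "\<dots> = (\<Sum>\<nu>\<in>PC. \<Sum>\<mu>\<in>PC. 0)"
      proof (rule sum.cong[OF refl], rule sum.cong[OF refl])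
        fix \<nu> \<mu> assume n: "\<nu> \<in> PC" and m: "\<mu> \<in> PC"
        let ?w = "E (Linv \<nu> \<star> a)" and ?z = "E (Linv \<mu> \<star> b)"
        have "(infl \<nu> \<star> ?w) \<star> (infl \<mu> \<star> ?z) = infl \<nu> \<star> ((?w \<star> infl \<mu>) \<star> ?z)" by (simp only: star_assoc)
        also have "?w \<star> infl \<mu> = infl \<mu> \<star> ?w" using centD[OF E_cent m] by simp
        also have "(infl \<mu> \<star> ?w) \<star> ?z = infl \<mu> \<star> (?w \<star> ?z)" by (simp only: star_assoc)
        also have "?w \<star> ?z = 0" using neg za[OF n] zb[OF m] by blast
        finally show "(infl \<nu> \<star> ?w) \<star> (infl \<mu> \<star> ?z) = 0" by (simp only: gstar_zero_right)
      qed
      finally show ?thesis by (simp only: sum.neutral_const)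
    qed
    obtain F where F: "one_fun = (\<Sum>x\<in>carrier G. \<Sum>y\<in>carrier G. sc (F x y) (proj (N.inv_char \<chi>) (gdelta x) \<star> proj \<chi> (gdelta y)))"
      using strongly_graded[OF \<chi>] by blast
    then have "(one_fun :: 'a \<Rightarrow> 'k) = 0"
      by (simp only: 0[OF proj_grade[OF \<chi>'] proj_grade[OF \<chi>]] sc_simps sum.neutral_const)
    from fun_cong[OF this, of \<one>] show False by (simp add: one_fun_def)
  qed
  then obtain w z where w: "w \<in> Z (N.inv_char \<chi>)" and z: "z \<in> Z \<chi>" and nz: "w \<star> z \<noteq> 0" by blast
  obtain c where c: "w \<star> z = sc c one_fun" using Z_triv Z_star[OF w z] \<chi> by auto
  obtain c' where c': "z \<star> w = sc c' one_fun" using Z_triv Z_star[OF z w] \<chi> by auto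
  have z_nz: "z \<noteq> 0" using nz by auto
  have "sc c z = z \<star> (w \<star> z)" using c z by simp
  also have "\<dots> = (z \<star> w) \<star> z" by (simp only: star_assoc)
  also have "\<dots> = sc c' z" using c' z by simp
  finally have cc: "c = c'" using z_nz by (rule sc_cancel)
  have c0: "c \<noteq> 0" using nz c by auto
  show ?thesis
    by (rule bexI[OF _ z], rule bexI[OF _ Z_sc[OF w, of "1 / c"]]) (use c c' cc c0 in simp)
qed

text \<open>f x' has trivial degree, hence is a scalar by \<open>Z_triv\<close>; multiplying by x
  recovers f.\<close>

lemma Z_line:
  assumes "x \<in> Z \<chi>" "x' \<in> Z (N.inv_char \<chi>)" "x' \<star> x = one_fun" "f \<in> Z \<chi>" "\<chi> \<in> NC"
  shows "\<exists>c. f = sc c x"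
proof -
  obtain c where "f \<star> x' = sc c one_fun" using Z_triv Z_star[OF assms(4,2)] assms(5) by auto
  then have "(f \<star> x') \<star> x = sc c x" using assms by simp
  then show ?thesis using assms by (auto simp: star_assoc)
qed

text \<open>Scaling an invertible element of \<open>Z \<chi>\<close> by a square root and then by a sign makes it a cube root
  of the unit on which the stabilizer of \<open>\<chi>\<close> acts trivially.\<close>
lemma Z_cube_root:
  assumes \<chi>: "\<chi> \<in> NC" and cb: "char_mult \<chi> (char_mult \<chi> \<chi>) = N.triv_char"
    and r: "r \<in> P" "r \<otimes> r = \<one>" "cact r \<chi> = N.inv_char \<chi>" and t: "t \<in> P" "t \<otimes> t = \<one>" "cact t \<chi> = \<chi>"
  shows "\<exists>y\<in>Z \<chi>. y \<star> y \<star> y = one_fun \<and> act r y = y \<star> y \<and> act t y = y"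
proof -
  obtain x x' where x: "x \<in> Z \<chi>" "x' \<in> Z (N.inv_char \<chi>)" "x \<star> x' = one_fun" "x' \<star> x = one_fun" using Z_invertible[OF \<chi>] by blast
  have one_nz: "(one_fun :: 'a \<Rightarrow> 'k) \<noteq> 0" using fun_cong[of one_fun 0 \<one>] by (auto simp: one_fun_def)
  have inv_inv: "N.inv_char (N.inv_char \<chi>) = \<chi>" using \<chi> by (auto simp: N.inv_char_def N.chars_outside fun_eq_iff)
  have "act r x \<in> Z (N.inv_char \<chi>)" using Z_act[OF x(1), of r] r by simp
  then obtain d where d: "act r x = sc d x'" using Z_line[OF x(2) _ x(3), of "act r x"] x(1) \<chi> inv_inv by auto
  have "act r (act r x) = x" using r x by (simp add: act_act)
  have "d \<noteq> 0"
  proof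
    assume "d = 0"
    then have "act r x = 0" using d by simp
    then have "act r (act r x) = 0" by (simp only: act_zero)
    then have "x = 0" using r x by (simp add: act_act)
    then show False using x(3) one_nz by simp
  qed
  \<comment> \<open>With s^2 = 1/d, translation by r takes the rescaled element exactly to its
    inverse.\<close>
  obtain s where s: "s ^ 2 = inverse d" using nth_root_exists[of 2 "inverse d"] by auto
  then have s0: "s \<noteq> 0" using \<open>d \<noteq> 0\<close> by auto
  define y0 where "y0 = sc s x"
  define y0' where "y0' = sc (inverse s) x'"
  have y0: "y0 \<in> Z \<chi>" "y0' \<in> Z (N.inv_char \<chi>)" "y0 \<star> y0' = one_fun" "y0' \<star> y0 = one_fun"
    using x s0 by (auto simp: y0_def y0'_def Z_sc)
  have "s * d = inverse s" using s s0 \<open>d \<noteq> 0\<close> by (simp add: field_simps power2_eq_square)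
  then have ry0: "act r y0 = y0'" by (simp add: y0_def y0'_def act_sc d)
  have "y0 \<star> (y0 \<star> y0) \<in> Z N.triv_char" using Z_star[OF y0(1) Z_star[OF y0(1) y0(1)]] cb by simp
  then obtain c where c: "y0 \<star> (y0 \<star> y0) = sc c one_fun" using Z_triv by blast
  have y0g: "y0 \<in> galg G" "y0' \<in> galg G" using y0 by auto
  have canc: "y0' \<star> (y0 \<star> f) = f" if "f \<in> galg G" for f using that y0(4) by (simp flip: star_assoc)
  \<comment> \<open>Applying r to y0^3 = c shows that y0^-3 is the same scalar, so c^2 = 1. The
    element c y0 then has cube c^4 = 1.\<close>
  have "act r (y0 \<star> (y0 \<star> y0)) = y0' \<star> (y0' \<star> y0')" using r by (simp add: act_gstar ry0)
  then have c1: "y0' \<star> (y0' \<star> y0') = sc c one_fun" unfolding c using r by (simp add: act_sc)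
  have "(y0' \<star> (y0' \<star> y0')) \<star> (y0 \<star> (y0 \<star> y0)) = one_fun"
    by (simp add: star_assoc canc y0g y0)
  then have "sc (c * c) one_fun = sc 1 one_fun" unfolding c c1 by (simp add: mult.commute)
  then have cc: "c * c = 1" using one_nz by (rule sc_cancel)
  define y where "y = sc c y0"
  have y: "y \<in> Z \<chi>" using y0 by (simp add: y_def Z_sc)
  have y3: "y \<star> (y \<star> y) = one_fun" using cc by (simp add: y_def c mult.assoc)
  have yg: "y \<in> galg G" using y by simp
  have y0'_eq: "y0' = sc c (y0 \<star> y0)"
  proof -
    have "y0 \<star> y0 = y0' \<star> (y0 \<star> (y0 \<star> y0))" using canc by simp
    then have "sc c (y0 \<star> y0) = sc (c * c) y0'" unfolding c using y0g by simp
    then show ?thesis using cc by simp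
  qed
  have ry: "act r y = y \<star> y"
    using cc by (simp add: y_def act_sc ry0 y0'_eq)
  have "act t y \<in> Z \<chi>" using Z_act[OF y, of t] t by simp
  moreover have yy: "y \<star> y \<in> Z (N.inv_char \<chi>)"
  proof -
    have "char_mult \<chi> \<chi> = N.inv_char \<chi>"
    proof -
      have "char_mult (N.inv_char \<chi>) (char_mult \<chi> (char_mult \<chi> \<chi>)) = N.inv_char \<chi>" using cb \<chi> by simp
      then show ?thesis using \<chi> by simp
    qed
    then show ?thesis using Z_star[OF y y] by simp
  qed
  moreover have "(y \<star> y) \<star> y = one_fun" using y3 by (simp add: star_assoc)
  \<comment> \<open>t preserves the line of y and acts on it by e. Here e^2 = 1 because t is an
    involution, and e^3 = 1 because y is a cube root of the unit.\<close>
  ultimately obtain e where e: "act t y = sc e y" using Z_line[OF y, of "y \<star> y" "act t y"] \<chi> by blast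
  have y_nz: "y \<noteq> 0" using y3 one_nz by auto
  have "act t (act t y) = y" using t yg by (simp add: act_act)
  then have "sc (e * e) y = sc 1 y" by (simp add: e act_sc)
  then have ee: "e * e = 1" using y_nz by (rule sc_cancel)
  have "act t (y \<star> (y \<star> y)) = sc (e * (e * e)) (y \<star> (y \<star> y))" using t by (simp add: act_gstar e mult_ac)
  then have "sc (e * (e * e)) (one_fun :: 'a \<Rightarrow> 'k) = sc 1 one_fun" unfolding y3 using t by simp
  then have "e * (e * e) = 1" using one_nz by (rule sc_cancel)
  then have "e = 1" using ee by simp
  then show ?thesis using y y3 ry e by (auto simp: star_assoc intro!: bexI[of _ y])
qed

end

context klein_semidirect
begin

text \<open>The cube roots y1 and y2 commute, so they generate a copy of the group algebra of a
  group of type (3,3). Its trivial idempotent e is fixed by P, and its N-translates are orthogonal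
  with sum 1; hence the elements infl \<alpha> \<star> e satisfy \<open>gauge_data\<close>.\<close>

lemma gauge_data_exists: "\<exists>u. gauge_data G J P u \<kappa>"
proof -
  have pqG: "p \<in> carrier G" "q \<in> carrier G" using p q by auto
  obtain y1 where y1: "y1 \<in> Z \<chi>1" "y1 \<star> y1 \<star> y1 = one_fun" "act q y1 = y1 \<star> y1" "act p y1 = y1"
    using Z_cube_root[OF \<chi>1 cube(1) q q_\<chi>(1) p p_\<chi>(1)] by blast
  obtain y2 where y2: "y2 \<in> Z \<chi>2" "y2 \<star> y2 \<star> y2 = one_fun" "act p y2 = y2 \<star> y2" "act q y2 = y2"
    using Z_cube_root[OF \<chi>2 cube(2) p p_\<chi>(2) q q_\<chi>(2)] by blast
  note y1_3 = y1(2)[unfolded star_assoc] and y2_3 = y2(2)[unfolded star_assoc]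
  have y1g [simp]: "y1 \<in> galg G" and y2g [simp]: "y2 \<in> galg G" using y1 y2 by auto
  have one_nz: "(one_fun :: 'a \<Rightarrow> 'k) \<noteq> 0" using fun_cong[of one_fun 0 \<one>] by (auto simp: one_fun_def)
  have canc1: "y1 \<star> (y1 \<star> (y1 \<star> f)) = f" and canc2: "y2 \<star> (y2 \<star> (y2 \<star> f)) = f" if "f \<in> galg G" for f
  proof -
    have "y1 \<star> (y1 \<star> (y1 \<star> f)) = (y1 \<star> (y1 \<star> y1)) \<star> f" "y2 \<star> (y2 \<star> (y2 \<star> f)) = (y2 \<star> (y2 \<star> y2)) \<star> f"
      by (simp_all only: star_assoc)
    then show "y1 \<star> (y1 \<star> (y1 \<star> f)) = f" "y2 \<star> (y2 \<star> (y2 \<star> f)) = f" using that by (simp_all add: y1_3 y2_3)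
  qed
  have sq: "char_mult \<chi>1 \<chi>1 = N.inv_char \<chi>1" "char_mult \<chi>2 \<chi>2 = N.inv_char \<chi>2"
  proof -
    have "char_mult (N.inv_char \<chi>1) (char_mult \<chi>1 (char_mult \<chi>1 \<chi>1)) = N.inv_char \<chi>1"
      "char_mult (N.inv_char \<chi>2) (char_mult \<chi>2 (char_mult \<chi>2 \<chi>2)) = N.inv_char \<chi>2" using cube \<chi>1 \<chi>2 by simp_all
    then show "char_mult \<chi>1 \<chi>1 = N.inv_char \<chi>1" "char_mult \<chi>2 \<chi>2 = N.inv_char \<chi>2" using \<chi>1 \<chi>2 by simp_all
  qed
  have line: "\<exists>c. f = sc c x" if "x \<in> Z \<chi>" "x' \<in> Z (N.inv_char \<chi>)" "x' \<star> x = one_fun" "f \<in> Z \<chi>" "\<chi> \<in> NC" for f x x' \<chi>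
    using Z_line[OF that] .
  let ?\<chi> = "char_mult \<chi>1 \<chi>2"
  \<comment> \<open>By \<open>Z_line\<close>, y1 y2 = b y2 y1. Since p fixes y1 and squares y2, it
    yields y1 y2^2 = b y2^2 y1, while moving y1 past y2 twice yields the factor b^2.\<close>
  have comm: "y1 \<star> y2 = y2 \<star> y1"
  proof -
    have 1: "y2 \<star> y1 \<in> Z ?\<chi>" using Z_star[OF y2(1) y1(1)] by (simp add: N.char_mult_commute)
    have 2: "y1 \<star> y2 \<in> Z ?\<chi>" using Z_star[OF y1(1) y2(1)] .
    have "N.inv_char ?\<chi> = char_mult (char_mult \<chi>1 \<chi>1) (char_mult \<chi>2 \<chi>2)"
      unfolding sq by (auto simp: N.inv_char_def char_mult_def)
    then have 3: "(y1 \<star> y1) \<star> (y2 \<star> y2) \<in> Z (N.inv_char ?\<chi>)"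
      using Z_star[OF Z_star[OF y1(1) y1(1)] Z_star[OF y2(1) y2(1)]] by simp
    have 4: "((y1 \<star> y1) \<star> (y2 \<star> y2)) \<star> (y2 \<star> y1) = one_fun"
      by (simp add: star_assoc canc2 y1_3)
    obtain b where b: "y1 \<star> y2 = sc b (y2 \<star> y1)" using line[OF 1 3 4 2] \<chi>1 \<chi>2 by auto
    have "act p (y1 \<star> y2) = act p (sc b (y2 \<star> y1))" using b by simp
    then have A: "y1 \<star> (y2 \<star> y2) = sc b (y2 \<star> (y2 \<star> y1))" using pqG y1 y2 by (simp add: act_gstar act_sc star_assoc)
    have "y1 \<star> (y2 \<star> y2) = (y1 \<star> y2) \<star> y2" by (simp only: star_assoc)
    also have "\<dots> = sc b (y2 \<star> (y1 \<star> y2))" by (simp add: b star_assoc)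
    also have "\<dots> = sc (b * b) (y2 \<star> (y2 \<star> y1))" by (simp add: b)
    finally have "sc (b * b) (y2 \<star> (y2 \<star> y1)) = sc b (y2 \<star> (y2 \<star> y1))" using A by simp
    moreover have "y2 \<star> (y2 \<star> y1) \<noteq> 0"
    proof
      assume "y2 \<star> (y2 \<star> y1) = 0"
      then have "y2 \<star> (y2 \<star> (y2 \<star> y1)) = y2 \<star> (y2 \<star> (y2 \<star> y1)) \<and> (y2 \<star> y2) \<star> (y2 \<star> (y2 \<star> y1)) = 0" by simp
      then have "y2 \<star> y1 = 0" by (simp add: star_assoc canc2)
      then have "y2 \<star> (y2 \<star> (y2 \<star> y1)) = 0" by simp
      then have "y1 = 0" by (simp add: canc2)
      then show False using y1_3 one_nz by simp
    qed
    ultimately have bb: "b * b = b" by (rule sc_cancel)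
    have "b \<noteq> 0"
    proof
      assume "b = 0"
      then have "y1 \<star> y2 = 0" using b by simp
      then have "y1 \<star> (y1 \<star> (y1 \<star> y2)) = 0" by simp
      then have "y2 = 0" by (simp add: canc1)
      then show False using y2_3 one_nz by simp
    qed
    then have "b = 1" using bb by simp
    then show ?thesis using b by simp
  qed
  \<comment> \<open>The average of the powers of y1, i.e. the idempotent on which y1 acts as 1;
    likewise \<open>e2\<close> for y2.\<close>
  define e1 where "e1 = sc (1/3) (one_fun + y1 + y1 \<star> y1)"
  define e2 where "e2 = sc (1/3) (one_fun + y2 + y2 \<star> y2)"
  define e where "e = e1 \<star> e2"
  have eg [simp]: "e1 \<in> galg G" "e2 \<in> galg G" "e \<in> galg G" by (simp_all add: e1_def e2_def e_def)
  note bil = gstar_add_left gstar_add_right sc_add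
  have y1e1: "y1 \<star> e1 = e1" "e1 \<star> y1 = e1" and y2e2: "y2 \<star> e2 = e2" "e2 \<star> y2 = e2"
    unfolding e1_def e2_def by (simp_all add: bil star_assoc y1_3 y2_3 add_ac)
  have y1e2: "y1 \<star> e2 = e2 \<star> y1" and y2e1: "y2 \<star> e1 = e1 \<star> y2"
  proof -
    have "y1 \<star> (y2 \<star> y2) = y2 \<star> y2 \<star> y1" by (metis comm star_assoc)
    then show "y1 \<star> e2 = e2 \<star> y1" unfolding e2_def by (simp add: bil comm)
    have "y2 \<star> (y1 \<star> y1) = y1 \<star> y1 \<star> y2" by (metis comm star_assoc)
    then show "y2 \<star> e1 = e1 \<star> y2" unfolding e1_def by (simp add: bil comm)
  qed
  have y1e: "y1 \<star> e = e" "e \<star> y1 = e" and y2e: "y2 \<star> e = e" "e \<star> y2 = e"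
  proof -
    have "y1 \<star> e = (y1 \<star> e1) \<star> e2" "e \<star> y2 = e1 \<star> (e2 \<star> y2)" by (simp_all only: e_def star_assoc)
    then show "y1 \<star> e = e" "e \<star> y2 = e" by (simp_all only: y1e1 y2e2 e_def)
    have "e \<star> y1 = (e1 \<star> y1) \<star> e2" by (simp only: e_def star_assoc y1e2)
    then show "e \<star> y1 = e" by (simp only: y1e1 e_def)
    have "y2 \<star> e = (y2 \<star> e1) \<star> e2" by (simp only: e_def star_assoc)
    also have "\<dots> = e1 \<star> (y2 \<star> e2)" by (simp only: y2e1 star_assoc)
    finally show "y2 \<star> e = e" by (simp only: y2e2 e_def)
  qed
  have third: "sc (1/3) (3 * f) = f" for f :: "'a \<Rightarrow> 'k" by (auto simp: sc_def fun_eq_iff)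
  have e1e: "e1 \<star> e = e" and e2e: "e2 \<star> e = e"
    unfolding e1_def e2_def by (simp_all add: bil star_assoc y1e y2e third flip: sc_add)
  have ee: "e \<star> e = e" by (metis e_def e1e e2e star_assoc)
  have e_cent: "e \<in> cent"
    unfolding e_def e1_def e2_def using y1(1) y2(1) by (intro cent_star cent_sc cent_add cent_one) (auto simp: Z_def)
  have commL: "e \<star> infl \<rho> = infl \<rho> \<star> e" if "\<rho> \<in> PC" for \<rho> using centD[OF e_cent that] by simp
  have act_p: "act p e = e" and act_q: "act q e = e"
  proof -
    have "act p e1 = e1" "act q e2 = e2" unfolding e1_def e2_def using pqG y1 y2 by (simp_all add: act_sc act_add act_gstar)
    moreover have "act p e2 = e2" "act q e1 = e1"
      unfolding e1_def e2_def using pqG y1 y2 y1_3 y2_3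
      by (simp_all add: act_sc act_add act_gstar star_assoc canc1 canc2 add_ac)
    ultimately show "act p e = e" "act q e = e" unfolding e_def using pqG by (simp_all add: act_gstar)
  qed
  have act_P: "act h e = e" if "h \<in> P" for h
  proof -
    have "act (p \<otimes> q) e = e" using act_act[OF pqG, of e] act_p act_q by simp
    then show ?thesis using Pgen[OF that] act_p act_q by auto
  qed
  \<comment> \<open>Among the products y1^i y2^j only i = j = 0 has trivial N-degree, so the trivial
    component of e is 1/9 of the unit.\<close>
  have e_nz: "e \<noteq> 0"
  proof
    assume "e = 0"
    have pj: "proj N.triv_char f = (if \<chi> = N.triv_char then f else 0)" if "\<chi> \<in> NC" "f \<in> Z \<chi>" for f \<chi>
      using proj_on_grade[OF N.triv_char_in that(1)] that by (auto simp: Z_def eq_commute)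
    have pj_add: "proj \<chi> (f + g) = proj \<chi> f + proj \<chi> g" for \<chi> f g
      unfolding proj_def by (simp only: act_add sc_add sum.distrib)
    let ?A = "{one_fun, y1, y1 \<star> y1}"
    have z2: "proj N.triv_char (x \<star> w) = 0"
      if "x \<in> Z \<phi>" "w \<in> Z \<psi>" "\<phi> \<in> {N.triv_char, \<chi>1, char_mult \<chi>1 \<chi>1}" "\<psi> \<in> {N.triv_char, \<chi>2, char_mult \<chi>2 \<chi>2}"
        "\<not> (\<phi> = N.triv_char \<and> \<psi> = N.triv_char)" for x w \<phi> \<psi>
    proof -
      have in_NC: "\<phi> \<in> NC" "\<psi> \<in> NC" using that(3,4) \<chi>1 \<chi>2 by auto
      have "char_mult \<phi> \<psi> \<noteq> N.triv_char" using indep[OF that(3,4)] that(5) by blast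
      then show ?thesis using pj[OF N.char_mult_in[OF in_NC] Z_star[OF that(1,2)]] by simp
    qed
    have one_Z: "one_fun \<in> Z N.triv_char" using one_grade cent_one by (simp add: Z_def)
    have y11: "y1 \<star> y1 \<in> Z (char_mult \<chi>1 \<chi>1)" and y22: "y2 \<star> y2 \<in> Z (char_mult \<chi>2 \<chi>2)"
      using Z_star[OF y1(1) y1(1)] Z_star[OF y2(1) y2(1)] by auto
    have eq: "e = sc (1/9) (one_fun \<star> one_fun + one_fun \<star> y2 + one_fun \<star> (y2 \<star> y2)
        + (y1 \<star> one_fun + y1 \<star> y2 + y1 \<star> (y2 \<star> y2)) + ((y1 \<star> y1) \<star> one_fun + (y1 \<star> y1) \<star> y2 + (y1 \<star> y1) \<star> (y2 \<star> y2)))"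
      unfolding e_def e1_def e2_def by (simp add: gstar_add_left gstar_add_right sc_add add_ac)
    have "proj N.triv_char e = sc (1/9) one_fun"
      unfolding eq proj_sc pj_add
      using z2[OF one_Z y2(1)] z2[OF one_Z y22] z2[OF y1(1) one_Z] z2[OF y1(1) y2(1)] z2[OF y1(1) y22]
        z2[OF y11 one_Z] z2[OF y11 y2(1)] z2[OF y11 y22] \<chi>_nontriv pj[OF N.triv_char_in one_Z]
      by (simp add: zero_fun_def plus_fun_def)
    moreover have "proj N.triv_char e = 0" unfolding \<open>e = 0\<close> using proj_sc[of N.triv_char 0 "0 :: 'a \<Rightarrow> 'k"] by simp
    ultimately show False using one_nz by (simp add: sc_eq_zero_iff)
  qed
  \<comment> \<open>Every line Z \<chi> is spanned by one of the products y1^i y2^j, all of which e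
    absorbs.\<close>
  have Z_e: "\<exists>y c. f = sc c y \<and> y \<in> Z \<chi> \<and> y \<star> e = e \<and> e \<star> y = e" if \<chi>: "\<chi> \<in> NC" and f: "f \<in> Z \<chi>" for f \<chi>
  proof -
    obtain \<phi> \<psi> where fp: "\<phi> \<in> {N.triv_char, \<chi>1, char_mult \<chi>1 \<chi>1}" "\<psi> \<in> {N.triv_char, \<chi>2, char_mult \<chi>2 \<chi>2}" "\<chi> = char_mult \<phi> \<psi>"
      using NC_gen[OF \<chi>] by blast
    have inv_triv: "N.inv_char N.triv_char = (N.triv_char :: 'a \<Rightarrow> 'k)" by (auto simp: N.inv_char_def N.triv_char_def)
    have inv_inv: "N.inv_char (N.inv_char \<chi>) = \<chi>" if "\<chi> \<in> NC" for \<chi> :: "'a \<Rightarrow> 'k"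
      using that by (auto simp: N.inv_char_def N.chars_outside fun_eq_iff)
    have one_Z: "one_fun \<in> Z N.triv_char" using one_grade cent_one by (simp add: Z_def)
    have a: "\<exists>x\<in>Z \<phi>. \<exists>x'\<in>Z (N.inv_char \<phi>). x' \<star> x = one_fun \<and> x \<star> e = e \<and> e \<star> x = e"
    proof -
      consider "\<phi> = N.triv_char" | "\<phi> = \<chi>1" | "\<phi> = char_mult \<chi>1 \<chi>1" using fp(1) by auto
      then show ?thesis
      proof cases
        case 1
        then show ?thesis using one_Z inv_triv by (intro bexI[of _ one_fun]) auto
      next
        case 2
        have "y1 \<star> y1 \<in> Z (N.inv_char \<phi>)" using Z_star[OF y1(1) y1(1)] sq 2 by simp
        then show ?thesis using y1 y1e 2 by (intro bexI[of _ y1] bexI[of _ "y1 \<star> y1"]) auto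
      next
        case 3
        have "y1 \<star> y1 \<in> Z \<phi>" using Z_star[OF y1(1) y1(1)] 3 by simp
        moreover have "y1 \<in> Z (N.inv_char \<phi>)" using y1(1) 3 sq inv_inv[OF \<chi>1] by simp
        moreover have "(y1 \<star> y1) \<star> e = e" by (simp add: star_assoc y1e)
        moreover have "e \<star> (y1 \<star> y1) = e"
        proof -
          have "e \<star> (y1 \<star> y1) = (e \<star> y1) \<star> y1" by (simp only: star_assoc)
          then show ?thesis by (simp only: y1e)
        qed
        ultimately show ?thesis using y1_3 by blast
      qed
    qed
    have b: "\<exists>x\<in>Z \<psi>. \<exists>x'\<in>Z (N.inv_char \<psi>). x' \<star> x = one_fun \<and> x \<star> e = e \<and> e \<star> x = e"
    proof -
      consider "\<psi> = N.triv_char" | "\<psi> = \<chi>2" | "\<psi> = char_mult \<chi>2 \<chi>2" using fp(2) by auto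
      then show ?thesis
      proof cases
        case 1
        then show ?thesis using one_Z inv_triv by (intro bexI[of _ one_fun]) auto
      next
        case 2
        have "y2 \<star> y2 \<in> Z (N.inv_char \<psi>)" using Z_star[OF y2(1) y2(1)] sq 2 by simp
        then show ?thesis using y2 y2e 2 by (intro bexI[of _ y2] bexI[of _ "y2 \<star> y2"]) auto
      next
        case 3
        have "y2 \<star> y2 \<in> Z \<psi>" using Z_star[OF y2(1) y2(1)] 3 by simp
        moreover have "y2 \<in> Z (N.inv_char \<psi>)" using y2(1) 3 sq inv_inv[OF \<chi>2] by simp
        moreover have "(y2 \<star> y2) \<star> e = e" by (simp add: star_assoc y2e)
        moreover have "e \<star> (y2 \<star> y2) = e"
        proof -
          have "e \<star> (y2 \<star> y2) = (e \<star> y2) \<star> y2" by (simp only: star_assoc)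
          then show ?thesis by (simp only: y2e)
        qed
        ultimately show ?thesis using y2_3 by blast
      qed
    qed
    obtain x x' where x: "x \<in> Z \<phi>" "x' \<in> Z (N.inv_char \<phi>)" "x' \<star> x = one_fun" "x \<star> e = e" "e \<star> x = e" using a by blast
    obtain w w' where w: "w \<in> Z \<psi>" "w' \<in> Z (N.inv_char \<psi>)" "w' \<star> w = one_fun" "w \<star> e = e" "e \<star> w = e" using b by blast
    have xw: "x \<star> w \<in> Z \<chi>" using Z_star[OF x(1) w(1)] fp(3) by simp
    have "N.inv_char \<chi> = char_mult (N.inv_char \<psi>) (N.inv_char \<phi>)" unfolding fp(3) by (auto simp: N.inv_char_def char_mult_def)
    then have xw': "w' \<star> x' \<in> Z (N.inv_char \<chi>)" using Z_star[OF w(2) x(2)] by simp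
    have "(w' \<star> x') \<star> (x \<star> w) = w' \<star> ((x' \<star> x) \<star> w)" by (simp only: star_assoc)
    then have "(w' \<star> x') \<star> (x \<star> w) = one_fun" using x w by simp
    from line[OF xw xw' this f \<chi>] obtain c where "f = sc c (x \<star> w)" by blast
    moreover have "(x \<star> w) \<star> e = e" using x w by (simp add: star_assoc)
    moreover have "e \<star> (x \<star> w) = e" using x w by (simp flip: star_assoc)
    ultimately show ?thesis using xw by blast
  qed
  \<comment> \<open>Translating y \<star> e = e by n makes the translate of e an eigenvector of y
    with eigenvalue \<chi>(n).\<close>
  have eig: "y \<star> act n e = sc (\<chi> n) (act n e)" if y: "y \<in> Z \<chi>" "y \<star> e = e" and n: "n \<in> N" and \<chi>: "\<chi> \<in> NC" for y \<chi> n
  proof -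
    have ay: "act n y = sc (\<chi> (inv n)) y" using grade_act[of y \<chi> n] y(1) n by (simp add: Z_def)
    have "act n e = act n (y \<star> e)" using y by simp
    also have "\<dots> = sc (\<chi> (inv n)) (y \<star> act n e)" using n by (simp add: act_gstar ay)
    finally have "sc (\<chi> n) (act n e) = sc (\<chi> n) (sc (\<chi> (inv n)) (y \<star> act n e))" by (rule arg_cong)
    then show ?thesis using N.chars_inv_mult[OF \<chi> n] by (simp add: mult.commute)
  qed
  have exZ: "\<exists>y\<in>Z \<chi>. y \<star> e = e \<and> e \<star> y = e" if \<chi>: "\<chi> \<in> NC" for \<chi>
  proof -
    obtain x where "x \<in> Z \<chi>" using Z_invertible[OF \<chi>] by blast
    from Z_e[OF \<chi> this] show ?thesis by blast
  qed
  \<comment> \<open>For \<chi>(n) different from 1, y can be absorbed into e on the left or act by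
    \<chi>(n) on the translate; both can hold only if the product vanishes.\<close>
  have orthN: "e \<star> act n e = 0" if n: "n \<in> N" "n \<noteq> \<one>" for n
  proof -
    obtain \<chi> where \<chi>: "\<chi> \<in> NC" "\<chi> n \<noteq> 1" using N.chars_separate[OF n] by blast
    obtain y where y: "y \<in> Z \<chi>" "y \<star> e = e" "e \<star> y = e" using exZ[OF \<chi>(1)] by blast
    have "e \<star> act n e = e \<star> (y \<star> act n e)" using y by (simp flip: star_assoc)
    also have "\<dots> = sc (\<chi> n) (e \<star> act n e)" using eig[OF y(1,2) n(1) \<chi>(1)] by simp
    finally have "sc 1 (e \<star> act n e) = sc (\<chi> n) (e \<star> act n e)" by simp
    then show ?thesis using \<chi>(2) sc_cancel by metis
  qed
  have act_G: "\<exists>n\<in>N. g = n \<otimes> pr g \<and> act g e = act n e" if g: "g \<in> carrier G" for g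
  proof -
    obtain n where n: "n \<in> N" "g = n \<otimes> pr g" using pr_decomp[OF g] by blast
    have "act n (act (pr g) e) = act (n \<otimes> pr g) e" by (rule act_act) (simp_all add: n(1) g)
    then show ?thesis using n act_P[OF pr_P[OF g]] by metis
  qed
  \<comment> \<open>The sum is N-invariant and centralizes the degree-one part, so it is a scalar;
    multiplication by e shows that the scalar is 1.\<close>
  have sum_e: "(\<Sum>n\<in>N. act n e) = one_fun"
  proof -
    let ?T = "\<Sum>n\<in>N. act n e"
    have "?T \<in> grade N.triv_char"
    proof (rule gradeI)
      show "?T \<in> galg G" by (intro galg_sum act_galg)
      fix m assume m: "m \<in> N"
      have "act m ?T = (\<Sum>n\<in>N. act (m \<otimes> n) e)" using m by (simp add: act_sum act_act cong: sum.cong)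
      also have "\<dots> = ?T" by (rule sum.reindex_bij_betw[OF bij_mult_N[OF m]])
      finally show "act m ?T = sc (N.triv_char (inv m)) ?T" using m by (simp add: N.triv_char_def)
    qed
    moreover have "?T \<in> cent"
    proof (rule centI)
      show "?T \<in> galg G" by (intro galg_sum act_galg)
      fix \<rho> assume r: "\<rho> \<in> PC"
      show "infl \<rho> \<star> ?T = ?T \<star> infl \<rho>" unfolding gstar_sum_left gstar_sum_right
        by (rule sum.cong[OF refl]) (rule centD[OF cent_act[OF e_cent] r], simp)
    qed
    ultimately obtain c where c: "?T = sc c one_fun" using Z_triv[of ?T] by (auto simp: Z_def)
    have "e \<star> ?T = (\<Sum>n\<in>N. if n = \<one> then e else 0)"
      unfolding gstar_sum_right by (rule sum.cong[OF refl]) (auto simp: ee orthN)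
    then have "e \<star> ?T = e" by (simp add: sum.delta)
    then have "sc c e = sc 1 e" unfolding c by simp
    then have "c = 1" using e_nz by (rule sc_cancel)
    then show ?thesis using c by simp
  qed
  define u where "u \<alpha> = infl \<alpha> \<star> e" for \<alpha>
  have "gauge_data G J P u \<kappa>"
  proof unfold_locales
    fix \<alpha> assume a: "\<alpha> \<in> PC"
    show "u \<alpha> \<in> galg G" by (simp add: u_def)
    show "act h (u \<alpha>) = sc (\<alpha> (inv h)) (u \<alpha>)" if "h \<in> P" for h
      using that a by (simp add: u_def act_gstar act_infl act_P)
    show "\<kappa> P.triv_char \<alpha> = 1" "\<kappa> \<alpha> P.triv_char = 1" using a by auto
    fix \<beta> assume b: "\<beta> \<in> PC"
    have "u \<alpha> \<star> u \<beta> = infl \<alpha> \<star> ((e \<star> infl \<beta>) \<star> e)" by (simp only: u_def star_assoc)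
    also have "\<dots> = (infl \<alpha> \<star> infl \<beta>) \<star> (e \<star> e)" unfolding commL[OF b] by (simp only: star_assoc)
    also have "\<dots> = sc (\<kappa> \<alpha> \<beta>) (u (char_mult \<alpha> \<beta>))" unfolding infl_star[OF a b] ee by (simp add: u_def)
    finally show "u \<alpha> \<star> u \<beta> = sc (\<kappa> \<alpha> \<beta>) (u (char_mult \<alpha> \<beta>))" .
    fix g assume g: "g \<in> carrier G" "g \<notin> P"
    obtain n where n: "n \<in> N" "g = n \<otimes> pr g" "act g e = act n e" using act_G[OF g(1)] by blast
    have "n \<noteq> \<one>"
    proof
      assume "n = \<one>"
      then have "g = pr g" using n(2) g(1) by (metis l_one P_carrier pr_P)
      then show False using g pr_P[OF g(1)] by simp
    qed
    have "u \<alpha> \<star> act g (u \<beta>) = sc (\<beta> (inv (pr g))) (infl \<alpha> \<star> ((e \<star> infl \<beta>) \<star> act g e))"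
      using g(1) b by (simp add: u_def act_gstar act_infl star_assoc)
    also have "\<dots> = sc (\<beta> (inv (pr g))) (infl \<alpha> \<star> (infl \<beta> \<star> (e \<star> act n e)))"
      unfolding commL[OF b] n(3) by (simp only: star_assoc)
    finally show "u \<alpha> \<star> act g (u \<beta>) = 0" unfolding orthN[OF n(1) \<open>n \<noteq> \<one>\<close>] by (simp only: gstar_zero_right sc_simps)
  next
    fix f :: "'a \<Rightarrow> 'k" assume f: "f \<in> galg G"
    have Zspan: "\<exists>c. z = (\<Sum>n\<in>N. sc (c n) (act n e))" if \<chi>: "\<chi> \<in> NC" and z: "z \<in> Z \<chi>" for z \<chi>
    proof -
      obtain y c where y: "z = sc c y" "y \<in> Z \<chi>" "y \<star> e = e" using Z_e[OF \<chi> z] by blast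
      have "z = sc c (y \<star> one_fun)" using y by simp
      also have "\<dots> = (\<Sum>n\<in>N. sc (c * \<chi> n) (act n e))"
        unfolding sum_e[symmetric] gstar_sum_right sc_sum
        by (rule sum.cong[OF refl]) (simp add: eig[OF y(2,3) _ \<chi>])
      finally show ?thesis by (intro exI[of _ "\<lambda>n. c * \<chi> n"])
    qed
    have ex: "\<exists>c. E (Linv \<mu> \<star> proj \<chi> f) = (\<Sum>n\<in>N. sc (c n) (act n e))" if \<chi>: "\<chi> \<in> NC" and m: "\<mu> \<in> PC" for \<chi> \<mu>
    proof (rule Zspan[OF \<chi>])
      show "E (Linv \<mu> \<star> proj \<chi> f) \<in> Z \<chi>"
        using grade_star[OF Linv_grade[OF m] proj_grade[OF \<chi>, of f]] \<chi> by (auto simp: Z_def E_cent intro!: E_grade)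
    qed
    define c where "c \<chi> \<mu> = (SOME c. E (Linv \<mu> \<star> proj \<chi> f) = (\<Sum>n\<in>N. sc (c n) (act n e)))" for \<chi> \<mu>
    have c: "E (Linv \<mu> \<star> proj \<chi> f) = (\<Sum>n\<in>N. sc (c \<chi> \<mu> n) (act n e))" if "\<chi> \<in> NC" "\<mu> \<in> PC" for \<chi> \<mu>
      unfolding c_def by (rule someI_ex[OF ex[OF that]])
    have Ln: "infl \<mu> \<star> act n e = act n (u \<mu>)" if "\<mu> \<in> PC" "n \<in> N" for \<mu> n
      using grade_act[OF infl_grade[OF that(1)] that(2)] that by (simp add: u_def act_gstar N.triv_char_def)
    have "f = (\<Sum>\<chi>\<in>NC. proj \<chi> f)" using sum_proj[OF f] by simp
    also have "\<dots> = (\<Sum>\<chi>\<in>NC. \<Sum>\<mu>\<in>PC. \<Sum>n\<in>N. sc (c \<chi> \<mu> n) (act n (u \<mu>)))"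
    proof (rule sum.cong[OF refl])
      fix \<chi> assume \<chi>: "\<chi> \<in> NC"
      have "proj \<chi> f = (\<Sum>\<mu>\<in>PC. infl \<mu> \<star> E (Linv \<mu> \<star> proj \<chi> f))" by (intro E_expand grade_galg[OF proj_grade[OF \<chi>]])
      also have "\<dots> = (\<Sum>\<mu>\<in>PC. \<Sum>n\<in>N. sc (c \<chi> \<mu> n) (act n (u \<mu>)))"
        using \<chi> by (simp add: c gstar_sum_right Ln cong: sum.cong)
      finally show "proj \<chi> f = (\<Sum>\<mu>\<in>PC. \<Sum>n\<in>N. sc (c \<chi> \<mu> n) (act n (u \<mu>)))" .
    qed
    also have "\<dots> = (\<Sum>\<mu>\<in>PC. \<Sum>n\<in>N. sc (\<Sum>\<chi>\<in>NC. c \<chi> \<mu> n) (act n (u \<mu>)))"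
      by (subst sum.swap, rule sum.cong[OF refl], subst sum.swap) (simp only: sum_sc)
    also have "\<dots> = (\<Sum>n\<in>N. \<Sum>\<mu>\<in>PC. sc (\<Sum>\<chi>\<in>NC. c \<chi> \<mu> n) (act n (u \<mu>)))" by (rule sum.swap)
    also have "\<dots> = (\<Sum>g\<in>carrier G. \<Sum>\<mu>\<in>PC. sc (if g \<in> N then \<Sum>\<chi>\<in>NC. c \<chi> \<mu> g else 0) (act g (u \<mu>)))"
      using N.H.subset by (intro sum.mono_neutral_cong_left) auto
    finally show "\<exists>C. f = (\<Sum>g\<in>carrier G. \<Sum>\<mu>\<in>PC. sc (C g \<mu>) (act g (u \<mu>)))"
      by (intro exI[of _ "\<lambda>g \<mu>. if g \<in> N then \<Sum>\<chi>\<in>NC. c \<chi> \<mu> g else 0"])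
  qed
  then show ?thesis by blast
qed

end

section \<open>Groups of order 36\<close>

lemma dvd_more_than_half: "c dvd n \<Longrightarrow> n < 2 * c \<Longrightarrow> 0 < n \<Longrightarrow> c = n" for c n :: nat
proof (elim dvdE)
  fix m assume "n < 2 * c" "0 < n" "n = c * m"
  then show "c = n" by (cases m; cases "m - 1") auto
qed

context fin_group
begin

lemma subgroup_pow_card:
  assumes "subgroup H G" "x \<in> H" shows "x [^] card H = \<one>"
proof -
  interpret H: group "G\<lparr>carrier := H\<rparr>" by (rule subgroup_imp_group[OF assms(1)])
  show ?thesis using H.pow_order_eq_1[of x] assms by (simp add: Coset.order_def nat_pow_consistent[symmetric])
qed

lemma card_subgroup_dvd:
  assumes "subgroup H G" "subgroup K G" "K \<subseteq> H" shows "card K dvd card H"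
proof -
  interpret H: group "G\<lparr>carrier := H\<rparr>" by (rule subgroup_imp_group[OF assms(1)])
  have "subgroup K (G\<lparr>carrier := H\<rparr>)" by (rule subgroup_incl[OF assms(2,1,3)])
  from H.lagrange[OF this] show ?thesis by (auto simp: Coset.order_def intro: dvdI[of _ _ "card _"] dest: sym)
qed

text \<open>Two pairs with the same product x y have first components differing by an element of
  both H and K, so each fibre of multiplication into C is at most as large as H \<inter> K.\<close>

lemma card_mult_subgroups_le:
  assumes H: "subgroup H G" and K: "subgroup K G" and C: "H \<subseteq> C" "K \<subseteq> C" "subgroup C G"
  shows "card H * card K \<le> card C * card (H \<inter> K)"
proof -
  interpret H: subgroup H G by fact
  interpret K: subgroup K G by fact
  interpret C: subgroup C G by fact
  have fH: "finite H" "finite K" "finite C" using finite_subset[OF _ fin] H.subset K.subset C.subset by auto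
  define Fb where "Fb c = {x \<in> H \<times> K. fst x \<otimes> snd x = c}" for c
  have "card (Fb c) \<le> card (H \<inter> K)" for c
  proof (cases "Fb c = {}")
    case False
    then obtain x0 y0 where xy: "x0 \<in> H" "y0 \<in> K" "x0 \<otimes> y0 = c" by (auto simp: Fb_def)
    show ?thesis
    proof (rule card_inj_on_le[of "\<lambda>x. inv x0 \<otimes> fst x"])
      show "inj_on (\<lambda>x. inv x0 \<otimes> fst x) (Fb c)"
      proof (rule inj_onI)
        fix u v assume u: "u \<in> Fb c" and v: "v \<in> Fb c" and eq: "inv x0 \<otimes> fst u = inv x0 \<otimes> fst v"
        have in_c: "fst u \<in> carrier G" "fst v \<in> carrier G" "snd u \<in> carrier G" "snd v \<in> carrier G" using u v by (auto simp: Fb_def)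
        then have f: "fst u = fst v" using eq xy by simp
        have "fst u \<otimes> snd u = fst u \<otimes> snd v" using u v f by (simp add: Fb_def)
        then have "snd u = snd v" using in_c by simp
        with f show "u = v" by (rule prod_eqI)
      qed
      show "(\<lambda>x. inv x0 \<otimes> fst x) ` Fb c \<subseteq> H \<inter> K"
      proof (intro image_subsetI)
        fix u assume u: "u \<in> Fb c"
        then have uHK: "fst u \<in> H" "snd u \<in> K" "fst u \<otimes> snd u = x0 \<otimes> y0" using xy by (auto simp: Fb_def)
        have "fst u = x0 \<otimes> y0 \<otimes> inv (snd u)" unfolding uHK(3)[symmetric] using uHK(1,2) by (simp add: m_assoc)
        moreover have "inv x0 \<otimes> (x0 \<otimes> y0 \<otimes> inv (snd u)) = y0 \<otimes> inv (snd u)"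
          using uHK(2) xy(1,2) by (simp add: m_assoc[symmetric])
        ultimately have "inv x0 \<otimes> fst u = y0 \<otimes> inv (snd u)" by (simp only:)
        then have "inv x0 \<otimes> fst u \<in> K" using uHK xy by simp
        then show "inv x0 \<otimes> fst u \<in> H \<inter> K" using uHK xy by simp
      qed
    qed (use fH in auto)
  qed simp
  then have le: "(\<Sum>c\<in>C. card (Fb c)) \<le> card C * card (H \<inter> K)"
    using sum_bounded_above[of C "\<lambda>c. card (Fb c)" "card (H \<inter> K)"] by simp
  have "H \<times> K = (\<Union>c\<in>C. Fb c)" using C(1,2) by (auto simp: Fb_def intro!: C.m_closed)
  then have "card (H \<times> K) \<le> (\<Sum>c\<in>C. card (Fb c))" using card_UN_le[OF fH(3), of Fb] by simp
  then show ?thesis using le by (simp add: card_cartesian_product)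
qed

lemma commuting_subgroup:
  assumes "D \<subseteq> carrier G" shows "subgroup {x \<in> carrier G. \<forall>d\<in>D. x \<otimes> d = d \<otimes> x} G"
proof (rule subgroupI)
  fix a assume "a \<in> {x \<in> carrier G. \<forall>d\<in>D. x \<otimes> d = d \<otimes> x}"
  then have a: "a \<in> carrier G" "\<And>d. d \<in> D \<Longrightarrow> a \<otimes> d = d \<otimes> a" by auto
  have "inv a \<otimes> d = d \<otimes> inv a" if "d \<in> D" for d
  proof -
    have d: "d \<in> carrier G" using that assms by auto
    have "inv a \<otimes> d = inv a \<otimes> (d \<otimes> a) \<otimes> inv a" using a(1) d by (simp add: m_assoc)
    also have "\<dots> = d \<otimes> inv a" using a(1) d by (simp add: a(2)[OF that, symmetric] m_assoc[symmetric])
    finally show ?thesis .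
  qed
  then show "inv a \<in> {x \<in> carrier G. \<forall>d\<in>D. x \<otimes> d = d \<otimes> x}" using a by simp
  fix b assume "b \<in> {x \<in> carrier G. \<forall>d\<in>D. x \<otimes> d = d \<otimes> x}"
  then have b: "b \<in> carrier G" "\<And>d. d \<in> D \<Longrightarrow> b \<otimes> d = d \<otimes> b" by auto
  have "a \<otimes> b \<otimes> d = d \<otimes> (a \<otimes> b)" if "d \<in> D" for d
  proof -
    have d: "d \<in> carrier G" using that assms by auto
    have "a \<otimes> b \<otimes> d = a \<otimes> d \<otimes> b" using a(1) b(1) d by (simp add: m_assoc b(2)[OF that])
    then show ?thesis using a(1) b(1) d by (simp add: a(2)[OF that] m_assoc)
  qed
  then show "a \<otimes> b \<in> {x \<in> carrier G. \<forall>d\<in>D. x \<otimes> d = d \<otimes> x}" using a b by simp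
qed (use assms in \<open>auto intro!: exI[of _ \<one>]\<close>)

lemma pow_mod:
  assumes "a \<in> carrier G" "a [^] (n::nat) = \<one>" shows "a [^] (m mod n) = a [^] (m::nat)"
proof -
  have "a [^] m = a [^] (n * (m div n) + m mod n)" by simp
  also have "\<dots> = (a [^] n) [^] (m div n) \<otimes> a [^] (m mod n)"
    using assms(1) by (simp only: nat_pow_mult[symmetric] nat_pow_pow)
  finally show ?thesis using assms by simp
qed

lemma conj_one_iff:
  assumes "x \<in> carrier G" "z \<in> carrier G" shows "x \<otimes> z \<otimes> inv x = \<one> \<longleftrightarrow> z = \<one>"
  using assms inv_solve_right[of \<one> "x \<otimes> z" x] by (simp add: eq_commute[of \<one>])

text \<open>If a and b did not commute, the centralizer D of a in Q would have order 3 and consist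
  of the powers of a. A counting argument then shows that b normalises D, hence inverts a.\<close>

lemma order9_commute:
  assumes Q: "subgroup Q G" "card Q = 9" and ab: "a \<in> Q" "b \<in> Q"
  shows "a \<otimes> b = b \<otimes> a"
proof (rule ccontr)
  assume nc: "a \<otimes> b \<noteq> b \<otimes> a"
  interpret Q: subgroup Q G by fact
  have fQ: "finite Q" using finite_subset[OF Q.subset fin] .
  have Qc [simp]: "x \<in> Q \<Longrightarrow> x \<in> carrier G" for x using Q.subset by auto
  define D where "D = Q \<inter> {x \<in> carrier G. \<forall>d\<in>{a}. x \<otimes> d = d \<otimes> x}"
  have subD: "subgroup D G" unfolding D_def
    by (rule subgroups_Inter_pair[OF Q(1) commuting_subgroup]) (use ab in simp)
  interpret D: subgroup D G by (rule subD)
  have D_mem: "x \<in> D \<longleftrightarrow> x \<in> Q \<and> x \<otimes> a = a \<otimes> x" for x unfolding D_def using Qc by blast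
  have aD: "a \<in> D" and bD: "b \<notin> D" unfolding D_mem using ab nc by (simp, metis)
  have DQ: "D \<subseteq> Q" using D_mem by blast
  have a1: "a \<noteq> \<one>" using nc ab by auto
  have fD: "finite D" using finite_subset[OF DQ fQ] .
  have D3: "card D = 3"
  proof -
    have "card D < 9" using psubset_card_mono[OF fQ, of D] DQ ab bD Q(2) by auto
    moreover have "card {\<one>, a} \<le> card D" using aD fD by (intro card_mono) auto
    then have "card D \<ge> 2" using a1 by simp
    ultimately have "card D \<in> {2, 3, 4, 5, 6, 7, 8}" by auto
    then show ?thesis using card_subgroup_dvd[OF Q(1) subD DQ] Q(2) by auto
  qed
  have a3: "a \<otimes> a \<otimes> a = \<one>" using subgroup_pow_card[OF subD aD] D3 ab by (simp add: numeral_eq_Suc)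
  have aa: "a \<otimes> a \<noteq> \<one>" "a \<otimes> a \<noteq> a"
  proof -
    show "a \<otimes> a \<noteq> \<one>"
    proof
      assume "a \<otimes> a = \<one>"
      then have "a = \<one>" using a3 ab by simp
      then show False using a1 by simp
    qed
    show "a \<otimes> a \<noteq> a" using a1 ab by simp
  qed
  have D_eq: "D = {\<one>, a, a \<otimes> a}"
  proof (rule card_subset_eq[OF fD, symmetric])
    show "{\<one>, a, a \<otimes> a} \<subseteq> D" using aD by simp
    show "card {\<one>, a, a \<otimes> a} = card D" using D3 a1 aa by (auto simp: card_insert_if)
  qed
  \<comment> \<open>If f is injective on D \<times> D it covers Q, in particular b^-1, and this puts
    b into D. Otherwise a collision gives a nontrivial z in D with b z b^-1 in D, and z generates
    D.\<close>
  define f where "f u = fst u \<otimes> (b \<otimes> snd u \<otimes> inv b)" for u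
  have "b \<otimes> a \<otimes> inv b \<in> D"
  proof (cases "inj_on f (D \<times> D)")
    case True
    have "f ` (D \<times> D) \<subseteq> Q"
    proof (rule image_subsetI)
      fix u assume "u \<in> D \<times> D"
      then have u: "fst u \<in> Q" "snd u \<in> Q" unfolding mem_Times_iff using DQ by blast+
      show "f u \<in> Q"
        unfolding f_def by (rule Q.m_closed[OF u(1) Q.m_closed[OF Q.m_closed[OF ab(2) u(2)] Q.m_inv_closed[OF ab(2)]]])
    qed
    moreover have "card (f ` (D \<times> D)) = card Q" using card_image[OF True] D3 Q(2) by (simp add: card_cartesian_product)
    ultimately have "f ` (D \<times> D) = Q" by (intro card_subset_eq[OF fQ])
    then have "inv b \<in> f ` (D \<times> D)" using ab by simp
    then obtain x y where xy: "x \<in> D" "y \<in> D" "inv b = x \<otimes> (b \<otimes> y \<otimes> inv b)" by (auto simp: f_def)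
    have xyc: "x \<in> carrier G" "y \<in> carrier G" using xy by auto
    have "\<one> = x \<otimes> (b \<otimes> y \<otimes> inv b) \<otimes> b" using xy(3) ab by (metis Qc l_inv)
    then have xby: "x \<otimes> b \<otimes> y = \<one>" using xyc ab by (simp add: m_assoc)
    have "inv x \<otimes> (x \<otimes> b \<otimes> y) \<otimes> inv y = inv x \<otimes> inv y" unfolding xby using xyc by simp
    moreover have "inv x \<otimes> (x \<otimes> b \<otimes> y) \<otimes> inv y = b"
    proof -
      have "inv x \<otimes> (x \<otimes> b \<otimes> y) \<otimes> inv y = (inv x \<otimes> x) \<otimes> b \<otimes> (y \<otimes> inv y)"
        using xyc ab by (simp only: m_assoc m_closed inv_closed Qc)
      then show ?thesis using xyc ab by simp
    qed
    ultimately have "b = inv x \<otimes> inv y" by (simp only:)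
    then have "b \<in> D" using xy by simp
    then show ?thesis using bD by simp
  next
    case False
    then obtain x y x' y' where xy: "x \<in> D" "y \<in> D" "x' \<in> D" "y' \<in> D" "(x, y) \<noteq> (x', y')"
      and eq: "x \<otimes> (b \<otimes> y \<otimes> inv b) = x' \<otimes> (b \<otimes> y' \<otimes> inv b)" by (auto simp: inj_on_def f_def)
    have xyc: "x \<in> carrier G" "y \<in> carrier G" "x' \<in> carrier G" "y' \<in> carrier G" using xy by auto
    define z where "z = y \<otimes> inv y'"
    have zD: "z \<in> D" using xy by (simp add: z_def)
    have "b \<otimes> z \<otimes> inv b = inv x \<otimes> (x \<otimes> (b \<otimes> y \<otimes> inv b)) \<otimes> (b \<otimes> inv y' \<otimes> inv b)"
      using xyc ab unfolding z_def by (simp add: m_assoc) (simp add: m_assoc[symmetric])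
    also have "\<dots> = inv x \<otimes> x'"
      unfolding eq using xyc ab by (simp add: m_assoc) (simp add: m_assoc[symmetric])
    finally have bz: "b \<otimes> z \<otimes> inv b \<in> D" using xy by simp
    have "z \<noteq> \<one>"
    proof
      assume "z = \<one>"
      then have "y = y'" using xyc inv_solve_right[of \<one> y y'] by (simp add: z_def)
      then have "x = x'" using eq xyc ab by simp
      then show False using xy(5) \<open>y = y'\<close> by simp
    qed
    moreover have "z \<in> {\<one>, a, a \<otimes> a}" using zD unfolding D_eq .
    ultimately have "z = a \<or> z = a \<otimes> a" by blast
    then show ?thesis
    proof
      assume "z = a"
      then show ?thesis using bz by simp
    next
      assume 2: "z = a \<otimes> a"
      have "z \<otimes> z = a \<otimes> a \<otimes> a \<otimes> a" unfolding 2 using ab by (simp add: m_assoc)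
      then have zz: "a = z \<otimes> z" using a3 ab by simp
      have zc: "z \<in> carrier G" using zD D.mem_carrier by simp
      have "(b \<otimes> z \<otimes> inv b) \<otimes> (b \<otimes> z \<otimes> inv b) = b \<otimes> z \<otimes> (inv b \<otimes> b) \<otimes> z \<otimes> inv b"
        using ab zc by (simp only: m_assoc m_closed inv_closed Qc)
      then have "b \<otimes> a \<otimes> inv b = (b \<otimes> z \<otimes> inv b) \<otimes> (b \<otimes> z \<otimes> inv b)"
        using ab zc zz by (simp add: m_assoc)
      then show ?thesis using bz by simp
    qed
  qed
  then have "b \<otimes> a \<otimes> inv b = \<one> \<or> b \<otimes> a \<otimes> inv b = a \<or> b \<otimes> a \<otimes> inv b = a \<otimes> a" unfolding D_eq by blast
  moreover have "b \<otimes> a \<otimes> inv b \<noteq> \<one>" using conj_one_iff[of b a] ab a1 by auto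
  moreover have "b \<otimes> a \<otimes> inv b \<noteq> a"
  proof
    assume "b \<otimes> a \<otimes> inv b = a"
    then have "b \<otimes> a = a \<otimes> b" using ab inv_solve_right[of a "b \<otimes> a" b] by simp
    then show False using nc by simp
  qed
  \<comment> \<open>b inverts a, as a a is a^-1. So b^2 commutes with a and lies in D, and then so
    does (b^2)^5 = b^9 b = b, a contradiction.\<close>
  ultimately have ba: "b \<otimes> a = a \<otimes> a \<otimes> b" using ab inv_solve_right[of "a \<otimes> a" "b \<otimes> a" b] by simp
  have ba1: "b \<otimes> a = a \<otimes> (a \<otimes> b)" using ba ab by (simp add: m_assoc)
  have ba2: "b \<otimes> (a \<otimes> z) = a \<otimes> (a \<otimes> (b \<otimes> z))" if "z \<in> carrier G" for z
    using ba that ab by (simp add: m_assoc[symmetric])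
  have a3': "a \<otimes> (a \<otimes> (a \<otimes> z)) = z" if "z \<in> carrier G" for z using a3 that ab by (simp add: m_assoc[symmetric])
  have "b \<otimes> b \<otimes> a = a \<otimes> (b \<otimes> b)" using ab by (simp add: m_assoc ba1 ba2 a3')
  then have bb: "b \<otimes> b \<in> D" using ab by (simp add: D_mem)
  have "(b \<otimes> b) [^] (i::nat) \<in> D" for i using bb by (induction i) auto
  then have "(b \<otimes> b) [^] (5::nat) \<in> D" .
  moreover have "(b \<otimes> b) [^] (5::nat) = b [^] (9::nat) \<otimes> b"
    using ab by (simp add: numeral_eq_Suc m_assoc)
  ultimately show False using subgroup_pow_card[OF Q(1) ab(2)] Q(2) ab bD by simp
qed

text \<open>Two different subgroups of order 9 meet in a group D of order 3, since 81 > 36 * 2. Both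
  are abelian, so the centralizer of D has at least 27 elements, hence is G, and D would be
  central.\<close>

lemma unique_order9:
  assumes card: "card (carrier G) = 36" and centerless: "\<And>z. z \<in> carrier G \<Longrightarrow> (\<forall>g\<in>carrier G. z \<otimes> g = g \<otimes> z) \<Longrightarrow> z = \<one>"
    and Q: "subgroup Q G" "card Q = 9" and Q': "subgroup Q' G" "card Q' = 9"
  shows "Q = Q'"
proof (rule ccontr)
  assume ne: "Q \<noteq> Q'"
  have fQ: "finite Q" "finite Q'" using finite_subset[OF subgroup.subset fin] Q Q' by auto
  let ?D = "Q \<inter> Q'"
  have subD: "subgroup ?D G" by (rule subgroups_Inter_pair[OF Q(1) Q'(1)])
  have Dc: "?D \<subseteq> carrier G" using subgroup.subset[OF subD] .
  have carrier: "subgroup (carrier G) G" by (rule subgroup_self)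
  have "?D \<noteq> Q"
  proof
    assume "?D = Q"
    then have "Q \<subseteq> Q'" by auto
    then have "Q = Q'" using card_subset_eq[OF fQ(2)] Q(2) Q'(2) by simp
    then show False using ne by simp
  qed
  then have "card ?D < 9" using psubset_card_mono[OF fQ(1), of ?D] Q(2) by auto
  moreover have "81 \<le> 36 * card ?D"
    using card_mult_subgroups_le[OF Q(1) Q'(1) _ _ carrier] subgroup.subset[OF Q(1)] subgroup.subset[OF Q'(1)] Q(2) Q'(2) card by simp
  then have "card ?D \<ge> 3" by simp
  ultimately have "card ?D \<in> {3, 4, 5, 6, 7, 8}" by auto
  then have D3: "card ?D = 3" using card_subgroup_dvd[OF Q(1) subD] Q(2) by auto
  let ?C = "{x \<in> carrier G. \<forall>d\<in>?D. x \<otimes> d = d \<otimes> x}"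
  have subC: "subgroup ?C G" by (rule commuting_subgroup[OF Dc])
  have QC: "Q \<subseteq> ?C" "Q' \<subseteq> ?C"
    using order9_commute[OF Q] order9_commute[OF Q'] subgroup.subset[OF Q(1)] subgroup.subset[OF Q'(1)] by auto
  have "81 \<le> card ?C * 3" using card_mult_subgroups_le[OF Q(1) Q'(1) QC subC] Q(2) Q'(2) D3 by simp
  moreover have "card ?C dvd 36" using card_subgroup_dvd[OF carrier subC] card subgroup.subset[OF subC] by simp
  ultimately have "card ?C = 36" using dvd_more_than_half[of "card ?C" 36] by simp
  then have C_eq: "?C = carrier G" using card card_subset_eq[OF fin, of ?C] by auto
  have "\<not> ?D \<subseteq> {\<one>}" using card_mono[of "{\<one>}" ?D] D3 by auto
  then obtain d where d: "d \<in> ?D" "d \<noteq> \<one>" by blast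
  have "\<forall>g\<in>carrier G. d \<otimes> g = g \<otimes> d"
  proof
    fix g assume "g \<in> carrier G"
    then have "g \<in> ?C" using C_eq by simp
    then show "d \<otimes> g = g \<otimes> d" using d by simp
  qed
  then show False using centerless[of d] d Dc by auto
qed

end

locale centerless36 = fin_group +
  assumes card36: "card (carrier G) = 36"
    and centerless: "\<And>z. z \<in> carrier G \<Longrightarrow> (\<forall>g\<in>carrier G. z \<otimes> g = g \<otimes> z) \<Longrightarrow> z = \<one>"

lemma (in fin_group) sylow_subgroup:
  assumes "Factorial_Ring.prime (p::nat)" "card (carrier G) = p ^ a * m" shows "\<exists>H. subgroup H G \<and> card H = p ^ a"
  using sylow_thm[of p G a m] assms fin group_axioms by (simp add: Coset.order_def)

text \<open>Since p^4 = 1 and p p is not 1, the four powers of p are distinct and exhaust P.\<close>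

lemma (in fin_group) order4_cases:
  assumes P: "subgroup P G" "card P = 4" and p: "p \<in> P" "p \<otimes> p \<noteq> \<one>" and x: "x \<in> P"
  shows "x = \<one> \<or> x = p \<or> x = p \<otimes> p \<or> x = p \<otimes> p \<otimes> p"
proof -
  interpret P: subgroup P G by fact
  have fP: "finite P" using finite_subset[OF P.subset fin] .
  have pc: "p \<in> carrier G" using p by auto
  have p4: "p \<otimes> p \<otimes> p \<otimes> p = \<one>" using subgroup_pow_card[OF P(1) p(1)] P(2) pc by (simp add: numeral_eq_Suc)
  have p1: "p \<noteq> \<one>" using p by auto
  have p3: "p \<otimes> p \<otimes> p \<noteq> \<one>"
  proof
    assume "p \<otimes> p \<otimes> p = \<one>"
    then show False using p4 p1 pc by simp
  qed
  have "p \<otimes> p \<noteq> p" using p1 pc by simp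
  moreover have "p \<otimes> p \<otimes> p \<noteq> p" using p(2) pc by (simp add: m_assoc)
  moreover have "p \<otimes> p \<otimes> p \<noteq> p \<otimes> p" using p1 pc by simp
  ultimately have "card {\<one>, p, p \<otimes> p, p \<otimes> p \<otimes> p} = card P" using p1 p(2) p3 P(2) by (simp add: card_insert_if eq_commute)
  moreover have "{\<one>, p, p \<otimes> p, p \<otimes> p \<otimes> p} \<subseteq> P" using p(1) by simp
  ultimately have "{\<one>, p, p \<otimes> p, p \<otimes> p \<otimes> p} = P" by (intro card_subset_eq[OF fP])
  then show ?thesis using x by blast
qed

text \<open>Either one element generates P, or every element is its own inverse.\<close>

lemma (in fin_group) order4_commute:
  assumes P: "subgroup P G" "card P = 4" and xy: "x \<in> P" "y \<in> P"
  shows "x \<otimes> y = y \<otimes> x"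
proof -
  interpret P: subgroup P G by fact
  have c: "x \<in> carrier G" "y \<in> carrier G" using xy by auto
  show ?thesis
  proof (cases "\<exists>p\<in>P. p \<otimes> p \<noteq> \<one>")
    case True
    then obtain p where p: "p \<in> P" "p \<otimes> p \<noteq> \<one>" by blast
    have pc: "p \<in> carrier G" using p by auto
    show ?thesis
      using order4_cases[OF P p xy(1)] order4_cases[OF P p xy(2)] pc by (elim disjE) (simp_all add: m_assoc)
  next
    case False
    then have "inv x = x" "inv y = y" "inv (x \<otimes> y) = x \<otimes> y" using xy c by (auto intro!: inv_equality)
    then show ?thesis using inv_mult_group[OF c] by simp
  qed
qed

text \<open>Conjugates of N have order 9, so \<open>unique_order9\<close> makes N normal. Coprime
  orders give a trivial intersection with P, and counting then gives NP = G.\<close>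

lemma (in centerless36) decomposition:
  obtains N P where "N \<lhd> G" "card N = 9" "subgroup P G" "card P = 4"
    "\<And>x y. x \<in> N \<Longrightarrow> y \<in> N \<Longrightarrow> x \<otimes> y = y \<otimes> x" "\<And>x y. x \<in> P \<Longrightarrow> y \<in> P \<Longrightarrow> x \<otimes> y = y \<otimes> x"
    "\<And>g. g \<in> carrier G \<Longrightarrow> \<exists>n\<in>N. \<exists>p\<in>P. g = n \<otimes> p" "N \<inter> P = {\<one>}"
proof -
  obtain N where N: "subgroup N G" "card N = 9" using sylow_subgroup[of 3 2 4] card36 by auto
  obtain P where P: "subgroup P G" "card P = 4" using sylow_subgroup[of 2 2 9] card36 by auto
  interpret N: subgroup N G by fact
  interpret P: subgroup P G by fact
  have "g \<otimes> n \<otimes> inv g \<in> N" if g: "g \<in> carrier G" and n: "n \<in> N" for g n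
  proof -
    let ?c = "\<lambda>x. g \<otimes> x \<otimes> inv g"
    have inj: "inj_on ?c N" using g N.mem_carrier by (intro inj_onI) simp
    have "subgroup (?c ` N) G"
    proof (rule subgroupI)
      show "?c ` N \<subseteq> carrier G" using g by auto
      show "?c ` N \<noteq> {}" using N.one_closed by blast
      fix a assume "a \<in> ?c ` N"
      then obtain x where x: "x \<in> N" "a = ?c x" by blast
      have "inv a = ?c (inv x)" using x g by (simp add: inv_mult_group m_assoc)
      then show "inv a \<in> ?c ` N" using x by (auto intro!: imageI)
      fix b assume "b \<in> ?c ` N"
      then obtain y where y: "y \<in> N" "b = ?c y" by blast
      have "a \<otimes> b = g \<otimes> x \<otimes> (inv g \<otimes> g) \<otimes> y \<otimes> inv g"
        unfolding x(2) y(2) using x(1) y(1) g by (simp only: m_assoc m_closed inv_closed N.mem_carrier)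
      then have "a \<otimes> b = ?c (x \<otimes> y)" using x(1) y(1) g by (simp add: m_assoc)
      then show "a \<otimes> b \<in> ?c ` N" using x y by (auto intro!: imageI)
    qed
    moreover have "card (?c ` N) = 9" using card_image[OF inj] N by simp
    ultimately have "?c ` N = N" using unique_order9[OF card36 centerless _ _ N] by blast
    then show ?thesis using n by blast
  qed
  then have nrm: "N \<lhd> G" using N(1) by (simp add: normal_inv_iff)
  have int: "N \<inter> P = {\<one>}"
  proof -
    have s: "subgroup (N \<inter> P) G" by (rule subgroups_Inter_pair[OF N(1) P(1)])
    have "card (N \<inter> P) dvd 9" "card (N \<inter> P) dvd 4"
      using card_subgroup_dvd[OF N(1) s] card_subgroup_dvd[OF P(1) s] N P by auto
    then have "card (N \<inter> P) dvd gcd 9 4" by (rule gcd_greatest)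
    moreover have "gcd 9 (4::nat) = 1" by (simp add: gcd_non_0_nat)
    ultimately have "card (N \<inter> P) = 1" by simp
    then obtain z where "N \<inter> P = {z}" by (auto simp: card_Suc_eq)
    then show ?thesis using N.one_closed P.one_closed by auto
  qed
  have inj: "inj_on (\<lambda>x. fst x \<otimes> snd x) (N \<times> P)"
  proof (rule inj_onI)
    fix u v assume u: "u \<in> N \<times> P" and v: "v \<in> N \<times> P" and eq: "fst u \<otimes> snd u = fst v \<otimes> snd v"
    have m: "fst u \<in> N" "fst v \<in> N" "snd u \<in> P" "snd v \<in> P" using u v by auto
    then have c: "fst u \<in> carrier G" "fst v \<in> carrier G" "snd u \<in> carrier G" "snd v \<in> carrier G" by auto
    have "inv (fst v) \<otimes> fst u = inv (fst v) \<otimes> (fst u \<otimes> snd u) \<otimes> inv (snd u)" using c by (simp add: m_assoc)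
    also have "\<dots> = (inv (fst v) \<otimes> fst v) \<otimes> snd v \<otimes> inv (snd u)"
      unfolding eq using c by (simp only: m_assoc m_closed inv_closed)
    also have "\<dots> = snd v \<otimes> inv (snd u)" using c by simp
    finally have e: "inv (fst v) \<otimes> fst u = snd v \<otimes> inv (snd u)" .
    have "inv (fst v) \<otimes> fst u \<in> N" using m by simp
    moreover have "inv (fst v) \<otimes> fst u \<in> P" unfolding e using m by simp
    ultimately have "inv (fst v) \<otimes> fst u \<in> N \<inter> P" by (rule IntI)
    then have "inv (fst v) \<otimes> fst u = \<one>" using int by simp
    then have "fst u = fst v" using c inv_solve_left[of \<one> "fst v" "fst u"] by simp
    moreover from this have "snd u = snd v" using eq c by simp
    ultimately show "u = v" by (rule prod_eqI)
  qed
  have NP: "(\<lambda>x. fst x \<otimes> snd x) ` (N \<times> P) = carrier G"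
  proof (rule card_subset_eq[OF fin])
    show "(\<lambda>x. fst x \<otimes> snd x) ` (N \<times> P) \<subseteq> carrier G" by auto
    show "card ((\<lambda>x. fst x \<otimes> snd x) ` (N \<times> P)) = card (carrier G)"
      using card_image[OF inj] N(2) P(2) card36 by (simp add: card_cartesian_product)
  qed
  have dec: "\<exists>n\<in>N. \<exists>p\<in>P. g = n \<otimes> p" if "g \<in> carrier G" for g
    using that unfolding NP[symmetric] image_iff by (metis mem_Times_iff)
  show thesis
    by (rule that[OF nrm N(2) P order9_commute[OF N] order4_commute[OF P] dec int]; assumption)
qed

text \<open>Triviality of the centre makes P act faithfully on N and without a common nontrivial
  fixed point. The elements a and b are joint eigenvectors for these commuting involutions: p fixes
  a and inverts b, q does the opposite.\<close>

lemma (in centerless36) klein_generators: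
  assumes nrm: "N \<lhd> G" and N9: "card N = 9" and P: "subgroup P G" "card P = 4"
    and comm_N: "\<And>x y. x \<in> N \<Longrightarrow> y \<in> N \<Longrightarrow> x \<otimes> y = y \<otimes> x"
    and comm_P: "\<And>x y. x \<in> P \<Longrightarrow> y \<in> P \<Longrightarrow> x \<otimes> y = y \<otimes> x"
    and dec: "\<And>g. g \<in> carrier G \<Longrightarrow> \<exists>n\<in>N. \<exists>p\<in>P. g = n \<otimes> p"
    and klein: "\<And>p. p \<in> P \<Longrightarrow> p \<otimes> p = \<one>"
  obtains a b p q where "a \<in> N" "b \<in> N" "p \<in> P" "q \<in> P" "a \<noteq> \<one>" "b \<noteq> \<one>"
    "a [^] (3::nat) = \<one>" "b [^] (3::nat) = \<one>"
    "p \<otimes> a = a \<otimes> p" "p \<otimes> b = inv b \<otimes> p" "q \<otimes> a = inv a \<otimes> q" "q \<otimes> b = b \<otimes> q"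
proof -
  interpret N: normal N G by fact
  interpret P: subgroup P G by fact
  have Nc [simp]: "x \<in> N \<Longrightarrow> x \<in> carrier G" for x by simp
  have Pc [simp]: "x \<in> P \<Longrightarrow> x \<in> carrier G" for x by simp
  have fP: "finite P" using finite_subset[OF P.subset fin] .
  have fN: "finite N" using finite_subset[OF N.subset fin] .
  define c where "c p n = p \<otimes> n \<otimes> inv p" for p n
  have cN: "c p n \<in> N" if "p \<in> P" "n \<in> N" for p n unfolding c_def using that N.inv_op_closed2 by simp
  have c_mult: "c p (n \<otimes> m) = c p n \<otimes> c p m" if "p \<in> P" "n \<in> N" "m \<in> N" for p n m
  proof -
    have "c p n \<otimes> c p m = p \<otimes> n \<otimes> (inv p \<otimes> p) \<otimes> m \<otimes> inv p"
      unfolding c_def using that by (simp only: m_assoc m_closed inv_closed Nc Pc)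
    then show ?thesis unfolding c_def using that by (simp add: m_assoc)
  qed
  have c_comp: "c p (c q n) = c (p \<otimes> q) n" if "p \<in> P" "q \<in> P" "n \<in> N" for p q n
    unfolding c_def using that by (simp add: inv_mult_group m_assoc)
  have c_one: "c p \<one> = \<one>" if "p \<in> P" for p unfolding c_def using that by simp
  have c_one_left: "c \<one> n = n" if "n \<in> N" for n unfolding c_def using that by simp
  have c_inv: "c p (inv n) = inv (c p n)" if "p \<in> P" "n \<in> N" for p n
    unfolding c_def using that by (simp add: inv_mult_group m_assoc)
  have c_eq: "p \<otimes> n = c p n \<otimes> p" if "p \<in> P" "n \<in> N" for p n
    unfolding c_def using that by (simp add: m_assoc)
  have c_swap: "c p (c q n) = c q (c p n)" if "p \<in> P" "q \<in> P" "n \<in> N" for p q n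
    using that by (simp add: c_comp comm_P)
  have c_sq: "c p (c p n) = n" if "p \<in> P" "n \<in> N" for p n
    using that by (simp add: c_comp klein c_one_left)
  have fixed: "n = \<one>" if n: "n \<in> N" "\<And>p. p \<in> P \<Longrightarrow> c p n = n" for n
  proof (rule centerless)
    show "\<forall>g\<in>carrier G. n \<otimes> g = g \<otimes> n"
    proof
      fix g assume "g \<in> carrier G"
      then obtain m p where g: "m \<in> N" "p \<in> P" "g = m \<otimes> p" using dec by blast
      have "n \<otimes> g = m \<otimes> (n \<otimes> p)" using g n by (simp add: m_assoc[symmetric] comm_N)
      also have "n \<otimes> p = p \<otimes> n" using c_eq[of p n] n g by simp
      finally show "n \<otimes> g = g \<otimes> n" using g n by (simp add: m_assoc)
    qed
  qed (use n in simp)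
  have faithful: "p = \<one>" if p: "p \<in> P" "\<And>n. n \<in> N \<Longrightarrow> c p n = n" for p
  proof (rule centerless)
    show "\<forall>g\<in>carrier G. p \<otimes> g = g \<otimes> p"
    proof
      fix g assume "g \<in> carrier G"
      then obtain m r where g: "m \<in> N" "r \<in> P" "g = m \<otimes> r" using dec by blast
      have "p \<otimes> m = m \<otimes> p" using c_eq[of p m] p g by simp
      then have "p \<otimes> g = m \<otimes> (p \<otimes> r)" using g p by (simp add: m_assoc[symmetric])
      then show "p \<otimes> g = g \<otimes> p" using g p comm_P[of p r] by (simp add: m_assoc)
    qed
  qed (use p in simp)
  have ex_P: "\<exists>t\<in>P. t \<noteq> \<one> \<and> t \<noteq> s" for s
  proof (rule ccontr)
    assume "\<not> (\<exists>t\<in>P. t \<noteq> \<one> \<and> t \<noteq> s)"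
    then have "P \<subseteq> {\<one>, s}" by blast
    then have "card P \<le> card {\<one>, s}" by (intro card_mono) auto
    also have "\<dots> \<le> 2" by (simp add: card_insert_if)
    finally show False using P by simp
  qed
  have prod_ne: "s \<otimes> t \<noteq> \<one>" if st: "s \<in> P" "t \<in> P" "s \<noteq> t" for s t
  proof
    assume "s \<otimes> t = \<one>"
    then have "s \<otimes> t = t \<otimes> t" using klein st by simp
    then show False using st by simp
  qed
  \<comment> \<open>An n of order 9 would generate N, and each element of P would act as a power k
    with k^2 = 1 mod 9, so k is 1 or 8. Faithfulness makes all nontrivial elements invert, yet a
    product of two of them acts trivially.\<close>
  have cube: "n [^] (3::nat) = \<one>" if n: "n \<in> N" for n
  proof (rule ccontr)
    assume n3: "n [^] (3::nat) \<noteq> \<one>"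
    have n9: "n [^] (9::nat) = \<one>" using subgroup_pow_card[OF N.subgroup_axioms n] N9 by simp
    have nc: "n \<in> carrier G" using n by simp
    have pw1: "m mod 9 = 0" if "n [^] m = \<one>" for m :: nat
    proof (rule ccontr)
      assume ne: "m mod 9 \<noteq> 0"
      have "n [^] gcd m 9 = \<one>"
      proof -
        have "ord n dvd m" "ord n dvd 9" using that n9 pow_eq_id[OF nc] by auto
        then have "ord n dvd gcd m 9" by simp
        then show ?thesis using pow_eq_id[OF nc] by auto
      qed
      moreover have "gcd m 9 dvd 3"
      proof -
        have "d dvd 3" if d: "d dvd 9" "d \<noteq> 9" for d :: nat
        proof -
          have "d \<le> 9" using d(1) by (rule dvd_imp_le) simp
          moreover have "d \<noteq> 0" using d(1) by (cases "d = 0") auto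
          ultimately have "d \<in> {1,2,3,4,5,6,7,8}" using d(2) by auto
          then show ?thesis using d(1) by (elim insertE emptyE) simp_all
        qed
        moreover have "gcd m 9 \<noteq> 9" using ne by (metis dvd_eq_mod_eq_0 gcd_dvd1)
        ultimately show ?thesis by simp
      qed
      ultimately have "n [^] (3::nat) = \<one>" using nc by (metis dvd_def nat_pow_pow nat_pow_one)
      then show False using n3 by simp
    qed
    have pw_inj: "i mod 9 = j mod 9" if "n [^] i = n [^] j" "i \<le> j" for i j :: nat
    proof -
      have "n [^] i \<otimes> n [^] (j - i) = n [^] (i + (j - i))" using nc by (rule nat_pow_mult)
      also have "\<dots> = n [^] i \<otimes> \<one>" using that nc by simp
      finally have "n [^] i \<otimes> n [^] (j - i) = n [^] i \<otimes> \<one>" .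
      then have "n [^] (j - i) = \<one>" using nc by (simp only: l_cancel nat_pow_closed one_closed)
      then have "9 dvd j - i" using pw1 by (simp add: dvd_eq_mod_eq_0)
      then show ?thesis using that(2) by (metis mod_eq_dvd_iff_nat)
    qed
    have pw_inj': "i mod 9 = j mod 9" if e: "n [^] i = n [^] j" for i j :: nat
    proof (cases "i \<le> j")
      case True
      then show ?thesis by (rule pw_inj[OF e])
    next
      case False
      then have "j \<le> i" by simp
      from pw_inj[OF e[symmetric] this] show ?thesis by (rule sym)
    qed
    have pwN: "n [^] i \<in> N" for i :: nat using n by (induction i) auto
    have inj: "inj_on (\<lambda>i::nat. n [^] i) {..<9}"
    proof (rule inj_onI)
      fix i j :: nat assume ij: "i \<in> {..<9}" "j \<in> {..<9}" "n [^] i = n [^] j"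
      have "i mod 9 = j mod 9" by (rule pw_inj'[OF ij(3)])
      then show "i = j" using ij by simp
    qed
    have N_eq: "(\<lambda>i::nat. n [^] i) ` {..<9} = N"
    proof (rule card_subset_eq[OF fN])
      show "(\<lambda>i::nat. n [^] i) ` {..<9} \<subseteq> N" using pwN by blast
      show "card ((\<lambda>i::nat. n [^] i) ` {..<9}) = card N" unfolding card_image[OF inj] N9 by simp
    qed
    have c_pow: "c p (n [^] i) = (c p n) [^] i" if "p \<in> P" for p and i :: nat
      using that n pwN by (induction i) (simp_all add: c_one c_mult)
    have pm: "c p n = n \<or> c p n = inv n" if p: "p \<in> P" for p
    proof -
      have "c p n \<in> (\<lambda>i::nat. n [^] i) ` {..<9}" using cN[OF p n] N_eq by simp
      then obtain k :: nat where k: "k < 9" "c p n = n [^] k" by blast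
      have "n [^] (k * k) = n [^] (1::nat)"
        using c_sq[OF p n] c_pow[OF p, of k] k(2) nc by (simp add: nat_pow_pow)
      then have e: "(k * k) mod 9 = 1 mod 9" by (rule pw_inj')
      have "k \<in> {0,1,2,3,4,5,6,7,8}" using k(1) by auto
      then have "k = 1 \<or> k = 8" using e by (elim insertE emptyE) simp_all
      then show ?thesis
      proof
        assume "k = 8"
        then have "c p n \<otimes> n = n [^] Suc 8" using k(2) by (simp only: nat_pow_Suc)
        also have "Suc 8 = 9" by simp
        finally have "c p n \<otimes> n = \<one>" unfolding n9 .
        then have "c p n = inv n" using nc cN[OF p n] by (intro inv_equality[symmetric]) auto
        then show ?thesis ..
      qed (use k nc in simp)
    qed
    have triv: "p = \<one>" if p: "p \<in> P" "c p n = n" for p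
    proof (rule faithful[OF p(1)])
      fix m assume "m \<in> N"
      then have "m \<in> (\<lambda>i::nat. n [^] i) ` {..<9}" using N_eq by simp
      then show "c p m = m" using c_pow[OF p(1)] p(2) by auto
    qed
    obtain s where s: "s \<in> P" "s \<noteq> \<one>" using ex_P[of \<one>] by blast
    obtain t where t: "t \<in> P" "t \<noteq> \<one>" "t \<noteq> s" using ex_P[of s] by blast
    have "c s n = inv n" "c t n = inv n" using pm triv s t by blast+
    then have "c (s \<otimes> t) n = n" using c_comp[OF s(1) t(1) n] c_inv[OF s(1) n] nc by simp
    then have "s \<otimes> t = \<one>" using triv s t by simp
    then show False using prod_ne[of s t] s t by simp
  qed
  \<comment> \<open>Without such fixed points every nontrivial p inverts N, since n times its image
    is fixed by p; two such elements would have a trivially acting product.\<close>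
  have "\<exists>p\<in>P. p \<noteq> \<one> \<and> (\<exists>a\<in>N. a \<noteq> \<one> \<and> c p a = a)"
  proof (rule ccontr)
    assume no: "\<not> (\<exists>p\<in>P. p \<noteq> \<one> \<and> (\<exists>a\<in>N. a \<noteq> \<one> \<and> c p a = a))"
    have inverts: "c p n = inv n" if p: "p \<in> P" "p \<noteq> \<one>" and n: "n \<in> N" for p n
    proof -
      have "c p (c p n \<otimes> n) = c p n \<otimes> n" using p n by (simp add: c_mult c_sq cN comm_N)
      then have "c p n \<otimes> n = \<one>" using no p n cN by (meson N.m_closed)
      then show ?thesis using p n cN by (intro inv_equality[symmetric]) auto
    qed
    obtain s where s: "s \<in> P" "s \<noteq> \<one>" using ex_P[of \<one>] by blast
    obtain t where t: "t \<in> P" "t \<noteq> \<one>" "t \<noteq> s" using ex_P[of s] by blast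
    have "s \<otimes> t = \<one>"
    proof (rule faithful)
      fix n assume n: "n \<in> N"
      show "c (s \<otimes> t) n = n" using c_comp[OF s(1) t(1) n] inverts[OF t(1,2) n] inverts[OF s, of "inv n"] n by simp
    qed (use s t in simp)
    then show False using prod_ne[of s t] s t by simp
  qed
  then obtain p a where p: "p \<in> P" "p \<noteq> \<one>" and a: "a \<in> N" "a \<noteq> \<one>" "c p a = a" by blast
  obtain n where n: "n \<in> N" "c p n \<noteq> n" using faithful[OF p(1)] p(2) by blast
  \<comment> \<open>The quotient of n by its image is inverted by the involution p, and it is
    nontrivial because p moves n.\<close>
  define b0 where "b0 = n \<otimes> inv (c p n)"
  have b0: "b0 \<in> N" unfolding b0_def using n cN p by simp
  have b0_ne: "b0 \<noteq> \<one>"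
  proof
    assume "b0 = \<one>"
    then have "n = c p n" using n cN[OF p(1) n(1)] inv_solve_right[of \<one> n "c p n"] by (simp add: b0_def)
    then show False using n by simp
  qed
  have pb0: "c p b0 = inv b0"
    unfolding b0_def using n p cN[OF p(1) n(1)] by (simp add: c_mult c_inv c_sq inv_mult_group)
  obtain q0 where q0: "q0 \<in> P" "q0 \<noteq> \<one>" "q0 \<noteq> p" using ex_P[of p] by blast
  have P_eq: "{\<one>, p, q0, p \<otimes> q0} = P"
  proof (rule card_subset_eq[OF fP])
    show "{\<one>, p, q0, p \<otimes> q0} \<subseteq> P" using p q0 by simp
    have "p \<otimes> q0 \<noteq> \<one>" using prod_ne[of p q0] p q0 by metis
    moreover have "p \<otimes> q0 \<noteq> p" "p \<otimes> q0 \<noteq> q0" using p q0 by simp_all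
    ultimately show "card {\<one>, p, q0, p \<otimes> q0} = card P" using p q0 P(2) by (simp add: card_insert_if eq_commute)
  qed
  have q0a: "c q0 a = inv a"
  proof -
    \<comment> \<open>This product is fixed by p and by q0, hence by all of P, hence
      trivial.\<close>
    let ?z = "c q0 a \<otimes> a"
    have z: "?z \<in> N" using a q0 cN by simp
    have zp: "c p ?z = ?z" using p q0 a cN by (simp add: c_mult c_swap[of p q0])
    have zq: "c q0 ?z = ?z" using p q0 a cN by (simp add: c_mult c_sq comm_N)
    have "?z = \<one>"
    proof (rule fixed[OF z])
      fix x assume "x \<in> P"
      then have "x \<in> {\<one>, p, q0, p \<otimes> q0}" using P_eq by simp
      then show "c x ?z = ?z"
        using zp zq c_one_left[OF z] c_comp[OF p(1) q0(1) z] by (elim insertE emptyE) simp_all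
    qed
    then show ?thesis using a q0 cN by (intro inv_equality[symmetric]) auto
  qed
  \<comment> \<open>If b1 is nontrivial, q0 fixes it and p inverts it. If b1 is trivial, q0 inverts
    b0 as p does, so p q0 fixes b0 while still inverting a.\<close>
  define b1 where "b1 = c q0 b0 \<otimes> b0"
  have b1: "b1 \<in> N" unfolding b1_def using b0 q0 cN by simp
  show thesis
  proof (cases "b1 = \<one>")
    case False
    have "c q0 b1 = b1" unfolding b1_def using b0 q0 cN by (simp add: c_mult c_sq comm_N)
    moreover have "c p b1 = inv b1" unfolding b1_def using b0 q0 p cN
      by (simp add: c_mult c_swap[of p q0] pb0 c_inv inv_mult_group comm_N)
    ultimately show thesis
      using that[of a b1 p q0] a b1 p q0 False cube c_eq[of p a] c_eq[of p b1] c_eq[of q0 a] c_eq[of q0 b1] q0a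
      by simp
  next
    case True
    then have "c q0 b0 = inv b0" unfolding b1_def using b0 q0 cN by (intro inv_equality[symmetric]) auto
    then have "c (p \<otimes> q0) b0 = b0" using c_comp[OF p(1) q0(1) b0] c_inv[OF p(1) b0] pb0 b0 by simp
    moreover have "c (p \<otimes> q0) a = inv a" using c_comp[OF p(1) q0(1) a(1)] c_inv[OF p(1) a(1)] q0a a by simp
    ultimately show thesis
      using that[of a b0 p "p \<otimes> q0"] a b0 p q0 b0_ne pb0 cube c_eq[of p a] c_eq[of p b0] c_eq[of "p \<otimes> q0" a] c_eq[of "p \<otimes> q0" b0]
      by simp
  qed
qed

section \<open>The dihedral group of order 6 and homomorphisms out of it\<close>

lemma D3_simps [simp]:
  "carrier D3 = {0..<3} \<times> {0..<2}" "\<one>\<^bsub>D3\<^esub> = (0, 0)"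
  "(a, s) \<otimes>\<^bsub>D3\<^esub> (b, t) = ((a + (if s = 0 then b else 2 * b)) mod 3, (s + t) mod 2)"
  by (simp_all add: D3_def)

text \<open>A rotation by i is inverted by doubling i modulo 3, and a reflection is its own
  inverse.\<close>

lemma D3_inverse:
  "i < 3 \<Longrightarrow> s < 2 \<Longrightarrow> (if s = 0 then 2 * i mod 3 else i, s) \<otimes>\<^bsub>D3\<^esub> (i, s) = (0, 0)"
  by (auto simp: less_2_cases_iff) presburger

lemma group_D3: "group D3"
proof (rule groupI)
  fix x y z assume "x \<in> carrier D3" "y \<in> carrier D3" "z \<in> carrier D3"
  then obtain a s b t c u where xyz: "x = (a, s)" "y = (b, t)" "z = (c, u)" and stu: "s < 2" "t < 2" "u < 2"
    by (cases x; cases y; cases z) auto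
  have double: "(a + 2 * (y mod 3)) mod 3 = (a + 2 * y) mod 3" for y
    by (metis mod_add_right_eq mod_mult_right_eq)
  from stu have "s = 0 \<or> s = Suc 0" "t = 0 \<or> t = Suc 0" "u = 0 \<or> u = Suc 0" by auto
  moreover have "((a + b) mod 3 + x) mod 3 = (a + (b + x) mod 3) mod 3" for x by (simp add: mod_simps add.assoc)
  moreover have "((a + 2 * b) mod 3 + 2 * c) mod 3 = (a + 2 * ((b + c) mod 3)) mod 3"
    unfolding double by (simp only: mod_simps distrib_left add.assoc)
  moreover have "((a + 2 * b) mod 3 + c) mod 3 = (a + 2 * ((b + 2 * c) mod 3)) mod 3"
  proof -
    have "(a + 2 * ((b + 2 * c) mod 3)) mod 3 = (a + 2 * (b + 2 * c)) mod 3" by (rule double)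
    also have "a + 2 * (b + 2 * c) = (a + 2 * b + c) + 3 * c" by simp
    also have "\<dots> mod 3 = (a + 2 * b + c) mod 3" by (rule mod_mult_self2)
    finally show ?thesis by (simp only: mod_simps)
  qed
  ultimately show "x \<otimes>\<^bsub>D3\<^esub> y \<otimes>\<^bsub>D3\<^esub> z = x \<otimes>\<^bsub>D3\<^esub> (y \<otimes>\<^bsub>D3\<^esub> z)"
    unfolding xyz by (elim disjE) simp_all
next
  fix x assume "x \<in> carrier D3"
  then obtain i s where x: "x = (i, s)" "i < 3" "s < 2" by auto
  then show "\<exists>y\<in>carrier D3. y \<otimes>\<^bsub>D3\<^esub> x = \<one>\<^bsub>D3\<^esub>"
    using D3_inverse[of i s] by (intro bexI[of _ "(if s = 0 then 2 * i mod 3 else i, s)"]) auto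
qed auto

lemma inv_D3: "i < 3 \<Longrightarrow> s < 2 \<Longrightarrow> inv\<^bsub>D3\<^esub> (i, s) = (if s = 0 then 2 * i mod 3 else i, s)"
  by (rule group.inv_equality[OF group_D3]) (use D3_inverse[of i s] in auto)

lemma fin_group_D3: "fin_group D3"
  using group_D3 by (simp add: fin_group_def fin_group_axioms_def)

context fin_group
begin

lemma subgroup_pow_closed: "subgroup H G \<Longrightarrow> x \<in> H \<Longrightarrow> x [^] (n::nat) \<in> H"
  by (induction n) (auto simp: subgroup.one_closed subgroup.m_closed)

text \<open>These are the defining relations of \<open>D3\<close>. Writing x^-1 as x^2 keeps
  exponents natural and matches the factor 2 in its multiplication.\<close>

lemma D3_hom:
  assumes xy: "x \<in> carrier G" "y \<in> carrier G" and x3: "x [^] (3::nat) = \<one>" and y2: "y \<otimes> y = \<one>" and yx: "y \<otimes> x = inv x \<otimes> y"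
  shows "(\<lambda>u. x [^] fst u \<otimes> y [^] snd u) \<in> hom D3 G"
proof (rule homI)
  have inv_x: "inv x = x [^] (2::nat)"
    using xy x3 by (intro inv_equality) (simp_all add: numeral_eq_Suc)
  have y_pow: "y \<otimes> x [^] i = x [^] (2 * i) \<otimes> y" for i :: nat
  proof (induction i)
    case (Suc i)
    have "y \<otimes> x [^] Suc i = (y \<otimes> x [^] i) \<otimes> x" using xy by (simp add: m_assoc)
    also have "\<dots> = x [^] (2 * i) \<otimes> (y \<otimes> x)" using xy by (simp add: Suc m_assoc)
    also have "\<dots> = (x [^] (2 * i) \<otimes> x [^] (2::nat)) \<otimes> y" unfolding yx inv_x using xy by (simp add: m_assoc)
    also have "\<dots> = x [^] (2 * Suc i) \<otimes> y" using xy by (simp add: nat_pow_mult)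
    finally show ?case .
  qed (use xy in simp)
  have y2': "y [^] (2::nat) = \<one>" using xy y2 by (simp add: numeral_eq_Suc)
  fix u v assume "u \<in> carrier D3" "v \<in> carrier D3"
  then obtain i s j t where uv: "u = (i, s)" "v = (j, t)" and st: "s < 2" "t < 2" by auto
  let ?e = "if s = 0 then j else 2 * j"
  have sw: "y [^] s \<otimes> x [^] j = x [^] ?e \<otimes> y [^] s"
    using st xy y_pow[of j] by (auto simp: less_2_cases_iff)
  have "x [^] ((i + ?e) mod 3) \<otimes> y [^] ((s + t) mod 2) = x [^] (i + ?e) \<otimes> y [^] (s + t)"
    using pow_mod[OF xy(1) x3] pow_mod[OF xy(2) y2'] by simp
  also have "\<dots> = x [^] i \<otimes> (x [^] ?e \<otimes> y [^] s) \<otimes> y [^] t"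
    using xy by (simp only: nat_pow_mult[symmetric] m_assoc m_closed nat_pow_closed)
  also have "\<dots> = (x [^] i \<otimes> y [^] s) \<otimes> (x [^] j \<otimes> y [^] t)"
    unfolding sw[symmetric] using xy by (simp only: m_assoc m_closed nat_pow_closed)
  finally show "x [^] fst (u \<otimes>\<^bsub>D3\<^esub> v) \<otimes> y [^] snd (u \<otimes>\<^bsub>D3\<^esub> v) = (x [^] fst u \<otimes> y [^] snd u) \<otimes> (x [^] fst v \<otimes> y [^] snd v)"
    by (simp add: uv)
qed (use assms in simp)

end

text \<open>a with q and b with p give two commuting homomorphisms from \<open>D3\<close>. Their
  product map is injective, and both groups have order 36.\<close>

lemma (in centerless36) iso_D3_D3:
  assumes nrm: "N \<lhd> G" and N9: "card N = 9" and P: "subgroup P G" "card P = 4"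
    and comm_N: "\<And>x y. x \<in> N \<Longrightarrow> y \<in> N \<Longrightarrow> x \<otimes> y = y \<otimes> x"
    and comm_P: "\<And>x y. x \<in> P \<Longrightarrow> y \<in> P \<Longrightarrow> x \<otimes> y = y \<otimes> x"
    and dec: "\<And>g. g \<in> carrier G \<Longrightarrow> \<exists>n\<in>N. \<exists>p\<in>P. g = n \<otimes> p"
    and int: "N \<inter> P = {\<one>}"
    and klein: "\<And>p. p \<in> P \<Longrightarrow> p \<otimes> p = \<one>"
  shows "G \<cong> D3 \<times>\<times> D3"
proof -
  obtain a b p q where ab: "a \<in> N" "b \<in> N" and pq: "p \<in> P" "q \<in> P" and ne: "a \<noteq> \<one>" "b \<noteq> \<one>"
    and cube: "a [^] (3::nat) = \<one>" "b [^] (3::nat) = \<one>"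
    and rel: "p \<otimes> a = a \<otimes> p" "p \<otimes> b = inv b \<otimes> p" "q \<otimes> a = inv a \<otimes> q" "q \<otimes> b = b \<otimes> q"
    by (rule klein_generators[OF nrm N9 P comm_N comm_P dec klein])
  interpret N: normal N G by fact
  interpret P: subgroup P G by fact
  have abc [simp]: "a \<in> carrier G" "b \<in> carrier G" "p \<in> carrier G" "q \<in> carrier G" using ab pq by simp_all
  have ninv: "z \<otimes> z \<noteq> \<one>" "inv z \<noteq> z" if z: "z \<in> carrier G" "z \<noteq> \<one>" "z [^] (3::nat) = \<one>" for z
  proof -
    show zz: "z \<otimes> z \<noteq> \<one>"
    proof
      assume "z \<otimes> z = \<one>"
      then have "z [^] (3::nat) = z" using z(1) by (simp add: numeral_eq_Suc)
      then show False using z by simp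
    qed
    then show "inv z \<noteq> z" using z(1) by (metis r_inv)
  qed
  define f1 where "f1 u = a [^] fst u \<otimes> q [^] snd u" for u :: "nat \<times> nat"
  define f2 where "f2 u = b [^] fst u \<otimes> p [^] snd u" for u :: "nat \<times> nat"
  have hom1: "f1 \<in> hom D3 G" unfolding f1_def by (rule D3_hom) (use cube klein pq rel in simp_all)
  have hom2: "f2 \<in> hom D3 G" unfolding f2_def by (rule D3_hom) (use cube klein pq rel in simp_all)
  have f1c [simp]: "f1 u \<in> carrier G" and f2c [simp]: "f2 u \<in> carrier G" for u by (simp_all add: f1_def f2_def)
  have comm: "f1 u \<otimes> f2 v = f2 v \<otimes> f1 u" for u v
  proof -
    let ?C = "{x \<in> carrier G. \<forall>d\<in>{a, q}. x \<otimes> d = d \<otimes> x}" and ?C' = "{x \<in> carrier G. \<forall>d\<in>{f2 v}. x \<otimes> d = d \<otimes> x}"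
    have C: "subgroup ?C G" by (rule commuting_subgroup) simp
    have C': "subgroup ?C' G" by (rule commuting_subgroup) simp
    have "b \<in> ?C" "p \<in> ?C" using rel comm_N[OF ab] comm_P[OF pq] by auto
    then have "f2 v \<in> ?C" unfolding f2_def by (intro subgroup.m_closed[OF C] subgroup_pow_closed[OF C])
    then have "a \<in> ?C'" "q \<in> ?C'" by auto
    then have "f1 u \<in> ?C'" unfolding f1_def by (intro subgroup.m_closed[OF C'] subgroup_pow_closed[OF C'])
    then show ?thesis by simp
  qed
  define f where "f u = f1 (fst u) \<otimes> f2 (snd u)" for u
  have hom: "f \<in> hom (D3 \<times>\<times> D3) G"
  proof (rule homI)
    fix u v assume u: "u \<in> carrier (D3 \<times>\<times> D3)" and v: "v \<in> carrier (D3 \<times>\<times> D3)"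
    have m: "fst u \<in> carrier D3" "snd u \<in> carrier D3" "fst v \<in> carrier D3" "snd v \<in> carrier D3"
      using u v by (auto simp: DirProd_def)
    have "f (u \<otimes>\<^bsub>D3 \<times>\<times> D3\<^esub> v) = f1 (fst u \<otimes>\<^bsub>D3\<^esub> fst v) \<otimes> f2 (snd u \<otimes>\<^bsub>D3\<^esub> snd v)"
      by (simp add: f_def mult_DirProd' del: D3_simps)
    also have "\<dots> = f1 (fst u) \<otimes> (f1 (fst v) \<otimes> f2 (snd u)) \<otimes> f2 (snd v)"
      by (simp only: hom_mult[OF hom1 m(1,3)] hom_mult[OF hom2 m(2,4)] m_assoc m_closed f1c f2c)
    also have "\<dots> = f u \<otimes> f v"
      unfolding comm[of "fst v" "snd u"] f_def by (simp only: m_assoc m_closed f1c f2c)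
    finally show "f (u \<otimes>\<^bsub>D3 \<times>\<times> D3\<^esub> v) = f u \<otimes> f v" .
  qed (simp add: f_def)
  have grp: "group (D3 \<times>\<times> D3)" by (rule DirProd_group[OF group_D3 group_D3])
  interpret f: group_hom "D3 \<times>\<times> D3" G f
    by (intro group_hom.intro group_hom_axioms.intro grp hom is_group)
  \<comment> \<open>In a kernel element the N-part and the P-part are trivial separately. Then a^i =
    b^-j commutes with q, while q inverts a, so i = 0.\<close>
  have triv: "u = ((0, 0), (0, 0))" if u: "u \<in> carrier (D3 \<times>\<times> D3)" "f u = \<one>" for u
  proof -
    obtain i s j t where ijst: "u = ((i, s), (j, t))" "i < 3" "s < 2" "j < 3" "t < 2"
      using u(1) by (cases u) (auto simp: DirProd_def)
    let ?A = "a [^] i" and ?B = "b [^] j" and ?Q = "q [^] s" and ?R = "p [^] t"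
    have AB: "?A \<in> N" "?B \<in> N" using ab subgroup_pow_closed[OF N.subgroup_axioms] by auto
    have QR: "?Q \<in> P" "?R \<in> P" using pq subgroup_pow_closed[OF P(1)] by auto
    have sw: "?Q \<otimes> ?B = ?B \<otimes> ?Q" using comm[of "(0, s)" "(j, 0)"] by (simp add: f1_def f2_def)
    have "?A \<otimes> ?B \<otimes> (?Q \<otimes> ?R) = ?A \<otimes> (?Q \<otimes> ?B) \<otimes> ?R" unfolding sw by (simp add: m_assoc)
    also have "\<dots> = \<one>" using u(2) by (simp add: ijst(1) f_def f1_def f2_def m_assoc)
    finally have e: "?A \<otimes> ?B \<otimes> (?Q \<otimes> ?R) = \<one>" .
    then have "?A \<otimes> ?B = inv (?Q \<otimes> ?R)" by (intro inv_equality[symmetric]) simp_all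
    then have "?A \<otimes> ?B \<in> P" using QR by simp
    then have "?A \<otimes> ?B \<in> N \<inter> P" using AB by simp
    then have AB1: "?A \<otimes> ?B = \<one>" using int by simp
    then have QR1: "?Q \<otimes> ?R = \<one>" using e by simp
    have q1: "q \<noteq> \<one>" using rel(3) ninv(2)[of a] cube ne by auto
    have p1: "p \<noteq> \<one>" using rel(2) ninv(2)[of b] cube ne by auto
    have qp: "q \<otimes> p \<noteq> \<one>"
    proof
      assume qp: "q \<otimes> p = \<one>"
      have "a = (q \<otimes> p) \<otimes> a" by (simp add: qp)
      also have "\<dots> = (q \<otimes> a) \<otimes> p" by (simp add: m_assoc rel(1))
      also have "\<dots> = inv a \<otimes> (q \<otimes> p)" unfolding rel(3) by (simp add: m_assoc)
      finally have "a = inv a" by (simp add: qp)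
      then show False using ninv(2)[of a] cube ne by simp
    qed
    have st: "s = 0" "t = 0" using QR1 q1 p1 qp ijst(3,5) by (auto simp: less_2_cases_iff)
    let ?C = "{x \<in> carrier G. \<forall>d\<in>{q}. x \<otimes> d = d \<otimes> x}"
    have C: "subgroup ?C G" by (rule commuting_subgroup) simp
    have "b \<in> ?C" using rel(4) by simp
    then have "?B \<in> ?C" by (rule subgroup_pow_closed[OF C])
    then have "inv ?B \<in> ?C" by (rule subgroup.m_inv_closed[OF C])
    moreover have "?A = inv ?B" using AB1 by (intro inv_equality[symmetric]) simp_all
    ultimately have AC: "?A \<in> ?C" by (simp only:)
    have aC: "a \<notin> ?C"
    proof
      assume "a \<in> ?C"
      then have "inv a \<otimes> q = a \<otimes> q" using rel(3) by simp
      then show False using ninv(2)[of a] cube ne by simp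
    qed
    have "i \<noteq> 1" using AC aC by auto
    moreover have "i \<noteq> 2"
    proof
      assume i: "i = 2"
      have "a \<otimes> ?A = \<one>" using cube(1) by (simp add: i numeral_eq_Suc m_assoc)
      then have "a = inv ?A" by (intro inv_equality[symmetric]) simp_all
      moreover have "inv ?A \<in> ?C" by (rule subgroup.m_inv_closed[OF C AC])
      ultimately show False using aC by simp
    qed
    ultimately have i: "i = 0" using ijst(2) by simp
    then have B1: "?B = \<one>" using AB1 by simp
    have "j \<noteq> 1" using B1 ne by auto
    moreover have "j \<noteq> 2" using B1 ninv(1)[of b] cube ne by (auto simp: numeral_eq_Suc)
    ultimately have "j = 0" using ijst(4) by simp
    then show ?thesis using ijst(1) st i by simp
  qed
  have ker: "kernel (D3 \<times>\<times> D3) G f = {\<one>\<^bsub>D3 \<times>\<times> D3\<^esub>}"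
    using triv f.hom_one f.one_closed unfolding kernel_def by auto
  then have inj: "inj_on f (carrier (D3 \<times>\<times> D3))" using f.inj_iff_trivial_ker by simp
  have "f ` carrier (D3 \<times>\<times> D3) = carrier G"
  proof (rule card_subset_eq[OF fin])
    show "f ` carrier (D3 \<times>\<times> D3) \<subseteq> carrier G" using f.hom_closed by blast
    show "card (f ` carrier (D3 \<times>\<times> D3)) = card (carrier G)"
      using card_image[OF inj] card36 by (simp add: DirProd_def card_cartesian_product)
  qed
  then have "f \<in> iso (D3 \<times>\<times> D3) G" using hom inj by (simp add: iso_def bij_betw_def)
  then have "D3 \<times>\<times> D3 \<cong> G" by (rule is_isoI)
  then show ?thesis by (rule group.iso_sym[OF grp])
qed

text \<open>The maps \<open>dup1\<close>, \<open>dup2\<close>, \<open>ins3\<close>,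
  \<open>ins1\<close> and the projections commute with \<theta> applied in each leg, so every twist
  condition is pushed forward.\<close>

lemma is_twist_gpush:
  fixes G :: "('a, 'm) monoid_scheme" and H :: "('b, 'n) monoid_scheme" and J :: "'a \<times> 'a \<Rightarrow> 'k::comm_ring_1"
  assumes "twist G J" "fin_group H" and \<theta>: "\<theta> \<in> hom G H"
  shows "is_twist H (gpush (G \<times>\<times> G) (map_prod \<theta> \<theta>) J)"
proof -
  interpret G: twist G J by fact
  interpret H: tensor_group H using assms(2) by (rule tensor_group.intro)
  let ?h = "map_prod \<theta> \<theta>" and ?h3 = "map_prod \<theta> (map_prod \<theta> \<theta>)"
  let ?J = "gpush G.G2 ?h J"
  have \<theta>c: "\<theta> \<in> carrier G \<rightarrow> carrier H" using \<theta> by (auto simp: hom_def)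
  have one: "\<theta> \<one>\<^bsub>G\<^esub> = \<one>\<^bsub>H\<^esub>" by (rule hom_one[OF \<theta> G.is_group H.is_group])
  have h: "?h \<in> hom G.G2 H.G2" and h3: "?h3 \<in> hom G.G3 H.G3" using \<theta> by (auto simp: hom_def)
  have hc: "?h \<in> carrier G.G2 \<rightarrow> carrier H.G2" and h3c: "?h3 \<in> carrier G.G3 \<rightarrow> carrier H.G3"
    using h h3 by (auto simp: hom_def)
  have push3: "gpush H.G2 e' ?J = gpush G.G3 ?h3 (gpush G.G2 e J)"
    if "e \<in> carrier G.G2 \<rightarrow> carrier G.G3" "e' \<in> carrier H.G2 \<rightarrow> carrier H.G3" "\<And>x. e' (?h x) = ?h3 (e x)" for e e'
    using that by (simp only: gpush_gpush[OF G.two.fin H.fin_group_G3 H.two.fin hc]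
        gpush_gpush[OF G.two.fin H.fin_group_G3 G.three.fin _ h3c])
  have push1: "gpush H.G2 e' ?J = gpush G \<theta> (gpush G.G2 e J)"
    if "e \<in> carrier G.G2 \<rightarrow> carrier G" "e' \<in> carrier H.G2 \<rightarrow> carrier H" "\<And>x. e' (?h x) = \<theta> (e x)" for e e'
    using that by (simp only: gpush_gpush[OF G.two.fin H.fin_group_G H.two.fin hc]
        gpush_gpush[OF G.two.fin H.fin_group_G G.fin _ \<theta>c])
  have p: "gpush H.G2 H.dup1 ?J = gpush G.G3 ?h3 (gpush G.G2 G.dup1 J)"
    "gpush H.G2 H.dup2 ?J = gpush G.G3 ?h3 (gpush G.G2 G.dup2 J)"
    "gpush H.G2 H.ins3 ?J = gpush G.G3 ?h3 (gpush G.G2 G.ins3 J)"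
    "gpush H.G2 H.ins1 ?J = gpush G.G3 ?h3 (gpush G.G2 G.ins1 J)"
    by (rule push3[OF G.fun_ins_dup(1) H.fun_ins_dup(1)], force simp: G.ins_dup_defs H.ins_dup_defs)
      (rule push3[OF G.fun_ins_dup(2) H.fun_ins_dup(2)], force simp: G.ins_dup_defs H.ins_dup_defs,
       rule push3[OF G.fun_ins_dup(3) H.fun_ins_dup(3)], force simp: G.ins_dup_defs H.ins_dup_defs one,
       rule push3[OF G.fun_ins_dup(4) H.fun_ins_dup(4)], force simp: G.ins_dup_defs H.ins_dup_defs one)
  have "ginvertible H.G2 ?J"
  proof -
    obtain b where b: "b \<in> galg G.G2" "gmult G.G2 J b = gunit G.G2" "gmult G.G2 b J = gunit G.G2"
      using G.J_invertible unfolding ginvertible_def by blast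
    show ?thesis unfolding ginvertible_def
      using b by (intro bexI[of _ "gpush G.G2 ?h b"])
        (simp_all add: gpush_gmult[OF G.fin_group_G2 H.fin_group_G2 h, symmetric]
          gpush_gunit[OF G.fin_group_G2 H.fin_group_G2 h] gpush_galg[OF hc])
  qed
  moreover have "fst \<in> carrier G.G2 \<rightarrow> carrier G" "snd \<in> carrier G.G2 \<rightarrow> carrier G"
    "fst \<in> carrier H.G2 \<rightarrow> carrier H" "snd \<in> carrier H.G2 \<rightarrow> carrier H" by (auto simp: DirProd_def)
  then have "gpush H.G2 fst ?J = gunit H" "gpush H.G2 snd ?J = gunit H"
    using push1[of fst fst] push1[of snd snd] G.counit_fst G.counit_snd gpush_gunit[OF G.fin_group_G H.fin_group_G \<theta>] by auto
  ultimately show ?thesis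
    unfolding H.is_twist_iff p
    by (simp add: gpush_galg[OF hc] gpush_gmult[OF G.fin_group_G3 H.fin_group_G3 h3, symmetric] G.cocycle)
qed

text \<open>Central subgroups span normal Hopf subalgebras, so a nontrivial centre would be all of
  G. A subgroup of order 9 would then be central, proper and nontrivial, against simplicity.\<close>

lemma (in twist) twisted_simple_centerless:
  assumes simple: "twisted_simple G J" and card: "card (carrier G) = 36"
    and z: "z \<in> carrier G" "\<forall>g\<in>carrier G. z \<otimes> g = g \<otimes> z"
  shows "z = \<one>"
proof (rule ccontr)
  assume ne: "z \<noteq> \<one>"
  let ?Z = "{x \<in> carrier G. \<forall>d\<in>carrier G. x \<otimes> d = d \<otimes> x}"
  have triv: "M = carrier G \<or> M = {\<one>}" if M: "subgroup M G" "M \<subseteq> ?Z" for M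
  proof -
    have "normal_hopf_subalg G J (supported_on M)" using M by (intro normal_hopf_subalg_central) auto
    then show ?thesis using not_twisted_simple[OF twist_axioms M(1)] simple by blast
  qed
  have "?Z = carrier G" using triv[OF commuting_subgroup[of "carrier G"]] z ne by blast
  moreover obtain M where M: "subgroup M G" "card M = 9" using sylow_subgroup[of 3 2 4] card by auto
  ultimately have "M = carrier G \<or> M = {\<one>}" using triv[OF M(1)] subgroup.subset[OF M(1)] by simp
  then show False using M(2) card by auto
qed

section \<open>The product of two dihedral groups\<close>

abbreviation (input) "D33 \<equiv> D3 \<times>\<times> D3"

definition D33_rot :: "((nat \<times> nat) \<times> (nat \<times> nat)) set" where
  "D33_rot = ({0..<3} \<times> {0}) \<times> ({0..<3} \<times> {0})"
definition D33_klein :: "((nat \<times> nat) \<times> (nat \<times> nat)) set" where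
  "D33_klein = ({0} \<times> {0..<2}) \<times> ({0} \<times> {0..<2})"

lemma fin_group_D33: "fin_group D33" by (rule fin_group_DirProd[OF fin_group_D3 fin_group_D3])
lemma group_D33: "group D33" by (rule fin_group.axioms[OF fin_group_D33])

lemma D33_simps:
  "carrier D33 = ({0..<3} \<times> {0..<2}) \<times> ({0..<3} \<times> {0..<2})" "\<one>\<^bsub>D33\<^esub> = ((0, 0), (0, 0))"
  "((a, s), (b, t)) \<otimes>\<^bsub>D33\<^esub> ((a', s'), (b', t')) =
    (((a + (if s = 0 then a' else 2 * a')) mod 3, (s + s') mod 2), ((b + (if t = 0 then b' else 2 * b')) mod 3, (t + t') mod 2))"
  by (simp_all add: DirProd_def)

lemma inv_D33:
  "a < 3 \<Longrightarrow> s < 2 \<Longrightarrow> b < 3 \<Longrightarrow> t < 2 \<Longrightarrow>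
   inv\<^bsub>D33\<^esub> ((a, s), (b, t)) = ((if s = 0 then 2 * a mod 3 else a, s), (if t = 0 then 2 * b mod 3 else b, t))"
  by (simp add: inv_DirProd[OF group_D3 group_D3] inv_D3)

lemma D33_rotE:
  assumes "x \<in> D33_rot" obtains i j where "x = ((i, 0), (j, 0))" "i < 3" "j < 3"
  using assms that by (auto simp: D33_rot_def)

lemma D33_kleinE:
  assumes "x \<in> D33_klein" obtains s t where "x = ((0, s), (0, t))" "s < 2" "t < 2"
  using assms that by (auto simp: D33_klein_def)

lemma D33E:
  assumes "x \<in> carrier D33" obtains i s j t where "x = ((i, s), (j, t))" "i < 3" "s < 2" "j < 3" "t < 2"
  using assms that by (cases x) (auto simp: D33_simps)

lemma D33_rot_normal: "D33_rot \<lhd> D33"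
proof -
  interpret group D33 by (rule group_D33)
  have "subgroup D33_rot D33"
  proof (rule subgroupI)
    fix x y assume x: "x \<in> D33_rot" and y: "y \<in> D33_rot"
    show "inv\<^bsub>D33\<^esub> x \<in> D33_rot" using x by (elim D33_rotE) (simp add: inv_D33 D33_rot_def)
    show "x \<otimes>\<^bsub>D33\<^esub> y \<in> D33_rot" using x y by (elim D33_rotE) (simp add: D33_simps D33_rot_def)
  qed (auto simp: D33_rot_def D33_simps)
  moreover have "g \<otimes>\<^bsub>D33\<^esub> x \<otimes>\<^bsub>D33\<^esub> inv\<^bsub>D33\<^esub> g \<in> D33_rot" if "g \<in> carrier D33" "x \<in> D33_rot" for g x
    using that by (elim D33_rotE D33E) (simp add: D33_simps inv_D33 D33_rot_def less_2_cases_iff, linarith?)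
  ultimately show ?thesis by (simp add: normal_inv_iff)
qed

lemma D33_klein_subgroup: "subgroup D33_klein D33"
proof -
  interpret group D33 by (rule group_D33)
  show ?thesis
  proof (rule subgroupI)
    fix x y assume x: "x \<in> D33_klein" and y: "y \<in> D33_klein"
    show "inv\<^bsub>D33\<^esub> x \<in> D33_klein" using x by (elim D33_kleinE) (simp add: inv_D33 D33_klein_def)
    show "x \<otimes>\<^bsub>D33\<^esub> y \<in> D33_klein" using x y by (elim D33_kleinE) (simp add: D33_simps D33_klein_def)
  qed (auto simp: D33_klein_def D33_simps)
qed

lemma D33_klein_iso: "D33\<lparr>carrier := D33_klein\<rparr> \<cong> Klein4"
proof (rule is_isoI, rule isoI)
  let ?f = "\<lambda>x :: (nat \<times> nat) \<times> (nat \<times> nat). (int (snd (fst x)), int (snd (snd x)))"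
  show "?f \<in> hom (D33\<lparr>carrier := D33_klein\<rparr>) Klein4"
  proof (rule homI)
    fix x y assume "x \<in> carrier (D33\<lparr>carrier := D33_klein\<rparr>)" "y \<in> carrier (D33\<lparr>carrier := D33_klein\<rparr>)"
    then have x: "x \<in> D33_klein" and y: "y \<in> D33_klein" by auto
    show "?f x \<in> carrier Klein4"
      using x by (elim D33_kleinE) (simp add: Klein4_def carrier_integer_mod_group)
    show "?f (x \<otimes>\<^bsub>D33\<lparr>carrier := D33_klein\<rparr>\<^esub> y) = ?f x \<otimes>\<^bsub>Klein4\<^esub> ?f y"
      using x y by (elim D33_kleinE) (simp add: Klein4_def D33_simps mult_integer_mod_group zmod_int)
  qed
  show "bij_betw ?f (carrier (D33\<lparr>carrier := D33_klein\<rparr>)) (carrier Klein4)"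
    by (rule bij_betwI[where g = "\<lambda>y. ((0, nat (fst y)), (0, nat (snd y)))"])
      (auto simp: D33_klein_def Klein4_def carrier_integer_mod_group)
qed

locale D33_twist = twist D33 J for J :: "((nat \<times> nat) \<times> (nat \<times> nat)) \<times> ((nat \<times> nat) \<times> (nat \<times> nat)) \<Rightarrow> 'k::{alg_closed_field, field_char_0}"

sublocale D33_twist \<subseteq> semidirect_twist D33 J D33_rot D33_klein
proof (intro semidirect_twist.intro semidirect_twist_axioms.intro)
  show "twist D33 J" ..
  show "D33_rot \<lhd> D33" by (rule D33_rot_normal)
  show "x \<otimes>\<^bsub>D33\<^esub> y = y \<otimes>\<^bsub>D33\<^esub> x" if "x \<in> D33_rot" "y \<in> D33_rot" for x y
    using that by (elim D33_rotE) (simp add: D33_simps add.commute)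
  show "subgroup D33_klein D33" by (rule D33_klein_subgroup)
  show "x \<otimes>\<^bsub>D33\<^esub> y = y \<otimes>\<^bsub>D33\<^esub> x" if "x \<in> D33_klein" "y \<in> D33_klein" for x y
    using that by (elim D33_kleinE) (simp add: D33_simps add.commute)
  show "\<exists>n\<in>D33_rot. \<exists>p\<in>D33_klein. g = n \<otimes>\<^bsub>D33\<^esub> p" if "g \<in> carrier D33" for g
    using that
  proof (elim D33E)
    fix i s j t :: nat assume g: "g = ((i, s), (j, t))" "i < 3" "s < 2" "j < 3" "t < 2"
    then have "g = ((i, 0), (j, 0)) \<otimes>\<^bsub>D33\<^esub> ((0, s), (0, t))" by (simp add: D33_simps)
    moreover have "((i, 0), (j, 0)) \<in> D33_rot" "((0, s), (0, t)) \<in> D33_klein" using g by (simp_all add: D33_rot_def D33_klein_def)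
    ultimately show ?thesis by blast
  qed
  show "D33_rot \<inter> D33_klein = {\<one>\<^bsub>D33\<^esub>}" by (auto simp: D33_rot_def D33_klein_def D33_simps)
qed

lemma card_D33_rot: "card D33_rot = 9" and card_D33_klein: "card D33_klein = 4"
  by (simp_all add: D33_rot_def D33_klein_def card_cartesian_product)

context D33_twist
begin

text \<open>Coordinates for \<open>klein_semidirect\<close>: \<open>X1\<close> and \<open>X2\<close>
  are powers of a primitive cube root of unity on the two rotation factors, and p and q are
  reflections in the second and first factor. Hence p inverts only \<open>X2 1\<close> and q only
  \<open>X1 1\<close>.\<close>

lemma gauge_data_klein:
  assumes rm: "\<rho>0 \<in> PC" "\<mu>0 \<in> PC" "\<kappa> \<mu>0 \<rho>0 \<noteq> \<kappa> \<rho>0 \<mu>0"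
  shows "\<exists>u. gauge_data D33 J D33_klein u \<kappa>"
proof -
  obtain \<zeta> :: 'k where z: "\<zeta> ^ 3 = 1" "\<zeta> \<noteq> 1" using nontrivial_root_of_unity[of 3] by auto
  have z3: "\<zeta> * \<zeta> * \<zeta> = 1" using z(1) by (simp add: power3_eq_cube)
  have zz: "\<zeta> * \<zeta> \<noteq> 1" using z3 z(2) by auto
  have zmod: "\<zeta> ^ (m mod 3) = \<zeta> ^ m" for m
  proof -
    have "\<zeta> ^ m = \<zeta> ^ (3 * (m div 3) + m mod 3)" by simp
    then show ?thesis using z(1) by (simp only: power_add power_mult) simp
  qed
  have roots: "\<exists>k\<in>{0, 1, 2}. v = \<zeta> ^ k" if v: "v * (v * v) = 1" for v
  proof -
    have "(\<zeta> - 1) * (1 + \<zeta> + \<zeta> * \<zeta>) = 0" using z3 by (simp add: algebra_simps)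
    then have s: "1 + \<zeta> + \<zeta> * \<zeta> = 0" using z(2) by (metis mult_eq_0_iff right_minus_eq)
    \<comment> \<open>The factorisation of v^3 - 1 over the cube roots of unity, expanded so that
      the relations for \<zeta> and v make it vanish.\<close>
    have "(v - 1) * ((v - \<zeta>) * (v - \<zeta> * \<zeta>)) = v * (v * v) - \<zeta> * \<zeta> * \<zeta>
       - (1 + \<zeta> + \<zeta> * \<zeta>) * (v * v) + (\<zeta> * \<zeta> * \<zeta> + \<zeta> + \<zeta> * \<zeta>) * v" by (simp add: algebra_simps)
    also have "\<dots> = 0" by (simp only: v z3 s) simp
    finally have "v = 1 \<or> v = \<zeta> \<or> v = \<zeta> * \<zeta>" by auto
    then show ?thesis by (auto simp: power2_eq_square)
  qed
  define X1 where "X1 k x = (if x \<in> D33_rot then \<zeta> ^ (k * fst (fst x)) else 0)" for k and x :: "(nat \<times> nat) \<times> (nat \<times> nat)"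
  define X2 where "X2 k x = (if x \<in> D33_rot then \<zeta> ^ (k * fst (snd x)) else 0)" for k and x :: "(nat \<times> nat) \<times> (nat \<times> nat)"
  define a where "a = ((Suc 0, 0 :: nat), (0 :: nat, 0 :: nat))"
  define b where "b = ((0 :: nat, 0 :: nat), (Suc 0, 0 :: nat))"
  define p where "p = ((0 :: nat, 0 :: nat), (0 :: nat, Suc 0))"
  define q where "q = ((0 :: nat, Suc 0), (0 :: nat, 0 :: nat))"
  have rot [simp]: "((i, 0), (j, 0)) \<in> D33_rot \<longleftrightarrow> i < 3 \<and> j < 3" for i j :: nat by (auto simp: D33_rot_def)
  have klein [simp]: "((0, s), (0, t)) \<in> D33_klein \<longleftrightarrow> s < 2 \<and> t < 2" for s t :: nat by (auto simp: D33_klein_def)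
  have abN: "a \<in> D33_rot" "b \<in> D33_rot" by (simp_all add: a_def b_def)
  have pqP: "p \<in> D33_klein" "q \<in> D33_klein" by (simp_all add: p_def q_def)
  have X_simps: "X1 k ((i, 0), (j, 0)) = \<zeta> ^ (k * i)" "X2 k ((i, 0), (j, 0)) = \<zeta> ^ (k * j)" if "i < 3" "j < 3" for k i j
    using that by (simp_all add: X1_def X2_def)
  have X_out: "X1 k x = 0" "X2 k x = 0" if "x \<notin> D33_rot" for k x using that by (simp_all add: X1_def X2_def)
  have zk: "\<zeta> ^ (k * (m mod 3)) = \<zeta> ^ (k * m)" for k m
    by (metis zmod mod_mult_right_eq)
  have X1_in: "X1 k \<in> NC" for k
    unfolding chars_def
  proof (intro CollectI conjI ballI allI impI)
    fix x y assume "x \<in> D33_rot" "y \<in> D33_rot"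
    then show "X1 k (x \<otimes>\<^bsub>D33\<^esub> y) = X1 k x * X1 k y"
      by (elim D33_rotE) (simp add: D33_simps X_simps zk distrib_left power_add)
  qed (simp_all add: X_out X_simps D33_simps)
  have X2_in: "X2 k \<in> NC" for k
    unfolding chars_def
  proof (intro CollectI conjI ballI allI impI)
    fix x y assume "x \<in> D33_rot" "y \<in> D33_rot"
    then show "X2 k (x \<otimes>\<^bsub>D33\<^esub> y) = X2 k x * X2 k y"
      by (elim D33_rotE) (simp add: D33_simps X_simps zk distrib_left power_add)
  qed (simp_all add: X_out X_simps D33_simps)
  have X0: "N.triv_char = X1 0" "N.triv_char = X2 0" by (simp_all add: fun_eq_iff N.triv_char_def X1_def X2_def)
  have XX: "char_mult (X1 k) (X1 l) = X1 (k + l)" "char_mult (X2 k) (X2 l) = X2 (k + l)" for k l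
    by (simp_all add: fun_eq_iff char_mult_def X1_def X2_def distrib_right power_add)
  have X3: "X1 3 = X1 0" "X2 3 = X2 0"
    using z(1) by (simp_all add: fun_eq_iff X1_def X2_def power_mult)
  have Xa: "X1 k a = \<zeta> ^ k" "X2 k a = 1" "X1 k b = 1" "X2 k b = \<zeta> ^ k" for k
    by (simp_all add: a_def b_def X_simps)
  have pw1: "k = 0" if "k \<in> {0, 1, 2}" "\<zeta> ^ k = 1" for k :: nat
    using that z(2) zz by (auto simp: power2_eq_square)
  have set1: "{N.triv_char, X1 1, char_mult (X1 1) (X1 1)} = X1 ` {0, 1, 2}"
    and set2: "{N.triv_char, X2 1, char_mult (X2 1) (X2 1)} = X2 ` {0, 1, 2}"
    unfolding XX by (simp add: X0(1) numeral_eq_Suc, simp add: X0(2) numeral_eq_Suc)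
  have X_ne: "X1 k \<noteq> N.triv_char" "X2 k \<noteq> N.triv_char" if "k \<in> {1, 2}" for k
  proof -
    have "\<zeta> ^ k \<noteq> 1" using pw1[of k] that by auto
    then show "X1 k \<noteq> N.triv_char" "X2 k \<noteq> N.triv_char"
      using Xa(1)[of k] Xa(4)[of k] abN by (auto simp: N.triv_char_def)
  qed
  have inv_z: "inverse (\<zeta> ^ i) = \<zeta> ^ (2 * i)" for i
  proof (rule inverse_unique)
    show "\<zeta> ^ i * \<zeta> ^ (2 * i) = 1" using z3 by (simp add: power_mult power_mult_distrib[symmetric] power2_eq_square mult.assoc)
  qed
  have inv_X: "N.inv_char (X1 1) = X1 2" "N.inv_char (X2 1) = X2 2"
    by (simp_all add: fun_eq_iff N.inv_char_def X1_def X2_def inv_z)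
  have conj: "inv\<^bsub>D33\<^esub> p \<otimes>\<^bsub>D33\<^esub> ((i, 0), (j, 0)) \<otimes>\<^bsub>D33\<^esub> p = ((i, 0), (2 * j mod 3, 0))"
    "inv\<^bsub>D33\<^esub> q \<otimes>\<^bsub>D33\<^esub> ((i, 0), (j, 0)) \<otimes>\<^bsub>D33\<^esub> q = ((2 * i mod 3, 0), (j, 0))" if "i < 3" "j < 3" for i j
    using that by (simp_all add: p_def q_def inv_D33 D33_simps)
  have cact: "cact p (X1 1) = X1 1" "cact p (X2 1) = N.inv_char (X2 1)" "cact q (X1 1) = N.inv_char (X1 1)" "cact q (X2 1) = X2 1"
  proof -
    have "cact p (X1 1) x = X1 1 x \<and> cact p (X2 1) x = X2 2 x \<and> cact q (X1 1) x = X1 2 x \<and> cact q (X2 1) x = X2 1 x" for x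
    proof (cases "x \<in> D33_rot")
      case True
      then show ?thesis by (elim D33_rotE) (simp add: cact_def conj X_simps zmod)
    qed (simp add: cact_def X_out)
    then show "cact p (X1 1) = X1 1" "cact p (X2 1) = N.inv_char (X2 1)" "cact q (X1 1) = N.inv_char (X1 1)" "cact q (X2 1) = X2 1"
      unfolding inv_X by blast+
  qed
  \<comment> \<open>A character of the rotation group is determined by its values at a and b, which
    are cube roots of unity.\<close>
  have gen: "\<exists>\<phi>\<in>X1 ` {0, 1, 2}. \<exists>\<psi>\<in>X2 ` {0, 1, 2}. \<chi> = char_mult \<phi> \<psi>" if \<chi>: "\<chi> \<in> NC" for \<chi>
  proof -
    have mult: "\<chi> (x \<otimes>\<^bsub>D33\<^esub> y) = \<chi> x * \<chi> y" if "x \<in> D33_rot" "y \<in> D33_rot" for x y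
      using \<chi> that by (simp add: N.chars_mult)
    have one: "\<chi> ((0, 0), (0, 0)) = 1" using \<chi> by (simp add: chars_def D33_simps)
    have a2: "\<chi> ((2, 0), (0, 0)) = \<chi> a * \<chi> a" using mult[of a a] by (simp add: a_def D33_simps numeral_2_eq_2)
    have b2: "\<chi> ((0, 0), (2, 0)) = \<chi> b * \<chi> b" using mult[of b b] by (simp add: b_def D33_simps numeral_2_eq_2)
    have "\<chi> a * (\<chi> a * \<chi> a) = 1" unfolding a2[symmetric] using mult[of a "((2, 0), (0, 0))"] one by (simp add: a_def D33_simps)
    then obtain k where k: "k \<in> {0, 1, 2}" "\<chi> a = \<zeta> ^ k" using roots by blast
    have "\<chi> b * (\<chi> b * \<chi> b) = 1" unfolding b2[symmetric] using mult[of b "((0, 0), (2, 0))"] one by (simp add: b_def D33_simps)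
    then obtain l where l: "l \<in> {0, 1, 2}" "\<chi> b = \<zeta> ^ l" using roots by blast
    have ai: "\<chi> ((i, 0), (0, 0)) = \<zeta> ^ (k * i)" if "i < 3" for i
    proof -
      have "i \<in> {0, Suc 0, 2}" using that by auto
      then show ?thesis using one a2 k(2) by (auto simp: a_def power_mult power2_eq_square)
    qed
    have bj: "\<chi> ((0, 0), (j, 0)) = \<zeta> ^ (l * j)" if "j < 3" for j
    proof -
      have "j \<in> {0, Suc 0, 2}" using that by auto
      then show ?thesis using one b2 l(2) by (auto simp: b_def power_mult power2_eq_square)
    qed
    have "\<chi> = char_mult (X1 k) (X2 l)"
    proof
      fix x show "\<chi> x = char_mult (X1 k) (X2 l) x"
      proof (cases "x \<in> D33_rot")
        case True
        then obtain i j where x: "x = ((i, 0), (j, 0))" "i < 3" "j < 3" by (rule D33_rotE)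
        then have "\<chi> x = \<chi> ((i, 0), (0, 0)) * \<chi> ((0, 0), (j, 0))"
          using mult[of "((i, 0), (0, 0))" "((0, 0), (j, 0))"] by (simp add: D33_simps)
        then show ?thesis using x by (simp add: ai bj char_mult_def X_simps)
      next
        case False
        then show ?thesis using N.chars_outside[OF \<chi>] by (simp add: char_mult_def X_out)
      qed
    qed
    then show ?thesis using k l by blast
  qed
  interpret K: klein_semidirect D33 J D33_rot D33_klein \<rho>0 \<mu>0 "X1 1" "X2 1" p q
  proof (intro klein_semidirect.intro klein_semidirect_axioms.intro)
    show "semidirect_twist D33 J D33_rot D33_klein" ..
    show "p \<otimes>\<^bsub>D33\<^esub> p = \<one>\<^bsub>D33\<^esub>" "q \<otimes>\<^bsub>D33\<^esub> q = \<one>\<^bsub>D33\<^esub>" by (simp_all add: p_def q_def D33_simps)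
    show "x = \<one>\<^bsub>D33\<^esub> \<or> x = p \<or> x = q \<or> x = p \<otimes>\<^bsub>D33\<^esub> q" if "x \<in> D33_klein" for x
      using that by (elim D33_kleinE) (auto simp: p_def q_def D33_simps less_2_cases_iff)
    show "char_mult (X1 1) (char_mult (X1 1) (X1 1)) = N.triv_char"
      unfolding XX X0(1) using X3 by (simp add: numeral_eq_Suc)
    show "char_mult (X2 1) (char_mult (X2 1) (X2 1)) = N.triv_char"
      unfolding XX X0(2) using X3 by (simp add: numeral_eq_Suc)
    show "X1 1 \<noteq> N.triv_char" "X2 1 \<noteq> N.triv_char" using X_ne[of 1] by simp_all
    show "char_mult (X1 1) (X1 1) \<noteq> N.triv_char" "char_mult (X2 1) (X2 1) \<noteq> N.triv_char"
      unfolding XX using X_ne[of 2] by (simp_all add: numeral_eq_Suc)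
    show "\<phi> = N.triv_char \<and> \<psi> = N.triv_char"
      if fp: "\<phi> \<in> {N.triv_char, X1 1, char_mult (X1 1) (X1 1)}" "\<psi> \<in> {N.triv_char, X2 1, char_mult (X2 1) (X2 1)}"
        "char_mult \<phi> \<psi> = N.triv_char" for \<phi> \<psi>
    proof -
      obtain k l where kl: "k \<in> {0, 1, 2}" "\<phi> = X1 k" "l \<in> {0, 1, 2}" "\<psi> = X2 l" using fp(1,2) unfolding set1 set2 by blast
      have "char_mult \<phi> \<psi> a = 1" "char_mult \<phi> \<psi> b = 1" unfolding fp(3) using abN by (simp_all add: N.triv_char_def)
      then have "\<zeta> ^ k = 1" "\<zeta> ^ l = 1" unfolding char_mult_def kl Xa by simp_all
      then have "k = 0" "l = 0" using pw1 kl by auto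
      then show ?thesis using kl X0 by simp
    qed
    show "\<exists>\<phi>\<in>{N.triv_char, X1 1, char_mult (X1 1) (X1 1)}. \<exists>\<psi>\<in>{N.triv_char, X2 1, char_mult (X2 1) (X2 1)}. \<chi> = char_mult \<phi> \<psi>"
      if "\<chi> \<in> NC" for \<chi> unfolding set1 set2 by (rule gen[OF that])
  qed (fact card_D33_klein rm pqP cact X1_in X2_in)+
  show ?thesis by (rule K.gauge_data_exists)
qed

end

theorem theorem4p9:
  fixes G :: "'g monoid" and J :: "'g \<times> 'g \<Rightarrow> 'k::{alg_closed_field, field_char_0}"
  assumes "group G" and "finite (carrier G)" and "card (carrier G) = 36"
    and "is_twist G J"
    and "twisted_simple G J"
  shows "G \<cong> D3 \<times>\<times> D3 \<and>
    (\<exists>H1 (\<omega> :: ((nat \<times> nat) \<times> (nat \<times> nat) \<Rightarrow> 'k) \<Rightarrow> ((nat \<times> nat) \<times> (nat \<times> nat) \<Rightarrow> 'k) \<Rightarrow> 'k).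
        subgroup H1 (D3 \<times>\<times> D3) \<and>
        (D3 \<times>\<times> D3)\<lparr>carrier := H1\<rparr> \<cong> Klein4 \<and>
        two_cocycle (D3 \<times>\<times> D3) H1 \<omega> \<and>
        \<not> coboundary (D3 \<times>\<times> D3) H1 \<omega> \<and>
        is_twist (D3 \<times>\<times> D3) (lifted_twist (D3 \<times>\<times> D3) H1 \<omega>) \<and>
        hopf_isomorphic G J (D3 \<times>\<times> D3) (lifted_twist (D3 \<times>\<times> D3) H1 \<omega>))"
proof -
  interpret T: twist G J
    using assms by (intro twist.intro tensor_group.intro fin_group.intro fin_group_axioms.intro twist_axioms.intro)
  interpret centerless36 G
    by unfold_locales (use assms T.twisted_simple_centerless in blast)+
  obtain N P where nrm: "N \<lhd> G" and N9: "card N = 9" and P: "subgroup P G" "card P = 4"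
    and comm_N: "\<And>x y. x \<in> N \<Longrightarrow> y \<in> N \<Longrightarrow> x \<otimes>\<^bsub>G\<^esub> y = y \<otimes>\<^bsub>G\<^esub> x"
    and comm_P: "\<And>x y. x \<in> P \<Longrightarrow> y \<in> P \<Longrightarrow> x \<otimes>\<^bsub>G\<^esub> y = y \<otimes>\<^bsub>G\<^esub> x"
    and dec: "\<And>g. g \<in> carrier G \<Longrightarrow> \<exists>n\<in>N. \<exists>p\<in>P. g = n \<otimes>\<^bsub>G\<^esub> p" and int: "N \<inter> P = {\<one>\<^bsub>G\<^esub>}"
    by (rule decomposition) blast
  interpret S: semidirect_twist G J N P
    by (intro semidirect_twist.intro semidirect_twist_axioms.intro T.twist_axioms nrm comm_N P comm_P dec int)
  \<comment> \<open>An element of P that is not an involution or the unit would generate P, which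
    \<open>cyclic_not_simple\<close> excludes.\<close>
  have klein: "p \<otimes>\<^bsub>G\<^esub> p = \<one>\<^bsub>G\<^esub>" if p: "p \<in> P" for p
  proof (rule ccontr)
    assume "p \<otimes>\<^bsub>G\<^esub> p \<noteq> \<one>\<^bsub>G\<^esub>"
    then have "\<not> twisted_simple G J"
      using T.order4_cases[OF P p] p P(2) N9 by (intro S.cyclic_not_simple[of p]) auto
    then show False using assms(5) by simp
  qed
  have iso: "G \<cong> D33" by (rule iso_D3_D3[OF nrm N9 P comm_N comm_P dec int klein])
  then obtain \<theta> where \<theta>: "\<theta> \<in> iso G D33" unfolding is_iso_def by blast
  \<comment> \<open>From here J is replaced by its transport to the concrete group, where explicit
    characters and generators are available.\<close>
  define J0 where "J0 = gpush (G \<times>\<times> G) (map_prod \<theta> \<theta>) J"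
  have "is_twist D33 J0"
    unfolding J0_def by (rule is_twist_gpush[OF T.twist_axioms fin_group_D33]) (use \<theta> in \<open>simp add: iso_def\<close>)
  then have T0: "twist D33 J0"
    using fin_group_D33 by (intro twist.intro tensor_group.intro twist_axioms.intro)
  interpret D: D33_twist J0 using T0 by (rule D33_twist.intro)
  \<comment> \<open>With gauge element 1, transport along \<theta> is itself an isomorphism of
    twisted algebras, and simplicity passes along it.\<close>
  have simple0: "twisted_simple D33 J0"
  proof (rule bialg_iso.twisted_simple_transfer[OF bialg_iso_gauge[where c = "gunit D33" and d = "gunit D33", OF T.twist_axioms T0 \<theta>] assms(5)])
    show "gmult (D33 \<times>\<times> D33) (gpush (G \<times>\<times> G) (map_prod \<theta> \<theta>) J) (gten (gunit D33) (gunit D33)) =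
        gmult (D33 \<times>\<times> D33) (gcomult D33 (gunit D33)) J0"
    proof -
      have "gten (gunit D33) (gunit D33) = (gunit (D33 \<times>\<times> D33) :: _ \<Rightarrow> 'k)"
        by (auto simp: fun_eq_iff gten_def gunit_def gdelta_def)
      then show ?thesis by (simp add: J0_def[symmetric] D.gcomult_gunit)
    qed
  qed (simp_all add: D.gmult_gunit_left)
  have "\<exists>\<rho> \<in> D.PC. \<exists>\<mu> \<in> D.PC. D.\<kappa> \<mu> \<rho> \<noteq> D.\<kappa> \<rho> \<mu>"
  proof (rule ccontr)
    assume "\<not> (\<exists>\<rho> \<in> D.PC. \<exists>\<mu> \<in> D.PC. D.\<kappa> \<mu> \<rho> \<noteq> D.\<kappa> \<rho> \<mu>)"
    then have "\<not> twisted_simple D33 J0"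
      by (intro D.symmetric_not_simple) (auto simp: card_D33_rot card_D33_klein)
    then show False using simple0 by simp
  qed
  then obtain \<rho> \<mu> where rm: "\<rho> \<in> D.PC" "\<mu> \<in> D.PC" "D.\<kappa> \<mu> \<rho> \<noteq> D.\<kappa> \<rho> \<mu>" by blast
  obtain u where "gauge_data D33 J0 D33_klein u D.\<kappa>" using D.gauge_data_klein[OF rm] by blast
  then interpret gd: gauge_data D33 J0 D33_klein u D.\<kappa> .
  obtain w where w: "w \<in> galg D33" "gmult D33 w gd.v = gunit D33" "gmult D33 gd.v w = gunit D33"
    using gd.v_invertible by blast
  note gauge = gd.gauge[OF w]
  have T1: "twist D33 gd.J1"
    using fin_group_D33 gauge(4) by (intro twist.intro tensor_group.intro twist_axioms.intro)
  \<comment> \<open>Transport along \<theta> and the gauge of \<open>J0\<close> by v are combined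
    into one application of \<open>bialg_iso_gauge\<close>.\<close>
  have "gmult (D33 \<times>\<times> D33) (gpush (G \<times>\<times> G) (map_prod \<theta> \<theta>) J) (gten (D.ginvol gd.v) (D.ginvol gd.v)) =
      gmult (D33 \<times>\<times> D33) (gcomult D33 (D.ginvol gd.v)) gd.J1"
    using gauge(3) by (simp only: J0_def[symmetric])
  from bialg_iso.hopf_iso[OF bialg_iso_gauge[OF T.twist_axioms T1 \<theta> D.ginvol_galg D.ginvol_galg gauge(1,2) this]]
  have "hopf_isomorphic G J D33 gd.J1"
    unfolding hopf_isomorphic_def by blast
  moreover have "two_cocycle D33 D33_klein D.\<kappa>"
    unfolding two_cocycle_def using D.\<kappa>_nz D.\<kappa>_cocycle by blast
  \<comment> \<open>Multiplication of characters is commutative, so a coboundary is symmetric,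
    whereas \<kappa> is not.\<close>
  moreover have "\<not> coboundary D33 D33_klein D.\<kappa>"
  proof
    assume "coboundary D33 D33_klein D.\<kappa>"
    then obtain m where "\<forall>\<alpha>\<in>D.PC. \<forall>\<beta>\<in>D.PC. D.\<kappa> \<alpha> \<beta> = m \<alpha> * m \<beta> / m (char_mult \<alpha> \<beta>)"
      unfolding coboundary_def by blast
    then have "D.\<kappa> \<mu> \<rho> = D.\<kappa> \<rho> \<mu>" using rm(1,2) by (simp add: char_mult_def mult.commute)
    then show False using rm(3) by simp
  qed
  ultimately show ?thesis
    using iso D33_klein_subgroup D33_klein_iso gauge(4) by blast
qed

end
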